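(* There exists $p^*\in(0.4012,0.4013)$ such that the following hold for a real number $p$ and $q:=1-p$. (1) If $p^*<p\le \frac12$, then with high probability, \[ \operatorname{tww}(G(n,p))=2pqn-\sqrt{6pq(1-2pq)n\ln n}+o(\sqrt{n\ln n}). \] (2) If $0<p<p^*$, then there exists $c:=c(p)>0$ such that with high probability, \[ \operatorname{tww}(G(n,p))>(2pq+c)n. \]
   Context: $G(n,p)$ is the random graph on vertex set $\{1,\ldots,n\}$ in which each unordered pair of distinct vertices is adjacent with probability $p$, independently; here $p$ is a constant not depending on $n$. "With high probability" means with probability tending to $1$ as $n\to\infty$. A statement "with high probability $X_n=f(n)+o(g(n))$" means that there is a function $h$ with $h(n)/g(n)\to0$ such that $|X_n-f(n)|\le h(n)$ with probability tending to $1$. $\ln$ is the natural logarithm. All graphs are finite and simple. Twin-width. A trigraph is a triple $G=(V,B,R)$ where $B,R$ are disjoint sets of $2$-element subsets of the finite set $V$; elements of $B$ are black edges and elements of $R$ are red edges. A graph $(V,E)$ is identified with the trigraph $(V,E,\emptyset)$. The red-degree of a vertex is the number of red edges incident with it. For distinct vertices $u,v$ (not necessarily adjacent), contracting $u$ and $v$ yields the trigraph obtained by deleting $u,v$, adding a new vertex $w$, keeping all edges (with colors) among the other vertices, and for each other vertex $x$: $wx$ is a black edge if both $ux$ and $vx$ are black edges; $wx$ is a non-edge if both $ux$ and $vx$ are non-edges; and $wx$ is a red edge otherwise. A $d$-contraction sequence of $G$ is a sequence of trigraphs starting with $G$, ending with a $1$-vertex graph, each obtained from the previous one by contracting two vertices,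 in which all trigraphs have maximum red-degree at most $d$. The twin-width $\operatorname{tww}(G)$ is the minimum $d$ such that $G$ has a $d$-contraction sequence. *)

theory Defs
  imports "HOL-Probability.Probability" "HOL-Probability.Product_PMF"
begin

definition all_edges :: "'a set \<Rightarrow> 'a set set" where
  "all_edges V = {e. e \<subseteq> V \<and> card e = 2}"

type_synonym 'a graph = "'a set \<times> 'a set set"

record 'a trigraph =
  verts :: "'a set"
  black :: "'a set set"
  red :: "'a set set"

definition is_trigraph :: "'a trigraph \<Rightarrow> bool" where
  "is_trigraph G \<longleftrightarrow> finite (verts G) \<and>
     black G \<subseteq> all_edges (verts G) \<and> red G \<subseteq> all_edges (verts G) \<and>
     black G \<inter> red G = {}"

definition trigraph_of_graph :: "'a graph \<Rightarrow> 'a trigraph" where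
  "trigraph_of_graph G = \<lparr>verts = fst G, black = snd G, red = {}\<rparr>"

definition red_degree :: "'a trigraph \<Rightarrow> 'a \<Rightarrow> nat" where
  "red_degree G x = card {e \<in> red G. x \<in> e}"

definition contract :: "'a \<Rightarrow> 'a \<Rightarrow> 'a \<Rightarrow> 'a trigraph \<Rightarrow> 'a trigraph" where
  "contract u v w G =
    \<lparr>verts = insert w (verts G - {u, v}),
     black = {e \<in> black G. u \<notin> e \<and> v \<notin> e} \<union>
       {{w, x} | x. x \<in> verts G - {u, v} \<and> {u, x} \<in> black G \<and> {v, x} \<in> black G},
     red = {e \<in> red G. u \<notin> e \<and> v \<notin> e} \<union>
       {{w, x} | x. x \<in> verts G - {u, v} \<and>
          \<not> ({u, x} \<in> black G \<and> {v, x} \<in> black G) \<and>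
          \<not> ({u, x} \<notin> black G \<union> red G \<and> {v, x} \<notin> black G \<union> red G)}\<rparr>"

text \<open>The added vertex w only has to be new relative to the vertices that remain once u and v
  have been deleted, so it may reuse the name u or v. All choices of w give isomorphic trigraphs,
  and a choice exists over every vertex type, finite ones included.\<close>

definition contraction :: "'a trigraph \<Rightarrow> 'a trigraph \<Rightarrow> bool" where
  "contraction G H \<longleftrightarrow>
     (\<exists>u v w. u \<in> verts G \<and> v \<in> verts G \<and> u \<noteq> v \<and> w \<notin> verts G - {u, v} \<and>
        H = contract u v w G)"

definition contraction_sequence :: "nat \<Rightarrow> 'a trigraph \<Rightarrow> 'a trigraph list \<Rightarrow> bool" where
  "contraction_sequence d G Hs \<longleftrightarrow>
     Hs \<noteq> [] \<and> hd Hs = G \<and> card (verts (last Hs)) = 1 \<and> successively contraction Hs \<and>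
     (\<forall>H \<in> set Hs. is_trigraph H \<and> (\<forall>x \<in> verts H. red_degree H x \<le> d))"

text \<open>Meaningful for trigraphs with at least one vertex; a trigraph without vertices has no
  contraction sequence.\<close>

definition tww :: "'a trigraph \<Rightarrow> nat" where
  "tww G = (LEAST d. \<exists>Hs. contraction_sequence d G Hs)"

definition gnp :: "nat \<Rightarrow> real \<Rightarrow> nat graph pmf" where
  "gnp n p = map_pmf (\<lambda>present. ({1..n}, {e \<in> all_edges {1..n}. present e}))
     (Pi_pmf (all_edges {1..n}) False (\<lambda>_. bernoulli_pmf p))"

definition gnp_whp :: "real \<Rightarrow> (nat \<Rightarrow> nat graph \<Rightarrow> bool) \<Rightarrow> bool" where
  "gnp_whp p Q \<longleftrightarrow> (\<lambda>n. measure_pmf.prob (gnp n p) {G. Q n G}) \<longlonglongrightarrow> 1"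

text \<open>With high probability, X = f + o(g), where X is a random variable on G(n,p).\<close>

definition gnp_whp_eq_plus_o ::
  "real \<Rightarrow> (nat graph \<Rightarrow> real) \<Rightarrow> (nat \<Rightarrow> real) \<Rightarrow> (nat \<Rightarrow> real) \<Rightarrow> bool" where
  "gnp_whp_eq_plus_o p X f g \<longleftrightarrow>
     (\<exists>h :: nat \<Rightarrow> real. (\<lambda>n. h n / g n) \<longlonglongrightarrow> 0 \<and>
        gnp_whp p (\<lambda>n G. \<bar>X G - f n\<bar> \<le> h n))"

end

theory Submission
  imports Defs "HOL-Real_Asymp.Real_Asymp"
begin

text \<open>A contraction sequence of a graph is the same thing as a chain of partitions of its vertex set, from
the singletons to a single part, in which two parts are merged at a time; two parts are joined by a
red edge when some but not all of the pairs between them are edges. So the twin-width asks for a chain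
of partitions in which every part is mixed to few other parts. Write \<open>s = p * (1 - p)\<close>. In the random
graph, parts of sizes \<open>i\<close> and \<open>k\<close> are mixed with probability \<open>1 - p ^ (i * k) - (1 - p) ^ (i * k)\<close>, so the
red degree of a fixed part of size \<open>k\<close> in a fixed partition is close to the sum of these numbers. Pairs
against singletons give \<open>2 * s * n\<close>, and each further merged pair lowers the expected red degree of a
pair by \<open>2 * s ^ 2\<close>.

Critical window, lower bound (\<open>tww_lower_critical\<close>). After about \<open>sqrt n\<close> merges only \<open>O(sqrt n)\<close>
vertices have been touched, so any two vertices of a common part differ in at most
\<open>d + O(sqrt n)\<close> other vertices, and there are at least \<open>sqrt n\<close> such pairs of vertices. By a
Chernoff bound with the exact variance, a fixed pair falls below its mean by
\<open>sqrt (6 * s * (1 - 2 * s) * n * ln n)\<close> with probability about \<open>n powr - (3/2)\<close>, so this value of the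
deviation is where the expected number of good pairs is \<open>n ^ 2 * n powr - (3/2) = sqrt n\<close>.

Critical window, upper bound (\<open>tww_upper_critical\<close>). For a slightly smaller deviation there are
far more than \<open>sqrt n\<close> good pairs, and a second moment argument (\<open>good_matching\<close>) finds
\<open>sqrt n * ln n\<close> disjoint ones. Merging them produces a gain that exceeds all random fluctuations, which
have order \<open>sqrt (n * ln n)\<close>. From then on a chain fixed in advance works: merge singletons to
pairs until a fraction \<open>\<alpha>\<close> of the vertices, slightly more than \<open>1 / (9 * s - 2 * s ^ 2)\<close>, counts the
pairs, then merge the remaining singletons with pairs to triples, then pairs to quadruples, until the
number of parts itself is below the target. Independence is kept by splitting the vertices into three
sets: the good pairs live in the first set and are selected by their edges to the third, so they are
independent of the edges inside the first two.

Part sizes and the critical probability. A triple has red degree at most \<open>2 * s * n\<close> only once the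
number of pairs is at least \<open>\<alpha> * n\<close> with \<open>\<alpha> = 1 / (9 * s - 2 * s ^ 2)\<close>. At that time at most \<open>(1 - 2 * \<alpha>) * n\<close> singletons are
left, which bounds the number of triples that can ever coexist with no larger parts. A quadruple then
sees at best \<open>(3 * \<alpha> - 1) * n\<close> pairs and \<open>(1 - 2 * \<alpha>) * n\<close> triples, and comparing its red degree with
\<open>2 * s * n\<close> gives a polynomial in \<open>s\<close> (\<open>critical_poly\<close>) that decreases on the relevant interval and
changes sign for exactly one \<open>p\<close> between 0.4012 and 0.4013 (\<open>critical_probability\<close>).

Below the critical probability (\<open>tww_lower_subcritical\<close>). A single part can be served by a
partition adapted to it, but linearly many parts cannot: the number of mixed pairs between two families
of disjoint sets is concentrated up to \<open>\<delta> * n ^ 2\<close> simultaneously for all families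
(\<open>edge_whp_uniform_mix\<close>), because the failure probability \<open>exp (- c * n ^ 2)\<close> beats the \<open>n powr O(n)\<close> families. Applying this at the first times
at which linearly many parts have size at least three, respectively four, turns the heuristic of the previous paragraph
into a proof. Very large parts are excluded because a part of large constant size is red to almost
every part, which forces the number of parts to be small already.\<close>

section \<open>Contraction sequences as chains of partitions\<close>

definition joined :: "'a set set \<Rightarrow> 'a set \<Rightarrow> 'a set \<Rightarrow> bool" where
  "joined E A B \<longleftrightarrow> (\<forall>a\<in>A. \<forall>b\<in>B. {a, b} \<in> E)"

definition mixed :: "'a set set \<Rightarrow> 'a set \<Rightarrow> 'a set \<Rightarrow> bool" where
  "mixed E A B \<longleftrightarrow> (\<exists>a\<in>A. \<exists>b\<in>B. {a, b} \<in> E) \<and> (\<exists>a\<in>A. \<exists>b\<in>B. {a, b} \<notin> E)"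

definition redcount :: "'a set set \<Rightarrow> 'a set \<Rightarrow> 'a set set \<Rightarrow> nat" where
  "redcount E A Q = card {B \<in> Q. mixed E A B}"

definition red_bounded :: "'a set set \<Rightarrow> nat \<Rightarrow> 'a set set \<Rightarrow> bool" where
  "red_bounded E d P \<longleftrightarrow> (\<forall>A\<in>P. redcount E A (P - {A}) \<le> d)"

definition merge_step :: "'a set set \<Rightarrow> 'a set set \<Rightarrow> bool" where
  "merge_step P P' \<longleftrightarrow> (\<exists>A\<in>P. \<exists>B\<in>P. A \<noteq> B \<and> P' = insert (A \<union> B) (P - {A, B}))"

definition singles :: "'a set \<Rightarrow> 'a set set" where
  "singles V = (\<lambda>x. {x}) ` V"

text \<open>Existence of a suitable chain of merges, with vertex names abstracted away; as an inductive predicate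
it can be matched against contraction sequences by one induction in each direction.\<close>

inductive reducible :: "'a set set \<Rightarrow> nat \<Rightarrow> 'a set set \<Rightarrow> bool" for E d where
  single: "card P = 1 \<Longrightarrow> red_bounded E d P \<Longrightarrow> reducible E d P"
| step: "red_bounded E d P \<Longrightarrow> merge_step P P' \<Longrightarrow> reducible E d P' \<Longrightarrow> reducible E d P"

text \<open>The trigraphs in a contraction sequence are quotients of the initial graph. Here \<open>\<phi>\<close> sends a vertex
to the set of original vertices it stands for; it is kept as a relation because the name of a new
vertex in a contraction is arbitrary, so the vertex does not determine its part.\<close>

definition represents :: "'a set set \<Rightarrow> 'a set set \<Rightarrow> ('a \<Rightarrow> 'a set) \<Rightarrow> 'a trigraph \<Rightarrow> bool" where
  "represents E P \<phi> H \<longleftrightarrow>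
     finite (verts H) \<and> bij_betw \<phi> (verts H) P \<and>
     black H \<subseteq> all_edges (verts H) \<and> red H \<subseteq> all_edges (verts H) \<and>
     (\<forall>x\<in>verts H. \<forall>y\<in>verts H. x \<noteq> y \<longrightarrow>
        ({x, y} \<in> black H \<longleftrightarrow> joined E (\<phi> x) (\<phi> y)) \<and>
        ({x, y} \<in> red H \<longleftrightarrow> mixed E (\<phi> x) (\<phi> y)))"

lemma mixed_commute: "mixed E A B \<longleftrightarrow> mixed E B A"
proof -
  have "mixed E B A" if "mixed E A B" for A B
  proof -
    obtain a b c d where "a \<in> A" "b \<in> B" "{a, b} \<in> E" "c \<in> A" "d \<in> B" "{c, d} \<notin> E"
      using \<open>mixed E A B\<close> unfolding mixed_def by auto
    moreover from this have "{b, a} \<in> E" "{d, c} \<notin> E" by (simp_all add: insert_commute)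
    ultimately show ?thesis unfolding mixed_def by blast
  qed
  then show ?thesis by blast
qed

lemma joined_commute: "joined E A B \<longleftrightarrow> joined E B A"
proof -
  have "{a, b} = {b, a}" for a b :: 'a by blast
  then show ?thesis unfolding joined_def by metis
qed

lemma mixed_mono: "mixed E A B \<Longrightarrow> A \<subseteq> A' \<Longrightarrow> B \<subseteq> B' \<Longrightarrow> mixed E A' B'"
  unfolding mixed_def by blast

lemma joined_not_mixed: "joined E A B \<Longrightarrow> \<not> mixed E A B"
  unfolding joined_def mixed_def by blast

lemma joined_Un: "joined E (A \<union> B) C \<longleftrightarrow> joined E A C \<and> joined E B C"
  unfolding joined_def by blast

text \<open>The form in which the definition of a contraction decides redness: the new edge is red unless both old
pairs are black or both are non-edges.\<close>

lemma mixed_Un: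
  assumes "A \<noteq> {}" "B \<noteq> {}" "C \<noteq> {}"
  shows "mixed E (A \<union> B) C \<longleftrightarrow> \<not> (joined E A C \<and> joined E B C) \<and>
     \<not> ((\<not> joined E A C \<and> \<not> mixed E A C) \<and> (\<not> joined E B C \<and> \<not> mixed E B C))"
  using assms unfolding joined_def mixed_def by blast

lemma all_edges_iff: "{x, y} \<in> all_edges V \<longleftrightarrow> x \<in> V \<and> y \<in> V \<and> x \<noteq> y"
  unfolding all_edges_def by (auto simp: card_2_iff)

lemma all_edgesE:
  assumes "e \<in> all_edges V" obtains x y where "e = {x, y}" "x \<in> V" "y \<in> V" "x \<noteq> y"
  using assms unfolding all_edges_def by (auto simp: card_2_iff)

lemma finite_all_edges: "finite V \<Longrightarrow> finite (all_edges V)"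
  unfolding all_edges_def by (rule finite_subset[of _ "Pow V"]) auto

text \<open>Contracting two vertices is merging their parts. The new name \<open>w\<close> may be one of the deleted names,
which is harmless because every edge kept from \<open>H\<close> avoids \<open>u\<close> and \<open>v\<close>.\<close>

lemma contract_represents:
  assumes P: "partition_on V P" and rep: "represents E P \<phi> H"
    and uv: "u \<in> verts H" "v \<in> verts H" "u \<noteq> v" and w: "w \<notin> verts H - {u, v}"
  shows "represents E (insert (\<phi> u \<union> \<phi> v) (P - {\<phi> u, \<phi> v})) (\<phi>(w := \<phi> u \<union> \<phi> v)) (contract u v w H)"
proof -
  define X where "X = verts H - {u, v}"
  define \<psi> where "\<psi> = \<phi>(w := \<phi> u \<union> \<phi> v)"
  have fin: "finite (verts H)" and bij: "bij_betw \<phi> (verts H) P"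
    and bl: "black H \<subseteq> all_edges (verts H)" and re: "red H \<subseteq> all_edges (verts H)"
    and edges: "\<And>x y. x \<in> verts H \<Longrightarrow> y \<in> verts H \<Longrightarrow> x \<noteq> y \<Longrightarrow>
        ({x, y} \<in> black H \<longleftrightarrow> joined E (\<phi> x) (\<phi> y)) \<and> ({x, y} \<in> red H \<longleftrightarrow> mixed E (\<phi> x) (\<phi> y))"
    using rep unfolding represents_def by auto
  have inj: "inj_on \<phi> (verts H)" and img: "\<phi> ` verts H = P"
    using bij by (auto simp: bij_betw_def)
  have ne: "\<phi> x \<noteq> {}" if "x \<in> verts H" for x
    using that img P unfolding partition_on_def by auto
  have wX: "w \<notin> X" using w X_def by auto
  have psiX: "\<psi> x = \<phi> x" if "x \<in> X" for x using that wX by (auto simp: \<psi>_def)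
  have psiw: "\<psi> w = \<phi> u \<union> \<phi> v" by (simp add: \<psi>_def)
  have vc: "verts (contract u v w H) = insert w X" by (simp add: contract_def X_def)
  have imgX: "\<phi> ` X = P - {\<phi> u, \<phi> v}"
    using inj uv img unfolding X_def by (auto simp: inj_on_def)
  have disj: "\<phi> x \<inter> \<phi> y = {}" if "x \<in> verts H" "y \<in> verts H" "x \<noteq> y" for x y
  proof -
    have "\<phi> x \<noteq> \<phi> y" using inj that by (auto simp: inj_on_def)
    moreover have "\<phi> x \<in> P" "\<phi> y \<in> P" using img that by auto
    ultimately show ?thesis using P unfolding partition_on_def disjoint_def by auto
  qed
  have new: "\<phi> u \<union> \<phi> v \<notin> P - {\<phi> u, \<phi> v}"
  proof
    assume "\<phi> u \<union> \<phi> v \<in> P - {\<phi> u, \<phi> v}"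
    then have "\<phi> u \<union> \<phi> v \<in> \<phi> ` X" unfolding imgX .
    then obtain x where x: "\<phi> x = \<phi> u \<union> \<phi> v" "x \<in> X" by (metis imageE)
    then have "\<phi> x \<inter> \<phi> u = {}" using disj[of x u] uv X_def by auto
    then show False using x ne[OF uv(1)] by auto
  qed
  have F1: "bij_betw \<psi> (insert w X) (insert (\<phi> u \<union> \<phi> v) (P - {\<phi> u, \<phi> v}))"
  proof (rule bij_betw_imageI)
    have "inj_on \<psi> X" using inj psiX unfolding inj_on_def X_def by auto
    moreover have "\<psi> w \<notin> \<psi> ` X" using new imgX psiX psiw by auto
    ultimately show "inj_on \<psi> (insert w X)" using wX by auto
    show "\<psi> ` insert w X = insert (\<phi> u \<union> \<phi> v) (P - {\<phi> u, \<phi> v})"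
      using imgX psiX psiw by auto
  qed
  have F2: "finite (insert w X)" using fin X_def by auto
  have Xe: "e \<in> all_edges X" if "e \<in> black H \<union> red H" "u \<notin> e" "v \<notin> e" for e
    using that bl re unfolding all_edges_def X_def by auto
  have F3: "black (contract u v w H) \<subseteq> all_edges (insert w X)"
  proof
    fix e assume "e \<in> black (contract u v w H)"
    then consider "e \<in> black H" "u \<notin> e" "v \<notin> e" | x where "x \<in> X" "e = {w, x}"
      unfolding contract_def X_def by auto
    then show "e \<in> all_edges (insert w X)"
    proof cases
      case 1 then show ?thesis using Xe[of e] unfolding all_edges_def by auto
    next
      case 2 then show ?thesis using wX by (auto simp: all_edges_iff)
    qed
  qed
  have F4: "red (contract u v w H) \<subseteq> all_edges (insert w X)"
  proof
    fix e assume "e \<in> red (contract u v w H)"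
    then consider "e \<in> red H" "u \<notin> e" "v \<notin> e" | x where "x \<in> X" "e = {w, x}"
      unfolding contract_def X_def by auto
    then show "e \<in> all_edges (insert w X)"
    proof cases
      case 1 then show ?thesis using Xe[of e] unfolding all_edges_def by auto
    next
      case 2 then show ?thesis using wX by (auto simp: all_edges_iff)
    qed
  qed
  have main: "({w, x} \<in> black (contract u v w H) \<longleftrightarrow> joined E (\<psi> w) (\<psi> x)) \<and>
      ({w, x} \<in> red (contract u v w H) \<longleftrightarrow> mixed E (\<psi> w) (\<psi> x))" if x: "x \<in> X" for x
  proof -
    have xu: "x \<in> verts H" "x \<noteq> u" "x \<noteq> v" using x X_def by auto
    have nw: "{w, x} \<notin> black H \<union> red H \<or> u \<in> {w, x} \<or> v \<in> {w, x}"
      using Xe[of "{w, x}"] wX by (auto simp: all_edges_iff)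
    have eq: "{w, x} = {w, y} \<longleftrightarrow> y = x" for y by (auto simp: doubleton_eq_iff)
    have b: "{w, x} \<in> black (contract u v w H) \<longleftrightarrow> {u, x} \<in> black H \<and> {v, x} \<in> black H"
      using nw x unfolding contract_def X_def by (auto simp: eq)
    have r: "{w, x} \<in> red (contract u v w H) \<longleftrightarrow>
       \<not> ({u, x} \<in> black H \<and> {v, x} \<in> black H) \<and>
       \<not> ({u, x} \<notin> black H \<union> red H \<and> {v, x} \<notin> black H \<union> red H)"
      using nw x unfolding contract_def X_def by (simp add: eq) blast
    have e1: "{u, x} \<in> black H \<longleftrightarrow> joined E (\<phi> u) (\<phi> x)" "{u, x} \<in> red H \<longleftrightarrow> mixed E (\<phi> u) (\<phi> x)"
      "{v, x} \<in> black H \<longleftrightarrow> joined E (\<phi> v) (\<phi> x)" "{v, x} \<in> red H \<longleftrightarrow> mixed E (\<phi> v) (\<phi> x)"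
      using edges[of u x] edges[of v x] uv xu by auto
    show ?thesis
      unfolding b r psiw psiX[OF x] joined_Un
        mixed_Un[OF ne[OF uv(1)] ne[OF uv(2)] ne[OF xu(1)]] e1 by (simp add: e1)
  qed
  have old: "({x, y} \<in> black (contract u v w H) \<longleftrightarrow> joined E (\<psi> x) (\<psi> y)) \<and>
      ({x, y} \<in> red (contract u v w H) \<longleftrightarrow> mixed E (\<psi> x) (\<psi> y))"
    if x: "x \<in> X" and y: "y \<in> X" and xy: "x \<noteq> y" for x y
  proof -
    have neq: "{x, y} \<noteq> {w, z}" for z using wX x y by (auto simp: doubleton_eq_iff)
    have uvn: "u \<notin> {x, y}" "v \<notin> {x, y}" using x y X_def by auto
    have "{x, y} \<in> black (contract u v w H) \<longleftrightarrow> {x, y} \<in> black H"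
      "{x, y} \<in> red (contract u v w H) \<longleftrightarrow> {x, y} \<in> red H"
      unfolding contract_def using neq uvn by simp_all
    then show ?thesis using edges[of x y] x y xy psiX by (auto simp: X_def)
  qed
  have F5: "({x, y} \<in> black (contract u v w H) \<longleftrightarrow> joined E (\<psi> x) (\<psi> y)) \<and>
      ({x, y} \<in> red (contract u v w H) \<longleftrightarrow> mixed E (\<psi> x) (\<psi> y))"
    if xyw: "x \<in> insert w X" "y \<in> insert w X" "x \<noteq> y" for x y
  proof -
    consider "x = w" "y \<in> X" | "y = w" "x \<in> X" | "x \<in> X" "y \<in> X" using xyw by auto
    then show ?thesis
    proof cases
      case 1 then show ?thesis using main by auto
    next
      case 2 then show ?thesis using main[of x]
        by (simp add: insert_commute joined_commute[of E "\<psi> x"] mixed_commute[of E "\<psi> x"])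
    next
      case 3 then show ?thesis using old xyw by auto
    qed
  qed
  show ?thesis unfolding represents_def vc \<psi>_def[symmetric]
    using F1 F2 F3 F4 by (intro conjI ballI impI) (assumption | rule conjunct1[OF F5] conjunct2[OF F5])+
qed

lemma represents_card: "represents E P \<phi> H \<Longrightarrow> card (verts H) = card P"
  unfolding represents_def using bij_betw_same_card by blast

lemma represents_is_trigraph: "represents E P \<phi> H \<Longrightarrow> is_trigraph H"
proof -
  assume rep: "represents E P \<phi> H"
  have "e \<notin> red H" if "e \<in> black H" for e
  proof -
    have "e \<in> all_edges (verts H)" using rep that unfolding represents_def by auto
    then obtain x y where "e = {x, y}" "x \<in> verts H" "y \<in> verts H" "x \<noteq> y" by (rule all_edgesE)
    then show ?thesis using rep that joined_not_mixed[of E "\<phi> x" "\<phi> y"] unfolding represents_def by simp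
  qed
  then show ?thesis using rep unfolding represents_def is_trigraph_def by auto
qed

lemma represents_red_degree:
  assumes rep: "represents E P \<phi> H" and x: "x \<in> verts H"
  shows "red_degree H x = redcount E (\<phi> x) (P - {\<phi> x})"
proof -
  have bij: "bij_betw \<phi> (verts H) P" and re: "red H \<subseteq> all_edges (verts H)"
    and edges: "\<And>x y. x \<in> verts H \<Longrightarrow> y \<in> verts H \<Longrightarrow> x \<noteq> y \<Longrightarrow>
         ({x, y} \<in> red H \<longleftrightarrow> mixed E (\<phi> x) (\<phi> y))"
    using rep unfolding represents_def by auto
  have inj: "inj_on \<phi> (verts H)" and img: "\<phi> ` verts H = P"
    using bij by (auto simp: bij_betw_def)
  define Y where "Y = {y \<in> verts H. y \<noteq> x \<and> mixed E (\<phi> x) (\<phi> y)}"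
  have "{e \<in> red H. x \<in> e} = (\<lambda>y. {x, y}) ` Y"
  proof (intro equalityI subsetI)
    fix e assume e: "e \<in> {e \<in> red H. x \<in> e}"
    then obtain a b where ab: "e = {a, b}" "a \<in> verts H" "b \<in> verts H" "a \<noteq> b"
      using re all_edgesE[of e "verts H"] by blast
    then obtain y where "e = {x, y}" "y \<in> verts H" "y \<noteq> x" using e by (auto simp: insert_commute)
    then show "e \<in> (\<lambda>y. {x, y}) ` Y" using e x edges[of x y] by (auto simp: Y_def)
  next
    fix e assume "e \<in> (\<lambda>y. {x, y}) ` Y"
    then show "e \<in> {e \<in> red H. x \<in> e}" using x edges by (auto simp: Y_def)
  qed
  moreover have "inj_on (\<lambda>y. {x, y}) Y" by (auto simp: inj_on_def doubleton_eq_iff)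
  ultimately have "red_degree H x = card Y" unfolding red_degree_def by (simp add: card_image)
  also have "\<dots> = card (\<phi> ` Y)"
    by (rule card_image[symmetric]) (use inj in \<open>auto simp: inj_on_def Y_def\<close>)
  also have "\<phi> ` Y = {B \<in> P - {\<phi> x}. mixed E (\<phi> x) B}"
    using inj x img unfolding Y_def inj_on_def by auto
  finally show ?thesis unfolding redcount_def .
qed

lemma represents_bounded_iff:
  assumes "represents E P \<phi> H"
  shows "(\<forall>x\<in>verts H. red_degree H x \<le> d) \<longleftrightarrow> red_bounded E d P"
proof -
  have "\<phi> ` verts H = P" using assms by (auto simp: represents_def bij_betw_def)
  then show ?thesis unfolding red_bounded_def using represents_red_degree[OF assms] by auto
qed

lemma partition_on_singles: "partition_on V (singles V)"
  unfolding partition_on_def singles_def disjoint_def by auto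

lemma represents_graph:
  assumes "finite V" "E \<subseteq> all_edges V"
  shows "represents E (singles V) (\<lambda>x. {x}) (trigraph_of_graph (V, E))"
  using assms unfolding represents_def trigraph_of_graph_def singles_def
  by (auto simp: bij_betw_def inj_on_def joined_def mixed_def)

lemma merge_step_partition:
  assumes "partition_on V P" "merge_step P P'"
  shows "partition_on V P'"
proof -
  obtain A B where AB: "A \<in> P" "B \<in> P" "A \<noteq> B" "P' = insert (A \<union> B) (P - {A, B})"
    using assms(2) unfolding merge_step_def by auto
  have dj: "C \<inter> D = {}" if "C \<in> P" "D \<in> P" "C \<noteq> D" for C D
    using assms(1) that unfolding partition_on_def disjoint_def by auto
  have "\<Union> P' = V" using AB assms(1) unfolding partition_on_def by auto
  moreover have "{} \<notin> P'" using AB assms(1) unfolding partition_on_def by auto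
  moreover have "disjoint P'" unfolding disjoint_def AB(4)
    using AB dj by (auto simp: Int_Un_distrib Int_Un_distrib2)
  ultimately show ?thesis unfolding partition_on_def by auto
qed

lemma merge_step_card:
  assumes "partition_on V P" "finite P" "merge_step P P'"
  shows "card P = Suc (card P')"
proof -
  obtain A B where AB: "A \<in> P" "B \<in> P" "A \<noteq> B" "P' = insert (A \<union> B) (P - {A, B})"
    using assms(3) unfolding merge_step_def by auto
  have "A \<union> B \<notin> P - {A, B}"
  proof
    assume C: "A \<union> B \<in> P - {A, B}"
    then have "A \<union> B \<in> P" "A \<union> B \<noteq> A" by auto
    moreover have "\<forall>C\<in>P. \<forall>D\<in>P. C \<noteq> D \<longrightarrow> C \<inter> D = {}"
      using assms(1) unfolding partition_on_def disjoint_def by simp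
    ultimately have "(A \<union> B) \<inter> A = {}" using AB(1) by metis
    then have "A = {}" by blast
    then show False using AB(1) assms(1) unfolding partition_on_def by simp
  qed
  moreover have "card (P - {A, B}) + 2 = card P"
  proof -
    have "card {A, B} \<le> card P" using AB assms(2) by (intro card_mono) auto
    moreover have "card (P - {A, B}) = card P - card {A, B}" using AB assms(2)
      by (intro card_Diff_subset) auto
    ultimately show ?thesis using AB(3) by simp
  qed
  ultimately show ?thesis using AB(4) assms(2) by simp
qed

lemma reducible_imp_sequence:
  assumes "reducible E d P" "partition_on V P" "represents E P \<phi> H"
  shows "\<exists>Hs. contraction_sequence d H Hs"
  using assms
proof (induction arbitrary: \<phi> H rule: reducible.induct)
  case (single P)
  then have "contraction_sequence d H [H]"
    unfolding contraction_sequence_def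
    using represents_card[OF single(4)] represents_is_trigraph[OF single(4)] represents_bounded_iff[OF single(4)]
    by auto
  then show ?case by blast
next
  case (step P P')
  obtain A B where AB: "A \<in> P" "B \<in> P" "A \<noteq> B" "P' = insert (A \<union> B) (P - {A, B})"
    using step(2) unfolding merge_step_def by auto
  have img: "\<phi> ` verts H = P" using step(6) by (auto simp: represents_def bij_betw_def)
  obtain u v where uv: "u \<in> verts H" "v \<in> verts H" "\<phi> u = A" "\<phi> v = B" using img AB by blast
  then have "u \<noteq> v" using AB by auto
  have rep: "represents E P' (\<phi>(u := A \<union> B)) (contract u v u H)"
    using contract_represents[OF step(5,6) uv(1,2) \<open>u \<noteq> v\<close>, of u] uv AB by auto
  obtain Hs where Hs: "contraction_sequence d (contract u v u H) Hs"
    using step.IH[OF merge_step_partition[OF step(5,2)] rep] by auto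
  have "contraction H (contract u v u H)" unfolding contraction_def
    using uv \<open>u \<noteq> v\<close> by (intro exI[of _ u] exI[of _ v] exI[of _ u]) auto
  then have "contraction_sequence d H (H # Hs)" using Hs
    represents_is_trigraph[OF step(6)] represents_bounded_iff[OF step(6)] step(1)
    unfolding contraction_sequence_def by (cases Hs) auto
  then show ?case by blast
qed

lemma sequence_imp_reducible:
  assumes "contraction_sequence d H Hs" "partition_on V P" "represents E P \<phi> H"
  shows "reducible E d P"
  using assms
proof (induction Hs arbitrary: P \<phi> H)
  case Nil
  then show ?case by (simp add: contraction_sequence_def)
next
  case (Cons H' Hs)
  have H': "H' = H" using Cons.prems(1) by (simp add: contraction_sequence_def)
  have bd: "red_bounded E d P" using Cons.prems represents_bounded_iff[OF Cons.prems(3)]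
    by (auto simp: contraction_sequence_def)
  show ?case
  proof (cases Hs)
    case Nil
    then have "card P = 1" using Cons.prems represents_card[OF Cons.prems(3)] H'
      by (auto simp: contraction_sequence_def)
    then show ?thesis using bd by (rule reducible.single)
  next
    case (Cons H2 Hs2)
    then have cs: "contraction_sequence d H2 Hs" and "contraction H H2" using Cons.prems(1) H'
      by (auto simp: contraction_sequence_def)
    then obtain u v w where uvw: "u \<in> verts H" "v \<in> verts H" "u \<noteq> v" "w \<notin> verts H - {u, v}"
      "H2 = contract u v w H" unfolding contraction_def by auto
    have rep: "represents E (insert (\<phi> u \<union> \<phi> v) (P - {\<phi> u, \<phi> v})) (\<phi>(w := \<phi> u \<union> \<phi> v)) H2"
      using contract_represents[OF Cons.prems(2,3) uvw(1-4)] uvw(5) by simp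
    have "bij_betw \<phi> (verts H) P" using Cons.prems(3) by (simp add: represents_def)
    then have "\<phi> u \<in> P" "\<phi> v \<in> P" "\<phi> u \<noteq> \<phi> v" using uvw(1-3) by (auto simp: bij_betw_def inj_on_def)
    then have "merge_step P (insert (\<phi> u \<union> \<phi> v) (P - {\<phi> u, \<phi> v}))"
      unfolding merge_step_def by blast
    then show ?thesis
      using bd Cons.IH[OF cs merge_step_partition[OF Cons.prems(2)] rep] reducible.step by blast
  qed
qed

lemma tww_eq_reducible:
  assumes "finite V" "E \<subseteq> all_edges V"
  shows "tww (trigraph_of_graph (V, E)) = (LEAST d. reducible E d (singles V))"
  unfolding tww_def
  using sequence_imp_reducible[OF _ partition_on_singles represents_graph[OF assms]]
    reducible_imp_sequence[OF _ partition_on_singles represents_graph[OF assms]]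
  by (metis (no_types, lifting))

lemma redcount_le_card: "finite Q \<Longrightarrow> redcount E A Q \<le> card Q"
  unfolding redcount_def by (rule card_mono) auto

text \<open>A part has fewer red neighbours than there are parts, so once few parts are left every order of merging
is admissible. This also shows that the minimum defining twin-width is attained.\<close>

lemma reducible_of_few_parts:
  assumes "partition_on V P" "finite P" "P \<noteq> {}" "card P \<le> Suc d"
  shows "reducible E d P"
  using assms
proof (induction "card P" arbitrary: P)
  case 0 then show ?case by simp
next
  case (Suc k)
  have bd: "red_bounded E d P" unfolding red_bounded_def
  proof
    fix A assume "A \<in> P"
    then have "card (P - {A}) \<le> d" using Suc.prems by simp
    then show "redcount E A (P - {A}) \<le> d"
      using redcount_le_card[of "P - {A}" E A] Suc.prems(2) by simp
  qed
  show ?case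
  proof (cases "k = 0")
    case True then show ?thesis using Suc bd by (intro reducible.single) auto
  next
    case False
    then have "\<not> card P \<le> 1" using Suc by simp
    then obtain A B where AB: "A \<in> P" "B \<in> P" "A \<noteq> B"
      using card_le_Suc0_iff_eq[OF Suc.prems(2)] by auto
    define P' where "P' = insert (A \<union> B) (P - {A, B})"
    have ms: "merge_step P P'" unfolding merge_step_def P'_def using AB by auto
    have "card P = Suc (card P')" using merge_step_card[OF Suc.prems(1,2) ms] .
    then have "reducible E d P'" using Suc(1)[of P'] Suc(2) merge_step_partition[OF Suc.prems(1) ms]
        Suc.prems P'_def by auto
    then show ?thesis using bd ms reducible.step by blast
  qed
qed

lemma reducible_chain:
  assumes "\<And>i. i < k \<Longrightarrow> merge_step (P i) (P (Suc i))" "\<And>i. i < k \<Longrightarrow> red_bounded E d (P i)"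
    "reducible E d (P k)"
  shows "reducible E d (P 0)"
  using assms
proof (induction k)
  case (Suc k)
  have "reducible E d (P k)" using Suc.prems reducible.step by blast
  then show ?case using Suc by auto
qed auto

lemma reducible_obtain_chain:
  assumes "reducible E d P0"
  shows "\<exists>P k. P 0 = P0 \<and> (\<forall>i<k. merge_step (P i) (P (Suc i))) \<and> card (P k) = 1 \<and>
     (\<forall>i\<le>k. red_bounded E d (P i))"
  using assms
proof (induction rule: reducible.induct)
  case (single P)
  then show ?case by (intro exI[of _ "\<lambda>_. P"] exI[of _ 0]) auto
next
  case (step P P')
  then obtain Q k where Q: "Q 0 = P'" "\<forall>i<k. merge_step (Q i) (Q (Suc i))" "card (Q k) = 1"
    "\<forall>i\<le>k. red_bounded E d (Q i)" by auto
  define R where "R = (\<lambda>i. case i of 0 \<Rightarrow> P | Suc j \<Rightarrow> Q j)"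
  have "merge_step (R i) (R (Suc i))" if "i < Suc k" for i
    using that Q step by (cases i) (auto simp: R_def)
  moreover have "red_bounded E d (R i)" if "i \<le> Suc k" for i
    using that Q step by (cases i) (auto simp: R_def)
  ultimately show ?case using Q by (intro exI[of _ R] exI[of _ "Suc k"]) (auto simp: R_def)
qed

lemma tww_le:
  assumes "finite V" "E \<subseteq> all_edges V" "reducible E d (singles V)"
  shows "tww (trigraph_of_graph (V, E)) \<le> d"
  unfolding tww_eq_reducible[OF assms(1,2)] by (rule Least_le) (rule assms(3))

lemma reducible_tww:
  assumes "finite V" "V \<noteq> {}" "E \<subseteq> all_edges V"
  shows "reducible E (tww (trigraph_of_graph (V, E))) (singles V)"
  unfolding tww_eq_reducible[OF assms(1,3)]
  by (rule LeastI[of _ "card V"], rule reducible_of_few_parts[OF partition_on_singles])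
     (use assms in \<open>auto simp: singles_def intro: le_SucI card_image_le\<close>)

section \<open>Random subsets and independence\<close>

text \<open>The random graph as a random set of edges. Compared with a random Boolean function this form makes
restriction to a set \<open>F\<close> of edges an intersection \<open>X \<inter> F\<close>, which is how independence is expressed below.\<close>

definition rand_subset :: "'e set \<Rightarrow> real \<Rightarrow> 'e set pmf" where
  "rand_subset S p = map_pmf (\<lambda>y. {e \<in> S. y e}) (Pi_pmf S False (\<lambda>_. bernoulli_pmf p))"

abbreviation expec :: "'e set \<Rightarrow> real \<Rightarrow> ('e set \<Rightarrow> real) \<Rightarrow> real" where
  "expec S p f \<equiv> measure_pmf.expectation (rand_subset S p) f"

abbreviation Prob :: "'e set \<Rightarrow> real \<Rightarrow> ('e set \<Rightarrow> bool) \<Rightarrow> real" where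
  "Prob S p Q \<equiv> measure_pmf.prob (rand_subset S p) {X. Q X}"

definition depends_on :: "'e set \<Rightarrow> ('e set \<Rightarrow> 'b) \<Rightarrow> bool" where
  "depends_on F f \<longleftrightarrow> (\<forall>X. f (X \<inter> F) = f X)"

lemma set_rand_subset: "set_pmf (rand_subset S p) \<subseteq> Pow S"
  unfolding rand_subset_def by auto

lemma finite_set_rand_subset: "finite S \<Longrightarrow> finite (set_pmf (rand_subset S p))"
  using set_rand_subset finite_subset by (metis finite_Pow_iff)

lemma integrable_rand_subset [simp]: "finite S \<Longrightarrow> integrable (measure_pmf (rand_subset S p)) (f :: _ \<Rightarrow> real)"
  by (rule integrable_measure_pmf_finite[OF finite_set_rand_subset])

lemma expec_mono: "finite S \<Longrightarrow> (\<And>X. X \<subseteq> S \<Longrightarrow> f X \<le> g X) \<Longrightarrow> expec S p f \<le> expec S p g"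
  using set_rand_subset[of S p] by (intro integral_mono_AE) (auto simp: AE_measure_pmf_iff)

lemma expec_cong: "(\<And>X. X \<subseteq> S \<Longrightarrow> f X = g X) \<Longrightarrow> expec S p f = expec S p g"
  using set_rand_subset[of S p] by (intro integral_cong_AE) (auto simp: AE_measure_pmf_iff)

lemma Prob_eq_Ex: "Prob S p Q = expec S p (\<lambda>X. of_bool (Q X))"
proof -
  have "expec S p (indicator {X. Q X}) = Prob S p Q" by simp
  moreover have "indicator {X. Q X} = (\<lambda>X. of_bool (Q X) :: real)" by (auto simp: fun_eq_iff indicator_def)
  ultimately show ?thesis by simp
qed

lemma Prob_le_Ex:
  assumes "finite S" "\<And>X. X \<subseteq> S \<Longrightarrow> 0 \<le> f X" "\<And>X. X \<subseteq> S \<Longrightarrow> Q X \<Longrightarrow> 1 \<le> f X"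
  shows "Prob S p Q \<le> expec S p f"
  unfolding Prob_eq_Ex by (rule expec_mono) (use assms in \<open>auto simp: of_bool_def\<close>)

lemma Prob_mono: "finite S \<Longrightarrow> (\<And>X. X \<subseteq> S \<Longrightarrow> Q X \<Longrightarrow> R X) \<Longrightarrow> Prob S p Q \<le> Prob S p R"
  unfolding Prob_eq_Ex by (rule expec_mono) (auto simp: of_bool_def)

lemma Prob_union_bound:
  assumes "finite S" "finite I" "\<And>X. X \<subseteq> S \<Longrightarrow> Q X \<Longrightarrow> \<exists>i\<in>I. R i X" "\<And>i. i \<in> I \<Longrightarrow> Prob S p (R i) \<le> b"
  shows "Prob S p Q \<le> real (card I) * b"
proof -
  have "Prob S p Q \<le> Prob S p (\<lambda>X. \<exists>i\<in>I. R i X)" by (rule Prob_mono) (use assms in auto)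
  also have "{X. \<exists>i\<in>I. R i X} = (\<Union>i\<in>I. {X. R i X})" by auto
  also have "measure_pmf.prob (rand_subset S p) \<dots> \<le> (\<Sum>i\<in>I. Prob S p (R i))"
    by (rule measure_pmf.finite_measure_subadditive_finite) (use assms in auto)
  also have "\<dots> \<le> real (card I) * b" using sum_mono[of I "\<lambda>i. Prob S p (R i)" "\<lambda>_. b"] assms(4) by simp
  finally show ?thesis .
qed

lemma Prob_disj: "finite S \<Longrightarrow> (\<And>X. X \<subseteq> S \<Longrightarrow> Q X \<Longrightarrow> R X \<or> R' X) \<Longrightarrow> Prob S p Q \<le> Prob S p R + Prob S p R'"
proof -
  assume a: "finite S" "\<And>X. X \<subseteq> S \<Longrightarrow> Q X \<Longrightarrow> R X \<or> R' X"
  have "Prob S p Q \<le> Prob S p (\<lambda>X. R X \<or> R' X)" by (rule Prob_mono) (use a in auto)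
  also have "\<dots> \<le> Prob S p R + Prob S p R'"
    using measure_Un_le[of "{X. R X}" "rand_subset S p" "{X. R' X}"]
    by (simp add: Collect_disj_eq)
  finally show ?thesis .
qed

lemma rand_subset_union:
  assumes "finite S" "finite T" "S \<inter> T = {}"
  shows "rand_subset (S \<union> T) p = rand_subset S p \<bind> (\<lambda>X. map_pmf (\<lambda>Y. X \<union> Y) (rand_subset T p))"
proof -
  have eq: "{e. (e \<in> S \<or> e \<in> T) \<and> (if e \<in> S then f e else g e)} = {e \<in> S. f e} \<union> {e \<in> T. g e}" for f g
    using assms(3) by auto
  show ?thesis
  unfolding rand_subset_def Pi_pmf_union[OF assms] pair_pmf_def map_bind_pmf
  by (simp add: map_pmf_def[symmetric] bind_map_pmf map_bind_pmf pmf.map_comp o_def case_prod_unfold eq)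
qed

text \<open>Revealing the edges in two rounds: this Fubini rule is the source of every independence statement.\<close>

lemma expec_union:
  assumes "finite S" "finite T" "S \<inter> T = {}"
  shows "expec (S \<union> T) p f = expec S p (\<lambda>X. expec T p (\<lambda>Y. f (X \<union> Y)))"
proof -
  have "expec (S \<union> T) p f = (\<Sum>X\<in>Pow S. pmf (rand_subset S p) X *\<^sub>R measure_pmf.expectation (map_pmf (\<lambda>Y. X \<union> Y) (rand_subset T p)) f)"
    unfolding rand_subset_union[OF assms]
    by (rule pmf_expectation_bind) (use assms set_rand_subset[of S p] finite_set_rand_subset[OF assms(2)] in auto)
  also have "\<dots> = expec S p (\<lambda>X. expec T p (\<lambda>Y. f (X \<union> Y)))"
    by (subst integral_measure_pmf[of "Pow S"]) (use assms set_rand_subset[of S p] in auto)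
  finally show ?thesis .
qed

lemma expec_restrict:
  assumes "finite S" "F \<subseteq> S" "depends_on F f"
  shows "expec S p f = expec F p f"
proof -
  have fin: "finite F" "finite (S - F)" using assms finite_subset by auto
  have "expec S p f = expec (F \<union> (S - F)) p f" using assms by (simp add: Un_absorb1)
  also have "\<dots> = expec F p (\<lambda>X. expec (S - F) p (\<lambda>Y. f (X \<union> Y)))" by (rule expec_union) (use fin in auto)
  also have "\<dots> = expec F p (\<lambda>X. expec (S - F) p (\<lambda>Y. f X))"
  proof (intro expec_cong)
    fix X Y assume "X \<subseteq> F" "Y \<subseteq> S - F"
    then have "(X \<union> Y) \<inter> F = X \<inter> F" by auto
    then show "f (X \<union> Y) = f X" using assms(3) unfolding depends_on_def by metis
  qed
  finally show ?thesis by simp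
qed

lemma expec_mult:
  fixes f g :: "'e set \<Rightarrow> real"
  assumes "finite S" "F \<subseteq> S" "G \<subseteq> S" "F \<inter> G = {}" "depends_on F f" "depends_on G g"
  shows "expec S p (\<lambda>X. f X * g X) = expec S p f * expec S p g"
proof -
  have fin: "finite F" "finite (S - F)" using assms finite_subset by auto
  have "expec S p (\<lambda>X. f X * g X) = expec (F \<union> (S - F)) p (\<lambda>X. f X * g X)" using assms by (simp add: Un_absorb1)
  also have "\<dots> = expec F p (\<lambda>X. expec (S - F) p (\<lambda>Y. f (X \<union> Y) * g (X \<union> Y)))" by (rule expec_union) (use fin in auto)
  also have "\<dots> = expec F p (\<lambda>X. expec (S - F) p (\<lambda>Y. f X * g Y))"
  proof (intro expec_cong)
    fix X Y assume "X \<subseteq> F" "Y \<subseteq> S - F"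
    then have "(X \<union> Y) \<inter> F = X \<inter> F" "(X \<union> Y) \<inter> G = Y \<inter> G" using assms(4) by auto
    then have "f (X \<union> Y) = f X" "g (X \<union> Y) = g Y" using assms(5,6) unfolding depends_on_def by metis+
    then show "f (X \<union> Y) * g (X \<union> Y) = f X * g Y" by simp
  qed
  also have "\<dots> = expec F p f * expec (S - F) p g" by simp
  also have "expec F p f = expec S p f" using expec_restrict assms by metis
  also have "expec (S - F) p g = expec S p g"
  proof -
    have "depends_on (S - F) g" unfolding depends_on_def
    proof
      fix X have "X \<inter> (S - F) \<inter> G = X \<inter> G" using assms by auto
      then show "g (X \<inter> (S - F)) = g X" using assms(6) unfolding depends_on_def by metis
    qed
    then show ?thesis using expec_restrict[of S "S - F" g p] assms(1) by auto
  qed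
  finally show ?thesis .
qed

lemma expec_prod:
  fixes f :: "'i \<Rightarrow> 'e set \<Rightarrow> real"
  assumes "finite S" "finite I" "disjoint_family_on F I" "\<And>i. i \<in> I \<Longrightarrow> F i \<subseteq> S"
    "\<And>i. i \<in> I \<Longrightarrow> depends_on (F i) (f i)"
  shows "expec S p (\<lambda>X. \<Prod>i\<in>I. f i X) = (\<Prod>i\<in>I. expec S p (f i))"
  using assms(2-5)
proof (induction I rule: finite_induct)
  case (insert i I)
  have dep: "depends_on (\<Union>j\<in>I. F j) (\<lambda>X. \<Prod>j\<in>I. f j X)" unfolding depends_on_def
  proof (intro allI prod.cong refl)
    fix X j assume j: "j \<in> I"
    then have "X \<inter> (\<Union>j\<in>I. F j) \<inter> F j = X \<inter> F j" by auto
    then show "f j (X \<inter> (\<Union>j\<in>I. F j)) = f j X" using insert.prems(3)[of j] j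
      unfolding depends_on_def by (metis insertI2)
  qed
  have "F i \<inter> (\<Union>j\<in>I. F j) = {}" using insert unfolding disjoint_family_on_def by auto
  then have "expec S p (\<lambda>X. f i X * (\<Prod>j\<in>I. f j X)) = expec S p (f i) * expec S p (\<lambda>X. \<Prod>j\<in>I. f j X)"
    using insert dep by (intro expec_mult[of S "F i" "\<Union>j\<in>I. F j"] assms(1)) auto
  then show ?case using insert by (simp add: disjoint_family_on_def)
qed simp

lemma expec_mem:
  assumes "finite S" "e \<in> S" "0 \<le> p" "p \<le> 1"
  shows "expec S p (\<lambda>X. of_bool (e \<in> X)) = p" "expec S p (\<lambda>X. of_bool (e \<notin> X)) = 1 - p"
proof -
  have "expec S p (\<lambda>X. of_bool (e \<in> X)) = measure_pmf.expectation (map_pmf (\<lambda>y. y e) (Pi_pmf S False (\<lambda>_. bernoulli_pmf p))) of_bool"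
    using assms(2) unfolding rand_subset_def by simp
  also have "map_pmf (\<lambda>y. y e) (Pi_pmf S False (\<lambda>_. bernoulli_pmf p)) = bernoulli_pmf p"
    using Pi_pmf_component[OF assms(1), of e False "\<lambda>_. bernoulli_pmf p"] assms(2) by simp
  also have "measure_pmf.expectation (bernoulli_pmf p) (of_bool :: bool \<Rightarrow> real) = p"
    using assms by simp
  finally show 1: "expec S p (\<lambda>X. of_bool (e \<in> X)) = p" .
  have "expec S p (\<lambda>X. of_bool (e \<notin> X)) = expec S p (\<lambda>X. 1 - of_bool (e \<in> X))" by (rule expec_cong) auto
  also have "\<dots> = 1 - p" using assms(1) by (simp add: 1)
  finally show "expec S p (\<lambda>X. of_bool (e \<notin> X)) = 1 - p" .
qed

lemma Prob_all_none:
  assumes "finite S" "F \<subseteq> S" "0 \<le> p" "p \<le> 1"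
  shows "Prob S p (\<lambda>X. F \<subseteq> X) = p ^ card F" "Prob S p (\<lambda>X. F \<inter> X = {}) = (1 - p) ^ card F"
proof -
  have fin: "finite F" using assms finite_subset by auto
  have dep: "depends_on {e} (\<lambda>X. of_bool (e \<in> X) :: real)" "depends_on {e} (\<lambda>X. of_bool (e \<notin> X) :: real)" for e :: 'a
    by (auto simp: depends_on_def)
  have "Prob S p (\<lambda>X. F \<subseteq> X) = expec S p (\<lambda>X. \<Prod>e\<in>F. of_bool (e \<in> X))"
    unfolding Prob_eq_Ex
  proof (rule expec_cong)
    fix X :: "'a set"
    show "(of_bool (F \<subseteq> X) :: real) = (\<Prod>e\<in>F. of_bool (e \<in> X))"
    proof (cases "F \<subseteq> X")
      case True then show ?thesis by (simp add: subset_iff)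
    next
      case False
      then have "\<exists>e\<in>F. (of_bool (e \<in> X) :: real) = 0" by auto
      then show ?thesis using False fin by simp
    qed
  qed
  also have "\<dots> = (\<Prod>e\<in>F. expec S p (\<lambda>X. of_bool (e \<in> X)))"
    by (rule expec_prod[where F="\<lambda>e. {e}"]) (use assms fin dep in \<open>auto simp: disjoint_family_on_def\<close>)
  also have "\<dots> = p ^ card F" using assms expec_mem(1)[OF assms(1)] by (simp add: subset_iff)
  finally show "Prob S p (\<lambda>X. F \<subseteq> X) = p ^ card F" .
  have "Prob S p (\<lambda>X. F \<inter> X = {}) = expec S p (\<lambda>X. \<Prod>e\<in>F. of_bool (e \<notin> X))"
    unfolding Prob_eq_Ex
  proof (rule expec_cong)
    fix X :: "'a set"
    show "(of_bool (F \<inter> X = {}) :: real) = (\<Prod>e\<in>F. of_bool (e \<notin> X))"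
    proof (cases "F \<inter> X = {}")
      case True
      then have "(\<Prod>e\<in>F. of_bool (e \<notin> X) :: real) = (\<Prod>e\<in>F. 1)" by (intro prod.cong) auto
      then show ?thesis using True by simp
    next
      case False
      then have "\<exists>e\<in>F. (of_bool (e \<notin> X) :: real) = 0" by auto
      then show ?thesis using False fin by simp
    qed
  qed
  also have "\<dots> = (\<Prod>e\<in>F. expec S p (\<lambda>X. of_bool (e \<notin> X)))"
    by (rule expec_prod[where F="\<lambda>e. {e}"]) (use assms fin dep in \<open>auto simp: disjoint_family_on_def\<close>)
  also have "\<dots> = (1 - p) ^ card F" using assms expec_mem(2)[OF assms(1)] by (simp add: subset_iff)
  finally show "Prob S p (\<lambda>X. F \<inter> X = {}) = (1 - p) ^ card F" .
qed

section \<open>Exponential moments and tail bounds\<close>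

text \<open>Taylor bounds whose quadratic coefficient tends to \<open>1/2\<close> as \<open>c\<close> tends to zero. Hoeffding's lemma
would lose the variance, and the variance determines the constant in the critical window.\<close>

lemma exp_le_quadratic:
  fixes y :: real assumes "\<bar>y\<bar> \<le> c" shows "exp y \<le> 1 + y + y\<^sup>2 / 2 * exp c"
proof -
  obtain t where t: "\<bar>t\<bar> \<le> \<bar>y\<bar>" "exp y = (\<Sum>m<2. y ^ m / fact m) + exp t / fact 2 * y ^ 2"
    using Maclaurin_exp_le[of y 2] by auto
  have "exp t \<le> exp c" using t(1) assms by auto
  then have "exp t * y\<^sup>2 \<le> exp c * y\<^sup>2" by (intro mult_right_mono) auto
  then show ?thesis using t(2) by (simp add: lessThan_Suc numeral_2_eq_2 field_simps)
qed

lemma exp_ge_quadratic: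
  fixes y :: real assumes "\<bar>y\<bar> \<le> c" "c \<le> 1" shows "exp y \<ge> 1 + y + y\<^sup>2 / 2 * (1 - c)"
proof -
  obtain t where t: "\<bar>t\<bar> \<le> \<bar>y\<bar>" "exp y = (\<Sum>m<3. y ^ m / fact m) + exp t / fact 3 * y ^ 3"
    using Maclaurin_exp_le[of y 3] by auto
  have "exp t \<le> exp 1" using t(1) assms by auto
  also have "exp (1::real) \<le> 3" by (rule exp_le)
  finally have "exp t \<le> 3" .
  moreover have "\<bar>y ^ 3\<bar> \<le> y\<^sup>2 * c"
    using assms(1) by (simp add: power3_eq_cube power2_eq_square abs_mult mult_left_mono)
  ultimately have "exp t * \<bar>y ^ 3\<bar> \<le> 3 * (y\<^sup>2 * c)" by (intro mult_mono) auto
  then have "exp t * y ^ 3 \<ge> - (3 * (y\<^sup>2 * c))"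
    by (smt (verit) abs_mult abs_le_iff abs_exp_cancel)
  then show ?thesis using t(2) by (simp add: lessThan_Suc numeral_3_eq_3 numeral_2_eq_2 fact_numeral field_simps)
qed

text \<open>Bounds for the moment generating function with the correct variance; for small \<open>l\<close> they agree with the
Gaussian \<open>exp (v * l ^ 2 / 2)\<close> up to a factor \<open>1 + O(l)\<close> in the exponent.\<close>

lemma mgf_upper:
  assumes S: "finite S" and b: "\<And>X. X \<subseteq> S \<Longrightarrow> \<bar>Y X\<bar> \<le> b" and m: "expec S p Y = 0" and v: "expec S p (\<lambda>X. (Y X)\<^sup>2) \<le> v"
    and l: "0 \<le> (l::real)"
  shows "expec S p (\<lambda>X. exp (l * Y X)) \<le> exp (v * (l\<^sup>2 / 2 * exp (b * l)))"
proof -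
  have "expec S p (\<lambda>X. exp (l * Y X)) \<le> expec S p (\<lambda>X. 1 + l * Y X + (l\<^sup>2 / 2 * exp (b * l)) * (Y X)\<^sup>2)"
  proof (rule expec_mono[OF S])
    fix X assume "X \<subseteq> S"
    then have "\<bar>l * Y X\<bar> \<le> b * l" using b[of X] l by (simp add: abs_mult mult.commute[of b] mult_left_mono)
    from exp_le_quadratic[OF this] show "exp (l * Y X) \<le> 1 + l * Y X + (l\<^sup>2 / 2 * exp (b * l)) * (Y X)\<^sup>2"
      by (simp add: power_mult_distrib mult_ac)
  qed
  also have "\<dots> = 1 + (l\<^sup>2 / 2 * exp (b * l)) * expec S p (\<lambda>X. (Y X)\<^sup>2)"
    using S m by simp
  also have "\<dots> \<le> 1 + v * (l\<^sup>2 / 2 * exp (b * l))"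
    using mult_left_mono[OF v, of "l\<^sup>2 / 2 * exp (b * l)"] by (simp add: mult_ac)
  also have "\<dots> \<le> exp (v * (l\<^sup>2 / 2 * exp (b * l)))" by (rule exp_ge_add_one_self)
  finally show ?thesis .
qed

lemma mgf_lower:
  assumes S: "finite S" and b: "\<And>X. X \<subseteq> S \<Longrightarrow> \<bar>Y X\<bar> \<le> 1" and m: "expec S p Y = 0" and v: "expec S p (\<lambda>X. (Y X)\<^sup>2) = v"
    and l: "0 \<le> (l::real)" "l \<le> 1" and v01: "0 \<le> v" "v \<le> 1"
  shows "expec S p (\<lambda>X. exp (l * Y X)) \<ge> exp (v * (l\<^sup>2 / 2 * (1 - 2 * l)))"
proof -
  \<comment> \<open>The logarithm of \<open>1 + z\<close> costs a second factor \<open>1 - l\<close>, whence the \<open>2 * l\<close> in the claim.\<close>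
  define z where "z = v * (l\<^sup>2 / 2 * (1 - l))"
  have l2: "l\<^sup>2 \<le> l" "0 \<le> l\<^sup>2" using l by (auto simp: power2_eq_square mult_left_le)
  have z0: "0 \<le> z" using l v01 by (simp add: z_def)
  have "z \<le> 1 * (l\<^sup>2 / 2 * (1 - l))" unfolding z_def using v01 l by (intro mult_right_mono) auto
  also have "\<dots> \<le> l\<^sup>2 / 2 * 1" using l by (simp add: mult_left_le)
  finally have zl: "z \<le> l" using l2 l by linarith
  have "v * (l\<^sup>2 / 2 * (1 - 2 * l)) \<le> z * (1 - l)"
  proof -
    have "(1 - 2 * l) \<le> (1 - l) * (1 - l)" by (simp add: algebra_simps)
    then have "(v * (l\<^sup>2 / 2)) * (1 - 2 * l) \<le> (v * (l\<^sup>2 / 2)) * ((1 - l) * (1 - l))"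
      using v01 by (intro mult_left_mono) auto
    then show ?thesis unfolding z_def by (simp only: mult.assoc)
  qed
  also have "\<dots> \<le> z - z\<^sup>2" using mult_right_mono[OF zl z0] by (simp add: power2_eq_square algebra_simps)
  also have "\<dots> \<le> ln (1 + z)" using z0 zl l by (intro ln_one_plus_pos_lower_bound) auto
  finally have "exp (v * (l\<^sup>2 / 2 * (1 - 2 * l))) \<le> exp (ln (1 + z))" by simp
  also have "\<dots> = 1 + z" using z0 by simp
  also have "\<dots> = expec S p (\<lambda>X. 1 + l * Y X + (l\<^sup>2 / 2 * (1 - l)) * (Y X)\<^sup>2)"
    using S m v by (simp add: z_def)
  also have "\<dots> \<le> expec S p (\<lambda>X. exp (l * Y X))"
  proof (rule expec_mono[OF S])
    fix X assume "X \<subseteq> S"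
    then have "\<bar>l * Y X\<bar> \<le> l" using b[of X] l by (simp add: abs_mult mult_left_le)
    from exp_ge_quadratic[OF this l(2)] show "1 + l * Y X + (l\<^sup>2 / 2 * (1 - l)) * (Y X)\<^sup>2 \<le> exp (l * Y X)"
      by (simp add: power_mult_distrib mult_ac)
  qed
  finally show ?thesis .
qed

lemma expec_exp_sum:
  fixes Y :: "'i \<Rightarrow> 'e set \<Rightarrow> real"
  assumes "finite S" "finite I" "disjoint_family_on F I" "\<And>i. i \<in> I \<Longrightarrow> F i \<subseteq> S"
    "\<And>i. i \<in> I \<Longrightarrow> depends_on (F i) (Y i)"
  shows "expec S p (\<lambda>X. exp (l * (\<Sum>i\<in>I. Y i X))) = (\<Prod>i\<in>I. expec S p (\<lambda>X. exp (l * Y i X)))"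
proof -
  have "expec S p (\<lambda>X. exp (l * (\<Sum>i\<in>I. Y i X))) = expec S p (\<lambda>X. \<Prod>i\<in>I. exp (l * Y i X))"
    using assms(2) by (simp add: exp_sum sum_distrib_left)
  also have "\<dots> = (\<Prod>i\<in>I. expec S p (\<lambda>X. exp (l * Y i X)))"
    using assms by (intro expec_prod) (auto simp: depends_on_def)
  finally show ?thesis .
qed

text \<open>The parameter \<open>l\<close> stays free, since the applications need either the optimal constant (\<open>l\<close> tending to
zero) or only a crude bound.\<close>

lemma chernoff:
  fixes Y :: "'i \<Rightarrow> 'e set \<Rightarrow> real"
  assumes S: "finite S" and I: "finite I" "disjoint_family_on F I" "\<And>i. i \<in> I \<Longrightarrow> F i \<subseteq> S"
    "\<And>i. i \<in> I \<Longrightarrow> depends_on (F i) (Y i)"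
    and b: "\<And>i X. i \<in> I \<Longrightarrow> X \<subseteq> S \<Longrightarrow> \<bar>Y i X\<bar> \<le> b"
    and m: "\<And>i. i \<in> I \<Longrightarrow> expec S p (Y i) = 0" and v: "\<And>i. i \<in> I \<Longrightarrow> expec S p (\<lambda>X. (Y i X)\<^sup>2) \<le> v"
    and l: "0 \<le> (l::real)"
  shows "Prob S p (\<lambda>X. (\<Sum>i\<in>I. Y i X) \<ge> a) \<le> exp (real (card I) * v * (l\<^sup>2 / 2 * exp (b * l)) - l * a)"
proof -
  have "Prob S p (\<lambda>X. (\<Sum>i\<in>I. Y i X) \<ge> a) \<le> expec S p (\<lambda>X. exp (l * (\<Sum>i\<in>I. Y i X)) * exp (- (l * a)))"
    using l by (intro Prob_le_Ex S) (auto simp: exp_add[symmetric] mult_left_mono)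
  also have "\<dots> = expec S p (\<lambda>X. exp (l * (\<Sum>i\<in>I. Y i X))) * exp (- (l * a))" by simp
  also have "\<dots> = (\<Prod>i\<in>I. expec S p (\<lambda>X. exp (l * Y i X))) * exp (- (l * a))"
    by (subst expec_exp_sum[OF S I]) auto
  also have "(\<Prod>i\<in>I. expec S p (\<lambda>X. exp (l * Y i X))) \<le> (\<Prod>i\<in>I. exp (v * (l\<^sup>2 / 2 * exp (b * l))))"
    by (intro prod_mono conjI mgf_upper S b m v l) (auto intro!: integral_nonneg_AE)
  also have "(\<Prod>i\<in>I. exp (v * (l\<^sup>2 / 2 * exp (b * l)))) = exp (real (card I) * v * (l\<^sup>2 / 2 * exp (b * l)))"
    by (simp add: exp_of_nat_mult[symmetric] mult.assoc)
  finally show ?thesis by (simp add: mult_exp_exp mult_right_mono)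
qed

lemma expec_indicator_var:
  assumes "finite S" "Prob S p Z = r"
  shows "expec S p (\<lambda>X. of_bool (Z X) - r) = 0" "expec S p (\<lambda>X. (of_bool (Z X) - r)\<^sup>2) = r * (1 - r)"
    "expec S p (\<lambda>X. r - of_bool (Z X)) = 0" "expec S p (\<lambda>X. (r - of_bool (Z X))\<^sup>2) = r * (1 - r)"
proof -
  have e: "expec S p (\<lambda>X. of_bool (Z X)) = r" using assms(2) Prob_eq_Ex by metis
  show "expec S p (\<lambda>X. of_bool (Z X) - r) = 0" "expec S p (\<lambda>X. r - of_bool (Z X)) = 0" using assms e by simp_all
  have "expec S p (\<lambda>X. (of_bool (Z X) - r)\<^sup>2) = expec S p (\<lambda>X. (1 - 2 * r) * of_bool (Z X) + r\<^sup>2)"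
    by (rule expec_cong) (auto simp: of_bool_def power2_eq_square algebra_simps)
  also have "\<dots> = r * (1 - r)" using assms e by (simp add: power2_eq_square algebra_simps)
  finally show v: "expec S p (\<lambda>X. (of_bool (Z X) - r)\<^sup>2) = r * (1 - r)" .
  then show "expec S p (\<lambda>X. (r - of_bool (Z X))\<^sup>2) = r * (1 - r)" by (simp add: power2_commute)
qed

lemma Prob_bounds: "0 \<le> Prob S p Q" "Prob S p Q \<le> 1"
  by auto

lemma mult_one_minus_le_quarter: "(r::real) * (1 - r) \<le> 1 / 4"
  using zero_le_power2[of "r - 1/2"] by (simp add: power2_eq_square algebra_simps)

lemma hoeffding_exponent:
  fixes a N :: real assumes "0 \<le> a" "a \<le> N" "0 < N" "0 \<le> k" "k \<le> N"
  shows "exp (k * (1/4) * ((a / N)\<^sup>2 / 2 * exp (1 * (a / N))) - a / N * a) \<le> exp (- a\<^sup>2 / (2 * N))"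
proof -
  have "a / N \<le> 1" using assms by simp
  then have "exp (a / N) \<le> 4" using exp_le by (smt (verit) exp_le_cancel_iff)
  then have "k * (1/4) * ((a / N)\<^sup>2 / 2 * exp (1 * (a / N))) \<le> N * (1/4) * ((a / N)\<^sup>2 / 2 * 4)"
    using assms by (intro mult_mono) auto
  also have "\<dots> = a\<^sup>2 / (2 * N)" using assms by (simp add: power2_eq_square field_simps)
  finally show ?thesis using assms by (simp add: power2_eq_square field_simps)
qed

text \<open>The crude case with \<open>l = a / N\<close>. Large \<open>a\<close> is covered because deviations
above \<open>N\<close> cannot occur.\<close>

lemma hoeffding_upper:
  fixes Z :: "'i \<Rightarrow> 'e set \<Rightarrow> bool"
  assumes S: "finite S" and I: "finite I" "disjoint_family_on F I" "\<And>i. i \<in> I \<Longrightarrow> F i \<subseteq> S"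
    "\<And>i. i \<in> I \<Longrightarrow> depends_on (F i) (Z i)" and r: "\<And>i. i \<in> I \<Longrightarrow> Prob S p (Z i) = r i"
    and N: "real (card I) \<le> N" "0 < N" and a: "0 \<le> a"
  shows "Prob S p (\<lambda>X. real (card {i\<in>I. Z i X}) \<ge> (\<Sum>i\<in>I. r i) + a) \<le> exp (- a\<^sup>2 / (2 * N))"
proof (cases "a \<le> N")
  case True
  have eq: "real (card {i\<in>I. Z i X}) = (\<Sum>i\<in>I. of_bool (Z i X))" for X
    using I(1) by (simp add: sum_of_bool_eq Int_def)
  have "Prob S p (\<lambda>X. real (card {i\<in>I. Z i X}) \<ge> (\<Sum>i\<in>I. r i) + a) =
     Prob S p (\<lambda>X. (\<Sum>i\<in>I. of_bool (Z i X) - r i) \<ge> a)"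
    unfolding eq by (simp add: sum_subtractf algebra_simps)
  also have "\<dots> \<le> exp (real (card I) * (1/4) * ((a / N)\<^sup>2 / 2 * exp (1 * (a / N))) - a / N * a)"
  proof (rule chernoff[OF S I(1-3)])
    fix i assume i: "i \<in> I"
    show "depends_on (F i) (\<lambda>X. of_bool (Z i X) - r i)" using I(4)[OF i] by (simp add: depends_on_def)
    show "\<bar>of_bool (Z i X) - r i\<bar> \<le> 1" for X using Prob_bounds[of S p "Z i"] r[OF i] by (auto simp: of_bool_def)
    show "expec S p (\<lambda>X. of_bool (Z i X) - r i) = 0" using expec_indicator_var[OF S r[OF i]] by simp
    show "expec S p (\<lambda>X. (of_bool (Z i X) - r i)\<^sup>2) \<le> 1/4" using expec_indicator_var[OF S r[OF i]] mult_one_minus_le_quarter by simp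
  qed (use a N in auto)
  also have "\<dots> \<le> exp (- a\<^sup>2 / (2 * N))" using hoeffding_exponent[of a N "card I"] a N True by simp
  finally show ?thesis .
next
  case False
  have "0 \<le> (\<Sum>i\<in>I. r i)" using r Prob_bounds by (metis sum_nonneg)
  then have "\<not> real (card {i\<in>I. Z i X}) \<ge> (\<Sum>i\<in>I. r i) + a" for X
    using False N card_mono[OF I(1), of "{i\<in>I. Z i X}"] by auto
  then show ?thesis by simp
qed

lemma hoeffding_lower:
  fixes Z :: "'i \<Rightarrow> 'e set \<Rightarrow> bool"
  assumes S: "finite S" and I: "finite I" "disjoint_family_on F I" "\<And>i. i \<in> I \<Longrightarrow> F i \<subseteq> S"
    "\<And>i. i \<in> I \<Longrightarrow> depends_on (F i) (Z i)" and r: "\<And>i. i \<in> I \<Longrightarrow> Prob S p (Z i) = r i"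
    and N: "real (card I) \<le> N" "0 < N" and a: "0 < a"
  shows "Prob S p (\<lambda>X. real (card {i\<in>I. Z i X}) \<le> (\<Sum>i\<in>I. r i) - a) \<le> exp (- a\<^sup>2 / (2 * N))"
proof (cases "a \<le> N")
  case True
  have eq: "real (card {i\<in>I. Z i X}) = (\<Sum>i\<in>I. of_bool (Z i X))" for X
    using I(1) by (simp add: sum_of_bool_eq Int_def)
  have "Prob S p (\<lambda>X. real (card {i\<in>I. Z i X}) \<le> (\<Sum>i\<in>I. r i) - a) =
     Prob S p (\<lambda>X. (\<Sum>i\<in>I. r i - of_bool (Z i X)) \<ge> a)"
    unfolding eq by (simp add: sum_subtractf algebra_simps)
  also have "\<dots> \<le> exp (real (card I) * (1/4) * ((a / N)\<^sup>2 / 2 * exp (1 * (a / N))) - a / N * a)"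
  proof (rule chernoff[OF S I(1-3)])
    fix i assume i: "i \<in> I"
    show "depends_on (F i) (\<lambda>X. r i - of_bool (Z i X))" using I(4)[OF i] by (simp add: depends_on_def)
    show "\<bar>r i - of_bool (Z i X)\<bar> \<le> 1" for X using Prob_bounds[of S p "Z i"] r[OF i] by (auto simp: of_bool_def)
    show "expec S p (\<lambda>X. r i - of_bool (Z i X)) = 0" using expec_indicator_var[OF S r[OF i]] by simp
    show "expec S p (\<lambda>X. (r i - of_bool (Z i X))\<^sup>2) \<le> 1/4" using expec_indicator_var[OF S r[OF i]] mult_one_minus_le_quarter by simp
  qed (use a N in auto)
  also have "\<dots> \<le> exp (- a\<^sup>2 / (2 * N))" using hoeffding_exponent[of a N "card I"] a N True by simp
  finally show ?thesis .
next
  case False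
  have "(\<Sum>i\<in>I. r i) \<le> (\<Sum>i\<in>I. 1)" by (rule sum_mono) (metis r Prob_bounds(2))
  then have "(\<Sum>i\<in>I. r i) - a < 0" using N False by simp
  then have "\<not> real (card {i\<in>I. Z i X}) \<le> (\<Sum>i\<in>I. r i) - a" for X
    using of_nat_0_le_iff[of "card {i\<in>I. Z i X}", where 'a=real] by linarith
  then show ?thesis by simp
qed

section \<open>A lower bound for moderate deviations\<close>

text \<open>A converse of the Chernoff bound that uses only the moment generating function. Tilt by
\<open>l = (1 + 3 * a) * t / V\<close>, so that the tilted mean lies slightly above \<open>t\<close>. Comparing the moment
generating function at \<open>l\<close> with its values at \<open>l - 3 * a * t / V\<close> and \<open>l + 3 * a * t / V\<close> shows that values below \<open>t\<close> and above \<open>(1 + 6 * a) * t\<close> contribute at most a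
quarter each, so half of the tilted mass sits in the window between, where the density
is at most \<open>exp (l * (1 + 6 * a) * t)\<close>. The result loses only a factor \<open>1 + O(a)\<close> in the exponent.\<close>

lemma moderate_deviation_lower:
  fixes M :: "'a pmf" and W :: "'a \<Rightarrow> real"
  assumes fin: "finite (set_pmf M)" and V: "0 < V"
    and mgf: "\<And>l. 0 \<le> l \<Longrightarrow> l \<le> 1 \<Longrightarrow>
       exp (V * (l\<^sup>2 / 2 * (1 - 2 * l))) \<le> measure_pmf.expectation M (\<lambda>x. exp (l * W x)) \<and>
       measure_pmf.expectation M (\<lambda>x. exp (l * W x)) \<le> exp (V * (l\<^sup>2 / 2 * (1 + 2 * l)))"
    and a: "0 < a" "a \<le> 1 / 6" and t: "0 < t" "t / V \<le> a\<^sup>2 / 16" "t\<^sup>2 / V * a\<^sup>2 \<ge> 2"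
  shows "measure_pmf.prob M {x. W x \<ge> t} \<ge> exp (- (t\<^sup>2 / V) * (1 / 2 + 9 * a)) / 2"
proof -
  define r where "r = t / V"
  define \<tau> where "\<tau> = t\<^sup>2 / V"
  define \<eta> where "\<eta> = 4 * r"
  define E where "E = (\<lambda>f. measure_pmf.expectation M f :: real)"
  have int [simp]: "integrable (measure_pmf M) (f :: _ \<Rightarrow> real)" for f
    by (rule integrable_measure_pmf_finite[OF fin])
  have mono: "E f \<le> E g" if "\<And>x. f x \<le> g x" for f g
    unfolding E_def by (rule integral_mono) (use that in auto)
  have r0: "0 < r" and r1: "r \<le> a\<^sup>2 / 16" using t V by (auto simp: r_def)
  have asq: "a\<^sup>2 \<le> a / 6" using a by (simp add: power2_eq_square)
  have eta: "0 < \<eta>" "\<eta> \<le> a\<^sup>2 / 4" using r0 r1 by (auto simp: \<eta>_def)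
  have tau: "V * r\<^sup>2 = \<tau>" "t * r = \<tau>" using V by (auto simp: r_def \<tau>_def power2_eq_square)
  have tau0: "0 < \<tau>" using V t by (simp add: \<tau>_def)
  \<comment> \<open>In units of \<open>r = t / V\<close> all exponents become multiples of \<open>\<tau> = t ^ 2 / V\<close>.\<close>
  have ratio: "E (\<lambda>x. exp (c * r * W x)) \<le> exp (\<tau> * (c\<^sup>2 / 2 * (1 + \<eta>))) \<and>
     exp (\<tau> * (c\<^sup>2 / 2 * (1 - \<eta>))) \<le> E (\<lambda>x. exp (c * r * W x))" if c: "0 \<le> c" "c \<le> 2" for c
  proof -
    have c2: "2 * (c * r) \<le> \<eta>" using c r0 by (simp add: \<eta>_def)
    have "c * r \<le> 2 * r" using c r0 by simp
    also have "\<dots> \<le> 1" using r1 asq a by simp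
    finally have l: "0 \<le> c * r" "c * r \<le> 1" using c r0 by auto
    have eq: "V * ((c * r)\<^sup>2 / 2 * z) = \<tau> * (c\<^sup>2 / 2 * z)" for z
      by (simp add: tau(1)[symmetric] power_mult_distrib)
    have "V * ((c * r)\<^sup>2 / 2 * (1 + 2 * (c * r))) \<le> \<tau> * (c\<^sup>2 / 2 * (1 + \<eta>))"
      unfolding eq using tau0 c2 by (intro mult_left_mono) auto
    moreover have "\<tau> * (c\<^sup>2 / 2 * (1 - \<eta>)) \<le> V * ((c * r)\<^sup>2 / 2 * (1 - 2 * (c * r)))"
      unfolding eq using tau0 c2 by (intro mult_left_mono) auto
    ultimately show ?thesis using mgf[OF l] unfolding E_def
      by (meson exp_le_cancel_iff order_trans)
  qed
  define c where "c = 1 + 3 * a"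
  define T where "T = E (\<lambda>x. exp (c * r * W x))"
  define t2 where "t2 = (1 + 6 * a) * t"
  have Tlow: "T \<ge> exp (\<tau> * (c\<^sup>2 / 2 * (1 - \<eta>)))" using ratio[of c] a by (auto simp: T_def c_def)
  have Tpos: "0 < T" using Tlow by (meson exp_gt_zero less_le_trans)
  \<comment> \<open>A gain of \<open>a ^ 2\<close> in the exponent suffices, because \<open>\<tau> * a ^ 2 \<ge> 2\<close>.\<close>
  have quarter: "exp (\<tau> * x) \<le> T / 4" if "x \<le> c\<^sup>2 / 2 * (1 - \<eta>) - a\<^sup>2" for x
  proof -
    have "\<tau> * x \<le> \<tau> * (c\<^sup>2 / 2 * (1 - \<eta>) - a\<^sup>2)" using that tau0 by simp
    also have "\<dots> \<le> \<tau> * (c\<^sup>2 / 2 * (1 - \<eta>)) - 2" using t(3)[folded \<tau>_def] by (simp only: right_diff_distrib)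
    finally have "exp (\<tau> * x) \<le> exp (\<tau> * (c\<^sup>2 / 2 * (1 - \<eta>))) * exp (- 2)" by (simp add: exp_add[symmetric])
    also have "\<dots> \<le> T * (1 / 4)"
    proof (rule mult_mono)
      have "(2::real) * 2 \<le> exp 1 * exp 1" using exp_ge_add_one_self[of "1::real"] by (intro mult_mono) auto
      then have "4 \<le> exp (2::real)" by (simp add: exp_add[symmetric])
      then show "exp (- 2) \<le> 1 / (4::real)" by (simp add: exp_minus field_simps)
    qed (use Tlow Tpos in auto)
    finally show ?thesis by simp
  qed
  have csq: "c\<^sup>2 / 2 = 1/2 + 3 * a + 9/2 * a\<^sup>2" by (simp add: c_def power2_eq_square algebra_simps)
  have c94: "c\<^sup>2 / 2 \<le> 9/8" "0 \<le> c\<^sup>2 / 2" using a asq csq by auto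
  have c94e: "c\<^sup>2 / 2 * \<eta> \<le> 9/8 * \<eta>" using c94 eta by (intro mult_right_mono) auto
  have d6: "(1 + 6 * a)\<^sup>2 / 2 = 1/2 + 6 * a + 18 * a\<^sup>2" by (simp add: power2_eq_square algebra_simps)
  have d6e: "(1 + 6 * a)\<^sup>2 / 2 * \<eta> \<le> 2 * \<eta>" using eta d6 a asq by (intro mult_right_mono) auto
  have low: "E (\<lambda>x. exp (c * r * W x) * of_bool (W x < t)) \<le> T / 4"
  proof -
    have "E (\<lambda>x. exp (c * r * W x) * of_bool (W x < t)) \<le> E (\<lambda>x. exp (1 * r * W x) * exp (3 * a * r * t))"
    proof (rule mono)
      fix x
      have "3 * a * r * W x \<le> 3 * a * r * t" if "W x < t" using that a r0 by (intro mult_left_mono) auto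
      then show "exp (c * r * W x) * of_bool (W x < t) \<le> exp (1 * r * W x) * exp (3 * a * r * t)"
        by (auto simp: of_bool_def exp_add[symmetric] c_def algebra_simps)
    qed
    also have "\<dots> = E (\<lambda>x. exp (1 * r * W x)) * exp (3 * a * r * t)" by (simp add: E_def)
    also have "\<dots> \<le> exp (\<tau> * (1\<^sup>2 / 2 * (1 + \<eta>))) * exp (3 * a * r * t)" using ratio[of 1] by simp
    also have "\<dots> = exp (\<tau> * (1/2 + \<eta> / 2 + 3 * a))"
      by (simp add: exp_add[symmetric] algebra_simps tau(2)[symmetric])
    also have "\<dots> \<le> T / 4"
    proof (rule quarter)
      have "c\<^sup>2 / 2 * (1 - \<eta>) \<ge> 1/2 + 3 * a + 9/2 * a\<^sup>2 - 9/8 * \<eta>" using c94e csq by (simp add: algebra_simps)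
      then show "1/2 + \<eta> / 2 + 3 * a \<le> c\<^sup>2 / 2 * (1 - \<eta>) - a\<^sup>2" using eta zero_le_power2[of a] by linarith
    qed
    finally show ?thesis .
  qed
  have high: "E (\<lambda>x. exp (c * r * W x) * of_bool (W x > t2)) \<le> T / 4"
  proof -
    have "E (\<lambda>x. exp (c * r * W x) * of_bool (W x > t2)) \<le> E (\<lambda>x. exp ((1 + 6 * a) * r * W x) * exp (- (3 * a * r * t2)))"
    proof (rule mono)
      fix x
      have "3 * a * r * W x \<ge> 3 * a * r * t2" if "W x > t2" using that a r0 by (intro mult_left_mono) auto
      then show "exp (c * r * W x) * of_bool (W x > t2) \<le> exp ((1 + 6 * a) * r * W x) * exp (- (3 * a * r * t2))"
        by (auto simp: of_bool_def exp_add[symmetric] c_def algebra_simps)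
    qed
    also have "\<dots> = E (\<lambda>x. exp ((1 + 6 * a) * r * W x)) * exp (- (3 * a * r * t2))" by (simp add: E_def)
    also have "\<dots> \<le> exp (\<tau> * ((1 + 6 * a)\<^sup>2 / 2 * (1 + \<eta>))) * exp (- (3 * a * r * t2))"
      using ratio[of "1 + 6 * a"] a by simp
    also have "\<dots> = exp (\<tau> * ((1 + 6 * a)\<^sup>2 / 2 * (1 + \<eta>) - 3 * a * (1 + 6 * a)))"
      by (simp add: exp_add[symmetric] algebra_simps tau(2)[symmetric] t2_def)
    also have "\<dots> \<le> T / 4"
    proof (rule quarter)
      have "c\<^sup>2 / 2 * (1 - \<eta>) \<ge> 1/2 + 3 * a + 9/2 * a\<^sup>2 - 9/8 * \<eta>" using c94e csq by (simp add: algebra_simps)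
      moreover have "(1 + 6 * a)\<^sup>2 / 2 * (1 + \<eta>) \<le> 1/2 + 6 * a + 18 * a\<^sup>2 + 2 * \<eta>" using d6e d6 by (simp add: algebra_simps)
      moreover have "3 * a * (1 + 6 * a) = 3 * a + 18 * a\<^sup>2" by (simp add: power2_eq_square algebra_simps)
      ultimately show "(1 + 6 * a)\<^sup>2 / 2 * (1 + \<eta>) - 3 * a * (1 + 6 * a) \<le> c\<^sup>2 / 2 * (1 - \<eta>) - a\<^sup>2"
        using eta zero_le_power2[of a] by linarith
    qed
    finally show ?thesis .
  qed
  have "T \<le> E (\<lambda>x. exp (c * r * t2) * of_bool (W x \<ge> t) + (exp (c * r * W x) * of_bool (W x < t) + exp (c * r * W x) * of_bool (W x > t2)))"
    unfolding T_def
  proof (rule mono)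
    fix x
    have "0 \<le> c * r" using a r0 by (simp add: c_def)
    then have "c * r * W x \<le> c * r * t2" if "W x \<le> t2" using that by (intro mult_left_mono) auto
    then show "exp (c * r * W x) \<le> exp (c * r * t2) * of_bool (W x \<ge> t) + (exp (c * r * W x) * of_bool (W x < t) + exp (c * r * W x) * of_bool (W x > t2))"
      by (auto simp: of_bool_def)
  qed
  also have "\<dots> = exp (c * r * t2) * E (\<lambda>x. of_bool (W x \<ge> t)) + (E (\<lambda>x. exp (c * r * W x) * of_bool (W x < t)) + E (\<lambda>x. exp (c * r * W x) * of_bool (W x > t2)))"
    unfolding E_def by simp
  finally have half: "T / 2 \<le> exp (c * r * t2) * E (\<lambda>x. of_bool (W x \<ge> t))" using low high by linarith
  have Eq: "E (\<lambda>x. of_bool (W x \<ge> t)) = measure_pmf.prob M {x. W x \<ge> t}"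
  proof -
    have "measure_pmf.expectation M (indicator {x. W x \<ge> t}) = measure_pmf.prob M {x. W x \<ge> t}" by simp
    moreover have "indicator {x. W x \<ge> t} = (\<lambda>x. of_bool (W x \<ge> t) :: real)" by (auto simp: fun_eq_iff indicator_def)
    ultimately show ?thesis by (simp add: E_def)
  qed
  have crt: "c * r * t2 = \<tau> * (c * (1 + 6 * a))" by (simp add: t2_def tau(2)[symmetric])
  have "exp (- \<tau> * (1 / 2 + 9 * a)) / 2 \<le> exp (\<tau> * (c\<^sup>2 / 2 * (1 - \<eta>)) - c * r * t2) / 2"
  proof -
    have "c * (1 + 6 * a) = 1 + 9 * a + 18 * a\<^sup>2" by (simp add: c_def power2_eq_square algebra_simps)
    moreover have "c\<^sup>2 / 2 * (1 - \<eta>) \<ge> 1/2 + 3 * a + 9/2 * a\<^sup>2 - 9/8 * \<eta>" using c94e csq by (simp add: algebra_simps)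
    ultimately have "- (1/2 + 9 * a) \<le> c\<^sup>2 / 2 * (1 - \<eta>) - c * (1 + 6 * a)" using eta asq a zero_le_power2[of a] by linarith
    then have "\<tau> * (- (1/2 + 9 * a)) \<le> \<tau> * (c\<^sup>2 / 2 * (1 - \<eta>) - c * (1 + 6 * a))" using tau0 by simp
    then show ?thesis unfolding crt by (simp add: algebra_simps)
  qed
  also have "\<dots> \<le> (T / 2) / exp (c * r * t2)" using divide_right_mono[OF Tlow, of "2 * exp (c * r * t2)"] by (simp add: exp_diff mult.commute)
  also have "\<dots> \<le> measure_pmf.prob M {x. W x \<ge> t}" using half unfolding Eq by (simp add: field_simps)
  finally show ?thesis by (simp add: \<tau>_def)
qed

section \<open>Red edges between disjoint sets of vertices\<close>

text \<open>Probability that two disjoint sets with \<open>k\<close> pairs of vertices between them are neither completely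
adjacent nor completely non-adjacent.\<close>

definition mix_prob :: "real \<Rightarrow> nat \<Rightarrow> real" where
  "mix_prob p k = 1 - p ^ k - (1 - p) ^ k"

definition cross :: "'a set \<Rightarrow> 'a set \<Rightarrow> 'a set set" where
  "cross A B = (\<lambda>(a, b). {a, b}) ` (A \<times> B)"

definition disj_fam :: "'a set set \<Rightarrow> bool" where
  "disj_fam Q \<longleftrightarrow> partition_on (\<Union>Q) Q"

lemma disj_famD: "disj_fam Q \<Longrightarrow> B \<in> Q \<Longrightarrow> C \<in> Q \<Longrightarrow> B \<noteq> C \<Longrightarrow> B \<inter> C = {}"
  unfolding disj_fam_def partition_on_def disjoint_def by simp

lemma disj_fam_ne: "disj_fam Q \<Longrightarrow> B \<in> Q \<Longrightarrow> B \<noteq> {}"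
  unfolding disj_fam_def partition_on_def by auto

lemma disj_famI: "(\<And>B. B \<in> Q \<Longrightarrow> B \<noteq> {}) \<Longrightarrow> (\<And>B C. B \<in> Q \<Longrightarrow> C \<in> Q \<Longrightarrow> B \<noteq> C \<Longrightarrow> B \<inter> C = {}) \<Longrightarrow> disj_fam Q"
  unfolding disj_fam_def partition_on_def disjoint_def by auto

lemma disj_fam_subset: "disj_fam Q \<Longrightarrow> R \<subseteq> Q \<Longrightarrow> disj_fam R"
  by (intro disj_famI) (auto dest: disj_famD disj_fam_ne)

lemma disj_fam_partition: "partition_on V P \<Longrightarrow> disj_fam P"
  unfolding disj_fam_def partition_on_def by auto

lemma mix_prob_bounds:
  assumes "0 \<le> p" "p \<le> 1" "0 < k" shows "0 \<le> mix_prob p k" "mix_prob p k \<le> 1"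
proof -
  have "p ^ k \<le> p ^ 1" "(1 - p) ^ k \<le> (1 - p) ^ 1" using assms by (intro power_decreasing; simp)+
  then show "0 \<le> mix_prob p k" unfolding mix_prob_def by simp
  show "mix_prob p k \<le> 1" unfolding mix_prob_def using zero_le_power[of p k] zero_le_power[of "1 - p" k] assms by linarith
qed

lemma mix_prob_2: "mix_prob p 2 = 2 * p * (1 - p)"
  by (simp add: mix_prob_def power2_eq_square algebra_simps)

lemma mixed_cross: "mixed X A B \<longleftrightarrow> cross A B \<inter> X \<noteq> {} \<and> \<not> cross A B \<subseteq> X"
  unfolding mixed_def cross_def by auto

lemma depends_mixed: "depends_on (cross A B) (\<lambda>X. mixed X A B)"
  unfolding depends_on_def mixed_cross by auto

lemma card_cross:
  assumes "A \<inter> B = {}" shows "card (cross A B) = card A * card B"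
proof -
  have "inj_on (\<lambda>(a, b). {a, b}) (A \<times> B)"
    using assms by (auto simp: inj_on_def doubleton_eq_iff)
  then show ?thesis unfolding cross_def by (simp add: card_image card_cartesian_product)
qed

lemma cross_subset: "A \<subseteq> V \<Longrightarrow> B \<subseteq> V \<Longrightarrow> A \<inter> B = {} \<Longrightarrow> cross A B \<subseteq> all_edges V"
  unfolding cross_def by (auto simp: all_edges_iff)

text \<open>Different pairs of parts use disjoint sets of edges, so their colours are independent.\<close>

lemma cross_disjoint:
  assumes "A \<inter> B' = {}" "A \<inter> A' = {} \<or> B \<inter> B' = {}"
  shows "cross A B \<inter> cross A' B' = {}"
  using assms unfolding cross_def by (auto simp: doubleton_eq_iff)

lemma Prob_mixed:
  assumes V: "finite V" "A \<subseteq> V" "B \<subseteq> V" "A \<inter> B = {}" "A \<noteq> {}" "B \<noteq> {}" and p: "0 \<le> p" "p \<le> 1"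
  shows "Prob (all_edges V) p (\<lambda>X. mixed X A B) = mix_prob p (card A * card B)"
proof -
  let ?S = "all_edges V"
  have S: "finite ?S" by (rule finite_all_edges) fact
  have F: "cross A B \<subseteq> ?S" "cross A B \<noteq> {}" using cross_subset[OF V(2-4)] V by (auto simp: cross_def)
  have "Prob ?S p (\<lambda>X. mixed X A B) = expec ?S p (\<lambda>X. 1 - of_bool (cross A B \<subseteq> X) - of_bool (cross A B \<inter> X = {}))"
    unfolding Prob_eq_Ex mixed_cross by (rule expec_cong) (use F in \<open>auto simp: of_bool_def\<close>)
  also have "\<dots> = 1 - Prob ?S p (\<lambda>X. cross A B \<subseteq> X) - Prob ?S p (\<lambda>X. cross A B \<inter> X = {})"
    using S by (simp add: Prob_eq_Ex)
  also have "\<dots> = mix_prob p (card A * card B)"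
    unfolding Prob_all_none(1)[OF S F(1) p] Prob_all_none(2)[OF S F(1) p] card_cross[OF V(4)] mix_prob_def ..
  finally show ?thesis .
qed

lemma redcount_upper:
  assumes V: "finite V" "A \<subseteq> V" "A \<noteq> {}" "\<Union>Q \<subseteq> V" "disj_fam Q" "\<Union>Q \<inter> A = {}" and p: "0 \<le> p" "p \<le> 1"
    and N: "real (card Q) \<le> N" "0 < N" and a: "0 \<le> a"
  shows "Prob (all_edges V) p (\<lambda>X. real (redcount X A Q) \<ge> (\<Sum>B\<in>Q. mix_prob p (card A * card B)) + a) \<le> exp (- a\<^sup>2 / (2 * N))"
  unfolding redcount_def
proof (rule hoeffding_upper[where F = "cross A"])
  show "finite (all_edges V)" using V by (simp add: finite_all_edges)
  show "finite Q" using finite_UnionD[OF finite_subset[OF V(4,1)]] .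
  show "disjoint_family_on (cross A) Q" unfolding disjoint_family_on_def
  proof (intro ballI impI cross_disjoint)
    fix B C assume "B \<in> Q" "C \<in> Q" "B \<noteq> C"
    then show "A \<inter> C = {}" "A \<inter> A = {} \<or> B \<inter> C = {}" using V(6) disj_famD[OF V(5)] by auto
  qed
  fix B assume B: "B \<in> Q"
  have *: "B \<subseteq> V" "A \<inter> B = {}" "B \<noteq> {}" using B V(4,6) disj_fam_ne[OF V(5)] by auto
  show "cross A B \<subseteq> all_edges V" by (rule cross_subset[OF V(2) *(1,2)])
  show "depends_on (cross A B) (\<lambda>X. mixed X A B)" by (rule depends_mixed)
  show "Prob (all_edges V) p (\<lambda>X. mixed X A B) = mix_prob p (card A * card B)"
    by (rule Prob_mixed) (use V * p in auto)
qed (use N a in auto)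

lemma redcount_mono: "finite R \<Longrightarrow> Q \<subseteq> R \<Longrightarrow> redcount X A Q \<le> redcount X A R"
  unfolding redcount_def by (intro card_mono) auto

lemma redcount_mono_left: "finite Q \<Longrightarrow> A \<subseteq> A' \<Longrightarrow> redcount X A Q \<le> redcount X A' Q"
  unfolding redcount_def by (intro card_mono) (auto intro: mixed_mono)

lemma redcount_Un: "redcount X A (Q \<union> R) \<le> redcount X A Q + redcount X A R"
proof -
  have "{B \<in> Q \<union> R. mixed X A B} = {B \<in> Q. mixed X A B} \<union> {B \<in> R. mixed X A B}" by auto
  then show ?thesis unfolding redcount_def by (simp only: card_Un_le)
qed

lemma card_meeting:
  assumes "disj_fam Q" "finite A"
  shows "card {B \<in> Q. B \<inter> A \<noteq> {}} \<le> card A"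
proof -
  define f where "f B = (SOME x. x \<in> B \<inter> A)" for B
  have f: "f B \<in> B \<inter> A" if "B \<inter> A \<noteq> {}" for B
    unfolding f_def using that by (meson ex_in_conv someI_ex)
  have "inj_on f {B \<in> Q. B \<inter> A \<noteq> {}}"
  proof (rule inj_onI)
    fix B C assume *: "B \<in> {B \<in> Q. B \<inter> A \<noteq> {}}" "C \<in> {B \<in> Q. B \<inter> A \<noteq> {}}" "f B = f C"
    then have "f B \<in> B \<inter> C" using f[of B] f[of C] by auto
    then show "B = C" using disj_famD[OF assms(1), of B C] * by auto
  qed
  then show ?thesis by (rule card_inj_on_le) (use f assms in auto)
qed

text \<open>Parts that meet \<open>A\<close> may share edges inside \<open>A\<close>, so independence fails for them; being disjoint, there
are at most \<open>card A\<close> of them, an additive constant in all applications.\<close>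

lemma redcount_upper_general:
  assumes V: "finite V" "A \<subseteq> V" "A \<noteq> {}" "\<Union>Q \<subseteq> V" "disj_fam Q" and p: "0 \<le> p" "p \<le> 1"
    and N: "real (card Q) \<le> N" "0 < N" and a: "0 \<le> a"
  shows "Prob (all_edges V) p (\<lambda>X. real (redcount X A Q) \<ge> (\<Sum>B\<in>Q. mix_prob p (card A * card B)) + real (card A) + a)
    \<le> exp (- a\<^sup>2 / (2 * N))"
proof -
  define R where "R = {B \<in> Q. B \<inter> A = {}}"
  have fA: "finite A" and fQ: "finite Q" using finite_subset[OF V(2,1)] finite_UnionD[OF finite_subset[OF V(4,1)]] by auto
  have fS: "finite (all_edges V)" using V by (simp add: finite_all_edges)
  have RQ: "R \<subseteq> Q" by (auto simp: R_def)
  have gg0: "0 \<le> mix_prob p (card A * card B)" if "B \<in> Q" for B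
  proof (rule mix_prob_bounds)
    have "B \<subseteq> V" using that V(4) by auto
    then have "finite B" using V(1) finite_subset by auto
    moreover have "B \<noteq> {}" using disj_fam_ne[OF V(5) that] .
    ultimately
    show "0 < card A * card B" using fA V(3) by (simp add: card_gt_0_iff)
  qed fact+
  have "Prob (all_edges V) p (\<lambda>X. real (redcount X A Q) \<ge> (\<Sum>B\<in>Q. mix_prob p (card A * card B)) + real (card A) + a)
     \<le> Prob (all_edges V) p (\<lambda>X. real (redcount X A R) \<ge> (\<Sum>B\<in>R. mix_prob p (card A * card B)) + a)"
  proof (rule Prob_mono[OF fS])
    fix X assume *: "real (redcount X A Q) \<ge> (\<Sum>B\<in>Q. mix_prob p (card A * card B)) + real (card A) + a"
    have "Q \<subseteq> R \<union> {B \<in> Q. B \<inter> A \<noteq> {}}" by (auto simp: R_def)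
    then have "redcount X A Q \<le> redcount X A R + redcount X A {B \<in> Q. B \<inter> A \<noteq> {}}"
      using redcount_mono[of "R \<union> {B \<in> Q. B \<inter> A \<noteq> {}}" Q X A] fQ redcount_Un[of X A R "{B \<in> Q. B \<inter> A \<noteq> {}}"]
      by (auto simp: R_def)
    also have "\<dots> \<le> redcount X A R + card A"
      using redcount_le_card[of "{B \<in> Q. B \<inter> A \<noteq> {}}" X A] fQ card_meeting[OF V(5) fA] by simp
    finally have "real (redcount X A Q) \<le> redcount X A R + card A" by linarith
    moreover have "(\<Sum>B\<in>R. mix_prob p (card A * card B)) \<le> (\<Sum>B\<in>Q. mix_prob p (card A * card B))"
      using fQ RQ gg0 by (intro sum_mono2) auto
    ultimately show "real (redcount X A R) \<ge> (\<Sum>B\<in>R. mix_prob p (card A * card B)) + a" using * by linarith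
  qed
  also have "\<dots> \<le> exp (- a\<^sup>2 / (2 * N))"
  proof (rule redcount_upper)
    show "real (card R) \<le> N" using card_mono[OF fQ RQ] N by linarith
    show "disj_fam R" using disj_fam_subset[OF V(5) RQ] .
    show "\<Union>R \<inter> A = {}" "\<Union>R \<subseteq> V" using RQ V(4) by (auto simp: R_def)
  qed (use V p N a in auto)
  finally show ?thesis .
qed

text \<open>With linearly many sets in both families the deviation \<open>a\<close> may be of order \<open>n ^ 2\<close>, giving a failure
probability \<open>exp (- c * n ^ 2)\<close> that survives a union bound over all pairs of families.\<close>

lemma mixed_pairs_lower:
  assumes V: "finite V" "\<Union>\<A> \<subseteq> V" "\<Union>\<B> \<subseteq> V" "disj_fam \<A>" "disj_fam \<B>" "\<Union>\<A> \<inter> \<Union>\<B> = {}" and p: "0 \<le> p" "p \<le> 1"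
    and N: "real (card \<A> * card \<B>) \<le> N" "0 < N" and a: "0 < a"
  shows "Prob (all_edges V) p (\<lambda>X. real (card {(A, B) \<in> \<A> \<times> \<B>. mixed X A B}) \<le>
     (\<Sum>(A, B)\<in>\<A> \<times> \<B>. mix_prob p (card A * card B)) - a) \<le> exp (- a\<^sup>2 / (2 * N))"
proof -
  have fin: "finite (\<A> \<times> \<B>)" using finite_UnionD[OF finite_subset[OF V(2,1)]] finite_UnionD[OF finite_subset[OF V(3,1)]] by simp
  have dj: "A \<inter> B = {}" if "A \<in> \<A>" "B \<in> \<B>" for A B using that V(6) by blast
  have "Prob (all_edges V) p (\<lambda>X. real (card {z \<in> \<A> \<times> \<B>. mixed X (fst z) (snd z)}) \<le>
     (\<Sum>z\<in>\<A> \<times> \<B>. mix_prob p (card (fst z) * card (snd z))) - a) \<le> exp (- a\<^sup>2 / (2 * N))"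
  proof (rule hoeffding_lower[where F = "\<lambda>z. cross (fst z) (snd z)"])
    show "finite (all_edges V)" using V by (simp add: finite_all_edges)
    show "disjoint_family_on (\<lambda>z. cross (fst z) (snd z)) (\<A> \<times> \<B>)" unfolding disjoint_family_on_def
    proof (intro ballI impI cross_disjoint)
      fix z w assume zw: "z \<in> \<A> \<times> \<B>" "w \<in> \<A> \<times> \<B>" "z \<noteq> w"
      then show "fst z \<inter> snd w = {}" using dj[of "fst z" "snd w"] by (simp add: mem_Times_iff)
      have "fst z \<noteq> fst w \<or> snd z \<noteq> snd w" using zw by (simp add: prod_eq_iff)
      then show "fst z \<inter> fst w = {} \<or> snd z \<inter> snd w = {}"
        using zw disj_famD[OF V(4), of "fst z" "fst w"] disj_famD[OF V(5), of "snd z" "snd w"]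
        by (auto simp only: mem_Times_iff)
    qed
    fix z assume z: "z \<in> \<A> \<times> \<B>"
    then have *: "fst z \<subseteq> V" "snd z \<subseteq> V" "fst z \<inter> snd z = {}" "fst z \<noteq> {}" "snd z \<noteq> {}"
      using V(2,3) dj[of "fst z" "snd z"] disj_fam_ne[OF V(4), of "fst z"] disj_fam_ne[OF V(5), of "snd z"]
      by (auto simp only: mem_Times_iff)
    show "cross (fst z) (snd z) \<subseteq> all_edges V" by (rule cross_subset[OF *(1-3)])
    show "depends_on (cross (fst z) (snd z)) (\<lambda>X. mixed X (fst z) (snd z))" by (rule depends_mixed)
    show "Prob (all_edges V) p (\<lambda>X. mixed X (fst z) (snd z)) = mix_prob p (card (fst z) * card (snd z))"
      by (rule Prob_mixed) (use V * p in auto)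
  qed (use N a fin card_cartesian_product[of \<A> \<B>] in auto)
  then show ?thesis by (simp add: case_prod_unfold mem_Times_iff conj_assoc)
qed

section \<open>Two vertices against the remaining ones\<close>

text \<open>For a pair \<open>A\<close> this is the size of the symmetric difference of the two neighbourhoods inside \<open>W\<close>.\<close>

definition mixdeg :: "'a set set \<Rightarrow> 'a set \<Rightarrow> 'a set \<Rightarrow> nat" where
  "mixdeg X A W = card {x \<in> W. mixed X A {x}}"

lemma redcount_singles: "redcount X A (singles W) = mixdeg X A W"
proof -
  have "{B \<in> singles W. mixed X A B} = (\<lambda>x. {x}) ` {x \<in> W. mixed X A {x}}" by (auto simp: singles_def)
  then show ?thesis unfolding redcount_def mixdeg_def by (simp add: card_image)
qed

lemma mixdeg_sum: "finite W \<Longrightarrow> real (mixdeg X A W) = (\<Sum>x\<in>W. of_bool (mixed X A {x}))"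
  unfolding mixdeg_def by (simp add: sum_of_bool_eq Int_def)

context
  fixes V W :: "'a set" and p r :: real
  assumes V: "finite V" "W \<subseteq> V" and p: "0 \<le> p" "p \<le> 1" and r: "r = 2 * p * (1 - p)"
begin

lemma finite_W_edges: "finite W" "finite (all_edges V)"
  using V finite_subset finite_all_edges by auto

lemma Prob_mixed_vertex:
  assumes "card A = 2" "A \<subseteq> V - W" "x \<in> W"
  shows "Prob (all_edges V) p (\<lambda>X. mixed X A {x}) = r"
proof -
  have "A \<noteq> {}" using assms by auto
  then show ?thesis
    using Prob_mixed[of V A "{x}" p] V p assms r by (auto simp: mix_prob_2[symmetric])
qed

lemma cross_vertex_family:
  assumes "A \<subseteq> V - W"
  shows "disjoint_family_on (\<lambda>x. cross A {x}) W" "x \<in> W \<Longrightarrow> cross A {x} \<subseteq> all_edges V"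
proof -
  show "disjoint_family_on (\<lambda>x. cross A {x}) W" unfolding disjoint_family_on_def
    using assms by (intro ballI impI cross_disjoint) auto
  show "x \<in> W \<Longrightarrow> cross A {x} \<subseteq> all_edges V" using assms V by (intro cross_subset) auto
qed

lemma pair_tail_upper:
  assumes A: "card A = 2" "A \<subseteq> V - W" and l: "0 \<le> l"
  shows "Prob (all_edges V) p (\<lambda>X. real (mixdeg X A W) \<le> r * real (card W) - a)
     \<le> exp (real (card W) * (r * (1 - r)) * (l\<^sup>2 / 2 * exp (1 * l)) - l * a)"
proof -
  have "Prob (all_edges V) p (\<lambda>X. real (mixdeg X A W) \<le> r * real (card W) - a) =
     Prob (all_edges V) p (\<lambda>X. (\<Sum>x\<in>W. r - of_bool (mixed X A {x})) \<ge> a)"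
    unfolding mixdeg_sum[OF finite_W_edges(1)] by (simp add: sum_subtractf algebra_simps)
  also have "\<dots> \<le> exp (real (card W) * (r * (1 - r)) * (l\<^sup>2 / 2 * exp (1 * l)) - l * a)"
  proof (rule chernoff[where F="\<lambda>x. cross A {x}"])
    show "disjoint_family_on (\<lambda>x. cross A {x}) W" by (rule cross_vertex_family) fact
    fix x assume x: "x \<in> W"
    note q = Prob_mixed_vertex[OF A x]
    show "cross A {x} \<subseteq> all_edges V" using cross_vertex_family(2)[OF A(2) x] .
    show "depends_on (cross A {x}) (\<lambda>X. r - of_bool (mixed X A {x}))"
      using depends_mixed[of A "{x}"] by (simp add: depends_on_def)
    show "\<bar>r - of_bool (mixed X A {x})\<bar> \<le> 1" for X
      using Prob_bounds[of "all_edges V" p "\<lambda>X. mixed X A {x}"] q by (auto simp: of_bool_def)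
    show "expec (all_edges V) p (\<lambda>X. r - of_bool (mixed X A {x})) = 0"
      "expec (all_edges V) p (\<lambda>X. (r - of_bool (mixed X A {x}))\<^sup>2) \<le> r * (1 - r)"
      using expec_indicator_var[OF finite_W_edges(2) q] by auto
  qed (use finite_W_edges l in auto)
  finally show ?thesis .
qed

text \<open>Two pairs with a common vertex are correlated when \<open>p \<noteq> 1/2\<close>, because vertices of low degree help all
of their pairs. The variance \<open>6 * s - 16 * s ^ 2\<close> of the sum, with \<open>s = p * (1 - p)\<close>, stays close to twice the
single variance \<open>2 * s * (1 - 2 * s)\<close> for \<open>p\<close> near \<open>1/2\<close>, and that is what the second moment argument needs.\<close>

lemma two_pairs_moments:
  assumes uvw: "u \<noteq> v" "u \<noteq> v'" "v \<noteq> v'" "{u, v, v'} \<subseteq> V - W" and x: "x \<in> W"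
  defines "Y \<equiv> \<lambda>X. (r - of_bool (mixed X {u, v} {x})) + (r - of_bool (mixed X {u, v'} {x}))"
  shows "expec (all_edges V) p Y = 0"
    "expec (all_edges V) p (\<lambda>X. (Y X)\<^sup>2) = 6 * (p * (1 - p)) - 16 * (p * (1 - p))\<^sup>2"
proof -
  let ?S = "all_edges V"
  let ?E = "expec ?S p"
  have A: "card {u, v} = 2" "{u, v} \<subseteq> V - W" "card {u, v'} = 2" "{u, v'} \<subseteq> V - W" using uvw by auto
  note q1 = Prob_mixed_vertex[OF A(1,2) x] and q2 = Prob_mixed_vertex[OF A(3,4) x]
  have e: "?E (\<lambda>X. of_bool (mixed X {u, v} {x})) = r" "?E (\<lambda>X. of_bool (mixed X {u, v'} {x})) = r"
    using q1 q2 unfolding Prob_eq_Ex by auto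
  show "?E Y = 0" using finite_W_edges e by (simp add: Y_def)
  have mem: "{y, x} \<in> ?S" if "y \<in> {u, v, v'}" for y using that uvw(4) x V by (auto simp: all_edges_iff)
  define a b c where "a = {u, x}" and "b = {v, x}" and "c = {v', x}"
  have abc: "a \<in> ?S" "b \<in> ?S" "c \<in> ?S" "a \<noteq> b" "a \<noteq> c" "b \<noteq> c"
    using mem uvw by (auto simp: a_def b_def c_def doubleton_eq_iff)
  have m1: "mixed X {u, v} {x} \<longleftrightarrow> (a \<in> X) \<noteq> (b \<in> X)" and m2: "mixed X {u, v'} {x} \<longleftrightarrow> (a \<in> X) \<noteq> (c \<in> X)" for X
    by (auto simp: mixed_def a_def b_def c_def)
  have P1: "?E (\<lambda>X. of_bool (a \<in> X) * of_bool (b \<notin> X \<and> c \<notin> X)) = p * (1 - p)\<^sup>2"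
  proof -
    have "?E (\<lambda>X. of_bool (a \<in> X) * of_bool (b \<notin> X \<and> c \<notin> X)) = Prob ?S p (\<lambda>X. {a} \<subseteq> X) * Prob ?S p (\<lambda>X. {b, c} \<inter> X = {})"
      unfolding Prob_eq_Ex
      by (subst expec_mult[of ?S "{a}" "{b,c}"]) (use finite_W_edges abc in \<open>auto simp: depends_on_def\<close>)
    then show ?thesis
      using Prob_all_none(1)[OF finite_W_edges(2), of "{a}" p] Prob_all_none(2)[OF finite_W_edges(2), of "{b, c}" p] abc p by (simp add: power2_eq_square)
  qed
  have P2: "?E (\<lambda>X. of_bool (a \<notin> X) * of_bool (b \<in> X \<and> c \<in> X)) = (1 - p) * p\<^sup>2"
  proof -
    have "?E (\<lambda>X. of_bool (a \<notin> X) * of_bool (b \<in> X \<and> c \<in> X)) = Prob ?S p (\<lambda>X. {a} \<inter> X = {}) * Prob ?S p (\<lambda>X. {b, c} \<subseteq> X)"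
      unfolding Prob_eq_Ex
      by (subst expec_mult[of ?S "{a}" "{b,c}"]) (use finite_W_edges abc in \<open>auto simp: depends_on_def\<close>)
    then show ?thesis
      using Prob_all_none(2)[OF finite_W_edges(2), of "{a}" p] Prob_all_none(1)[OF finite_W_edges(2), of "{b, c}" p] abc p by (simp add: power2_eq_square)
  qed
  have "?E (\<lambda>X. (Y X)\<^sup>2) = ?E (\<lambda>X. (4 * r\<^sup>2) + (1 - 4 * r) * of_bool (mixed X {u, v} {x}) + (1 - 4 * r) * of_bool (mixed X {u, v'} {x})
     + 2 * (of_bool (a \<in> X) * of_bool (b \<notin> X \<and> c \<notin> X)) + 2 * (of_bool (a \<notin> X) * of_bool (b \<in> X \<and> c \<in> X)))"
    by (rule expec_cong) (auto simp: Y_def m1 m2 of_bool_def power2_eq_square algebra_simps)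
  also have "\<dots> = 4 * r\<^sup>2 + (1 - 4 * r) * r + (1 - 4 * r) * r + 2 * (p * (1 - p)\<^sup>2) + 2 * ((1 - p) * p\<^sup>2)"
    using finite_W_edges by (simp add: e P1 P2)
  also have "\<dots> = 6 * (p * (1 - p)) - 16 * (p * (1 - p))\<^sup>2"
    unfolding r by (simp add: power2_eq_square algebra_simps)
  finally show "?E (\<lambda>X. (Y X)\<^sup>2) = 6 * (p * (1 - p)) - 16 * (p * (1 - p))\<^sup>2" .
qed

lemma two_pairs_tail_upper:
  assumes uvw: "u \<noteq> v" "u \<noteq> v'" "v \<noteq> v'" "{u, v, v'} \<subseteq> V - W" and l: "0 \<le> l"
  shows "Prob (all_edges V) p (\<lambda>X. real (mixdeg X {u, v} W) \<le> r * real (card W) - a \<and> real (mixdeg X {u, v'} W) \<le> r * real (card W) - a)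
     \<le> exp (real (card W) * (6 * (p * (1 - p)) - 16 * (p * (1 - p))\<^sup>2) * (l\<^sup>2 / 2 * exp (2 * l)) - l * (2 * a))"
proof -
  define Y where "Y = (\<lambda>x X. (r - of_bool (mixed X {u, v} {x})) + (r - of_bool (mixed X {u, v'} {x})))"
  have "Prob (all_edges V) p (\<lambda>X. real (mixdeg X {u, v} W) \<le> r * real (card W) - a \<and> real (mixdeg X {u, v'} W) \<le> r * real (card W) - a)
     \<le> Prob (all_edges V) p (\<lambda>X. (\<Sum>x\<in>W. Y x X) \<ge> 2 * a)"
    unfolding mixdeg_sum[OF finite_W_edges(1)] Y_def
    by (rule Prob_mono[OF finite_W_edges(2)]) (auto simp: sum.distrib sum_subtractf algebra_simps)
  also have "\<dots> \<le> exp (real (card W) * (6 * (p * (1 - p)) - 16 * (p * (1 - p))\<^sup>2) * (l\<^sup>2 / 2 * exp (2 * l)) - l * (2 * a))"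
  proof (rule chernoff[where F="\<lambda>x. cross {u, v, v'} {x}"])
    show "disjoint_family_on (\<lambda>x. cross {u, v, v'} {x}) W" by (rule cross_vertex_family) fact
    fix x assume x: "x \<in> W"
    have A: "card {u, v} = 2" "{u, v} \<subseteq> V - W" using uvw by auto
    show "cross {u, v, v'} {x} \<subseteq> all_edges V" using cross_vertex_family(2)[OF uvw(4) x] .
    show "depends_on (cross {u, v, v'} {x}) (Y x)"
      unfolding depends_on_def Y_def by (auto simp: mixed_def cross_def)
    have "0 \<le> r" "r \<le> 1"
      using Prob_bounds[of "all_edges V" p "\<lambda>X. mixed X {u, v} {x}"] unfolding Prob_mixed_vertex[OF A x] by auto
    then show "\<bar>Y x X\<bar> \<le> 2" for X by (auto simp: of_bool_def Y_def)
    show "expec (all_edges V) p (Y x) = 0"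
      "expec (all_edges V) p (\<lambda>X. (Y x X)\<^sup>2) \<le> 6 * (p * (1 - p)) - 16 * (p * (1 - p))\<^sup>2"
      using two_pairs_moments[OF uvw x] unfolding Y_def by auto
  qed (use finite_W_edges l in auto)
  finally show ?thesis .
qed

lemma pair_tail_lower:
  assumes A: "card A = 2" "A \<subseteq> V - W" and p1: "0 < p" "p < 1" and W: "W \<noteq> {}"
    and a: "0 < a" "a \<le> 1 / 6"
    and t: "0 < t" "t / (real (card W) * (r * (1 - r))) \<le> a\<^sup>2 / 16" "t\<^sup>2 / (real (card W) * (r * (1 - r))) * a\<^sup>2 \<ge> 2"
  shows "Prob (all_edges V) p (\<lambda>X. real (mixdeg X A W) \<le> r * real (card W) - t)
     \<ge> exp (- (t\<^sup>2 / (real (card W) * (r * (1 - r)))) * (1 / 2 + 9 * a)) / 2"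
proof -
  define v where "v = r * (1 - r)"
  define Y where "Y = (\<lambda>x X. r - of_bool (mixed X A {x}))"
  have rpos: "0 < r" using p1 by (simp add: r)
  have "r \<le> 1/2" using mult_one_minus_le_quarter[of p] by (simp add: r)
  then have v0: "0 < v" "v \<le> 1" using rpos mult_one_minus_le_quarter[of r] by (auto simp: v_def)
  have V0: "0 < real (card W) * v" using v0 W finite_W_edges by (simp add: card_gt_0_iff)
  have mgf1: "exp (v * (l\<^sup>2 / 2 * (1 - 2 * l))) \<le> expec (all_edges V) p (\<lambda>X. exp (l * Y x X)) \<and>
      expec (all_edges V) p (\<lambda>X. exp (l * Y x X)) \<le> exp (v * (l\<^sup>2 / 2 * (1 + 2 * l)))"
    if x: "x \<in> W" and l: "0 \<le> l" "l \<le> 1" for x l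
  proof -
    note q = Prob_mixed_vertex[OF A x]
    have b: "\<bar>Y x X\<bar> \<le> 1" for X
      using Prob_bounds[of "all_edges V" p "\<lambda>X. mixed X A {x}"] q by (auto simp: of_bool_def Y_def)
    have m: "expec (all_edges V) p (Y x) = 0" "expec (all_edges V) p (\<lambda>X. (Y x X)\<^sup>2) = v"
      using expec_indicator_var[OF finite_W_edges(2) q] by (auto simp: Y_def v_def)
    have "expec (all_edges V) p (\<lambda>X. exp (l * Y x X)) \<le> exp (v * (l\<^sup>2 / 2 * exp (1 * l)))"
      by (rule mgf_upper) (use finite_W_edges b m l in auto)
    also have "\<dots> \<le> exp (v * (l\<^sup>2 / 2 * (1 + 2 * l)))"
    proof -
      have "l\<^sup>2 \<le> l" using l by (simp add: power2_eq_square mult_left_le)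
      then have "exp l \<le> 1 + 2 * l" using exp_bound[OF l] by linarith
      then show ?thesis using v0 by (simp add: mult_left_mono)
    qed
    finally show ?thesis using mgf_lower[of "all_edges V" "Y x" p v l] finite_W_edges b m l v0 by simp
  qed
  have mgf: "expec (all_edges V) p (\<lambda>X. exp (l * (\<Sum>x\<in>W. Y x X))) = (\<Prod>x\<in>W. expec (all_edges V) p (\<lambda>X. exp (l * Y x X)))" for l
  proof (rule expec_exp_sum[where F="\<lambda>x. cross A {x}"])
    show "disjoint_family_on (\<lambda>x. cross A {x}) W" by (rule cross_vertex_family) fact
    fix x assume x: "x \<in> W"
    show "cross A {x} \<subseteq> all_edges V" using cross_vertex_family(2)[OF A(2) x] .
    show "depends_on (cross A {x}) (Y x)"
      using depends_mixed[of A "{x}"] by (simp add: depends_on_def Y_def)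
  qed (use finite_W_edges in auto)
  have "exp (- (t\<^sup>2 / (real (card W) * v)) * (1 / 2 + 9 * a)) / 2 \<le> Prob (all_edges V) p (\<lambda>X. (\<Sum>x\<in>W. Y x X) \<ge> t)"
  proof (rule moderate_deviation_lower[OF finite_set_rand_subset[OF finite_W_edges(2)] V0 _ a])
    fix l :: real assume l: "0 \<le> l" "l \<le> 1"
    have "(\<Prod>x\<in>W. exp (v * z)) = exp (real (card W) * v * z)" for z
      by (simp add: exp_of_nat_mult[symmetric] mult.assoc)
    moreover have "(\<Prod>x\<in>W. exp (v * (l\<^sup>2 / 2 * (1 - 2 * l)))) \<le> (\<Prod>x\<in>W. expec (all_edges V) p (\<lambda>X. exp (l * Y x X)))"
      by (intro prod_mono) (use mgf1 l in auto)
    moreover have "(\<Prod>x\<in>W. expec (all_edges V) p (\<lambda>X. exp (l * Y x X))) \<le> (\<Prod>x\<in>W. exp (v * (l\<^sup>2 / 2 * (1 + 2 * l))))"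
      by (intro prod_mono) (use mgf1 l in \<open>auto intro!: integral_nonneg_AE\<close>)
    ultimately show "exp (real (card W) * v * (l\<^sup>2 / 2 * (1 - 2 * l))) \<le> expec (all_edges V) p (\<lambda>X. exp (l * (\<Sum>x\<in>W. Y x X))) \<and>
       expec (all_edges V) p (\<lambda>X. exp (l * (\<Sum>x\<in>W. Y x X))) \<le> exp (real (card W) * v * (l\<^sup>2 / 2 * (1 + 2 * l)))"
      unfolding mgf by metis
  qed (use t in \<open>auto simp: v_def\<close>)
  also have "\<dots> = Prob (all_edges V) p (\<lambda>X. real (mixdeg X A W) \<le> r * real (card W) - t)"
    unfolding mixdeg_sum[OF finite_W_edges(1)] Y_def by (simp add: sum_subtractf algebra_simps)
  finally show ?thesis by (simp add: v_def)
qed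

lemma disjoint_pairs_indep:
  assumes A: "A \<subseteq> V - W" "B \<subseteq> V - W" "A \<inter> B = {}"
  shows "Prob (all_edges V) p (\<lambda>X. real (mixdeg X A W) \<le> a \<and> real (mixdeg X B W) \<le> b) =
    Prob (all_edges V) p (\<lambda>X. real (mixdeg X A W) \<le> a) * Prob (all_edges V) p (\<lambda>X. real (mixdeg X B W) \<le> b)"
proof -
  have dep: "depends_on (cross A W) (\<lambda>X. mixdeg X A W)" for A :: "'a set"
    unfolding depends_on_def
  proof
    fix X :: "'a set set"
    have "mixed (X \<inter> cross A W) A {x} \<longleftrightarrow> mixed X A {x}" if "x \<in> W" for x
      using that unfolding mixed_def cross_def by auto
    then show "mixdeg (X \<inter> cross A W) A W = mixdeg X A W" unfolding mixdeg_def by (metis (no_types, lifting) Collect_cong)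
  qed
  have "expec (all_edges V) p (\<lambda>X. of_bool (real (mixdeg X A W) \<le> a) * of_bool (real (mixdeg X B W) \<le> b)) =
    expec (all_edges V) p (\<lambda>X. of_bool (real (mixdeg X A W) \<le> a)) * expec (all_edges V) p (\<lambda>X. of_bool (real (mixdeg X B W) \<le> b))"
  proof (rule expec_mult[where F="cross A W" and G="cross B W"])
    show "cross A W \<subseteq> all_edges V" by (rule cross_subset) (use A V in auto)
    show "cross B W \<subseteq> all_edges V" by (rule cross_subset) (use A V in auto)
    show "cross A W \<inter> cross B W = {}" using A by (intro cross_disjoint) auto
    show "depends_on (cross A W) (\<lambda>X. of_bool (real (mixdeg X A W) \<le> a))" "depends_on (cross B W) (\<lambda>X. of_bool (real (mixdeg X B W) \<le> b))"
      using dep[of A] dep[of B] by (auto simp: depends_on_def)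
  qed (use finite_W_edges in auto)
  then show ?thesis unfolding Prob_eq_Ex by (simp add: of_bool_conj)
qed

end

section \<open>Statements with high probability\<close>

text \<open>High probability for events of edge sets, phrased through the probability of failure so that union
bounds apply directly.\<close>

definition edge_whp :: "real \<Rightarrow> (nat \<Rightarrow> nat set set \<Rightarrow> bool) \<Rightarrow> bool" where
  "edge_whp p Q \<longleftrightarrow> (\<lambda>n. Prob (all_edges {1..n}) p (\<lambda>X. \<not> Q n X)) \<longlonglongrightarrow> 0"

declare finite_all_edges [simp]

lemma edge_whpI:
  assumes "eventually (\<lambda>n. Prob (all_edges {1..n}) p (\<lambda>X. \<not> Q n X) \<le> e n) sequentially" "e \<longlonglongrightarrow> 0"
  shows "edge_whp p Q"
  unfolding edge_whp_def
  by (rule tendsto_sandwich[OF _ assms(1) tendsto_const assms(2)]) auto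

lemma edge_whp_conj_mono:
  assumes "edge_whp p Q" "edge_whp p R"
    "eventually (\<lambda>n. \<forall>X. X \<subseteq> all_edges {1..n} \<longrightarrow> Q n X \<longrightarrow> R n X \<longrightarrow> T n X) sequentially"
  shows "edge_whp p T"
proof (rule edge_whpI)
  show "\<forall>\<^sub>F n in sequentially. Prob (all_edges {1..n}) p (\<lambda>X. \<not> T n X) \<le>
     Prob (all_edges {1..n}) p (\<lambda>X. \<not> Q n X) + Prob (all_edges {1..n}) p (\<lambda>X. \<not> R n X)"
    using assms(3) by eventually_elim (rule Prob_disj, auto)
  show "(\<lambda>n. Prob (all_edges {1..n}) p (\<lambda>X. \<not> Q n X) + Prob (all_edges {1..n}) p (\<lambda>X. \<not> R n X)) \<longlonglongrightarrow> 0"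
    using tendsto_add[OF assms(1,2)[unfolded edge_whp_def]] by simp
qed

lemma gnp_eq_rand_subset: "gnp n p = map_pmf (Pair {1..n}) (rand_subset (all_edges {1..n}) p)"
  unfolding gnp_def rand_subset_def by (simp add: pmf.map_comp o_def)

lemma gnp_whp_iff: "gnp_whp p Q \<longleftrightarrow> edge_whp p (\<lambda>n X. Q n ({1..n}, X))"
proof -
  have eq: "measure_pmf.prob (gnp n p) {G. Q n G} = 1 - Prob (all_edges {1..n}) p (\<lambda>X. \<not> Q n ({1..n}, X))" for n
  proof -
    have "measure_pmf.prob (gnp n p) {G. Q n G} = Prob (all_edges {1..n}) p (\<lambda>X. Q n ({1..n}, X))"
      unfolding gnp_eq_rand_subset by (simp add: vimage_def)
    also have "\<dots> = expec (all_edges {1..n}) p (\<lambda>X. 1 - of_bool (\<not> Q n ({1..n}, X)))"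
      unfolding Prob_eq_Ex by (rule expec_cong) auto
    also have "\<dots> = 1 - Prob (all_edges {1..n}) p (\<lambda>X. \<not> Q n ({1..n}, X))"
      unfolding Prob_eq_Ex by simp
    finally show ?thesis .
  qed
  show ?thesis unfolding gnp_whp_def edge_whp_def eq
    using tendsto_diff[OF tendsto_const[of "1::real"], of "\<lambda>n. Prob (all_edges {1..n}) p (\<lambda>X. \<not> Q n ({1..n}, X))" 0 sequentially]
      tendsto_diff[OF tendsto_const[of "1::real"], of "\<lambda>n. 1 - Prob (all_edges {1..n}) p (\<lambda>X. \<not> Q n ({1..n}, X))" 1 sequentially]
    by auto
qed

text \<open>Diagonalisation: the infimum of all \<open>\<epsilon>\<close> that fail with probability at most \<open>\<epsilon>\<close> tends to zero, and an
\<open>\<epsilon>\<close> close to that infimum serves as the error for the given \<open>n\<close>.\<close>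

lemma whp_o_from_epsilon:
  assumes "\<And>\<epsilon>. 0 < \<epsilon> \<Longrightarrow> gnp_whp p (\<lambda>n G. \<bar>X G - f n\<bar> \<le> \<epsilon> * g n)"
    and g: "eventually (\<lambda>n. 0 < g n) sequentially"
  shows "gnp_whp_eq_plus_o p X f g"
proof -
  define bad where "bad n \<epsilon> = Prob (all_edges {1..n}) p (\<lambda>Y. \<not> \<bar>X ({1..n}, Y) - f n\<bar> \<le> \<epsilon> * g n)" for n \<epsilon>
  have bad: "(\<lambda>n. bad n \<epsilon>) \<longlonglongrightarrow> 0" if "0 < \<epsilon>" for \<epsilon>
    using assms(1)[OF that] unfolding gnp_whp_iff edge_whp_def bad_def .
  define T where "T n = {\<epsilon>. 0 < \<epsilon> \<and> bad n \<epsilon> \<le> \<epsilon>}" for n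
  have T1: "1 \<in> T n" for n unfolding T_def bad_def by simp
  have bdd: "bdd_below (T n)" for n unfolding T_def by (rule bdd_belowI[of _ 0]) auto
  have "\<exists>\<epsilon>. \<epsilon> \<in> T n \<and> \<epsilon> < Inf (T n) + 1 / real (Suc n)" for n
  proof -
    have "Inf (T n) < Inf (T n) + 1 / real (Suc n)" by simp
    then show ?thesis using cInf_lessD[of "T n"] T1 by (metis empty_iff)
  qed
  then obtain e where e: "e n \<in> T n" "e n < Inf (T n) + 1 / real (Suc n)" for n by metis
  have e0: "e \<longlonglongrightarrow> 0"
  proof (rule LIMSEQ_I)
    fix d :: real assume d: "0 < d"
    have "eventually (\<lambda>n. bad n (d / 2) < d / 2) sequentially"
      using order_tendstoD(2)[OF bad[of "d / 2"], of "d / 2"] d by simp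
    moreover have "eventually (\<lambda>n. 1 / real (Suc n) < d / 2) sequentially"
      using order_tendstoD(2)[OF LIMSEQ_inverse_real_of_nat, of "d / 2"] d by (simp add: inverse_eq_divide)
    ultimately have "eventually (\<lambda>n. norm (e n - 0) < d) sequentially"
    proof eventually_elim
      case (elim n)
      have "d / 2 \<in> T n" using elim d by (simp add: T_def)
      then have "Inf (T n) \<le> d / 2" by (rule cInf_lower[OF _ bdd])
      moreover have "0 < e n" using e(1)[of n] by (simp add: T_def)
      ultimately show ?case using e(2)[of n] elim by simp
    qed
    then show "\<exists>no. \<forall>n\<ge>no. norm (e n - 0) < d" by (simp add: eventually_sequentially)
  qed
  show ?thesis unfolding gnp_whp_eq_plus_o_def
  proof (intro exI[of _ "\<lambda>n. e n * g n"] conjI)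
    have "eventually (\<lambda>n. e n * g n / g n = e n) sequentially" using g by eventually_elim simp
    then show "(\<lambda>n. e n * g n / g n) \<longlonglongrightarrow> 0" using e0 by (simp add: tendsto_cong)
    show "gnp_whp p (\<lambda>n G. \<bar>X G - f n\<bar> \<le> e n * g n)" unfolding gnp_whp_iff
      by (rule edge_whpI[OF _ e0]) (use e(1) in \<open>simp add: T_def bad_def\<close>)
  qed
qed

section \<open>Good pairs created by the first merges\<close>

lemma finite_partition: "finite V \<Longrightarrow> partition_on V P \<Longrightarrow> finite P"
  by (rule finite_elements)

lemma sum_card_partition:
  assumes "finite V" "partition_on V P" shows "(\<Sum>A\<in>P. card A) = card V"
proof -
  have "card V = card (\<Union>P)" using assms by (simp add: partition_on_def)
  also have "\<dots> = (\<Sum>A\<in>P. card A)"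
    by (rule card_Union_disjoint) (use assms in \<open>auto simp: partition_on_def disjoint_def pairwise_def disjnt_def intro: finite_subset\<close>)
  finally show ?thesis by simp
qed

lemma chain_partition:
  assumes "finite V" "partition_on V (P 0)" "\<forall>i<k. merge_step (P i) (P (Suc i))" "i \<le> k"
  shows "partition_on V (P i) \<and> card (P i) + i = card (P 0)"
  using assms(4)
proof (induction i)
  case 0 then show ?case using assms by simp
next
  case (Suc i)
  then have "merge_step (P i) (P (Suc i))" "partition_on V (P i)" "card (P i) + i = card (P 0)" using assms(3) by auto
  then show ?case using merge_step_partition merge_step_card finite_partition[OF assms(1)] by fastforce
qed

lemma card_singles [simp]: "card (singles V) = card V"
  unfolding singles_def by (simp add: card_image)

text \<open>After \<open>m\<close> merges at most \<open>2 * m\<close> vertices lie outside singleton parts. If \<open>u\<close> and \<open>v\<close> share a part \<open>A\<close>,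
every untouched vertex that distinguishes them is a red neighbour of \<open>A\<close>, so the pair has at most
\<open>d + 2 * m\<close> distinguishing vertices. Pairing each vertex with the minimum of its part yields exactly \<open>m\<close>
different pairs of this kind.\<close>

lemma many_good_pairs:
  fixes V :: "nat set"
  assumes V: "finite V" and red: "reducible E d (singles V)" and m: "m < card V"
  shows "m \<le> card {e. e \<subseteq> V \<and> card e = 2 \<and> mixdeg E e (V - e) \<le> d + 2 * m}"
proof -
  obtain P k where P: "P 0 = singles V" "\<forall>i<k. merge_step (P i) (P (Suc i))" "card (P k) = 1"
     "\<forall>i\<le>k. red_bounded E d (P i)" using reducible_obtain_chain[OF red] by auto
  have ch: "partition_on V (P i) \<and> card (P i) + i = card V" if "i \<le> k" for i
    using chain_partition[OF V, of P k i] P(1,2) that partition_on_singles[of V] by simp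
  have mk: "m \<le> k" using ch[of k] P(3) m by simp
  define Q where "Q = P m"
  have Q: "partition_on V Q" "card Q + m = card V" "red_bounded E d Q" using ch[OF mk] P(4) mk by (auto simp: Q_def)
  have fQ: "finite Q" using finite_partition[OF V Q(1)] .
  have sub: "A \<subseteq> V" "finite A" "A \<noteq> {}" if "A \<in> Q" for A
    using that Q(1) V by (auto simp: partition_on_def intro: finite_subset)
  have card1: "1 \<le> card A" if "A \<in> Q" for A using sub[OF that] by (simp add: card_gt_0_iff Suc_le_eq)
  define Sg where "Sg = {x \<in> V. {x} \<in> Q}"
  define Ns where "Ns = V - Sg"
  have nons: "card Ns \<le> 2 * m"
  proof -
    define Q1 where "Q1 = {A \<in> Q. card A = 1}"
    have c1: "card Q1 = card Sg"
    proof -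
      have "Q1 = (\<lambda>x. {x}) ` Sg" using sub by (auto simp: Q1_def Sg_def card_1_singleton_iff)
      then show ?thesis by (simp add: card_image)
    qed
    have Q1Q: "Q1 \<subseteq> Q" by (auto simp: Q1_def)
    have "card V = (\<Sum>A\<in>Q1. card A) + (\<Sum>A\<in>Q - Q1. card A)"
      using sum_card_partition[OF V Q(1)] sum.subset_diff[OF Q1Q fQ, of card] by simp
    moreover have "(\<Sum>A\<in>Q1. card A) = card Q1" by (simp add: Q1_def)
    moreover have "(\<Sum>A\<in>Q - Q1. card A) \<ge> (\<Sum>A\<in>Q - Q1. 2)"
    proof (rule sum_mono)
      fix A assume "A \<in> Q - Q1"
      then show "2 \<le> card A" using card1[of A] by (auto simp: Q1_def)
    qed
    moreover have "card (Q - Q1) + card Q1 = card Q"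
      using fQ Q1Q by (simp add: card_Diff_subset finite_subset card_mono)
    ultimately have "card V \<ge> card Q1 + 2 * (card Q - card Q1)" "card Q1 \<le> card Q" by auto
    moreover have "card Ns = card V - card Sg" unfolding Ns_def by (rule card_Diff_subset) (use V in \<open>auto simp: Sg_def\<close>)
    ultimately show ?thesis using Q(2) c1 by simp
  qed
  have good: "mixdeg E {u, v} (V - {u, v}) \<le> d + 2 * m" if uv: "A \<in> Q" "u \<in> A" "v \<in> A" "u \<noteq> v" for A u v
  proof -
    have "mixdeg E {u, v} (V - {u, v}) \<le> card ({x \<in> Sg. x \<notin> A \<and> mixed E {u, v} {x}} \<union> Ns)"
      unfolding mixdeg_def
    proof (rule card_mono)
      show "finite ({x \<in> Sg. x \<notin> A \<and> mixed E {u, v} {x}} \<union> Ns)" using V by (auto simp: Sg_def Ns_def)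
      have "x \<notin> A" if "x \<in> Sg" "x \<noteq> u" for x
      proof
        assume "x \<in> A"
        then have "{x} \<inter> A \<noteq> {}" by auto
        then have "A = {x}" using that uv(1) disj_famD[OF disj_fam_partition[OF Q(1)], of "{x}" A] by (auto simp: Sg_def)
        then show False using uv that by auto
      qed
      then show "{x \<in> V - {u, v}. mixed E {u, v} {x}} \<subseteq> {x \<in> Sg. x \<notin> A \<and> mixed E {u, v} {x}} \<union> Ns"
        by (auto simp: Ns_def)
    qed
    also have "\<dots> \<le> card {x \<in> Sg. x \<notin> A \<and> mixed E {u, v} {x}} + card Ns" by (rule card_Un_le)
    also have "card {x \<in> Sg. x \<notin> A \<and> mixed E {u, v} {x}} = card ((\<lambda>x. {x}) ` {x \<in> Sg. x \<notin> A \<and> mixed E {u, v} {x}})"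
      by (simp add: card_image)
    also have "\<dots> \<le> redcount E A (Q - {A})" unfolding redcount_def
    proof (rule card_mono)
      show "finite {B \<in> Q - {A}. mixed E A B}" using fQ by auto
      show "(\<lambda>x. {x}) ` {x \<in> Sg. x \<notin> A \<and> mixed E {u, v} {x}} \<subseteq> {B \<in> Q - {A}. mixed E A B}"
        using mixed_mono[of E "{u, v}"] uv by (auto simp: Sg_def)
    qed
    also have "\<dots> \<le> d" using Q(3) uv(1) by (auto simp: red_bounded_def)
    finally show ?thesis using nons by linarith
  qed
  define Sig where "Sig = Sigma Q (\<lambda>A. A - {Min A})"
  define h where "h = (\<lambda>(A, v::nat). {Min A, v})"
  have minA: "Min A \<in> A" if "A \<in> Q" for A using sub[OF that] by simp
  have "inj_on h Sig"
  proof (rule inj_onI)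
    fix z w assume zw: "z \<in> Sig" "w \<in> Sig" "h z = h w"
    obtain A v B v' where z: "z = (A, v)" "A \<in> Q" "v \<in> A" "v \<noteq> Min A" using zw by (auto simp: Sig_def)
    obtain B v' where w: "w = (B, v')" "B \<in> Q" "v' \<in> B" "v' \<noteq> Min B" using zw by (auto simp: Sig_def)
    have eq: "{Min A, v} = {Min B, v'}" using zw z w by (simp add: h_def)
    then have "Min A = Min B \<or> Min A = v'" by (auto simp: doubleton_eq_iff)
    then have "Min A \<in> B" using w(2,3) minA[of B] by auto
    then have "A \<inter> B \<noteq> {}" using minA[OF z(2)] by auto
    then have "A = B" using z(2) w(2) disj_famD[OF disj_fam_partition[OF Q(1)], of A B] by auto
    then show "z = w" using eq z w by (auto simp: doubleton_eq_iff)
  qed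
  then have "card (h ` Sig) = card Sig" by (rule card_image)
  also have "card Sig = (\<Sum>A\<in>Q. card (A - {Min A}))" unfolding Sig_def by (rule card_SigmaI) (use fQ sub in auto)
  also have "\<dots> = (\<Sum>A\<in>Q. card A - 1)" using minA sub by (intro sum.cong) (auto simp: card_Diff_singleton)
  also have "\<dots> = m"
  proof -
    have "(\<Sum>A\<in>Q. (card A - 1) + 1) = (\<Sum>A\<in>Q. card A)" by (intro sum.cong refl) (metis card1 le_add_diff_inverse2)
    then have "(\<Sum>A\<in>Q. card A - 1) + card Q = card V" using sum_card_partition[OF V Q(1)] by (simp add: sum.distrib del: One_nat_def)
    then show ?thesis using Q(2) by simp
  qed
  finally have "card (h ` Sig) = m" .
  moreover have "h ` Sig \<subseteq> {e. e \<subseteq> V \<and> card e = 2 \<and> mixdeg E e (V - e) \<le> d + 2 * m}"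
  proof
    fix e assume "e \<in> h ` Sig"
    then obtain A v where "A \<in> Q" "v \<in> A" "v \<noteq> Min A" "e = {Min A, v}" by (auto simp: h_def Sig_def)
    then show "e \<in> {e. e \<subseteq> V \<and> card e = 2 \<and> mixdeg E e (V - e) \<le> d + 2 * m}"
      using good[of A "Min A" v] minA[of A] sub(1)[of A] by auto
  qed
  moreover have "finite {e. e \<subseteq> V \<and> card e = 2 \<and> mixdeg E e (V - e) \<le> d + 2 * m}"
    by (rule finite_subset[of _ "Pow V"]) (use V in auto)
  ultimately show ?thesis using card_mono by metis
qed

section \<open>The lower bound in the critical window\<close>

lemma markov_count:
  assumes "finite S" "finite I" "0 < m"
  shows "Prob S p (\<lambda>X. m \<le> real (card {i\<in>I. Z i X})) \<le> (\<Sum>i\<in>I. Prob S p (Z i)) / m"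
proof -
  have eq: "real (card {i\<in>I. Z i X}) = (\<Sum>i\<in>I. of_bool (Z i X))" for X
    using assms(2) by (simp add: sum_of_bool_eq Int_def)
  have "Prob S p (\<lambda>X. m \<le> real (card {i\<in>I. Z i X})) \<le> expec S p (\<lambda>X. (\<Sum>i\<in>I. of_bool (Z i X)) / m)"
    unfolding eq by (rule Prob_le_Ex) (use assms in \<open>auto simp: sum_nonneg field_simps\<close>)
  also have "\<dots> = (\<Sum>i\<in>I. Prob S p (Z i)) / m"
    using assms by (simp add: Prob_eq_Ex del: sum_of_bool_eq)
  finally show ?thesis .
qed

lemma card_all_edges_le:
  assumes "finite V" shows "card (all_edges V) \<le> (card V)\<^sup>2"
proof -
  have "all_edges V \<subseteq> (\<lambda>(a, b). {a, b}) ` (V \<times> V)"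
  proof
    fix e assume "e \<in> all_edges V"
    then obtain x y where "e = {x, y}" "x \<in> V" "y \<in> V" by (rule all_edgesE)
    then show "e \<in> (\<lambda>(a, b). {a, b}) ` (V \<times> V)" by auto
  qed
  then have "card (all_edges V) \<le> card ((\<lambda>(a, b). {a, b}) ` (V \<times> V))" using assms by (intro card_mono) auto
  also have "\<dots> \<le> card (V \<times> V)" using assms by (intro card_image_le) auto
  finally show ?thesis by (simp add: card_cartesian_product power2_eq_square)
qed

text \<open>First moment argument. With \<open>m = sqrt n\<close> the error \<open>2 * m\<close> is below the scale \<open>sqrt (n * ln n)\<close>, while the
expected number of pairs that beat the stated deviation is a power of \<open>n\<close> smaller than \<open>m\<close>.\<close>

lemma tww_lower_critical:
  fixes p q \<epsilon> :: real
  assumes p: "0 < p" "p < 1" "q = 1 - p" and eps: "0 < \<epsilon>"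
  shows "edge_whp p (\<lambda>n X. real (tww (trigraph_of_graph ({1..n}, X))) \<ge>
     2 * p * q * real n - (1 + \<epsilon>) * sqrt (6 * p * q * (1 - 2 * p * q) * real n * ln (real n)))"
proof -
  define r where "r = 2 * p * (1 - p)"
  define v where "v = r * (1 - r)"
  \<comment> \<open>Half of \<open>\<epsilon>\<close> absorbs the error \<open>2 * sqrt n\<close>; the other half gives the saving in the exponent.\<close>
  define L where "L = 1 + \<epsilon> / 2"
  define \<tau> where "\<tau> n = sqrt (3 * v) * sqrt (real n * ln (real n))" for n :: nat
  define m where "m n = nat \<lfloor>sqrt (real n)\<rfloor>" for n :: nat
  define l where "l n = L * \<tau> n / (v * real n)" for n
  define b where "b n = exp (- (3 / 2 * L) * ln (real n))" for n :: nat
  have r0: "0 < r" "r \<le> 1/2" using p mult_one_minus_le_quarter[of p] by (auto simp: r_def)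
  then have v0: "0 < v" by (simp add: v_def)
  have L1: "1 < L" using eps by (simp add: L_def)
  have tau_eq: "sqrt (6 * p * q * (1 - 2 * p * q) * real n * ln (real n)) = \<tau> n" for n
  proof -
    have "6 * p * q * (1 - 2 * p * q) * real n * ln (real n) = 3 * v * (real n * ln (real n))"
      by (simp add: v_def r_def p(3) algebra_simps)
    then have "sqrt (6 * p * q * (1 - 2 * p * q) * real n * ln (real n)) = sqrt (3 * v * (real n * ln (real n)))"
      by (simp only:)
    also have "\<dots> = \<tau> n" unfolding \<tau>_def by (rule real_sqrt_mult)
    finally show ?thesis .
  qed
  have l_eq: "eventually (\<lambda>n. l n = (L * sqrt (3 * v) / v) * (sqrt (real n * ln (real n)) / real n)) sequentially"
    using v0 by (simp add: l_def \<tau>_def)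
  have "(\<lambda>n. sqrt (real n * ln (real n)) / real n) \<longlonglongrightarrow> 0" by real_asymp
  from tendsto_mult_right_zero[OF this, of "L * sqrt (3 * v) / v"]
  have l0: "l \<longlonglongrightarrow> 0" using l_eq by (simp add: tendsto_cong)
  have "(\<lambda>n. 2 - exp (l n)) \<longlonglongrightarrow> 2 - exp 0" by (intro tendsto_intros l0)
  then have "eventually (\<lambda>n. 2 - exp (l n) > 1 / L) sequentially"
    by (rule order_tendstoD) (use L1 in \<open>simp add: field_simps\<close>)
  then have ev1: "eventually (\<lambda>n. exp (l n) / 2 - 1 \<le> - (1 / (2 * L))) sequentially"
    by eventually_elim (simp add: field_simps)
  have tau_pos: "eventually (\<lambda>n. 0 < \<tau> n) sequentially"
  proof -
    have "eventually (\<lambda>n::nat. 0 < sqrt (real n * ln (real n))) sequentially" by real_asymp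
    then show ?thesis by eventually_elim (use v0 in \<open>simp add: \<tau>_def\<close>)
  qed
  have ev2: "eventually (\<lambda>n. 2 * sqrt (real n) + 1 \<le> \<epsilon> / 2 * \<tau> n) sequentially"
  proof -
    have c: "0 < \<epsilon> / 2 * sqrt (3 * v)" using eps v0 by simp
    have "eventually (\<lambda>n::nat. (2 * sqrt (real n) + 1) / sqrt (real n * ln (real n)) < \<epsilon> / 2 * sqrt (3 * v)) sequentially"
      by (rule order_tendstoD(2)[OF _ c]) real_asymp
    moreover have "eventually (\<lambda>n::nat. 0 < sqrt (real n * ln (real n))) sequentially" by real_asymp
    ultimately show ?thesis by eventually_elim (simp add: \<tau>_def field_simps)
  qed
  have ev3: "eventually (\<lambda>n::nat. 4 \<le> n) sequentially" by (rule eventually_ge_at_top)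
  show ?thesis unfolding tau_eq
  proof (rule edge_whpI)
    show "\<forall>\<^sub>F n in sequentially. Prob (all_edges {1..n}) p (\<lambda>X. \<not> 2 * p * q * real n - (1 + \<epsilon>) * \<tau> n \<le> real (tww (trigraph_of_graph ({1..n}, X))))
       \<le> 2 * (real n)\<^sup>2 * b n / sqrt (real n)"
      using ev1 ev2 ev3 tau_pos
    proof eventually_elim
      case (elim n)
      let ?V = "{1..n}"
      let ?S = "all_edges ?V"
      define Z where "Z e X \<longleftrightarrow> real (mixdeg X e (?V - e)) \<le> r * real (card (?V - e)) - L * \<tau> n" for e X
      have sq: "1 \<le> sqrt (real n) / 2" using real_le_rsqrt[of 2 "real n"] elim by simp
      have mr: "real (m n) = of_int \<lfloor>sqrt (real n)\<rfloor>" by (simp add: m_def)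
      have mle: "real (m n) \<le> sqrt (real n)" unfolding mr by linarith
      have "sqrt (real n) < real (m n) + 1" unfolding mr by linarith
      then have mle2: "m n \<ge> 1" "sqrt (real n) / 2 \<le> real (m n)" using sq by linarith+
      have cardW: "card (?V - e) = n - 2" if "e \<in> ?S" for e
        using that card_Diff_subset[of e ?V] by (auto simp: all_edges_def intro: finite_subset)
      have nn: "real (n - 2) = real n - 2" using elim by simp
      have l_nonneg: "0 \<le> l n" using elim v0 L1 by (simp add: l_def)
      have "Prob ?S p (\<lambda>X. \<not> 2 * p * q * real n - (1 + \<epsilon>) * \<tau> n \<le> real (tww (trigraph_of_graph (?V, X))))
        \<le> Prob ?S p (\<lambda>X. real (m n) \<le> real (card {e \<in> ?S. Z e X}))"
      proof (rule Prob_mono)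
        fix X assume X: "X \<subseteq> ?S" and neg: "\<not> 2 * p * q * real n - (1 + \<epsilon>) * \<tau> n \<le> real (tww (trigraph_of_graph (?V, X)))"
        define d where "d = tww (trigraph_of_graph (?V, X))"
        have red: "reducible X d (singles ?V)" unfolding d_def by (rule reducible_tww) (use X elim in auto)
        have "m n < card ?V"
        proof -
          have "sqrt (real n) < real n" using elim real_sqrt_less_mono[of "real n" "real n * real n"] by simp
          then show ?thesis using mle by (simp del: real_sqrt_le_iff)
        qed
        from many_good_pairs[OF _ red this]
        have "m n \<le> card {e. e \<subseteq> ?V \<and> card e = 2 \<and> mixdeg X e (?V - e) \<le> d + 2 * m n}" by simp
        also have "\<dots> \<le> card {e \<in> ?S. Z e X}"
        proof (rule card_mono)
          show "{e. e \<subseteq> ?V \<and> card e = 2 \<and> mixdeg X e (?V - e) \<le> d + 2 * m n} \<subseteq> {e \<in> ?S. Z e X}"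
          proof
            fix e assume "e \<in> {e. e \<subseteq> ?V \<and> card e = 2 \<and> mixdeg X e (?V - e) \<le> d + 2 * m n}"
            then have e: "e \<in> ?S" "mixdeg X e (?V - e) \<le> d + 2 * m n" by (auto simp: all_edges_def)
            have "real (mixdeg X e (?V - e)) \<le> real d + 2 * sqrt (real n)" using e(2) mle by linarith
            moreover have "real d < r * real n - (1 + \<epsilon>) * \<tau> n" using neg by (simp add: d_def r_def p(3))
            moreover have "r * real (n - 2) = r * real n - 2 * r" unfolding nn by (simp add: algebra_simps)
            moreover have "L * \<tau> n = (1 + \<epsilon>) * \<tau> n - \<epsilon> / 2 * \<tau> n" by (simp add: L_def algebra_simps)
            ultimately have "Z e X" using elim(2) r0 unfolding Z_def cardW[OF e(1)] by linarith
            then show "e \<in> {e \<in> ?S. Z e X}" using e(1) by simp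
          qed
        qed simp
        finally show "real (m n) \<le> real (card {e \<in> ?S. Z e X})" by simp
      qed simp
      also have "\<dots> \<le> (\<Sum>e\<in>?S. Prob ?S p (Z e)) / real (m n)"
        by (rule markov_count) (use mle2 in auto)
      also have "\<dots> \<le> (\<Sum>e\<in>?S. b n) / real (m n)"
      proof (intro divide_right_mono sum_mono)
        fix e assume e: "e \<in> ?S"
        have "Prob ?S p (Z e) \<le> exp (real (card (?V - e)) * (r * (1 - r)) * ((l n)\<^sup>2 / 2 * exp (1 * l n)) - l n * (L * \<tau> n))"
          unfolding Z_def by (rule pair_tail_upper) (use e p l_nonneg in \<open>auto simp: all_edges_def r_def\<close>)
        also have "\<dots> \<le> exp (real n * v * ((l n)\<^sup>2 / 2 * exp (l n)) - l n * (L * \<tau> n))"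
          unfolding v_def[symmetric] cardW[OF e] using v0 by (simp add: mult_right_mono)
        also have "real n * v * ((l n)\<^sup>2 / 2 * exp (l n)) - l n * (L * \<tau> n) = ((L * \<tau> n)\<^sup>2 / (real n * v)) * (exp (l n) / 2 - 1)"
          using elim v0 by (simp add: l_def power2_eq_square field_simps)
        also have "(L * \<tau> n)\<^sup>2 / (real n * v) = 3 * L\<^sup>2 * ln (real n)"
          using elim v0 by (simp add: \<tau>_def power_mult_distrib)
        also have "3 * L\<^sup>2 * ln (real n) * (exp (l n) / 2 - 1) \<le> 3 * L\<^sup>2 * ln (real n) * (- (1 / (2 * L)))"
          using elim by (intro mult_left_mono) auto
        also have "\<dots> = - (3 / 2 * L) * ln (real n)" using L1 by (simp add: power2_eq_square)
        finally show "Prob ?S p (Z e) \<le> b n" by (simp add: b_def)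
      qed (use mle2 in auto)
      also have "\<dots> \<le> (real n)\<^sup>2 * b n / (sqrt (real n) / 2)"
      proof (rule frac_le)
        have "real (card ?S) \<le> real ((card ?V)\<^sup>2)" using card_all_edges_le[of ?V] by (simp only: of_nat_le_iff finite_atLeastAtMost)
        then show "(\<Sum>e\<in>?S. b n) \<le> (real n)\<^sup>2 * b n" by (simp add: b_def)
      qed (use mle2 sq elim(3) in \<open>auto simp: b_def\<close>)
      finally show ?case by (simp add: mult_ac)
    qed
    show "(\<lambda>n. 2 * (real n)\<^sup>2 * b n / sqrt (real n)) \<longlonglongrightarrow> 0"
      unfolding b_def using L1 by real_asymp
  qed
qed

section \<open>The critical probability\<close>

text \<open>Symmetric functions of \<open>p\<close> and \<open>1 - p\<close> are polynomials in \<open>s\<close>; computing them by squaring and cubing keeps the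
polynomial identities small.\<close>

lemma power_sums:
  fixes p :: real defines "s \<equiv> p * (1 - p)"
  shows "p ^ 2 + (1 - p) ^ 2 = 1 - 2 * s"
    "p ^ 3 + (1 - p) ^ 3 = 1 - 3 * s"
    "p ^ 4 + (1 - p) ^ 4 = 1 - 4 * s + 2 * s ^ 2"
    "p ^ 6 + (1 - p) ^ 6 = 1 - 6 * s + 9 * s ^ 2 - 2 * s ^ 3"
    "p ^ 8 + (1 - p) ^ 8 = 1 - 8 * s + 20 * s ^ 2 - 16 * s ^ 3 + 2 * s ^ 4"
    "p ^ 12 + (1 - p) ^ 12 = (1 - 4 * s + 2 * s ^ 2) ^ 3 - 3 * s ^ 4 * (1 - 4 * s + 2 * s ^ 2)"
proof -
  define q where "q = 1 - p"
  have q: "p + q = 1" "p * q = s" by (auto simp: q_def s_def)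
  have e2: "p ^ 2 + q ^ 2 = 1 - 2 * s"
    unfolding q_def s_def by (simp add: power2_eq_square algebra_simps)
  have e3: "p ^ 3 + q ^ 3 = 1 - 3 * s"
    unfolding q_def s_def by (simp add: power3_eq_cube algebra_simps)
  have sq: "a ^ 2 + b ^ 2 = (a + b) ^ 2 - 2 * (a * b)" for a b :: real
    by (simp add: power2_eq_square algebra_simps)
  have cu: "a ^ 3 + b ^ 3 = (a + b) ^ 3 - 3 * (a * b) * (a + b)" for a b :: real
    by (simp add: power3_eq_cube algebra_simps)
  have e4: "p ^ 4 + q ^ 4 = 1 - 4 * s + 2 * s ^ 2"
  proof -
    have "p ^ 4 + q ^ 4 = (p ^ 2) ^ 2 + (q ^ 2) ^ 2" by (simp flip: power_mult)
    also have "\<dots> = (1 - 2 * s) ^ 2 - 2 * s ^ 2" unfolding sq[of "p ^ 2" "q ^ 2"] e2 by (simp add: power_mult_distrib flip: q(2))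
    finally show ?thesis by (simp add: power2_eq_square algebra_simps)
  qed
  have e6: "p ^ 6 + q ^ 6 = 1 - 6 * s + 9 * s ^ 2 - 2 * s ^ 3"
  proof -
    have "p ^ 6 + q ^ 6 = (p ^ 3) ^ 2 + (q ^ 3) ^ 2" by (simp flip: power_mult)
    also have "\<dots> = (1 - 3 * s) ^ 2 - 2 * s ^ 3" unfolding sq e3 by (simp add: power_mult_distrib flip: q(2))
    finally show ?thesis by (simp add: power2_eq_square algebra_simps)
  qed
  have e8: "p ^ 8 + q ^ 8 = 1 - 8 * s + 20 * s ^ 2 - 16 * s ^ 3 + 2 * s ^ 4"
  proof -
    have "p ^ 8 + q ^ 8 = (p ^ 4) ^ 2 + (q ^ 4) ^ 2" by (simp flip: power_mult)
    also have "\<dots> = (1 - 4 * s + 2 * s ^ 2) ^ 2 - 2 * s ^ 4" unfolding sq e4 by (simp add: power_mult_distrib flip: q(2))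
    finally show ?thesis by (simp add: eval_nat_numeral algebra_simps)
  qed
  have e12: "p ^ 12 + q ^ 12 = (1 - 4 * s + 2 * s ^ 2) ^ 3 - 3 * s ^ 4 * (1 - 4 * s + 2 * s ^ 2)"
  proof -
    have "p ^ 12 + q ^ 12 = (p ^ 4) ^ 3 + (q ^ 4) ^ 3" by (simp flip: power_mult)
    also have "\<dots> = (1 - 4 * s + 2 * s ^ 2) ^ 3 - 3 * (p ^ 4 * q ^ 4) * (1 - 4 * s + 2 * s ^ 2)" unfolding cu e4 ..
    finally show ?thesis by (simp add: power_mult_distrib flip: q(2))
  qed
  show "p ^ 2 + (1 - p) ^ 2 = 1 - 2 * s"
    "p ^ 3 + (1 - p) ^ 3 = 1 - 3 * s"
    "p ^ 4 + (1 - p) ^ 4 = 1 - 4 * s + 2 * s ^ 2"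
    "p ^ 6 + (1 - p) ^ 6 = 1 - 6 * s + 9 * s ^ 2 - 2 * s ^ 3"
    "p ^ 8 + (1 - p) ^ 8 = 1 - 8 * s + 20 * s ^ 2 - 16 * s ^ 3 + 2 * s ^ 4"
    "p ^ 12 + (1 - p) ^ 12 = (1 - 4 * s + 2 * s ^ 2) ^ 3 - 3 * s ^ 4 * (1 - 4 * s + 2 * s ^ 2)"
    using e2 e3 e4 e6 e8 e12 by (simp_all only: q_def)
qed

lemma mix_prob_polys:
  fixes p :: real defines "s \<equiv> p * (1 - p)"
  shows "mix_prob p 2 = 2 * s" "mix_prob p 3 = 3 * s" "mix_prob p 4 = 4 * s - 2 * s ^ 2" "mix_prob p 6 = 6 * s - 9 * s ^ 2 + 2 * s ^ 3"
    "mix_prob p 8 = 8 * s - 20 * s ^ 2 + 16 * s ^ 3 - 2 * s ^ 4"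
    "mix_prob p 12 = 1 - (1 - 4 * s + 2 * s ^ 2) ^ 3 + 3 * s ^ 4 * (1 - 4 * s + 2 * s ^ 2)"
  using power_sums[of p] unfolding mix_prob_def s_def by linarith+

text \<open>For \<open>D = 9 * s - 2 * s ^ 2\<close> and \<open>\<alpha> = 1 / D\<close>, the red degree per vertex of a quadruple against a fraction
\<open>3 * \<alpha> - 1\<close> of pairs and \<open>1 - 2 * \<alpha>\<close> of triples exceeds \<open>2 * s\<close> by \<open>s ^ 2 * critical_poly s / D\<close>, see
\<open>critical_poly_identity\<close>.\<close>

definition critical_poly :: "real \<Rightarrow> real" where
  "critical_poly s = 66 - 486 * s + 1136 * s ^ 2 - 1191 * s ^ 3 + 534 * s ^ 4 - 90 * s ^ 5 + 4 * s ^ 6"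

lemma critical_poly_identity:
  fixes p :: real defines "s \<equiv> p * (1 - p)" defines "D \<equiv> 9 * s - 2 * s ^ 2"
  shows "(3 - D) * mix_prob p 8 + (D - 2) * mix_prob p 12 - 2 * s * D = s ^ 2 * critical_poly s"
  unfolding mix_prob_polys s_def[symmetric] D_def critical_poly_def
  by (simp add: eval_nat_numeral algebra_simps)

lemma critical_poly_strict_decreasing:
  assumes "0 \<le> s" "s < t" "t \<le> 1 / 4" shows "critical_poly t < critical_poly s"
proof (rule DERIV_neg_imp_decreasing[OF assms(2)])
  fix x :: real assume x: "s \<le> x" "x \<le> t"
  then have x: "0 \<le> x" "x \<le> 1 / 4" using assms by auto
  have "(critical_poly has_real_derivative (- 486 + 2272 * x - 3573 * x ^ 2 + 2136 * x ^ 3 - 450 * x ^ 4 + 24 * x ^ 5)) (at x)"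
    unfolding critical_poly_def by (auto intro!: derivative_eq_intros)
  moreover have "- 486 + 2272 * x - 3573 * x ^ 2 + 2136 * x ^ 3 - 450 * x ^ 4 + 24 * x ^ 5 < 0"
  proof -
    have "x ^ 2 * x \<le> x ^ 2 * (1 / 4)" using x by (intro mult_left_mono) auto
    then have a: "x ^ 3 \<le> x ^ 2 / 4" by (simp add: power2_eq_square power3_eq_cube)
    have "x ^ 4 * x \<le> x ^ 4 * (1 / 4)" using x by (intro mult_left_mono) auto
    then have b: "x ^ 5 \<le> x ^ 4 / 4" by (simp add: eval_nat_numeral)
    have c: "0 \<le> x ^ 4" by simp
    have "0 \<le> (x - 1 / 4) ^ 2" by simp
    then have d: "x ^ 2 \<ge> x / 2 - 1 / 16" by (simp add: power2_eq_square algebra_simps)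
    show ?thesis using a b c d x by linarith
  qed
  ultimately show "\<exists>y. DERIV critical_poly x :> y \<and> y < 0" by blast
qed

lemma prod_strict_mono:
  fixes p p' :: real assumes "0 \<le> p" "p < p'" "p' \<le> 1 / 2"
  shows "p * (1 - p) < p' * (1 - p')"
proof -
  have "0 < (p' - p) * (1 - p - p')" using assms by (intro mult_pos_pos) auto
  then show ?thesis by (simp add: algebra_simps)
qed

lemma critical_probability:
  "\<exists>pstar::real. 0.4012 < pstar \<and> pstar < 0.4013 \<and>
     (\<forall>p. 0 < p \<and> p < pstar \<longrightarrow> 0 < critical_poly (p * (1 - p))) \<and>
     (\<forall>p. pstar < p \<and> p \<le> 1 / 2 \<longrightarrow> critical_poly (p * (1 - p)) < 0)"
proof -
  have pos: "0 < critical_poly (0.4012 * (1 - 0.4012))" by (simp add: critical_poly_def eval_nat_numeral)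
  have neg: "critical_poly (0.4013 * (1 - 0.4013)) < 0" by (simp add: critical_poly_def eval_nat_numeral)
  have "continuous_on {0.4012..0.4013} (\<lambda>p. critical_poly (p * (1 - p)))"
    unfolding critical_poly_def by (intro continuous_intros)
  then obtain z where z: "0.4012 \<le> z" "z \<le> 0.4013" "critical_poly (z * (1 - z)) = 0"
    using IVT2'[of "\<lambda>p. critical_poly (p * (1 - p))" "0.4013" 0 "0.4012"] pos neg by (auto simp: less_imp_le)
  have "z \<noteq> 0.4012" using z(3) pos by (metis less_irrefl)
  moreover have "z \<noteq> 0.4013" using z(3) neg by (metis less_irrefl)
  ultimately
  have zz: "0.4012 < z" "z < 0.4013" using z by auto
  moreover have "0 < critical_poly (p * (1 - p))" if "0 < p" "p < z" for p
  proof -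
    have "p * (1 - p) < z * (1 - z)" using that zz by (intro prod_strict_mono) auto
    then have "critical_poly (z * (1 - z)) < critical_poly (p * (1 - p))"
      using that zz mult_one_minus_le_quarter by (intro critical_poly_strict_decreasing) auto
    then show ?thesis using z by simp
  qed
  moreover have "critical_poly (p * (1 - p)) < 0" if "z < p" "p \<le> 1 / 2" for p
  proof -
    have "z * (1 - z) < p * (1 - p)" using that zz by (intro prod_strict_mono) auto
    then have "critical_poly (p * (1 - p)) < critical_poly (z * (1 - z))"
      using that zz mult_one_minus_le_quarter by (intro critical_poly_strict_decreasing) auto
    then show ?thesis using z by simp
  qed
  ultimately show ?thesis by blast
qed

text \<open>Merging two parts never increases the expected red degree of a third part of size at least two. With
\<open>x = p ^ (k * a)\<close>, \<open>y = p ^ (k * b)\<close> and \<open>x'\<close>, \<open>y'\<close> the same powers of \<open>1 - p\<close>, the claim reads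
\<open>1 \<le> (1 - x) * (1 - y) + (1 - x') * (1 - y')\<close>, and the worst case is \<open>k = 2\<close>, \<open>a = b = 1\<close>.\<close>

lemma mix_prob_subadditive:
  assumes p: "0 \<le> p" "p \<le> 1" and k: "2 \<le> k" and ab: "1 \<le> a" "1 \<le> b"
  shows "mix_prob p (k * (a + b)) \<le> mix_prob p (k * a) + mix_prob p (k * b)"
proof -
  have le: "x ^ (k * c) \<le> x ^ 2" if "0 \<le> x" "x \<le> 1" "1 \<le> c" for x :: real and c
    using that k by (intro power_decreasing) (auto intro: order_trans[OF k] simp: le_trans)
  have main: "(1 - x ^ 2) ^ 2 \<le> (1 - x ^ (k * a)) * (1 - x ^ (k * b))" if "0 \<le> x" "x \<le> 1" for x :: real
  proof -
    have "x ^ 2 \<le> 1" using that by (simp add: power_le_one)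
    then have "(1 - x ^ 2) * (1 - x ^ 2) \<le> (1 - x ^ (k * a)) * (1 - x ^ (k * b))"
      using le[OF that ab(1)] le[OF that ab(2)] by (intro mult_mono) auto
    then show ?thesis by (simp add: power2_eq_square)
  qed
  have "1 \<le> (1 - p ^ 2) ^ 2 + (1 - (1 - p) ^ 2) ^ 2"
  proof -
    have "(1 - p ^ 2) ^ 2 + (1 - (1 - p) ^ 2) ^ 2 = 1 + 2 * (p * (1 - p)) ^ 2"
      by (simp add: eval_nat_numeral algebra_simps)
    then show ?thesis by simp
  qed
  also have "\<dots> \<le> (1 - p ^ (k * a)) * (1 - p ^ (k * b)) + (1 - (1 - p) ^ (k * a)) * (1 - (1 - p) ^ (k * b))"
    using main[of p] main[of "1 - p"] p by (intro add_mono) auto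
  finally show ?thesis
    by (simp add: mix_prob_def power_add distrib_left algebra_simps)
qed

text \<open>Covering the same vertices by triples instead of pairs is never worse for a quadruple.\<close>

lemma mix_prob_12_le:
  assumes p: "0 \<le> p" "p \<le> 1" shows "mix_prob p 12 \<le> 3 / 2 * mix_prob p 8"
proof -
  define u where "u = p ^ 4"
  define w where "w = (1 - p) ^ 4"
  define t where "t = 1 - u - w"
  have s: "0 \<le> p * (1 - p)" "p * (1 - p) \<le> 1/4" using p mult_one_minus_le_quarter by auto
  have uw: "0 \<le> u" "0 \<le> w" using p by (auto simp: u_def w_def)
  have "mix_prob p 4 \<ge> 0" by (rule mix_prob_bounds) (use p in auto)
  then have t: "0 \<le> t" by (simp add: mix_prob_def t_def u_def w_def)
  have g: "mix_prob p 8 = 1 - u ^ 2 - w ^ 2" "mix_prob p 12 = 1 - u ^ 3 - w ^ 3"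
    by (simp_all add: mix_prob_def u_def w_def flip: power_mult)
  have ueq: "u = 1 - w - t" by (simp add: t_def)
  have "3 / 2 * (1 - u ^ 2 - w ^ 2) - (1 - u ^ 3 - w ^ 3) = t * (3 * w * u + t * (3 / 2 - t))"
    unfolding ueq by (simp add: power2_eq_square power3_eq_cube algebra_simps)
  moreover have "0 \<le> t * (3 * w * u + t * (3 / 2 - t))"
    using t uw by (intro mult_nonneg_nonneg add_nonneg_nonneg) (auto simp: t_def)
  ultimately show ?thesis unfolding g by linarith
qed

lemma nine_minus_mono:
  fixes x y :: real assumes "x \<le> y" "y \<le> 1"
  shows "x * (9 - 2 * x) \<le> y * (9 - 2 * y)"
proof -
  have "0 \<le> (y - x) * (9 - 2 * (x + y))" using assms by (intro mult_nonneg_nonneg) auto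
  then show ?thesis by (simp add: algebra_simps)
qed

text \<open>The linear program behind the lower bound, with all quantities divided by \<open>n\<close>. Here \<open>a1\<close>, \<open>a2\<close> count singletons and
pairs when linearly many triples appear, and \<open>x1\<close>, \<open>x2\<close>, \<open>x3\<close> count parts of sizes one, two and three
when linearly many quadruples, or one very large part, appear; \<open>\<zeta>\<close> absorbs all errors. The condition on triples forces \<open>a2\<close> to
be nearly \<open>1 / D\<close>, hence bounds \<open>x3\<close>. Then either the red degree of quadruples is too large, or the
number of parts is at least about \<open>1 / D > 0.487\<close>.\<close>

lemma subcritical_core:
  fixes p :: real defines "s \<equiv> p * (1 - p)"
  assumes p: "0 < p" "p < 0.4013" "0 < critical_poly s"
  shows "\<exists>\<zeta>>0. \<zeta> \<le> 1/1000 \<and> (\<forall>a1 a2 x1 x2 x3 :: real.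
     0 \<le> a1 \<longrightarrow> 0 \<le> a2 \<longrightarrow> 0 \<le> x1 \<longrightarrow> 0 \<le> x2 \<longrightarrow> 0 \<le> x3 \<longrightarrow>
     1 - \<zeta> \<le> a1 + 2 * a2 \<longrightarrow> a1 + 2 * a2 \<le> 1 \<longrightarrow> a1 * mix_prob p 3 + a2 * mix_prob p 6 \<le> 2 * s + \<zeta> \<longrightarrow>
     x3 \<le> a1 + \<zeta> \<longrightarrow> 1 - \<zeta> \<le> x1 + 2 * x2 + 3 * x3 \<longrightarrow>
     (x1 * mix_prob p 4 + x2 * mix_prob p 8 + x3 * mix_prob p 12 \<le> 2 * s + \<zeta> \<or> x1 + x2 + x3 \<le> 0.487) \<longrightarrow> False)"
proof -
  have s0: "0 < s" using p by (simp add: s_def)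
  have "s < 0.4013 * (1 - 0.4013)" unfolding s_def using p by (intro prod_strict_mono) auto
  then have s1: "s \<le> 0.24026" by simp
  define D where "D = 9 * s - 2 * s ^ 2"
  have D': "D = s * (9 - 2 * s)" by (simp add: D_def power2_eq_square algebra_simps)
  have D0: "0 < D" unfolding D' using s0 s1 by simp
  have D1: "D \<le> 2.0469"
  proof -
    have "D \<le> 0.24026 * (9 - 2 * 0.24026)" unfolding D' using s1 by (intro nine_minus_mono) auto
    then show ?thesis by simp
  qed
  define h where "h = s ^ 2 * critical_poly s"
  have h0: "0 < h" using s0 p(3) by (simp add: h_def)
  have h: "(3 - D) * mix_prob p 8 + (D - 2) * mix_prob p 12 - 2 * s * D = h"
    unfolding h_def D_def s_def by (rule critical_poly_identity)
  define R where "R = 3 / 2 * mix_prob p 8 - mix_prob p 12"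
  have R0: "0 \<le> R" using mix_prob_12_le[of p] p by (simp add: R_def)
  have g8: "0 \<le> mix_prob p 8" using p by (intro mix_prob_bounds) auto
  define C where "C = D + D * mix_prob p 8 / 2 + (2 * (1 / s + 3) + D) * R"
  have C0: "0 < C" unfolding C_def using D0 g8 s0 R0 by (intro add_pos_nonneg) (auto intro!: mult_nonneg_nonneg)
  \<comment> \<open>\<open>C\<close> collects the coefficients of \<open>\<zeta>\<close> in the final estimate, \<open>h\<close> is its strictly positive main term.\<close>
  define \<zeta> where "\<zeta> = min (s / 1000) (h / (2 * C))"
  have z0: "0 < \<zeta>" using s0 h0 C0 by (simp add: \<zeta>_def)
  have z1: "\<zeta> \<le> s / 1000" by (simp add: \<zeta>_def)
  have "\<zeta> \<le> h / (2 * C)" by (simp add: \<zeta>_def)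
  then have "\<zeta> * C \<le> h / 2" using C0 by (simp add: field_simps)
  then have z2: "\<zeta> * C < h" using h0 by linarith
  have g48: "mix_prob p 8 / 2 \<le> mix_prob p 4"
  proof -
    have "mix_prob p 4 - mix_prob p 8 / 2 = s ^ 2 * (8 * (1 - s) + s ^ 2)"
      unfolding mix_prob_polys s_def[symmetric] by (simp add: eval_nat_numeral algebra_simps add_divide_distrib diff_divide_distrib)
    moreover have "0 \<le> s ^ 2 * (8 * (1 - s) + s ^ 2)" using s0 s1 by simp
    ultimately show ?thesis by linarith
  qed
  show ?thesis
  proof (intro exI[of _ \<zeta>] conjI allI impI)
    show "0 < \<zeta>" "\<zeta> \<le> 1/1000" using z0 z1 s1 by auto
    fix a1 a2 x1 x2 x3 :: real
    assume nn: "0 \<le> a1" "0 \<le> a2" "0 \<le> x1" "0 \<le> x2" "0 \<le> x3"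
      and a: "1 - \<zeta> \<le> a1 + 2 * a2" "a1 + 2 * a2 \<le> 1" "a1 * mix_prob p 3 + a2 * mix_prob p 6 \<le> 2 * s + \<zeta>"
      and x: "x3 \<le> a1 + \<zeta>" "1 - \<zeta> \<le> x1 + 2 * x2 + 3 * x3"
      and alt: "x1 * mix_prob p 4 + x2 * mix_prob p 8 + x3 * mix_prob p 12 \<le> 2 * s + \<zeta> \<or> x1 + x2 + x3 \<le> 0.487"
    have "3 * s * (1 - \<zeta> - 2 * a2) \<le> 3 * s * a1" using a s0 by (intro mult_left_mono) auto
    moreover have "a1 * mix_prob p 3 + a2 * mix_prob p 6 = 3 * s * a1 + a2 * (6 * s) - s * (a2 * D)"
      unfolding mix_prob_polys s_def[symmetric] D_def by (simp add: eval_nat_numeral algebra_simps)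
    ultimately have "s - \<zeta> - 3 * s * \<zeta> \<le> s * (a2 * D)" using a(3) by (simp add: algebra_simps)
    then have "(s - \<zeta> - 3 * s * \<zeta>) / s \<le> a2 * D" using s0 by (simp add: field_simps)
    moreover have "(s - \<zeta> - 3 * s * \<zeta>) / s = 1 - \<zeta> * (1 / s + 3)" using s0 by (simp add: field_simps)
    ultimately have aD: "1 - \<zeta> * (1 / s + 3) \<le> a2 * D" by simp
    have x3: "x3 \<le> 1 - 2 * a2 + \<zeta>" using x(1) a(2) by simp
    show False using alt
    proof
      assume f: "x1 * mix_prob p 4 + x2 * mix_prob p 8 + x3 * mix_prob p 12 \<le> 2 * s + \<zeta>"
      have "x1 * (mix_prob p 8 / 2) \<le> x1 * mix_prob p 4" using g48 nn by (intro mult_left_mono) auto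
      moreover have "(1 - \<zeta> - x1 - 3 * x3) / 2 * mix_prob p 8 \<le> x2 * mix_prob p 8" using x(2) g8 by (intro mult_right_mono) auto
      moreover have "x3 * R \<le> (1 - 2 * a2 + \<zeta>) * R" using x3 R0 by (intro mult_right_mono) auto
      ultimately have "(1 - \<zeta>) * mix_prob p 8 / 2 - (1 - 2 * a2 + \<zeta>) * R \<le> 2 * s + \<zeta>" using f
        by (simp add: R_def algebra_simps add_divide_distrib diff_divide_distrib)
      then have "D * ((1 - \<zeta>) * mix_prob p 8 / 2 - (1 - 2 * a2 + \<zeta>) * R) \<le> D * (2 * s + \<zeta>)" using D0 by simp
      moreover have "(D - 2 * (a2 * D) + D * \<zeta>) * R \<le> (D - 2 * (1 - \<zeta> * (1 / s + 3)) + D * \<zeta>) * R"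
        using aD R0 by (intro mult_right_mono) auto
      moreover have "(3 - D) * mix_prob p 8 + (D - 2) * mix_prob p 12 = D * mix_prob p 8 / 2 - (D - 2) * R"
        by (simp add: R_def algebra_simps add_divide_distrib diff_divide_distrib)
      ultimately have "h \<le> \<zeta> * C" using h unfolding C_def by (simp add: algebra_simps add_divide_distrib diff_divide_distrib)
      then show False using z2 by simp
    next
      assume N: "x1 + x2 + x3 \<le> 0.487"
      have "a2 - \<zeta> \<le> x1 + x2 + x3" using x(2) x3 nn by linarith
      then have "(a2 - \<zeta>) * D \<le> 0.487 * 2.0469"
      proof -
        assume "a2 - \<zeta> \<le> x1 + x2 + x3"
        then have "(a2 - \<zeta>) * D \<le> 0.487 * D" using N D0 by (intro mult_right_mono) auto
        also have "\<dots> \<le> 0.487 * 2.0469" using D1 by simp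
        finally show ?thesis .
      qed
      moreover have "\<zeta> * (1 / s) \<le> 1 / 1000" using z1 s0 by (simp add: field_simps)
      moreover have "\<zeta> * D \<le> \<zeta> * 2.0469" using D1 z0 by (intro mult_left_mono) auto
      ultimately show False using aD z1 s1 by (simp add: algebra_simps)
    qed
  qed
qed

text \<open>The fraction \<open>\<alpha>\<close> of pairs is taken slightly above \<open>1 / D\<close>: this makes the condition for triples strict, and the
condition for quadruples is strict at \<open>1 / D\<close> already and survives a small change.\<close>

lemma supercritical_core:
  fixes p :: real defines "s \<equiv> p * (1 - p)"
  assumes p: "0.4012 < p" "p \<le> 1 / 2" "critical_poly s < 0"
  shows "\<exists>\<alpha> \<eta>. 2 / 5 \<le> \<alpha> \<and> \<alpha> < 1 / 2 \<and> 0 < \<eta> \<and>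
     (1 - 2 * \<alpha>) * mix_prob p 3 + \<alpha> * mix_prob p 6 \<le> 2 * s - \<eta> \<and>
     (3 * \<alpha> - 1) * mix_prob p 8 + (1 - 2 * \<alpha>) * mix_prob p 12 \<le> 2 * s - \<eta>"
proof -
  have "0.4012 * (1 - 0.4012) < s" unfolding s_def using p by (intro prod_strict_mono) auto
  then have s0: "0.24 < s" by simp
  have s1: "s \<le> 1/4" unfolding s_def by (rule mult_one_minus_le_quarter)
  define D where "D = 9 * s - 2 * s ^ 2"
  have D': "D = s * (9 - 2 * s)" by (simp add: D_def power2_eq_square algebra_simps)
  have "0.24 * (9 - 2 * 0.24) \<le> D" unfolding D' using s1 s0 by (intro nine_minus_mono) auto
  then have D2: "2 < D" by simp
  have "D \<le> 1/4 * (9 - 2 * (1/4))" unfolding D' using s1 by (intro nine_minus_mono) auto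
  then have D3: "D \<le> 2.125" by simp
  define h where "h = - (s ^ 2 * critical_poly s) / D"
  have h0: "0 < h" using s0 p(3) D2 by (simp add: h_def mult_neg_pos mult_pos_neg divide_neg_pos)
  have h: "(3 - D) * mix_prob p 8 + (D - 2) * mix_prob p 12 - 2 * s * D = - (h * D)"
  proof -
    have "(3 - D) * mix_prob p 8 + (D - 2) * mix_prob p 12 - 2 * s * D = s ^ 2 * critical_poly s"
      unfolding D_def s_def by (rule critical_poly_identity)
    then show ?thesis using D2 by (simp add: h_def)
  qed
  define \<alpha>0 where "\<alpha>0 = 1 / D"
  have a0: "\<alpha>0 < 1/2" "2/5 \<le> \<alpha>0" "\<alpha>0 * D = 1" using D2 D3 by (auto simp: \<alpha>0_def field_simps)
  have h2: "(3 * \<alpha>0 - 1) * mix_prob p 8 + (1 - 2 * \<alpha>0) * mix_prob p 12 = 2 * s - h"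
  proof -
    have "\<alpha>0 * ((3 - D) * mix_prob p 8 + (D - 2) * mix_prob p 12 - 2 * s * D) = \<alpha>0 * (- (h * D))" using h by simp
    then have "(3 * \<alpha>0 - \<alpha>0 * D) * mix_prob p 8 + (\<alpha>0 * D - 2 * \<alpha>0) * mix_prob p 12 - 2 * s * (\<alpha>0 * D) = - (h * (\<alpha>0 * D))"
      by (simp add: algebra_simps)
    then show ?thesis unfolding a0(3) by simp
  qed
  define \<tau> where "\<tau> = min (h / 6) ((1/2 - \<alpha>0) / 2)"
  have t0: "0 < \<tau>" "\<tau> \<le> h / 6" using h0 a0 by (auto simp: \<tau>_def)
  have t1: "\<alpha>0 + \<tau> < 1/2"
  proof -
    have "\<tau> \<le> (1/2 - \<alpha>0) / 2" unfolding \<tau>_def by (rule min.cobounded2)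
    then have "2 * \<tau> \<le> 1/2 - \<alpha>0" by simp
    then show ?thesis using a0(1) by linarith
  qed
  have g: "0 \<le> mix_prob p 12" "mix_prob p 8 \<le> 1" using p by (auto intro!: mix_prob_bounds)
  define \<eta> where "\<eta> = min (\<tau> * (s * D)) (h / 2)"
  have e0: "0 < \<eta>" using t0 h0 s0 D2 by (simp add: \<eta>_def)
  have "(1 - 2 * (\<alpha>0 + \<tau>)) * mix_prob p 3 + (\<alpha>0 + \<tau>) * mix_prob p 6 = 3 * s - s * (\<alpha>0 * D) - \<tau> * (s * D)"
    unfolding mix_prob_polys s_def[symmetric] D_def by (simp add: eval_nat_numeral algebra_simps)
  then have 1: "(1 - 2 * (\<alpha>0 + \<tau>)) * mix_prob p 3 + (\<alpha>0 + \<tau>) * mix_prob p 6 \<le> 2 * s - \<eta>" unfolding a0(3) by (simp add: \<eta>_def)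
  have "(3 * (\<alpha>0 + \<tau>) - 1) * mix_prob p 8 + (1 - 2 * (\<alpha>0 + \<tau>)) * mix_prob p 12 = 2 * s - h + 3 * (\<tau> * mix_prob p 8) - 2 * (\<tau> * mix_prob p 12)"
    using h2 by (simp add: algebra_simps)
  moreover have "\<tau> * mix_prob p 8 \<le> \<tau>" "0 \<le> \<tau> * mix_prob p 12" using t0 g by (auto simp: mult_left_le)
  moreover have "\<eta> \<le> h / 2" by (simp add: \<eta>_def)
  ultimately have 2: "(3 * (\<alpha>0 + \<tau>) - 1) * mix_prob p 8 + (1 - 2 * (\<alpha>0 + \<tau>)) * mix_prob p 12 \<le> 2 * s - \<eta>" using t0 by linarith
  show ?thesis using 1 2 e0 t1 a0 t0 by (intro exI[of _ "\<alpha>0 + \<tau>"] exI[of _ \<eta>]) auto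
qed

section \<open>Concentration over all families of disjoint sets\<close>

definition disj_fams :: "'a set \<Rightarrow> 'a set set set" where
  "disj_fams V = {\<A>. \<A> \<subseteq> Pow V \<and> disj_fam \<A>}"

lemma finite_disj_fams: "finite V \<Longrightarrow> finite (disj_fams V)"
  unfolding disj_fams_def by (rule finite_subset[of _ "Pow (Pow V)"]) auto

lemma card_fam_le:
  assumes "finite V" "\<A> \<in> disj_fams V" shows "card \<A> \<le> card V"
proof -
  have "\<A> = {B \<in> \<A>. B \<inter> V \<noteq> {}}"
    using assms(2) disj_fam_ne[of \<A>] by (auto simp: disj_fams_def)
  then show ?thesis using card_meeting[of \<A> V] assms by (simp add: disj_fams_def)
qed

text \<open>A family of disjoint sets is recovered from the function that labels each vertex by the minimum of
its set, or by 0 if it is uncovered.\<close>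

lemma card_disj_fams_le: "card (disj_fams {1..n}) \<le> (n + 1) ^ n"
proof -
  define \<Phi> where "\<Phi> f = {B. \<exists>i\<in>{1..n}. B = {x \<in> {1..n}. f x = i}} - {{}}" for f :: "nat \<Rightarrow> nat"
  have "disj_fams {1..n} \<subseteq> \<Phi> ` (PiE {1..n} (\<lambda>_. {0..n}))"
  proof
    fix \<A> assume A: "\<A> \<in> disj_fams {1..n}"
    then have dj: "disj_fam \<A>" and sub: "\<And>B. B \<in> \<A> \<Longrightarrow> B \<subseteq> {1..n}" by (auto simp: disj_fams_def)
    have fin: "finite B" if "B \<in> \<A>" for B using sub[OF that] finite_subset by auto
    have minB: "Min B \<in> B" if "B \<in> \<A>" for B using fin[OF that] disj_fam_ne[OF dj that] by simp
    define part where "part x = (THE B. B \<in> \<A> \<and> x \<in> B)" for x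
    have part: "part x = B" if "B \<in> \<A>" "x \<in> B" for x B
      unfolding part_def by (rule the_equality) (use that disj_famD[OF dj] in auto)
    define f where "f = restrict (\<lambda>x. if x \<in> \<Union>\<A> then Min (part x) else 0) {1..n}"
    have fB: "f x = Min B" if "B \<in> \<A>" "x \<in> B" for x B
      using that part[OF that] sub[OF that(1)] by (auto simp: f_def)
    have f0: "f x = 0" if "x \<in> {1..n}" "x \<notin> \<Union>\<A>" for x using that by (auto simp: f_def)
    have le: "Min B \<in> {1..n}" if "B \<in> \<A>" for B using minB[OF that] sub[OF that] by auto
    have cls: "{x \<in> {1..n}. f x = Min B} = B" if B: "B \<in> \<A>" for B
    proof (intro equalityI subsetI)
      fix x assume x: "x \<in> {x \<in> {1..n}. f x = Min B}"
      have "Min B \<noteq> 0" using le[OF B] by simp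
      then have "x \<in> \<Union>\<A>" using x f0[of x] by auto
      then obtain C where C: "C \<in> \<A>" "x \<in> C" by auto
      then have "Min C = Min B" using fB x by auto
      then have "Min B \<in> B \<inter> C" using minB[OF B] minB[OF C(1)] by simp
      then have "B = C" using disj_famD[OF dj B C(1)] by auto
      then show "x \<in> B" using C by simp
    next
      fix x assume "x \<in> B" then show "x \<in> {x \<in> {1..n}. f x = Min B}" using fB[OF B] sub[OF B] by auto
    qed
    have "f \<in> PiE {1..n} (\<lambda>_. {0..n})"
    proof (rule PiE_I)
      fix x assume x: "x \<in> {1..n}"
      show "f x \<in> {0..n}"
      proof (cases "x \<in> \<Union>\<A>")
        case True
        then obtain B where "B \<in> \<A>" "x \<in> B" by auto
        then show ?thesis using fB[of B x] le[of B] by auto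
      qed (use f0 x in auto)
    qed (auto simp: f_def)
    moreover have "\<Phi> f = \<A>"
    proof (intro equalityI subsetI)
      fix B assume "B \<in> \<Phi> f"
      then obtain i where i: "i \<in> {1..n}" "B = {x \<in> {1..n}. f x = i}" and "B \<noteq> {}" unfolding \<Phi>_def by blast
      then obtain x where x: "x \<in> B" by blast
      then have "x \<in> \<Union>\<A>" using f0[of x] i by auto
      then obtain C where C: "C \<in> \<A>" "x \<in> C" by auto
      then have "i = Min C" using fB x i by auto
      then show "B \<in> \<A>" using i cls[OF C(1)] C by simp
    next
      fix B assume B: "B \<in> \<A>"
      then show "B \<in> \<Phi> f" using cls[OF B] le[OF B] disj_fam_ne[OF dj B] unfolding \<Phi>_def by blast
    qed
    ultimately show "\<A> \<in> \<Phi> ` (PiE {1..n} (\<lambda>_. {0..n}))" by blast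
  qed
  moreover have fin: "finite (PiE {1..n} (\<lambda>_. {0..n}))" by (simp add: finite_PiE)
  ultimately have "card (disj_fams {1..n}) \<le> card (\<Phi> ` (PiE {1..n} (\<lambda>_. {0..n})))" by (intro card_mono) auto
  also have "\<dots> \<le> card (PiE {1..n} (\<lambda>_. {0..n}))" by (rule card_image_le) fact
  also have "\<dots> = (n + 1) ^ n" by (simp add: card_PiE)
  finally show ?thesis .
qed

definition uniform_mix :: "real \<Rightarrow> real \<Rightarrow> nat \<Rightarrow> nat set set \<Rightarrow> bool" where
  "uniform_mix p \<delta> n X \<longleftrightarrow> (\<forall>\<A>\<in>disj_fams {1..n}. \<forall>\<B>\<in>disj_fams {1..n}. \<Union>\<A> \<inter> \<Union>\<B> = {} \<longrightarrow>
     (\<Sum>(A, B)\<in>\<A> \<times> \<B>. mix_prob p (card A * card B)) - \<delta> * (real n)\<^sup>2 \<le> real (card {(A, B) \<in> \<A> \<times> \<B>. mixed X A B}))"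

lemma edge_whp_uniform_mix:
  assumes p: "0 \<le> p" "p \<le> 1" and d: "0 < \<delta>"
  shows "edge_whp p (uniform_mix p \<delta>)"
proof (rule edge_whpI)
  show "\<forall>\<^sub>F n in sequentially. Prob (all_edges {1..n}) p (\<lambda>X. \<not> uniform_mix p \<delta> n X)
     \<le> exp (2 * real n * ln (real n + 1)) * exp (- (\<delta>\<^sup>2 / 2) * (real n)\<^sup>2)"
    using eventually_gt_at_top[of 0]
  proof eventually_elim
    case (elim n)
    let ?V = "{1..n}"
    let ?I = "{(\<A>, \<B>). \<A> \<in> disj_fams ?V \<and> \<B> \<in> disj_fams ?V \<and> \<Union>\<A> \<inter> \<Union>\<B> = {}}"
    have sub: "?I \<subseteq> disj_fams ?V \<times> disj_fams ?V" by auto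
    have fI: "finite ?I" by (rule finite_subset[OF sub]) (simp add: finite_disj_fams)
    define bad where "bad z X \<longleftrightarrow> real (card {(A, B) \<in> fst z \<times> snd z. mixed X A B}) \<le>
       (\<Sum>(A, B)\<in>fst z \<times> snd z. mix_prob p (card A * card B)) - \<delta> * (real n)\<^sup>2" for z :: "nat set set \<times> nat set set" and X
    have "Prob (all_edges ?V) p (\<lambda>X. \<not> uniform_mix p \<delta> n X) \<le> real (card ?I) * exp (- (\<delta> * (real n)\<^sup>2)\<^sup>2 / (2 * (real n)\<^sup>2))"
    proof (rule Prob_union_bound)
      fix X assume "\<not> uniform_mix p \<delta> n X"
      then obtain \<A> \<B> where AB: "\<A> \<in> disj_fams ?V" "\<B> \<in> disj_fams ?V" "\<Union>\<A> \<inter> \<Union>\<B> = {}"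
        "\<not> (\<Sum>(A, B)\<in>\<A> \<times> \<B>. mix_prob p (card A * card B)) - \<delta> * (real n)\<^sup>2 \<le> real (card {(A, B) \<in> \<A> \<times> \<B>. mixed X A B})"
        unfolding uniform_mix_def by blast
      have "bad (\<A>, \<B>) X" using AB(4) unfolding bad_def fst_conv snd_conv by linarith
      moreover have "(\<A>, \<B>) \<in> ?I" using AB(1-3) by simp
      ultimately show "\<exists>z\<in>?I. bad z X" by blast
    next
      fix z assume z: "z \<in> ?I"
      then obtain \<A> \<B> where AB: "z = (\<A>, \<B>)" "\<A> \<in> disj_fams ?V" "\<B> \<in> disj_fams ?V" "\<Union>\<A> \<inter> \<Union>\<B> = {}" by auto
      have "card \<A> * card \<B> \<le> n * n" using card_fam_le[OF _ AB(2)] card_fam_le[OF _ AB(3)] by (intro mult_mono) auto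
      then have N: "real (card \<A> * card \<B>) \<le> (real n)\<^sup>2"
        unfolding power2_eq_square of_nat_mult[symmetric] of_nat_le_iff .
      show "Prob (all_edges ?V) p (bad z) \<le> exp (- (\<delta> * (real n)\<^sup>2)\<^sup>2 / (2 * (real n)\<^sup>2))"
        unfolding bad_def AB(1) fst_conv snd_conv
        by (rule mixed_pairs_lower) (use AB N p d elim in \<open>auto simp: disj_fams_def\<close>)
    qed (use fI in auto)
    also have "(\<delta> * (real n)\<^sup>2)\<^sup>2 / (2 * (real n)\<^sup>2) = \<delta>\<^sup>2 / 2 * (real n)\<^sup>2"
      using elim by (simp add: power2_eq_square)
    then have "exp (- (\<delta> * (real n)\<^sup>2)\<^sup>2 / (2 * (real n)\<^sup>2)) = exp (- (\<delta>\<^sup>2 / 2) * (real n)\<^sup>2)" by simp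
    also have "real (card ?I) \<le> exp (2 * real n * ln (real n + 1))"
    proof -
      have "card ?I \<le> card (disj_fams ?V \<times> disj_fams ?V)" using sub by (intro card_mono) (simp_all add: finite_disj_fams)
      also have "\<dots> \<le> (n + 1) ^ n * (n + 1) ^ n" unfolding card_cartesian_product
        by (intro mult_mono card_disj_fams_le) auto
      finally have "real (card ?I) \<le> real ((n + 1) ^ n * (n + 1) ^ n)" by (simp only: of_nat_le_iff)
      also have "\<dots> = (real n + 1) ^ (2 * n)" by (simp add: power_mult_distrib power_add[symmetric] mult_2 add.commute)
      also have "\<dots> = exp (ln (real n + 1)) ^ (2 * n)" by simp
      also have "\<dots> = exp (2 * real n * ln (real n + 1))" by (subst exp_of_nat_mult[symmetric]) simp
      finally show ?thesis .
    qed
    finally show ?case by (simp add: mult_right_mono)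
  qed
  show "(\<lambda>n. exp (2 * real n * ln (real n + 1)) * exp (- (\<delta>\<^sup>2 / 2) * (real n)\<^sup>2)) \<longlonglongrightarrow> 0"
    using d by real_asymp
qed

text \<open>A union bound over the polynomially many sets of a fixed size \<open>K\<close>.\<close>

lemma edge_whp_large_sets:
  assumes p: "0 \<le> p" "p \<le> 1" and d: "0 < \<delta>" and K: "1 \<le> K"
  shows "edge_whp p (\<lambda>n X. \<forall>A\<subseteq>{1..n}. card A = K \<longrightarrow>
     real (card {x \<in> {1..n} - A. \<not> mixed X A {x}}) \<le> (1 - mix_prob p K + \<delta>) * real n)"
proof (rule edge_whpI)
  show "\<forall>\<^sub>F n in sequentially. Prob (all_edges {1..n}) p (\<lambda>X. \<not> (\<forall>A\<subseteq>{1..n}. card A = K \<longrightarrow>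
     real (card {x \<in> {1..n} - A. \<not> mixed X A {x}}) \<le> (1 - mix_prob p K + \<delta>) * real n))
     \<le> real n ^ K * exp (- (\<delta>\<^sup>2 / 2) * real n)"
    using eventually_gt_at_top[of 0]
  proof eventually_elim
    case (elim n)
    let ?V = "{1..n}"
    let ?I = "{A. A \<subseteq> ?V \<and> card A = K}"
    have fI: "finite ?I" by (rule finite_subset[of _ "Pow ?V"]) auto
    define bad where "bad A X \<longleftrightarrow> real (card {x \<in> ?V - A. mixed X A {x}}) \<le> mix_prob p K * real (card (?V - A)) - \<delta> * real n" for A :: "nat set" and X
    have "Prob (all_edges ?V) p (\<lambda>X. \<not> (\<forall>A\<subseteq>{1..n}. card A = K \<longrightarrow>
     real (card {x \<in> {1..n} - A. \<not> mixed X A {x}}) \<le> (1 - mix_prob p K + \<delta>) * real n)) \<le> real (card ?I) * exp (- (\<delta> * real n)\<^sup>2 / (2 * real n))"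
    proof (rule Prob_union_bound)
      fix X assume "\<not> (\<forall>A\<subseteq>{1..n}. card A = K \<longrightarrow>
         real (card {x \<in> {1..n} - A. \<not> mixed X A {x}}) \<le> (1 - mix_prob p K + \<delta>) * real n)"
      then obtain A where A: "A \<subseteq> ?V" "card A = K" "\<not> real (card {x \<in> ?V - A. \<not> mixed X A {x}}) \<le> (1 - mix_prob p K + \<delta>) * real n" by blast
      have "card {x \<in> ?V - A. mixed X A {x}} + card {x \<in> ?V - A. \<not> mixed X A {x}} = card (?V - A)"
        by (subst card_Un_disjoint[symmetric]) (auto intro!: arg_cong[where f=card])
      then have "real (card {x \<in> ?V - A. mixed X A {x}}) + real (card {x \<in> ?V - A. \<not> mixed X A {x}}) = real (card (?V - A))"
        by (simp only: of_nat_add[symmetric])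
      moreover have "(1 - mix_prob p K) * real (card (?V - A)) \<le> (1 - mix_prob p K) * real n"
        using mix_prob_bounds[of p K] p K card_mono[of ?V "?V - A"] by (intro mult_left_mono) auto
      ultimately have "bad A X" unfolding bad_def using A(3) by (simp add: algebra_simps)
      then show "\<exists>A\<in>?I. bad A X" using A by auto
    next
      fix A assume A: "A \<in> ?I"
      then have ne: "A \<noteq> {}" "finite A" using K finite_subset[of A ?V] by auto
      show "Prob (all_edges ?V) p (bad A) \<le> exp (- (\<delta> * real n)\<^sup>2 / (2 * real n))"
        unfolding bad_def
      proof (subst mult.commute[of "mix_prob p K"], unfold sum_constant[symmetric], rule hoeffding_lower[where F="\<lambda>x. cross A {x}"])
        show "disjoint_family_on (\<lambda>x. cross A {x}) (?V - A)" unfolding disjoint_family_on_def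
          by (intro ballI impI cross_disjoint) auto
        fix x assume x: "x \<in> ?V - A"
        show "cross A {x} \<subseteq> all_edges ?V" using A x by (intro cross_subset) auto
        show "depends_on (cross A {x}) (\<lambda>X. mixed X A {x})" by (rule depends_mixed)
        show "Prob (all_edges ?V) p (\<lambda>X. mixed X A {x}) = mix_prob p K"
          using Prob_mixed[of ?V A "{x}" p] A x p ne by auto
      qed (use elim d card_mono[of ?V "?V - A"] in auto)
    qed (use fI in auto)
    also have "exp (- (\<delta> * real n)\<^sup>2 / (2 * real n)) = exp (- (\<delta>\<^sup>2 / 2) * real n)"
      using elim by (simp add: power2_eq_square)
    also have "real (card ?I) \<le> real n ^ K"
    proof -
      have "card ?I = n choose K" using n_subsets[of ?V K] by simp
      also have "\<dots> \<le> n ^ K"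
      proof (cases "K \<le> n")
        case True then show ?thesis by (rule binomial_le_pow)
      qed (simp add: binomial_eq_0)
      finally show ?thesis by (metis of_nat_le_iff of_nat_power)
    qed
    finally show ?case by (simp add: mult_right_mono)
  qed
  have "(\<lambda>n. real n powr real K * exp (- (\<delta>\<^sup>2 / 2) * real n)) \<longlonglongrightarrow> 0"
    using d by real_asymp
  moreover have "eventually (\<lambda>n. real n powr real K * exp (- (\<delta>\<^sup>2 / 2) * real n) = real n ^ K * exp (- (\<delta>\<^sup>2 / 2) * real n)) sequentially"
    using eventually_gt_at_top[of 0] by eventually_elim (simp add: powr_realpow)
  ultimately show "(\<lambda>n. real n ^ K * exp (- (\<delta>\<^sup>2 / 2) * real n)) \<longlonglongrightarrow> 0"
    by (rule Lim_transform_eventually)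
qed

text \<open>Each part that is not red to \<open>A\<close> consists of vertices that do not distinguish the vertices of \<open>A\<close>, and these are few
when \<open>A\<close> is large. So the red degree of \<open>A\<close> almost counts all parts.\<close>

lemma card_le_of_large_part:
  assumes V: "finite V" "partition_on V P" "red_bounded X d P" "A \<in> P" "A' \<subseteq> A"
  shows "card P \<le> d + 1 + card {x \<in> V - A'. \<not> mixed X A' {x}}"
proof -
  have fP: "finite P" using finite_partition V by auto
  have dj: "disj_fam P" using disj_fam_partition V by auto
  define R where "R = {B \<in> P - {A}. \<not> mixed X A B}"
  define f where "f B = (SOME x. x \<in> B)" for B :: "'a set"
  have f: "f B \<in> B" if "B \<in> P" for B unfolding f_def using disj_fam_ne[OF dj that] by (simp add: some_in_eq)
  have "inj_on f R"
  proof (rule inj_onI)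
    fix B C assume *: "B \<in> R" "C \<in> R" "f B = f C"
    then have "f B \<in> B \<inter> C" using f[of B] f[of C] by (auto simp: R_def)
    then show "B = C" using disj_famD[OF dj, of B C] * by (auto simp: R_def)
  qed
  moreover have "f ` R \<subseteq> {x \<in> V - A'. \<not> mixed X A' {x}}"
  proof
    fix x assume "x \<in> f ` R"
    then obtain B where B: "x = f B" "B \<in> P" "B \<noteq> A" "\<not> mixed X A B" by (auto simp: R_def)
    have "x \<in> B" using f B by auto
    moreover have "B \<inter> A = {}" using disj_famD[OF dj] B V(4) by auto
    moreover have "B \<subseteq> V" using B V(2) by (auto simp: partition_on_def)
    ultimately show "x \<in> {x \<in> V - A'. \<not> mixed X A' {x}}"
      using B(4) V(5) mixed_mono[of X A' "{x}" A B] by auto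
  qed
  ultimately have "card R \<le> card {x \<in> V - A'. \<not> mixed X A' {x}}"
    using V(1) by (intro card_inj_on_le) auto
  moreover have "redcount X A (P - {A}) \<le> d" using V(3,4) by (auto simp: red_bounded_def)
  moreover have "card P \<le> 1 + (redcount X A (P - {A}) + card R)"
  proof -
    have "card (P - {A}) \<le> card ({B \<in> P - {A}. mixed X A B} \<union> R)"
      by (rule card_mono) (use fP in \<open>auto simp: R_def\<close>)
    also have "\<dots> \<le> redcount X A (P - {A}) + card R" unfolding redcount_def by (rule card_Un_le)
    finally have "card (P - {A}) \<le> redcount X A (P - {A}) + card R" .
    then show ?thesis using fP V(4) by (simp add: card_Diff_singleton)
  qed
  ultimately show ?thesis by linarith
qed

section \<open>The lower bound below the critical probability\<close>

definition num_large :: "nat \<Rightarrow> 'a set set \<Rightarrow> nat" where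
  "num_large j P = card {A \<in> P. j \<le> card A}"

definition num_size :: "nat \<Rightarrow> 'a set set \<Rightarrow> nat" where
  "num_size j P = card {A \<in> P. card A = j}"

lemma num_large_step:
  assumes "finite P" "merge_step P P'" shows "num_large j P' \<le> Suc (num_large j P)"
proof -
  obtain A B where AB: "P' = insert (A \<union> B) (P - {A, B})"
    using assms(2) unfolding merge_step_def by auto
  have "num_large j P' \<le> card (insert (A \<union> B) {A \<in> P. j \<le> card A})"
    unfolding num_large_def by (rule card_mono) (use assms AB in auto)
  also have "\<dots> \<le> Suc (num_large j P)" unfolding num_large_def by (rule card_insert_le_m1[THEN order_trans]) auto
  finally show ?thesis .
qed

lemma sum_by_size:
  fixes f :: "nat \<Rightarrow> 'b :: comm_semiring_1"
  assumes P: "finite P" "\<And>A. A \<in> P \<Longrightarrow> 1 \<le> card A"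
  shows "(\<Sum>A\<in>{A \<in> P. card A < 3}. f (card A)) = of_nat (num_size 1 P) * f 1 + of_nat (num_size 2 P) * f 2"
    "(\<Sum>A\<in>{A \<in> P. card A < 4}. f (card A)) = of_nat (num_size 1 P) * f 1 + of_nat (num_size 2 P) * f 2 + of_nat (num_size 3 P) * f 3"
proof -
  have c: "(\<Sum>A\<in>{A \<in> P. card A = j}. f (card A)) = of_nat (num_size j P) * f j" for j
    by (simp add: num_size_def)
  have e3: "{A \<in> P. card A < 3} = {A \<in> P. card A = 1} \<union> {A \<in> P. card A = 2}" using P(2) by force
  have e4: "{A \<in> P. card A < 4} = {A \<in> P. card A < 3} \<union> {A \<in> P. card A = 3}" by auto
  show 1: "(\<Sum>A\<in>{A \<in> P. card A < 3}. f (card A)) = of_nat (num_size 1 P) * f 1 + of_nat (num_size 2 P) * f 2"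
    unfolding e3 by (subst sum.union_disjoint) (use P(1) in \<open>auto simp: num_size_def\<close>)
  show "(\<Sum>A\<in>{A \<in> P. card A < 4}. f (card A)) = of_nat (num_size 1 P) * f 1 + of_nat (num_size 2 P) * f 2 + of_nat (num_size 3 P) * f 3"
    unfolding e4 by (subst sum.union_disjoint) (use P(1) 1 in \<open>auto simp: num_size_def\<close>)
qed

lemma part_sizes:
  assumes "finite V" "partition_on V P" "A \<in> P" shows "1 \<le> card A" "A \<subseteq> V" "finite A"
proof -
  show "A \<subseteq> V" "finite A" using assms by (auto simp: partition_on_def intro: finite_subset)
  then show "1 \<le> card A" using assms by (auto simp: partition_on_def card_gt_0_iff Suc_le_eq)
qed

text \<open>Counting vertices and parts by size. Parts of size at least three (four) are few in the application,
so only the bound \<open>M\<close> on their size is used.\<close>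

lemma size_balance:
  assumes V: "finite V" "partition_on V P" and M: "\<And>A. A \<in> P \<Longrightarrow> card A \<le> M"
  shows "card V \<le> num_size 1 P + 2 * num_size 2 P + M * num_large 3 P"
    "card V \<le> num_size 1 P + 2 * num_size 2 P + 3 * num_size 3 P + M * num_large 4 P"
    "num_size 1 P + 2 * num_size 2 P \<le> card V"
    "card P = num_size 1 P + num_size 2 P + num_large 3 P"
    "card P = num_size 1 P + num_size 2 P + num_size 3 P + num_large 4 P"
proof -
  have fP: "finite P" using finite_partition V by auto
  note ps = part_sizes[OF V]
  have split: "(\<Sum>A\<in>P. f (card A)) = (\<Sum>A\<in>{A \<in> P. card A < j}. f (card A)) + (\<Sum>A\<in>{A \<in> P. j \<le> card A}. f (card A))" for f :: "nat \<Rightarrow> nat" and j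
    by (subst sum.union_disjoint[symmetric]) (use fP in \<open>auto intro!: sum.cong\<close>)
  have bnd: "(\<Sum>A\<in>{A \<in> P. j \<le> card A}. card A) \<le> M * num_large j P" for j
    unfolding num_large_def using sum_mono[of "{A \<in> P. j \<le> card A}" card "\<lambda>_. M"] M by (simp add: mult.commute)
  note s3 = sum_by_size(1)[OF fP ps(1), where f = "\<lambda>x. x"] and s4 = sum_by_size(2)[OF fP ps(1), where f = "\<lambda>x. x"]
  note o3 = sum_by_size(1)[OF fP ps(1), where f = "\<lambda>x. 1::nat"] and o4 = sum_by_size(2)[OF fP ps(1), where f = "\<lambda>x. 1::nat"]
  show "card V \<le> num_size 1 P + 2 * num_size 2 P + M * num_large 3 P" "num_size 1 P + 2 * num_size 2 P \<le> card V"
    using split[of "\<lambda>x. x" 3] s3 bnd[of 3] sum_card_partition[OF V] by simp_all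
  show "card V \<le> num_size 1 P + 2 * num_size 2 P + 3 * num_size 3 P + M * num_large 4 P"
    using split[of "\<lambda>x. x" 4] s4 bnd[of 4] sum_card_partition[OF V] by simp
  show "card P = num_size 1 P + num_size 2 P + num_large 3 P" "card P = num_size 1 P + num_size 2 P + num_size 3 P + num_large 4 P"
    using split[of "\<lambda>x. 1" 3] split[of "\<lambda>x. 1" 4] o3 o4 by (simp_all add: num_large_def)
qed

text \<open>Shrinking each large part to \<open>j\<close> vertices can only remove red edges and makes the family
eligible for the uniform count; averaging over the large parts then bounds the sum from above.\<close>

lemma average_red_degree:
  assumes V: "partition_on {1..n} P" "red_bounded X d P" and U: "uniform_mix p \<delta> n X" and j: "0 < j"
  shows "real (num_large j P) * (\<Sum>B\<in>{B \<in> P. card B < j}. mix_prob p (j * card B)) - \<delta> * (real n)\<^sup>2 \<le> real (num_large j P) * real d"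
proof -
  have fP: "finite P" using finite_partition V(1) by auto
  note ps = part_sizes[OF _ V(1)]
  have dj: "disj_fam P" using disj_fam_partition V by auto
  define S where "S = {A \<in> P. j \<le> card A}"
  define \<B> where "\<B> = {B \<in> P. card B < j}"
  have fS: "finite S" "finite \<B>" using fP by (auto simp: S_def \<B>_def)
  have "\<exists>T. T \<subseteq> A \<and> card T = j" if "A \<in> S" for A
    using obtain_subset_with_card_n[of j A] that by (auto simp: S_def)
  then obtain T where T: "\<And>A. A \<in> S \<Longrightarrow> T A \<subseteq> A \<and> card (T A) = j" by metis
  have Tne: "T A \<noteq> {}" if "A \<in> S" for A using T[OF that] j by auto
  have Tdj: "T A \<inter> T B = {}" if "A \<in> S" "B \<in> S" "A \<noteq> B" for A B
    using T[OF that(1)] T[OF that(2)] disj_famD[OF dj, of A B] that by (auto simp: S_def)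
  have inj: "inj_on T S"
  proof (rule inj_onI)
    fix A B assume *: "A \<in> S" "B \<in> S" "T A = T B"
    then show "A = B" using Tdj[of A B] Tne[of A] by auto
  qed
  define \<A> where "\<A> = T ` S"
  have Asub: "A \<subseteq> {1..n}" if "A \<in> S" for A using ps(2)[of A] that by (auto simp: S_def)
  have "disj_fam \<A>" unfolding \<A>_def by (rule disj_famI) (use Tne Tdj in auto)
  moreover have "\<A> \<subseteq> Pow {1..n}" using T Asub by (fastforce simp: \<A>_def)
  ultimately have 1: "\<A> \<in> disj_fams {1..n}" by (simp add: disj_fams_def)
  have 2: "\<B> \<in> disj_fams {1..n}" using disj_fam_subset[OF dj, of \<B>] ps(2) by (auto simp: disj_fams_def \<B>_def)
  have SB: "A \<inter> B = {}" if "A \<in> S" "B \<in> \<B>" for A B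
  proof -
    have "A \<noteq> B" "A \<in> P" "B \<in> P" using that by (auto simp: S_def \<B>_def)
    then show ?thesis using disj_famD[OF dj] by metis
  qed
  have 3: "\<Union>\<A> \<inter> \<Union>\<B> = {}" using SB T by (fastforce simp: \<A>_def)
  have "(\<Sum>(A, B)\<in>\<A> \<times> \<B>. mix_prob p (card A * card B)) - \<delta> * (real n)\<^sup>2 \<le> real (card {(A, B) \<in> \<A> \<times> \<B>. mixed X A B})"
    using U 1 2 3 unfolding uniform_mix_def by blast
  moreover have "(\<Sum>(A, B)\<in>\<A> \<times> \<B>. mix_prob p (card A * card B)) = real (num_large j P) * (\<Sum>B\<in>\<B>. mix_prob p (j * card B))"
  proof -
    have "(\<Sum>(A, B)\<in>\<A> \<times> \<B>. mix_prob p (card A * card B)) = (\<Sum>A\<in>\<A>. \<Sum>B\<in>\<B>. mix_prob p (card A * card B))"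
      by (simp add: sum.cartesian_product)
    also have "\<dots> = (\<Sum>A\<in>S. \<Sum>B\<in>\<B>. mix_prob p (card (T A) * card B))" unfolding \<A>_def by (simp add: sum.reindex[OF inj])
    also have "\<dots> = (\<Sum>A\<in>S. \<Sum>B\<in>\<B>. mix_prob p (j * card B))" using T by (intro sum.cong refl) auto
    finally show ?thesis by (simp add: num_large_def S_def)
  qed
  moreover have "card {(A, B) \<in> \<A> \<times> \<B>. mixed X A B} \<le> num_large j P * d"
  proof -
    have "{(A, B) \<in> \<A> \<times> \<B>. mixed X A B} = Sigma \<A> (\<lambda>A. {B \<in> \<B>. mixed X A B})" by auto
    then have "card {(A, B) \<in> \<A> \<times> \<B>. mixed X A B} = (\<Sum>A\<in>\<A>. card {B \<in> \<B>. mixed X A B})"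
      using fS by (simp add: card_SigmaI \<A>_def)
    also have "\<dots> = (\<Sum>A\<in>S. card {B \<in> \<B>. mixed X (T A) B})" unfolding \<A>_def by (simp add: sum.reindex[OF inj])
    also have "\<dots> \<le> (\<Sum>A\<in>S. d)"
    proof (rule sum_mono)
      fix A assume A: "A \<in> S"
      have "card {B \<in> \<B>. mixed X (T A) B} \<le> redcount X A (P - {A})" unfolding redcount_def
      proof (rule card_mono)
        show "{B \<in> \<B>. mixed X (T A) B} \<subseteq> {B \<in> P - {A}. mixed X A B}"
          using A T[OF A] mixed_mono[of X "T A" _ A] by (auto simp: S_def \<B>_def)
      qed (use fP in auto)
      also have "\<dots> \<le> d" using V(2) A by (auto simp: red_bounded_def S_def)
      finally show "card {B \<in> \<B>. mixed X (T A) B} \<le> d" .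
    qed
    finally show ?thesis by (simp add: num_large_def S_def)
  qed
  then have "real (card {(A, B) \<in> \<A> \<times> \<B>. mixed X A B}) \<le> real (num_large j P) * real d"
    unfolding of_nat_mult[symmetric] of_nat_le_iff .
  ultimately show ?thesis unfolding \<B>_def by linarith
qed

lemma chain_refines:
  assumes "\<And>l. i \<le> l \<Longrightarrow> l < j \<Longrightarrow> merge_step (P l) (P (Suc l))" "i \<le> j" "A \<in> P i"
  shows "\<exists>B\<in>P j. A \<subseteq> B"
  using assms(2,1)
proof (induction j rule: dec_induct)
  case base then show ?case using assms(3) by auto
next
  case (step j)
  then obtain B where B: "B \<in> P j" "A \<subseteq> B" by auto
  have "merge_step (P j) (P (Suc j))" using step by auto
  then obtain C D where "P (Suc j) = insert (C \<union> D) (P j - {C, D})" by (auto simp: merge_step_def)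
  then show ?case using B by (cases "B = C \<or> B = D") auto
qed

text \<open>When \<open>P\<close> is refined by merging, a part of size three cannot be a union of parts of size two, so it
contains a former singleton or was present already.\<close>

lemma triples_bound:
  assumes V: "finite V" "partition_on V P" "partition_on V Q" and ref: "\<And>A. A \<in> P \<Longrightarrow> \<exists>B\<in>Q. A \<subseteq> B"
  shows "num_size 3 Q \<le> num_size 1 P + num_large 3 P"
proof -
  have fP: "finite P" using finite_partition V by auto
  have djP: "disj_fam P" and djQ: "disj_fam Q" using disj_fam_partition V by auto
  have ex: "\<exists>A. A \<in> P \<and> card A \<noteq> 2 \<and> A \<subseteq> B" if B: "B \<in> Q" "card B = 3" for B
  proof -
    have fB: "finite B" and BV: "B \<subseteq> V" using part_sizes[OF V(1,3) B(1)] by auto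
    have piece: "\<exists>A\<in>P. x \<in> A \<and> A \<subseteq> B" if x: "x \<in> B" for x
    proof -
      obtain A where A: "A \<in> P" "x \<in> A" using x BV V(2) by (auto simp: partition_on_def)
      obtain C where C: "C \<in> Q" "A \<subseteq> C" using ref[OF A(1)] by auto
      then have "x \<in> C \<inter> B" using A x by auto
      then have "C = B" using disj_famD[OF djQ C(1) B(1)] by auto
      then show ?thesis using A C by auto
    qed
    obtain x where "x \<in> B" using B by (metis card.empty ex_in_conv zero_neq_numeral)
    then obtain A where A: "A \<in> P" "x \<in> A" "A \<subseteq> B" using piece by auto
    show ?thesis
    proof (cases "card A = 2")
      case True
      then have c1: "card (B - A) = 1" using A fB B by (simp add: card_Diff_subset finite_subset)
      then obtain y where y: "B - A = {y}" by (auto simp: card_1_singleton_iff)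
      then obtain A' where A': "A' \<in> P" "y \<in> A'" "A' \<subseteq> B" using piece[of y] by auto
      then have "A' \<noteq> A" using y by auto
      then have "A' \<subseteq> B - A" using A' A disj_famD[OF djP A'(1) A(1)] by auto
      then have "A' = {y}" using y A' by auto
      then show ?thesis using A' by (intro exI[of _ A']) auto
    qed (use A in auto)
  qed
  then obtain f where f: "\<And>B. B \<in> Q \<Longrightarrow> card B = 3 \<Longrightarrow> f B \<in> P \<and> card (f B) \<noteq> 2 \<and> f B \<subseteq> B" by metis
  have "num_size 3 Q \<le> card ({A \<in> P. card A = 1} \<union> {A \<in> P. 3 \<le> card A})" unfolding num_size_def
  proof (rule card_inj_on_le)
    show "inj_on f {A \<in> Q. card A = 3}"
    proof (rule inj_onI)
      fix B C assume *: "B \<in> {A \<in> Q. card A = 3}" "C \<in> {A \<in> Q. card A = 3}" "f B = f C"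
      then have "f B \<subseteq> B \<inter> C" using f[of B] f[of C] by auto
      moreover have "f B \<noteq> {}" using f[of B] * disj_fam_ne[OF djP] by auto
      ultimately have "B \<inter> C \<noteq> {}" by auto
      then show "B = C" using disj_famD[OF djQ, of B C] * by auto
    qed
    show "f ` {A \<in> Q. card A = 3} \<subseteq> {A \<in> P. card A = 1} \<union> {A \<in> P. 3 \<le> card A}"
    proof
      fix A assume "A \<in> f ` {A \<in> Q. card A = 3}"
      then have "A \<in> P" "card A \<noteq> 2" using f by auto
      moreover have "1 \<le> card A" using part_sizes(1)[OF V(1,2)] calculation by auto
      ultimately show "A \<in> {A \<in> P. card A = 1} \<union> {A \<in> P. 3 \<le> card A}" by force
    qed
  qed (use fP in auto)
  also have "\<dots> \<le> num_size 1 P + num_large 3 P" unfolding num_size_def num_large_def by (rule card_Un_le)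
  finally show ?thesis .
qed

text \<open>Let \<open>tb\<close> be the first time with a part of size at least \<open>K\<close>. At that time there are at most
\<open>0.487 * n\<close> parts, and until then parts have at most \<open>2 * K\<close> vertices, so that \<open>\<epsilon> * n\<close> parts with \<open>\<epsilon> = \<zeta> / (8 * K)\<close>
cover at most a fraction \<open>\<zeta> / 4\<close> of the vertices. Hence linearly many parts of size at least three exist at some first
time \<open>t3\<close> up to \<open>tb\<close>. The counts at \<open>t3\<close>, together with those at the first later time with
linearly many parts of size at least four, or at \<open>tb\<close> if there is none, contradict the assumption \<open>core\<close>.\<close>

lemma subcritical_deterministic:
  fixes p \<zeta> :: real
  assumes p: "0 < p" "p < 0.4013"
    and z: "0 < \<zeta>" "\<zeta> \<le> 1/1000"
    and core: "\<And>a1 a2 x1 x2 x3 :: real.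
     0 \<le> a1 \<Longrightarrow> 0 \<le> a2 \<Longrightarrow> 0 \<le> x1 \<Longrightarrow> 0 \<le> x2 \<Longrightarrow> 0 \<le> x3 \<Longrightarrow>
     1 - \<zeta> \<le> a1 + 2 * a2 \<Longrightarrow> a1 + 2 * a2 \<le> 1 \<Longrightarrow> a1 * mix_prob p 3 + a2 * mix_prob p 6 \<le> 2 * (p * (1 - p)) + \<zeta> \<Longrightarrow>
     x3 \<le> a1 + \<zeta> \<Longrightarrow> 1 - \<zeta> \<le> x1 + 2 * x2 + 3 * x3 \<Longrightarrow>
     (x1 * mix_prob p 4 + x2 * mix_prob p 8 + x3 * mix_prob p 12 \<le> 2 * (p * (1 - p)) + \<zeta> \<or> x1 + x2 + x3 \<le> 0.487) \<Longrightarrow> False"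
    and K: "4 \<le> K" "1 - mix_prob p K \<le> 0.002"
    and eps: "\<epsilon> = \<zeta> / (8 * real K)" and delta: "\<delta> = \<epsilon> * \<zeta> / 2"
    and n: "K \<le> n" "1 \<le> \<epsilon> * real n" "2 * real K \<le> \<zeta> / 4 * real n" "1 \<le> real n / 1000"
    and large: "\<And>A. A \<subseteq> {1..n} \<Longrightarrow> card A = K \<Longrightarrow> real (card {x \<in> {1..n} - A. \<not> mixed X A {x}}) \<le> (1 - mix_prob p K + 1/1000) * real n"
    and unif: "uniform_mix p \<delta> n X"
    and d: "real d \<le> (2 * (p * (1 - p)) + \<zeta> / 2) * real n"
    and red: "reducible X d (singles {1..n})"
  shows False
proof -
  let ?V = "{1..n}"
  define s where "s = p * (1 - p)"
  have "s < 0.4013 * (1 - 0.4013)" unfolding s_def using p by (intro prod_strict_mono) auto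
  then have s1: "s \<le> 0.24026" by simp
  have n0: "0 < real n" using n(4) by simp
  have K0: "0 < real K" using K by simp
  have e0: "0 < \<epsilon>" using z K0 by (simp add: eps)
  have Ke: "2 * real K * \<epsilon> = \<zeta> / 4" using K0 by (simp add: eps)
  obtain P k where P: "P 0 = singles ?V" "\<forall>i<k. merge_step (P i) (P (Suc i))" "card (P k) = 1"
     "\<forall>i\<le>k. red_bounded X d (P i)" using reducible_obtain_chain[OF red] by auto
  have part: "partition_on ?V (P i)" if "i \<le> k" for i
    using chain_partition[of ?V P k i] P(1,2) that partition_on_singles[of ?V] by simp
  have fin: "finite (P i)" if "i \<le> k" for i using finite_partition[OF _ part[OF that]] by simp
  define Big where "Big i \<longleftrightarrow> i \<le> k \<and> (\<exists>A\<in>P i. K \<le> card A)" for i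
  have Bk: "Big k"
  proof -
    obtain A where A: "P k = {A}" using P(3) by (auto simp: card_1_singleton_iff)
    then have "A = ?V" using part[of k] by (auto simp: partition_on_def)
    then show ?thesis using A n by (auto simp: Big_def)
  qed
  define tb where "tb = (LEAST i. Big i)"
  have Btb: "Big tb" unfolding tb_def by (rule LeastI) (rule Bk)
  then have tbk: "tb \<le> k" by (simp add: Big_def)
  have before: "\<not> Big i" if "i < tb" for i using not_less_Least[of i Big] that by (simp add: tb_def)
  have size2K: "card A \<le> 2 * K" if "i \<le> tb" "A \<in> P i" for i A
  proof (cases "i < tb")
    case True then show ?thesis using before[of i] that tbk by (auto simp: Big_def)
  next
    case False
    show ?thesis
    proof (cases i)
      case 0 then show ?thesis using that P(1) K by (auto simp: singles_def)
    next
      case (Suc l)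
      then have l: "l < tb" "l < k" using that tbk by auto
      then obtain C D where CD: "C \<in> P l" "D \<in> P l" "P i = insert (C \<union> D) (P l - {C, D})"
      proof -
        have "merge_step (P l) (P i)" using P(2) l Suc by simp
        then show thesis unfolding merge_step_def using that by blast
      qed
      have sm: "card E \<le> K" if "E \<in> P l" for E using before[OF l(1)] that l by (auto simp: Big_def not_le intro: less_imp_le)
      show ?thesis using that CD sm[of C] sm[of D] sm[of A] card_Un_le[of C D] by auto
    qed
  qed
  have cardtb: "real (card (P tb)) \<le> 0.487 * real n"
  proof -
    obtain A where A: "A \<in> P tb" "K \<le> card A" using Btb by (auto simp: Big_def)
    obtain A' where A': "A' \<subseteq> A" "card A' = K" using obtain_subset_with_card_n[OF A(2)] by metis
    have "A' \<subseteq> ?V" using A' part_sizes(2)[OF _ part[OF tbk] A(1)] by auto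
    then have "real (card {x \<in> ?V - A'. \<not> mixed X A' {x}}) \<le> (1 - mix_prob p K + 1/1000) * real n" using large A' by auto
    also have "\<dots> \<le> 0.003 * real n" using K n0 by (intro mult_right_mono) auto
    finally have 1: "real (card {x \<in> ?V - A'. \<not> mixed X A' {x}}) \<le> 0.003 * real n" .
    have "card (P tb) \<le> d + 1 + card {x \<in> ?V - A'. \<not> mixed X A' {x}}"
      by (rule card_le_of_large_part[OF _ part[OF tbk] _ A(1) A'(1)]) (use P(4) tbk in auto)
    then have "real (card (P tb)) \<le> real d + 1 + real (card {x \<in> ?V - A'. \<not> mixed X A' {x}})" by linarith
    moreover have "real d \<le> 0.4811 * real n"
    proof -
      have "(2 * s + \<zeta> / 2) * real n \<le> 0.4811 * real n" using s1 z n0 by (intro mult_right_mono) auto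
      then show ?thesis using d unfolding s_def[symmetric] by (rule order_trans[rotated])
    qed
    ultimately show ?thesis using 1 n(4) by simp
  qed
  have step_big: "num_large j (P (Suc i)) \<le> Suc (num_large j (P i))" if "i < k" for i j
    using num_large_step[OF fin] P(2) that by auto
  have zero_big: "num_large j (P 0) = 0" if "1 < j" for j using that unfolding P(1) num_large_def singles_def by auto
  have first: "\<exists>t\<le>i. real (num_large j (P t)) \<ge> \<epsilon> * real n \<and> real (num_large j (P t)) \<le> \<epsilon> * real n + 1 \<and> (\<forall>l<t. real (num_large j (P l)) < \<epsilon> * real n)"
    if i: "i \<le> k" "real (num_large j (P i)) \<ge> \<epsilon> * real n" "1 < j" for i j
  proof -
    define t where "t = (LEAST t. real (num_large j (P t)) \<ge> \<epsilon> * real n)"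
    have 1: "real (num_large j (P t)) \<ge> \<epsilon> * real n" unfolding t_def by (rule LeastI) (rule i(2))
    have 2: "t \<le> i" unfolding t_def by (rule Least_le) (rule i(2))
    have 3: "real (num_large j (P l)) < \<epsilon> * real n" if "l < t" for l using not_less_Least[OF that[unfolded t_def]] by simp
    have "t \<noteq> 0"
    proof
      assume "t = 0"
      then have "real (num_large j (P t)) = 0" using zero_big[OF i(3)] by simp
      then show False using 1 n(2) by linarith
    qed
    then obtain l where l: "t = Suc l" by (cases t) auto
    then have "real (num_large j (P t)) \<le> real (num_large j (P l)) + 1" using step_big[of l j] 2 i(1) by simp
    moreover have "real (num_large j (P l)) < \<epsilon> * real n" by (rule 3) (simp add: l)
    ultimately have "real (num_large j (P t)) \<le> \<epsilon> * real n + 1" by linarith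
    then show ?thesis using 1 2 3 by (intro exI[of _ t]) auto
  qed
  have mass3: "real (num_size 1 (P i)) + 2 * real (num_size 2 (P i)) \<ge> (1 - \<zeta>) * real n" "real (num_size 1 (P i)) + 2 * real (num_size 2 (P i)) \<le> real n"
    if i: "i \<le> tb" "real (num_large 3 (P i)) \<le> \<epsilon> * real n + 1" for i
  proof -
    note sb = size_balance[OF _ part[of i], of "2 * K"]
    have b: "n \<le> num_size 1 (P i) + 2 * num_size 2 (P i) + 2 * K * num_large 3 (P i)" using sb(1) size2K[OF i(1)] i tbk by simp
    have "real n \<le> real (num_size 1 (P i) + 2 * num_size 2 (P i) + 2 * K * num_large 3 (P i))" using b by (simp only: of_nat_le_iff)
    then have "real n \<le> real (num_size 1 (P i)) + 2 * real (num_size 2 (P i)) + 2 * real K * real (num_large 3 (P i))" by simp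
    moreover have "2 * real K * real (num_large 3 (P i)) \<le> 2 * real K * (\<epsilon> * real n + 1)" using i(2) K0 by (intro mult_left_mono) auto
    moreover have "2 * real K * (\<epsilon> * real n + 1) = \<zeta> / 4 * real n + 2 * real K" using Ke by (simp add: algebra_simps)
    moreover have "0 < \<zeta> * real n" using z n0 by simp
    moreover have "(1 - \<zeta>) * real n = real n - \<zeta> * real n" by (simp add: algebra_simps)
    ultimately show "real (num_size 1 (P i)) + 2 * real (num_size 2 (P i)) \<ge> (1 - \<zeta>) * real n" using n(3) by linarith
    have "num_size 1 (P i) + 2 * num_size 2 (P i) \<le> n" using sb(3) size2K[OF i(1)] i tbk by simp
    then have "real (num_size 1 (P i) + 2 * num_size 2 (P i)) \<le> real n" by (simp only: of_nat_le_iff)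
    then show "real (num_size 1 (P i)) + 2 * real (num_size 2 (P i)) \<le> real n" by simp
  qed
  have mass4: "real (num_size 1 (P i)) + 2 * real (num_size 2 (P i)) + 3 * real (num_size 3 (P i)) \<ge> (1 - \<zeta>) * real n"
    if i: "i \<le> tb" "real (num_large 4 (P i)) \<le> \<epsilon> * real n + 1" for i
  proof -
    note sb = size_balance[OF _ part[of i], of "2 * K"]
    have b: "n \<le> num_size 1 (P i) + 2 * num_size 2 (P i) + 3 * num_size 3 (P i) + 2 * K * num_large 4 (P i)" using sb(2) size2K[OF i(1)] i tbk by simp
    have "real n \<le> real (num_size 1 (P i) + 2 * num_size 2 (P i) + 3 * num_size 3 (P i) + 2 * K * num_large 4 (P i))" using b by (simp only: of_nat_le_iff)
    then have "real n \<le> real (num_size 1 (P i)) + 2 * real (num_size 2 (P i)) + 3 * real (num_size 3 (P i)) + 2 * real K * real (num_large 4 (P i))" by simp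
    moreover have "2 * real K * real (num_large 4 (P i)) \<le> 2 * real K * (\<epsilon> * real n + 1)" using i(2) K0 by (intro mult_left_mono) auto
    moreover have "2 * real K * (\<epsilon> * real n + 1) = \<zeta> / 4 * real n + 2 * real K" using Ke by (simp add: algebra_simps)
    moreover have "0 < \<zeta> * real n" using z n0 by simp
    moreover have "(1 - \<zeta>) * real n = real n - \<zeta> * real n" by (simp add: algebra_simps)
    ultimately show ?thesis using n(3) by linarith
  qed
  have avg: "(\<Sum>B\<in>{B \<in> P i. card B < j}. mix_prob p (j * card B)) \<le> (2 * s + \<zeta>) * real n"
    if i: "i \<le> k" "real (num_large j (P i)) \<ge> \<epsilon> * real n" "0 < j" for i j
  proof -
    let ?b = "real (num_large j (P i))"
    let ?S = "\<Sum>B\<in>{B \<in> P i. card B < j}. mix_prob p (j * card B)"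
    have b0: "0 < ?b" using i(2) n(2) by linarith
    have "?b * ?S - \<delta> * (real n)\<^sup>2 \<le> ?b * real d"
      by (rule average_red_degree[OF part[OF i(1)] _ unif i(3)]) (use P(4) i in auto)
    moreover have "\<delta> * (real n)\<^sup>2 \<le> ?b * (\<zeta> / 2 * real n)"
    proof -
      have "(\<epsilon> * real n) * (\<zeta> / 2 * real n) \<le> ?b * (\<zeta> / 2 * real n)" using i(2) z n0 by (intro mult_right_mono) auto
      then show ?thesis by (simp add: delta power2_eq_square algebra_simps)
    qed
    moreover have "?b * real d \<le> ?b * ((2 * s + \<zeta> / 2) * real n)" using d b0 by (simp add: s_def)
    ultimately have "?b * ?S \<le> ?b * ((2 * s + \<zeta>) * real n)" by (simp add: algebra_simps)
    then show ?thesis using b0 by simp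
  qed
  have big3tb: "real (num_large 3 (P tb)) \<ge> \<epsilon> * real n"
  proof (rule ccontr)
    assume "\<not> real (num_large 3 (P tb)) \<ge> \<epsilon> * real n"
    then have b: "real (num_large 3 (P tb)) \<le> \<epsilon> * real n + 1" by simp
    note m = mass3(1)[OF order_refl b]
    have "card (P tb) = num_size 1 (P tb) + num_size 2 (P tb) + num_large 3 (P tb)"
      by (rule size_balance(4)[OF _ part[OF tbk]]) (use size2K in auto)
    then have "real (num_size 1 (P tb)) + real (num_size 2 (P tb)) \<le> 0.487 * real n" using cardtb by simp
    then have "(1 - \<zeta>) * real n \<le> 0.974 * real n" using m by linarith
    then have "1 - \<zeta> \<le> 0.974" using n0 by simp
    then show False using z by simp
  qed
  obtain t3 where t3: "t3 \<le> tb" "real (num_large 3 (P t3)) \<ge> \<epsilon> * real n" "real (num_large 3 (P t3)) \<le> \<epsilon> * real n + 1"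
     "\<And>l. l < t3 \<Longrightarrow> real (num_large 3 (P l)) < \<epsilon> * real n"
    using first[OF tbk big3tb] by auto
  have t3k: "t3 \<le> k" using t3 tbk by simp
  define a1 where "a1 = real (num_size 1 (P t3)) / real n"
  define a2 where "a2 = real (num_size 2 (P t3)) / real n"
  have A1: "0 \<le> a1" "0 \<le> a2" by (auto simp: a1_def a2_def)
  have A2: "1 - \<zeta> \<le> a1 + 2 * a2" "a1 + 2 * a2 \<le> 1"
    using mass3[OF t3(1,3)] n0 by (auto simp: a1_def a2_def field_simps)
  have A3: "a1 * mix_prob p 3 + a2 * mix_prob p 6 \<le> 2 * (p * (1 - p)) + \<zeta>"
  proof -
    have "(\<Sum>B\<in>{B \<in> P t3. card B < 3}. mix_prob p (3 * card B)) = real (num_size 1 (P t3)) * mix_prob p (3 * 1) + real (num_size 2 (P t3)) * mix_prob p (3 * 2)"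
      by (rule sum_by_size(1)[OF fin[OF t3k]]) (use part_sizes(1)[OF _ part[OF t3k]] in auto)
    then have "real (num_size 1 (P t3)) * mix_prob p 3 + real (num_size 2 (P t3)) * mix_prob p 6 \<le> (2 * s + \<zeta>) * real n"
      using avg[OF t3k t3(2)] by simp
    then show ?thesis using n0 by (simp add: a1_def a2_def s_def field_simps)
  qed
  have finish: False if i: "t3 \<le> i" "i \<le> tb" "real (num_large 4 (P i)) \<le> \<epsilon> * real n + 1"
    and alt: "real (num_large 4 (P i)) \<ge> \<epsilon> * real n \<or> i = tb" for i
  proof -
    have ik: "i \<le> k" using i tbk by simp
    define x1 where "x1 = real (num_size 1 (P i)) / real n"
    define x2 where "x2 = real (num_size 2 (P i)) / real n"
    define x3 where "x3 = real (num_size 3 (P i)) / real n"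
    have X1: "0 \<le> x1" "0 \<le> x2" "0 \<le> x3" by (auto simp: x1_def x2_def x3_def)
    have X2: "1 - \<zeta> \<le> x1 + 2 * x2 + 3 * x3"
      using mass4[OF i(2,3)] n0 by (auto simp: x1_def x2_def x3_def field_simps)
    have X3: "x3 \<le> a1 + \<zeta>"
    proof -
      have "num_size 3 (P i) \<le> num_size 1 (P t3) + num_large 3 (P t3)"
      proof (rule triples_bound[OF _ part[OF t3k] part[OF ik]])
        fix A assume A: "A \<in> P t3"
        show "\<exists>B\<in>P i. A \<subseteq> B" by (rule chain_refines[where i=t3]) (use P(2) ik i A in auto)
      qed simp
      then have "real (num_size 3 (P i)) \<le> real (num_size 1 (P t3)) + (\<epsilon> * real n + 1)" using t3(3) by linarith
      moreover have "\<epsilon> * real n + 1 \<le> \<zeta> * real n"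
      proof -
        have "\<epsilon> \<le> \<zeta> / 4"
        proof -
          have "1 * \<epsilon> \<le> 2 * real K * \<epsilon>" using K e0 by (intro mult_right_mono) auto
          then show ?thesis using Ke by simp
        qed
        then have "\<epsilon> * real n \<le> \<zeta> / 4 * real n" using n0 by (intro mult_right_mono) auto
        moreover have "1 \<le> 2 * real K" using K by simp
        moreover have "0 < \<zeta> * real n" using z n0 by simp
        ultimately show ?thesis using n(3) by simp
      qed
      ultimately have "real (num_size 3 (P i)) \<le> real (num_size 1 (P t3)) + \<zeta> * real n" by simp
      then show ?thesis using n0 by (simp add: x3_def a1_def field_simps)
    qed
    have X4: "x1 * mix_prob p 4 + x2 * mix_prob p 8 + x3 * mix_prob p 12 \<le> 2 * (p * (1 - p)) + \<zeta> \<or> x1 + x2 + x3 \<le> 0.487"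
      using alt
    proof
      assume b4: "real (num_large 4 (P i)) \<ge> \<epsilon> * real n"
      have "(\<Sum>B\<in>{B \<in> P i. card B < 4}. mix_prob p (4 * card B)) = real (num_size 1 (P i)) * mix_prob p (4 * 1) + real (num_size 2 (P i)) * mix_prob p (4 * 2) + real (num_size 3 (P i)) * mix_prob p (4 * 3)"
        by (rule sum_by_size(2)[OF fin[OF ik]]) (use part_sizes(1)[OF _ part[OF ik]] in auto)
      then have "real (num_size 1 (P i)) * mix_prob p 4 + real (num_size 2 (P i)) * mix_prob p 8 + real (num_size 3 (P i)) * mix_prob p 12 \<le> (2 * s + \<zeta>) * real n"
        using avg[OF ik b4] by simp
      then have "x1 * mix_prob p 4 + x2 * mix_prob p 8 + x3 * mix_prob p 12 \<le> 2 * (p * (1 - p)) + \<zeta>"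
        using n0 by (simp add: x1_def x2_def x3_def s_def field_simps)
      then show ?thesis ..
    next
      assume itb: "i = tb"
      have "card (P tb) = num_size 1 (P tb) + num_size 2 (P tb) + num_size 3 (P tb) + num_large 4 (P tb)"
        by (rule size_balance(5)[OF _ part[OF tbk]]) (use size2K in auto)
      then have "real (num_size 1 (P tb)) + real (num_size 2 (P tb)) + real (num_size 3 (P tb)) \<le> 0.487 * real n" using cardtb by simp
      then have "x1 + x2 + x3 \<le> 0.487" using n0 by (simp add: x1_def x2_def x3_def itb field_simps)
      then show ?thesis ..
    qed
    show False by (rule core[OF A1 X1 A2 A3 X3 X2 X4])
  qed
  show False
  proof (cases "real (num_large 4 (P tb)) \<ge> \<epsilon> * real n")
    case False
    then show False using finish[OF t3(1) order_refl] by simp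
  next
    case True
    then obtain t4 where t4: "t4 \<le> tb" "real (num_large 4 (P t4)) \<ge> \<epsilon> * real n" "real (num_large 4 (P t4)) \<le> \<epsilon> * real n + 1"
      using first[OF tbk True] by auto
    have "t3 \<le> t4"
    proof (rule ccontr)
      assume "\<not> t3 \<le> t4"
      then have "real (num_large 3 (P t4)) < \<epsilon> * real n" using t3(4) by simp
      moreover have "num_large 4 (P t4) \<le> num_large 3 (P t4)" unfolding num_large_def
        by (rule card_mono) (use fin[of t4] t4 tbk in auto)
      ultimately show False using t4(2) by simp
    qed
    then show False using finish[OF _ t4(1,3)] t4(2) by simp
  qed
qed

lemma tww_lower_subcritical:
  fixes p :: real
  assumes p: "0 < p" "p < 0.4013" "0 < critical_poly (p * (1 - p))"
  shows "\<exists>c>0. edge_whp p (\<lambda>n X. real (tww (trigraph_of_graph ({1..n}, X))) > (2 * p * (1 - p) + c) * real n)"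
proof -
  obtain \<zeta> where z: "0 < \<zeta>" "\<zeta> \<le> 1/1000" and core: "\<And>a1 a2 x1 x2 x3 :: real.
     0 \<le> a1 \<Longrightarrow> 0 \<le> a2 \<Longrightarrow> 0 \<le> x1 \<Longrightarrow> 0 \<le> x2 \<Longrightarrow> 0 \<le> x3 \<Longrightarrow>
     1 - \<zeta> \<le> a1 + 2 * a2 \<Longrightarrow> a1 + 2 * a2 \<le> 1 \<Longrightarrow> a1 * mix_prob p 3 + a2 * mix_prob p 6 \<le> 2 * (p * (1 - p)) + \<zeta> \<Longrightarrow>
     x3 \<le> a1 + \<zeta> \<Longrightarrow> 1 - \<zeta> \<le> x1 + 2 * x2 + 3 * x3 \<Longrightarrow>
     (x1 * mix_prob p 4 + x2 * mix_prob p 8 + x3 * mix_prob p 12 \<le> 2 * (p * (1 - p)) + \<zeta> \<or> x1 + x2 + x3 \<le> 0.487) \<Longrightarrow> False"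
    using subcritical_core[OF p] by blast
  have "(\<lambda>K. p ^ K + (1 - p) ^ K) \<longlonglongrightarrow> 0 + 0"
    by (intro tendsto_add LIMSEQ_power_zero) (use p in auto)
  then have "eventually (\<lambda>K. p ^ K + (1 - p) ^ K < 0.002) sequentially" by (rule order_tendstoD) simp
  then obtain K where K: "4 \<le> K" "p ^ K + (1 - p) ^ K < 0.002"
    using eventually_conj[OF _ eventually_ge_at_top[of 4]] by (metis (mono_tags, lifting) eventually_sequentially le_refl)
  have K': "1 - mix_prob p K \<le> 0.002" using K by (simp add: mix_prob_def)
  define \<epsilon> where "\<epsilon> = \<zeta> / (8 * real K)"
  define \<delta> where "\<delta> = \<epsilon> * \<zeta> / 2"
  have e0: "0 < \<epsilon>" using z K by (simp add: \<epsilon>_def)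
  have d0: "0 < \<delta>" using z e0 by (simp add: \<delta>_def)
  have p01: "0 \<le> p" "p \<le> 1" using p by auto
  have "edge_whp p (\<lambda>n X. real (tww (trigraph_of_graph ({1..n}, X))) > (2 * p * (1 - p) + \<zeta> / 2) * real n)"
  proof (rule edge_whp_conj_mono[OF edge_whp_uniform_mix[OF p01 d0] edge_whp_large_sets[OF p01, of "1/1000" K]])
    show "0 < (1/1000::real)" "1 \<le> K" using K by auto
    have c: "eventually (\<lambda>n. C \<le> e * real n) sequentially" if "0 < e" for C e :: real
      using that eventually_ge_at_top[of "nat \<lceil>C / e\<rceil>"]
      by (auto elim!: eventually_mono simp: field_simps le_nat_iff nat_le_iff ceiling_le_iff)
    have ev: "eventually (\<lambda>n. K \<le> n) sequentially" "eventually (\<lambda>n. 1 \<le> \<epsilon> * real n) sequentially"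
      "eventually (\<lambda>n. 2 * real K \<le> \<zeta> / 4 * real n) sequentially" "eventually (\<lambda>n. 1 \<le> 1 / 1000 * real n) sequentially"
      using e0 z by (auto intro!: c eventually_ge_at_top)
    show "\<forall>\<^sub>F n in sequentially. \<forall>X\<subseteq>all_edges {1..n}. uniform_mix p \<delta> n X \<longrightarrow>
       (\<forall>A\<subseteq>{1..n}. card A = K \<longrightarrow> real (card {x \<in> {1..n} - A. \<not> mixed X A {x}}) \<le> (1 - mix_prob p K + 1 / 1000) * real n) \<longrightarrow>
       (2 * p * (1 - p) + \<zeta> / 2) * real n < real (tww (trigraph_of_graph ({1..n}, X)))"
      using ev
    proof eventually_elim
      case (elim n)
      show ?case
      proof (intro allI impI, rule ccontr)
        fix X assume X: "X \<subseteq> all_edges {1..n}" "uniform_mix p \<delta> n X"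
          "\<forall>A\<subseteq>{1..n}. card A = K \<longrightarrow> real (card {x \<in> {1..n} - A. \<not> mixed X A {x}}) \<le> (1 - mix_prob p K + 1 / 1000) * real n"
          "\<not> (2 * p * (1 - p) + \<zeta> / 2) * real n < real (tww (trigraph_of_graph ({1..n}, X)))"
        have red: "reducible X (tww (trigraph_of_graph ({1..n}, X))) (singles {1..n})"
          by (rule reducible_tww) (use X elim in auto)
        show False
          by (rule subcritical_deterministic[OF p(1,2) z core K(1) K' \<epsilon>_def \<delta>_def elim(1-3) _ _ X(2) _ red])
             (use X elim in \<open>auto simp: mult.assoc\<close>)
      qed
    qed
  qed
  then show ?thesis using z by (intro exI[of _ "\<zeta> / 2"]) auto
qed

section \<open>Chains of partitions with prescribed part sizes\<close>

lemma merge_step_Un: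
  assumes "merge_step P P'" "partition_on A P" "partition_on B Q" "A \<inter> B = {}"
  shows "merge_step (P \<union> Q) (P' \<union> Q)"
proof -
  obtain C D where CD: "C \<in> P" "D \<in> P" "C \<noteq> D" "P' = insert (C \<union> D) (P - {C, D})"
    using assms(1) unfolding merge_step_def by auto
  have "E \<notin> Q" if "E \<in> P" for E
  proof
    assume "E \<in> Q"
    then have "E \<subseteq> A" "E \<subseteq> B" "E \<noteq> {}" using that assms(2,3) by (auto simp: partition_on_def)
    then show False using assms(4) by auto
  qed
  then have "C \<notin> Q" "D \<notin> Q" using CD by auto
  then have "P' \<union> Q = insert (C \<union> D) ((P \<union> Q) - {C, D})" using CD(4) by auto
  then show ?thesis unfolding merge_step_def using CD(1-3) by blast
qed

lemma partition_on_Un: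
  "partition_on A P \<Longrightarrow> partition_on B Q \<Longrightarrow> A \<inter> B = {} \<Longrightarrow> partition_on (A \<union> B) (P \<union> Q)"
  unfolding partition_on_def disjoint_def by auto blast+

lemma singles_Un: "singles (A \<union> B) = singles A \<union> singles B"
  by (auto simp: singles_def)

lemma iterate_steps:
  assumes "Inv 0 P0" "\<And>t P. t < T \<Longrightarrow> Inv t P \<Longrightarrow> \<exists>P'. merge_step P P' \<and> Inv (Suc t) P'"
  shows "\<exists>Q. Q 0 = P0 \<and> (\<forall>t<T. merge_step (Q t) (Q (Suc t))) \<and> (\<forall>t\<le>T. Inv t (Q t))"
proof -
  have "\<exists>Q. \<forall>t. ((t \<le> T \<longrightarrow> Inv t (Q t)) \<and> (t = 0 \<longrightarrow> Q t = P0)) \<and> (t < T \<longrightarrow> merge_step (Q t) (Q (Suc t)))"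
  proof (rule dependent_nat_choice)
    show "\<exists>P. (0 \<le> T \<longrightarrow> Inv 0 P) \<and> (0 = (0::nat) \<longrightarrow> P = P0)" using assms(1) by blast
    fix P t assume *: "(t \<le> T \<longrightarrow> Inv t P) \<and> (t = 0 \<longrightarrow> P = P0)"
    show "\<exists>P'. ((Suc t \<le> T \<longrightarrow> Inv (Suc t) P') \<and> (Suc t = 0 \<longrightarrow> P' = P0)) \<and> (t < T \<longrightarrow> merge_step P P')"
    proof (cases "t < T")
      case True
      then obtain P' where "merge_step P P'" "Inv (Suc t) P'" using assms(2)[of t P] * by auto
      then show ?thesis by auto
    next
      case False
      then show ?thesis by auto
    qed
  qed
  then obtain Q where "\<And>t. ((t \<le> T \<longrightarrow> Inv t (Q t)) \<and> (t = 0 \<longrightarrow> Q t = P0)) \<and> (t < T \<longrightarrow> merge_step (Q t) (Q (Suc t)))" by auto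
  then show ?thesis by (intro exI[of _ Q]) simp
qed

definition weight :: "(nat \<Rightarrow> real) \<Rightarrow> 'a set set \<Rightarrow> real" where
  "weight F P = (\<Sum>B\<in>P. F (card B))"

text \<open>Testing against all weight functions \<open>F\<close> encodes the multiset of part sizes and turns a merge into a
linear update; it yields both the counts of parts and the expected red degrees.\<close>

definition has_sizes :: "'a set \<Rightarrow> 'a set set \<Rightarrow> nat \<Rightarrow> nat \<Rightarrow> nat \<Rightarrow> nat \<Rightarrow> bool" where
  "has_sizes V P x1 x2 x3 x4 \<longleftrightarrow> partition_on V P \<and>
     (\<forall>F. weight F P = real x1 * F 1 + real x2 * F 2 + real x3 * F 3 + real x4 * F 4)"

lemma weight_merge:
  assumes V: "finite V" "partition_on V P" and AB: "A \<in> P" "B \<in> P" "A \<noteq> B"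
  shows "weight F (insert (A \<union> B) (P - {A, B})) = weight F P - F (card A) - F (card B) + F (card A + card B)"
proof -
  have fP: "finite P" using finite_partition[OF V] .
  have dj: "A \<inter> B = {}" using disj_famD[OF disj_fam_partition[OF V(2)]] AB by auto
  have ne: "A \<noteq> {}" using disj_fam_ne[OF disj_fam_partition[OF V(2)] AB(1)] .
  have "A \<union> B \<notin> P - {A, B}"
  proof
    assume "A \<union> B \<in> P - {A, B}"
    then have "(A \<union> B) \<inter> A = {}" using disj_famD[OF disj_fam_partition[OF V(2)], of "A \<union> B" A] AB by auto
    then show False using ne by auto
  qed
  then have "weight F (insert (A \<union> B) (P - {A, B})) = F (card (A \<union> B)) + weight F (P - {A, B})"
    using fP by (simp add: weight_def)
  also have "card (A \<union> B) = card A + card B"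
    by (rule card_Un_disjoint) (use part_sizes(3)[OF V] AB dj in auto)
  also have "weight F P = F (card A) + (F (card B) + weight F (P - {A, B}))"
  proof -
    have "P - {A} - {B} = P - {A, B}" by auto
    then show ?thesis unfolding weight_def using sum.remove[OF fP AB(1), of "\<lambda>B. F (card B)"]
      sum.remove[of "P - {A}" B "\<lambda>B. F (card B)"] fP AB by simp
  qed
  then have "weight F (P - {A, B}) = weight F P - F (card A) - F (card B)" by simp
  finally show ?thesis by simp
qed

lemma has_sizes_cnt:
  assumes V: "finite V" "has_sizes V P x1 x2 x3 x4"
  shows "num_size 1 P = x1" "num_size 2 P = x2" "num_size 3 P = x3" "card P = x1 + x2 + x3 + x4"
proof -
  have fP: "finite P" using finite_partition[OF V(1)] V(2) by (auto simp: has_sizes_def)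
  have sz: "weight F P = real x1 * F 1 + real x2 * F 2 + real x3 * F 3 + real x4 * F 4" for F
    using V(2) by (simp add: has_sizes_def)
  have c: "weight (\<lambda>k. of_bool (k = j)) P = real (num_size j P)" for j
    using fP by (simp add: weight_def num_size_def sum_of_bool_eq Int_def)
  show "num_size 1 P = x1" using c[of 1] sz[of "\<lambda>k. of_bool (k = 1)"] by simp
  show "num_size 2 P = x2" using c[of 2] sz[of "\<lambda>k. of_bool (k = 2)"] by simp
  show "num_size 3 P = x3" using c[of 3] sz[of "\<lambda>k. of_bool (k = 3)"] by simp
  have "weight (\<lambda>k. 1) P = real (card P)" by (simp add: weight_def)
  then have "real (card P) = real (x1 + x2 + x3 + x4)" using sz[of "\<lambda>k. 1"] by simp
  then show "card P = x1 + x2 + x3 + x4" by (simp only: of_nat_eq_iff)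
qed

lemma has_sizes_max:
  assumes V: "finite V" "has_sizes V P x1 x2 x3 x4" and B: "B \<in> P"
    and k: "k < 1 \<longrightarrow> x1 = 0" "k < 2 \<longrightarrow> x2 = 0" "k < 3 \<longrightarrow> x3 = 0" "k < 4 \<longrightarrow> x4 = 0"
  shows "card B \<le> k"
proof (rule ccontr)
  assume n: "\<not> card B \<le> k"
  have fP: "finite P" using finite_partition[OF V(1)] V(2) by (auto simp: has_sizes_def)
  define F where "F = (\<lambda>j::nat. of_bool (k < j) :: real)"
  have "weight F P = real x1 * F 1 + real x2 * F 2 + real x3 * F 3 + real x4 * F 4"
    using V(2) by (simp add: has_sizes_def)
  also have "\<dots> = 0" using k by (auto simp: F_def)
  finally have "weight F P = 0" .
  moreover have "F (card B) \<le> weight F P" unfolding weight_def using fP B by (intro member_le_sum) (auto simp: F_def)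
  ultimately show False using n by (simp add: F_def)
qed

lemma has_sizes_singles: "finite V \<Longrightarrow> has_sizes V (singles V) (card V) 0 0 0"
  unfolding has_sizes_def using partition_on_singles[of V]
  by (auto simp: weight_def singles_def sum.reindex)

lemma has_sizes_obtain:
  assumes V: "finite V" "has_sizes V P x1 x2 x3 x4"
  shows "2 \<le> x1 \<Longrightarrow> \<exists>P'. merge_step P P' \<and> has_sizes V P' (x1 - 2) (x2 + 1) x3 x4"
    "1 \<le> x1 \<Longrightarrow> 1 \<le> x2 \<Longrightarrow> \<exists>P'. merge_step P P' \<and> has_sizes V P' (x1 - 1) (x2 - 1) (x3 + 1) x4"
    "2 \<le> x2 \<Longrightarrow> \<exists>P'. merge_step P P' \<and> has_sizes V P' x1 (x2 - 2) x3 (x4 + 1)"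
proof -
  have part: "partition_on V P" using V(2) by (simp add: has_sizes_def)
  have fP: "finite P" using finite_partition[OF V(1) part] .
  note cs = has_sizes_cnt[OF V]
  have two: "\<exists>A B. A \<in> P \<and> B \<in> P \<and> A \<noteq> B \<and> card A = j \<and> card B = j" if "2 \<le> num_size j P" for j
  proof -
    have "\<not> card {A \<in> P. card A = j} \<le> Suc 0" using that by (simp add: num_size_def)
    then show ?thesis using card_le_Suc0_iff_eq[of "{A \<in> P. card A = j}"] fP by auto
  qed
  have one: "\<exists>A. A \<in> P \<and> card A = j" if "1 \<le> num_size j P" for j
  proof -
    have "{A \<in> P. card A = j} \<noteq> {}" using that unfolding num_size_def by (metis card.empty not_one_le_zero)
    then show ?thesis by auto
  qed
  have merge: "\<exists>P'. merge_step P P' \<and> has_sizes V P' y1 y2 y3 y4"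
    if AB: "A \<in> P" "B \<in> P" "A \<noteq> B"
      and eq: "\<And>F. real x1 * F 1 + real x2 * F 2 + real x3 * F 3 + real x4 * F 4 - F (card A) - F (card B) + F (card A + card B)
          = real y1 * F 1 + real y2 * F 2 + real y3 * F 3 + real y4 * F 4" for A B y1 y2 y3 y4
  proof -
    define P' where "P' = insert (A \<union> B) (P - {A, B})"
    have ms: "merge_step P P'" unfolding merge_step_def P'_def using AB by blast
    have "weight F P' = real y1 * F 1 + real y2 * F 2 + real y3 * F 3 + real y4 * F 4" for F
    proof -
      have "weight F P' = weight F P - F (card A) - F (card B) + F (card A + card B)"
        unfolding P'_def by (rule weight_merge[OF V(1) part AB])
      also have "weight F P = real x1 * F 1 + real x2 * F 2 + real x3 * F 3 + real x4 * F 4"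
        using V(2) by (simp add: has_sizes_def)
      finally show ?thesis using eq by simp
    qed
    then have "has_sizes V P' y1 y2 y3 y4" unfolding has_sizes_def using merge_step_partition[OF part ms] by blast
    then show ?thesis using ms by blast
  qed
  show "\<exists>P'. merge_step P P' \<and> has_sizes V P' (x1 - 2) (x2 + 1) x3 x4" if h: "2 \<le> x1"
  proof -
    obtain A B where AB: "A \<in> P" "B \<in> P" "A \<noteq> B" "card A = 1" "card B = 1" using two[of 1] h cs by auto
    show ?thesis by (rule merge[OF AB(1-3)]) (use AB h in \<open>simp add: of_nat_diff numeral_2_eq_2 algebra_simps\<close>)
  qed
  show "\<exists>P'. merge_step P P' \<and> has_sizes V P' (x1 - 1) (x2 - 1) (x3 + 1) x4" if h: "1 \<le> x1" "1 \<le> x2"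
  proof -
    obtain A B where AB: "A \<in> P" "B \<in> P" "card A = 1" "card B = 2" using one[of 1] one[of 2] h cs by auto
    then have "A \<noteq> B" by auto
    show ?thesis by (rule merge[OF AB(1,2) \<open>A \<noteq> B\<close>]) (use AB h in \<open>simp add: of_nat_diff numeral_3_eq_3 algebra_simps\<close>)
  qed
  show "\<exists>P'. merge_step P P' \<and> has_sizes V P' x1 (x2 - 2) x3 (x4 + 1)" if h: "2 \<le> x2"
  proof -
    obtain A B where AB: "A \<in> P" "B \<in> P" "A \<noteq> B" "card A = 2" "card B = 2" using two[of 2] h cs by auto
    show ?thesis by (rule merge[OF AB(1-3)]) (use AB h in \<open>simp add: of_nat_diff algebra_simps\<close>)
  qed
qed

lemma pairing_chain:
  assumes V: "finite V" "card V = 2 * u"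
  shows "\<exists>Q. Q 0 = singles V \<and> (\<forall>t<u. merge_step (Q t) (Q (Suc t))) \<and> (\<forall>t\<le>u. has_sizes V (Q t) (2 * u - 2 * t) t 0 0)"
proof (rule iterate_steps)
  show "has_sizes V (singles V) (2 * u - 2 * 0) 0 0 0" using has_sizes_singles[OF V(1)] V(2) by simp
  fix t P assume "t < u" "has_sizes V P (2 * u - 2 * t) t 0 0"
  then show "\<exists>P'. merge_step P P' \<and> has_sizes V P' (2 * u - 2 * Suc t) (Suc t) 0 0"
    using has_sizes_obtain(1)[OF V(1), of P "2 * u - 2 * t" t 0 0] by simp
qed

text \<open>Pairs first, then the \<open>c\<close> left-over singletons join \<open>c\<close> of the pairs, then the remaining pairs are
merged to quadruples. The chain depends only on \<open>V\<close>, hence is fixed before the random graph is revealed.\<close>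

lemma quad_chain:
  assumes V: "finite V" "card V = 2 * a + c" "c \<le> a"
  defines "T \<equiv> a + c + (a - c) div 2"
  shows "\<exists>Q. Q 0 = singles V \<and> (\<forall>t<T. merge_step (Q t) (Q (Suc t))) \<and>
    (\<forall>t\<le>a. has_sizes V (Q t) (2 * a + c - 2 * t) t 0 0) \<and>
    (\<forall>t\<le>c. has_sizes V (Q (a + t)) (c - t) (a - t) t 0) \<and>
    (\<forall>t\<le>(a - c) div 2. has_sizes V (Q (a + c + t)) 0 (a - c - 2 * t) c t)"
proof -
  define x1 where "x1 t = (if t \<le> a then 2 * a + c - 2 * t else if t \<le> a + c then c - (t - a) else 0)" for t
  define x2 where "x2 t = (if t \<le> a then t else if t \<le> a + c then a - (t - a) else a - c - 2 * (t - (a + c)))" for t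
  define x3 where "x3 t = (if t \<le> a then 0 else if t \<le> a + c then t - a else c)" for t
  define x4 where "x4 t = (if t \<le> a + c then 0 else t - (a + c))" for t
  have "\<exists>Q. Q 0 = singles V \<and> (\<forall>t<T. merge_step (Q t) (Q (Suc t))) \<and> (\<forall>t\<le>T. has_sizes V (Q t) (x1 t) (x2 t) (x3 t) (x4 t))"
  proof (rule iterate_steps)
    show "has_sizes V (singles V) (x1 0) (x2 0) (x3 0) (x4 0)"
      using has_sizes_singles[OF V(1)] V(2) by (simp add: x1_def x2_def x3_def x4_def)
    fix t P assume t: "t < T" and h: "has_sizes V P (x1 t) (x2 t) (x3 t) (x4 t)"
    consider "t < a" | "a \<le> t" "t < a + c" | "a + c \<le> t" by linarith
    then show "\<exists>P'. merge_step P P' \<and> has_sizes V P' (x1 (Suc t)) (x2 (Suc t)) (x3 (Suc t)) (x4 (Suc t))"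
    proof cases
      case 1
      have "x1 (Suc t) = x1 t - 2" "x2 (Suc t) = x2 t + 1" "x3 (Suc t) = x3 t" "x4 (Suc t) = x4 t" "2 \<le> x1 t"
        using 1 by (auto simp: x1_def x2_def x3_def x4_def)
      then show ?thesis using has_sizes_obtain(1)[OF V(1) h] by simp
    next
      case 2
      have "x1 (Suc t) = x1 t - 1" "x2 (Suc t) = x2 t - 1" "x3 (Suc t) = x3 t + 1" "x4 (Suc t) = x4 t" "1 \<le> x1 t" "1 \<le> x2 t"
        using 2 V(3) by (auto simp: x1_def x2_def x3_def x4_def)
      then show ?thesis using has_sizes_obtain(2)[OF V(1) h] by simp
    next
      case 3
      have b: "2 * Suc (t - (a + c)) \<le> a - c" using t 3 by (simp add: T_def)
      have "x1 (Suc t) = x1 t" "x2 (Suc t) = x2 t - 2" "x3 (Suc t) = x3 t" "x4 (Suc t) = x4 t + 1" "2 \<le> x2 t"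
        using 3 V(3) b by (auto simp: x1_def x2_def x3_def x4_def split: if_splits)
      then show ?thesis using has_sizes_obtain(3)[OF V(1) h] by simp
    qed
  qed
  then obtain Q where Q: "Q 0 = singles V" "\<forall>t<T. merge_step (Q t) (Q (Suc t))"
    "\<forall>t\<le>T. has_sizes V (Q t) (x1 t) (x2 t) (x3 t) (x4 t)" by auto
  show ?thesis
  proof (intro exI[of _ Q] conjI Q(1,2) allI impI)
    fix t assume "t \<le> a"
    then show "has_sizes V (Q t) (2 * a + c - 2 * t) t 0 0"
      using Q(3)[rule_format, of t] by (simp add: x1_def x2_def x3_def x4_def T_def)
  next
    fix t assume "t \<le> c"
    then show "has_sizes V (Q (a + t)) (c - t) (a - t) t 0"
      using Q(3)[rule_format, of "a + t"] by (auto simp: x1_def x2_def x3_def x4_def T_def split: if_splits)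
  next
    fix t assume "t \<le> (a - c) div 2"
    then show "has_sizes V (Q (a + c + t)) 0 (a - c - 2 * t) c t"
      using Q(3)[rule_format, of "a + c + t"] V(3) by (auto simp: x1_def x2_def x3_def x4_def T_def split: if_splits)
  qed
qed

definition matching :: "'a set \<Rightarrow> nat \<Rightarrow> (nat \<Rightarrow> 'a set) \<Rightarrow> bool" where
  "matching U m e \<longleftrightarrow> (\<forall>i<m. e i \<subseteq> U \<and> card (e i) = 2) \<and> (\<forall>i<m. \<forall>j<m. i \<noteq> j \<longrightarrow> e i \<inter> e j = {})"

definition pair_part :: "(nat \<Rightarrow> 'a set) \<Rightarrow> nat \<Rightarrow> 'a set \<Rightarrow> 'a set set" where
  "pair_part e j U = e ` {..<j} \<union> singles (U - \<Union> (e ` {..<j}))"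

lemma pair_part_0 [simp]: "pair_part e 0 U = singles U"
  by (simp add: pair_part_def)

lemma matching_mono: "matching U m e \<Longrightarrow> j \<le> m \<Longrightarrow> matching U j e"
  unfolding matching_def by auto

lemma pair_part_partition:
  assumes "matching U j e" shows "partition_on U (pair_part e j U)"
proof -
  have 1: "partition_on (\<Union> (e ` {..<j})) (e ` {..<j})"
  proof -
    have "disj_fam (e ` {..<j})"
    proof (rule disj_famI)
      fix B assume "B \<in> e ` {..<j}"
      then have "card B = 2" using assms unfolding matching_def by auto
      then show "B \<noteq> {}" by auto
    next
      fix B C assume "B \<in> e ` {..<j}" "C \<in> e ` {..<j}" "B \<noteq> C"
      then show "B \<inter> C = {}" using assms unfolding matching_def by blast
    qed
    then show ?thesis by (simp add: disj_fam_def)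
  qed
  have "partition_on (\<Union> (e ` {..<j}) \<union> (U - \<Union> (e ` {..<j}))) (pair_part e j U)"
    unfolding pair_part_def by (rule partition_on_Un[OF 1 partition_on_singles]) auto
  moreover have "\<Union> (e ` {..<j}) \<union> (U - \<Union> (e ` {..<j})) = U"
    using assms unfolding matching_def by blast
  ultimately show ?thesis by simp
qed

lemma matching_inj: "matching U j e \<Longrightarrow> inj_on e {..<j}"
  unfolding matching_def inj_on_def
  by (metis Int_absorb card.empty lessThan_iff zero_neq_numeral)

lemma pair_part_step:
  assumes M: "matching U m e" and j: "j < m"
  shows "merge_step (pair_part e j U) (pair_part e (Suc j) U)"
proof -
  have ej: "e j \<subseteq> U" "card (e j) = 2" using M j by (auto simp: matching_def)
  obtain x y where xy: "e j = {x, y}" "x \<noteq> y" using ej(2) by (auto simp: card_2_iff)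
  have dj: "e j \<inter> e i = {}" if "i < j" for i using M j that unfolding matching_def by auto
  have xn: "x \<notin> \<Union> (e ` {..<j})" "y \<notin> \<Union> (e ` {..<j})" using dj xy by auto
  have c2: "card (e i) = 2" if "i < j" for i using M j that by (auto simp: matching_def)
  have ns: "{x} \<notin> e ` {..<j}" "{y} \<notin> e ` {..<j}" using c2 by (auto simp: image_iff) (metis card_1_singleton_iff numeral_One numeral_eq_iff semiring_norm(85) One_nat_def)+
  have "pair_part e (Suc j) U = insert ({x} \<union> {y}) (pair_part e j U - {{x}, {y}})"
  proof -
    have 1: "e ` {..<Suc j} = insert {x, y} (e ` {..<j})" using xy by (auto simp: lessThan_Suc)
    have 2: "singles (U - \<Union> (e ` {..<Suc j})) = singles (U - \<Union> (e ` {..<j})) - {{x}, {y}}"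
      unfolding 1 by (auto simp: singles_def)
    show ?thesis unfolding pair_part_def 2 using 1 ns by auto
  qed
  moreover have "{x} \<in> pair_part e j U" "{y} \<in> pair_part e j U"
    using xn ej(1) xy by (auto simp: pair_part_def singles_def)
  moreover have "{x} \<noteq> {y}" using xy(2) by simp
  ultimately show ?thesis unfolding merge_step_def by metis
qed

lemma pair_part_sizes:
  assumes M: "matching U j e" and U: "finite U"
  shows "has_sizes U (pair_part e j U) (card U - 2 * j) j 0 0"
proof -
  have inj: "inj_on e {..<j}" by (rule matching_inj[OF M])
  have cU: "card (\<Union> (e ` {..<j})) = 2 * j"
  proof -
    have "card (\<Union> (e ` {..<j})) = (\<Sum>i<j. card (e i))"
      by (rule card_UN_disjoint) (use M in \<open>auto simp: matching_def intro: card_ge_0_finite\<close>)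
    also have "\<dots> = 2 * j" using M by (simp add: matching_def)
    finally show ?thesis .
  qed
  have sub: "\<Union> (e ` {..<j}) \<subseteq> U" using M by (auto simp: matching_def)
  have fin: "finite (\<Union> (e ` {..<j}))" using sub U finite_subset by blast
  have cR: "card (U - \<Union> (e ` {..<j})) = card U - 2 * j" using card_Diff_subset[OF fin sub] cU by simp
  have dj: "e ` {..<j} \<inter> singles (U - \<Union> (e ` {..<j})) = {}" using M by (auto simp: matching_def singles_def)
  have "weight F (pair_part e j U) = real (card U - 2 * j) * F 1 + real j * F 2 + real 0 * F 3 + real 0 * F 4" for F
  proof -
    have "weight F (pair_part e j U) = weight F (e ` {..<j}) + weight F (singles (U - \<Union> (e ` {..<j})))"
      unfolding weight_def pair_part_def by (rule sum.union_disjoint) (use U dj in \<open>auto simp: singles_def\<close>)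
    also have "weight F (e ` {..<j}) = (\<Sum>i<j. F (card (e i)))" unfolding weight_def by (simp add: sum.reindex[OF inj])
    also have "\<dots> = real j * F 2" using M by (simp add: matching_def)
    also have "weight F (singles (U - \<Union> (e ` {..<j}))) = real (card (U - \<Union> (e ` {..<j}))) * F 1"
      by (simp add: weight_def singles_def sum.reindex)
    finally show ?thesis unfolding cR by simp
  qed
  then show ?thesis unfolding has_sizes_def using pair_part_partition[OF M] by blast
qed

text \<open>The crude bound for pairs chosen depending on the random graph: each of them costs at most one.\<close>

lemma redcount_pair_part:
  assumes "finite U"
  shows "redcount X A (pair_part e j U) \<le> j + redcount X A (singles U)"
proof -
  have "redcount X A (pair_part e j U) \<le> redcount X A (e ` {..<j}) + redcount X A (singles (U - \<Union> (e ` {..<j})))"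
    unfolding pair_part_def by (rule redcount_Un)
  also have "redcount X A (e ` {..<j}) \<le> j" using redcount_le_card[of "e ` {..<j}" X A] card_image_le[of "{..<j}" e] by simp
  also have "redcount X A (singles (U - \<Union> (e ` {..<j}))) \<le> redcount X A (singles U)"
    by (rule redcount_mono) (use assms in \<open>auto simp: singles_def\<close>)
  finally show ?thesis by simp
qed

text \<open>Singletons are never red to each other, only to larger parts.\<close>

lemma redcount_singleton:
  assumes "finite V" "has_sizes V P x1 x2 x3 x4"
  shows "redcount X {x} P \<le> x2 + x3 + x4"
proof -
  have part: "partition_on V P" using assms by (simp add: has_sizes_def)
  have fP: "finite P" using finite_partition[OF assms(1) part] .
  have "redcount X {x} P \<le> card {A \<in> P. card A \<noteq> 1}" unfolding redcount_def
    by (rule card_mono) (use fP in \<open>auto simp: mixed_def card_1_singleton_iff\<close>)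
  also have "\<dots> + num_size 1 P = card P" unfolding num_size_def
    by (subst card_Un_disjoint[symmetric]) (use fP in \<open>auto intro!: arg_cong[where f=card]\<close>)
  then have "card {A \<in> P. card A \<noteq> 1} = x2 + x3 + x4" using has_sizes_cnt[OF assms] by simp
  finally show ?thesis .
qed

text \<open>The vertex set is split into three blocks that are merged one after the other, each by its own chain; the final partition is
small enough to be merged in any order.\<close>

lemma three_stage_reducible:
  assumes U: "finite U1" "finite U2" "finite W" "U1 \<inter> U2 = {}" "U1 \<inter> W = {}" "U2 \<inter> W = {}" "W \<noteq> {}"
    and A: "A 0 = singles U1" "\<And>t. t < m \<Longrightarrow> merge_step (A t) (A (Suc t))" "\<And>t. t \<le> m \<Longrightarrow> partition_on U1 (A t)"
    and B: "B 0 = singles U2" "\<And>t. t < k \<Longrightarrow> merge_step (B t) (B (Suc t))" "\<And>t. t \<le> k \<Longrightarrow> partition_on U2 (B t)"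
    and C: "C 0 = singles W" "\<And>t. t < l \<Longrightarrow> merge_step (C t) (C (Suc t))" "\<And>t. t \<le> l \<Longrightarrow> partition_on W (C t)"
    and red: "\<And>t. t < m \<Longrightarrow> red_bounded X d (A t \<union> singles U2 \<union> singles W)"
      "\<And>t. t < k \<Longrightarrow> red_bounded X d (A m \<union> B t \<union> singles W)"
      "\<And>t. t < l \<Longrightarrow> red_bounded X d (A m \<union> B k \<union> C t)"
    and fin: "card (A m) + card (B k) + card (C l) \<le> Suc d"
  shows "reducible X d (singles (U1 \<union> U2 \<union> W))"
proof -
  have p: "partition_on (U1 \<union> U2 \<union> W) (A i \<union> B j \<union> C t)" if "i \<le> m" "j \<le> k" "t \<le> l" for i j t
    by (intro partition_on_Un A B C that) (use U in auto)
  have f: "finite (A m)" "finite (B k)" "finite (C l)"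
    using finite_partition[OF U(1) A(3)] finite_partition[OF U(2) B(3)] finite_partition[OF U(3) C(3)] by auto
  have "reducible X d (A m \<union> B k \<union> C l)"
  proof (rule reducible_of_few_parts[OF p])
    show "finite (A m \<union> B k \<union> C l)" using f by simp
    show "A m \<union> B k \<union> C l \<noteq> {}" using p[of m k l] U(7) by (auto simp: partition_on_def)
    show "card (A m \<union> B k \<union> C l) \<le> Suc d"
      using card_Un_le[of "A m \<union> B k" "C l"] card_Un_le[of "A m" "B k"] fin by linarith
  qed auto
  then have "reducible X d (A m \<union> B k \<union> C 0)"
  proof (rule reducible_chain[rotated 2, where P = "\<lambda>t. A m \<union> B k \<union> C t"])
    fix t assume t: "t < l"
    show "red_bounded X d (A m \<union> B k \<union> C t)" by (rule red) fact
    have "merge_step (C t \<union> (A m \<union> B k)) (C (Suc t) \<union> (A m \<union> B k))"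
      by (rule merge_step_Un[OF C(2)[OF t] C(3) partition_on_Un[OF A(3) B(3)]]) (use t U in auto)
    then show "merge_step (A m \<union> B k \<union> C t) (A m \<union> B k \<union> C (Suc t))" by (simp add: Un_commute)
  qed
  then have "reducible X d (A m \<union> B k \<union> singles W)" unfolding C(1) .
  then have "reducible X d (A m \<union> B 0 \<union> singles W)"
  proof (rule reducible_chain[rotated 2, where P = "\<lambda>t. A m \<union> B t \<union> singles W"])
    fix t assume t: "t < k"
    show "red_bounded X d (A m \<union> B t \<union> singles W)" by (rule red) fact
    have "merge_step (B t \<union> (A m \<union> singles W)) (B (Suc t) \<union> (A m \<union> singles W))"
      by (rule merge_step_Un[OF B(2)[OF t] B(3) partition_on_Un[OF A(3) partition_on_singles]]) (use t U in auto)
    moreover have "B t \<union> (A m \<union> singles W) = A m \<union> B t \<union> singles W" for t by auto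
    ultimately show "merge_step (A m \<union> B t \<union> singles W) (A m \<union> B (Suc t) \<union> singles W)" by simp
  qed
  then have "reducible X d (A m \<union> singles U2 \<union> singles W)" unfolding B(1) .
  then have "reducible X d (A 0 \<union> singles U2 \<union> singles W)"
  proof (rule reducible_chain[rotated 2, where P = "\<lambda>t. A t \<union> singles U2 \<union> singles W"])
    fix t assume t: "t < m"
    show "red_bounded X d (A t \<union> singles U2 \<union> singles W)" by (rule red) fact
    have "merge_step (A t \<union> (singles U2 \<union> singles W)) (A (Suc t) \<union> (singles U2 \<union> singles W))"
      by (rule merge_step_Un[OF A(2)[OF t] A(3) partition_on_Un[OF partition_on_singles partition_on_singles]]) (use t U in auto)
    then show "merge_step (A t \<union> singles U2 \<union> singles W) (A (Suc t) \<union> singles U2 \<union> singles W)" by (simp add: Un_assoc)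
  qed
  then show ?thesis unfolding A(1) by (simp add: singles_Un)
qed

section \<open>Disjoint pairs of small symmetric difference\<close>

text \<open>Chebyshev's inequality for a sum of indicators that are independent outside of \<open>R\<close>.\<close>

lemma second_moment:
  assumes S: "finite S" and I: "finite I" and R: "R \<subseteq> I \<times> I"
    and indep: "\<And>i j. i \<in> I \<Longrightarrow> j \<in> I \<Longrightarrow> i \<noteq> j \<Longrightarrow> (i, j) \<notin> R \<Longrightarrow>
       Prob S p (\<lambda>X. Z i X \<and> Z j X) = Prob S p (Z i) * Prob S p (Z j)"
    and \<mu>: "\<mu> = (\<Sum>i\<in>I. Prob S p (Z i))" "0 < \<mu>"
  shows "Prob S p (\<lambda>X. real (card {i\<in>I. Z i X}) \<le> \<mu> / 2) \<le>
     4 * (\<mu> + (\<Sum>(i, j)\<in>R. Prob S p (\<lambda>X. Z i X \<and> Z j X))) / \<mu>\<^sup>2"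
proof -
  define N where "N X = (\<Sum>i\<in>I. of_bool (Z i X) :: real)" for X
  have N: "real (card {i\<in>I. Z i X}) = N X" for X
    using I by (simp add: N_def sum_of_bool_eq Int_def)
  have EN: "expec S p N = \<mu>" unfolding N_def \<mu>(1) Prob_eq_Ex using S by (simp del: sum_of_bool_eq)
  have N2: "(N X)\<^sup>2 = (\<Sum>z\<in>I \<times> I. of_bool (Z (fst z) X \<and> Z (snd z) X))" for X
    unfolding N_def power2_eq_square sum_product sum.cartesian_product
    by (intro sum.cong) (auto simp: of_bool_conj)
  define \<pi> where "\<pi> z = Prob S p (\<lambda>X. Z (fst z) X \<and> Z (snd z) X)" for z
  have "expec S p (\<lambda>X. (N X)\<^sup>2) = (\<Sum>z\<in>I \<times> I. \<pi> z)"
    unfolding N2 \<pi>_def Prob_eq_Ex using S by (simp del: sum_of_bool_eq)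
  also have "\<dots> \<le> (\<Sum>z\<in>I \<times> I. (if fst z = snd z then Prob S p (Z (fst z)) else 0) + (if z \<in> R then \<pi> z else 0) + Prob S p (Z (fst z)) * Prob S p (Z (snd z)))"
  proof (rule sum_mono)
    fix z assume z: "z \<in> I \<times> I"
    have nn: "0 \<le> Prob S p (Z (fst z)) * Prob S p (Z (snd z))" "0 \<le> \<pi> z" "0 \<le> Prob S p (Z (fst z))"
      by (simp_all add: \<pi>_def)
    show "\<pi> z \<le> (if fst z = snd z then Prob S p (Z (fst z)) else 0) + (if z \<in> R then \<pi> z else 0) + Prob S p (Z (fst z)) * Prob S p (Z (snd z))"
    proof (cases "z \<in> R")
      case True then show ?thesis using nn by auto
    next
      case False
      show ?thesis
      proof (cases "fst z = snd z")
        case True then show ?thesis using nn by (auto simp: \<pi>_def)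
      next
        case neq: False
        then have "\<pi> z = Prob S p (Z (fst z)) * Prob S p (Z (snd z))"
          unfolding \<pi>_def by (intro indep) (use z False in auto)
        then show ?thesis using nn by auto
      qed
    qed
  qed
  also have "\<dots> = \<mu> + (\<Sum>z\<in>R. \<pi> z) + \<mu>\<^sup>2"
  proof -
    have "(\<Sum>z\<in>I \<times> I. if fst z = snd z then Prob S p (Z (fst z)) else 0) = (\<Sum>i\<in>I. \<Sum>j\<in>I. if i = j then Prob S p (Z i) else 0)"
      by (simp add: sum.cartesian_product case_prod_unfold)
    also have "\<dots> = \<mu>" unfolding \<mu>(1) using I by simp
    finally have 1: "(\<Sum>z\<in>I \<times> I. if fst z = snd z then Prob S p (Z (fst z)) else 0) = \<mu>" .
    have 2: "(\<Sum>z\<in>I \<times> I. if z \<in> R then \<pi> z else 0) = (\<Sum>z\<in>R. \<pi> z)"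
      using sum.inter_restrict[of "I \<times> I" \<pi> R] I R by (simp add: Int_absorb1)
    have 3: "(\<Sum>z\<in>I \<times> I. Prob S p (Z (fst z)) * Prob S p (Z (snd z))) = \<mu>\<^sup>2"
      unfolding \<mu>(1) power2_eq_square sum_product by (simp add: sum.cartesian_product case_prod_unfold)
    show ?thesis by (simp add: sum.distrib 1 2 3)
  qed
  finally have EN2: "expec S p (\<lambda>X. (N X)\<^sup>2) \<le> \<mu> + (\<Sum>z\<in>R. \<pi> z) + \<mu>\<^sup>2" .
  have "Prob S p (\<lambda>X. real (card {i\<in>I. Z i X}) \<le> \<mu> / 2) \<le> expec S p (\<lambda>X. (N X - \<mu>)\<^sup>2 * (4 / \<mu>\<^sup>2))"
    unfolding N
  proof (rule Prob_le_Ex[OF S])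
    fix X assume "N X \<le> \<mu> / 2"
    then have "\<mu> / 2 \<le> \<mu> - N X" by simp
    then have "(\<mu> / 2)\<^sup>2 \<le> (\<mu> - N X)\<^sup>2" using \<mu>(2) by (intro power_mono) auto
    then show "1 \<le> (N X - \<mu>)\<^sup>2 * (4 / \<mu>\<^sup>2)" using \<mu>(2) by (simp add: power2_commute field_simps power_divide)
  qed auto
  also have "\<dots> = expec S p (\<lambda>X. (N X)\<^sup>2 - 2 * \<mu> * N X + \<mu>\<^sup>2) * (4 / \<mu>\<^sup>2)"
    unfolding power2_diff by (subst integral_mult_left_zero[symmetric]) (simp add: algebra_simps)
  also have "expec S p (\<lambda>X. (N X)\<^sup>2 - 2 * \<mu> * N X + \<mu>\<^sup>2) = expec S p (\<lambda>X. (N X)\<^sup>2) - \<mu>\<^sup>2"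
    using S EN by (simp add: power2_eq_square)
  also have "(expec S p (\<lambda>X. (N X)\<^sup>2) - \<mu>\<^sup>2) * (4 / \<mu>\<^sup>2) \<le> (\<mu> + (\<Sum>z\<in>R. \<pi> z)) * (4 / \<mu>\<^sup>2)"
    using EN2 by (intro mult_right_mono) auto
  finally show ?thesis by (simp add: \<pi>_def case_prod_unfold mult_ac)
qed

text \<open>Discarding every pair that meets another one loses at most one pair per element of \<open>R\<close>.\<close>

lemma obtain_matching:
  assumes E: "finite E" "\<And>e. e \<in> E \<Longrightarrow> e \<subseteq> U \<and> card e = 2"
    and R: "R = {(e, f) \<in> E \<times> E. e \<noteq> f \<and> e \<inter> f \<noteq> {}}" and m: "m + card R \<le> card E"
  shows "\<exists>f. matching U m f \<and> (\<forall>i<m. f i \<in> E)"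
proof -
  have fR: "finite R" unfolding R by (rule finite_subset[of _ "E \<times> E"]) (use E in auto)
  \<comment> \<open>The pairs in \<open>J\<close> meet no other pair.\<close>
  define J where "J = E - fst ` R"
  have "card E \<le> card J + card (fst ` R)"
    unfolding J_def using diff_card_le_card_Diff[of "fst ` R" E] fR by simp
  moreover have "card (fst ` R) \<le> card R" by (rule card_image_le[OF fR])
  ultimately have "m \<le> card J" using m by linarith
  then obtain K where K: "K \<subseteq> J" "card K = m" using obtain_subset_with_card_n by metis
  have fK: "finite K" using K(1) E(1) finite_subset[of K E] by (auto simp: J_def)
  obtain f where f: "bij_betw f {..<m} K"
    using ex_bij_betw_nat_finite[OF fK] K(2) by (auto simp: atLeast0LessThan)
  have fJ: "f i \<in> J" if "i < m" for i using f K(1) that by (auto simp: bij_betw_def)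
  have "f i \<inter> f j = {}" if "i < m" "j < m" "i \<noteq> j" for i j
  proof (rule ccontr)
    assume ne: "f i \<inter> f j \<noteq> {}"
    have "f i \<noteq> f j" using f that by (auto simp: bij_betw_def inj_on_def)
    then have "(f i, f j) \<in> R" using fJ[OF that(1)] fJ[OF that(2)] ne by (auto simp: R J_def)
    then have "f i \<in> fst ` R" by force
    then show False using fJ[OF that(1)] by (auto simp: J_def)
  qed
  then show ?thesis using fJ E(2) by (intro exI[of _ f]) (auto simp: matching_def J_def)
qed

lemma card_intersecting_pairs:
  assumes "finite U"
  shows "card {(e, f) \<in> all_edges U \<times> all_edges U. e \<noteq> f \<and> e \<inter> f \<noteq> {}} \<le> (card U) ^ 3"
proof -
  have "{(e, f) \<in> all_edges U \<times> all_edges U. e \<noteq> f \<and> e \<inter> f \<noteq> {}} \<subseteq> (\<lambda>(x, y, z). ({x, y}, {x, z})) ` (U \<times> U \<times> U)"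
  proof
    fix w assume "w \<in> {(e, f) \<in> all_edges U \<times> all_edges U. e \<noteq> f \<and> e \<inter> f \<noteq> {}}"
    then obtain e f x where w: "w = (e, f)" "e \<in> all_edges U" "f \<in> all_edges U" "x \<in> e" "x \<in> f" by auto
    obtain a b where ab: "e = {a, b}" "a \<in> U" "b \<in> U" using w(2) by (rule all_edgesE)
    obtain c d where cd: "f = {c, d}" "c \<in> U" "d \<in> U" using w(3) by (rule all_edgesE)
    obtain y where y: "e = {x, y}" "x \<in> U" "y \<in> U" using ab w(4) by (auto simp: insert_commute)
    obtain z where z: "f = {x, z}" "z \<in> U" using cd w(5) by (auto simp: insert_commute)
    show "w \<in> (\<lambda>(x, y, z). ({x, y}, {x, z})) ` (U \<times> U \<times> U)"
      by (rule image_eqI[of _ _ "(x, y, z)"]) (use w(1) y z in auto)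
  qed
  then have "card {(e, f) \<in> all_edges U \<times> all_edges U. e \<noteq> f \<and> e \<inter> f \<noteq> {}} \<le> card ((\<lambda>(x, y, z). ({x, y}, {x, z})) ` (U \<times> U \<times> U))"
    using assms by (intro card_mono) auto
  also have "\<dots> \<le> card (U \<times> U \<times> U)" using assms by (intro card_image_le) auto
  finally show ?thesis by (simp add: card_cartesian_product power3_eq_cube)
qed

text \<open>\<open>L\<close> bounds the expected number of good pairs from below and \<open>M\<close> the expected number of ordered
pairs of good pairs with a common vertex from above. At least half of the expected number of good pairs exists by \<open>second_moment\<close>, and at most a quarter of it is lost by Markov's
inequality.\<close>

lemma good_matching_fixed:
  fixes V U W :: "'a set"
  assumes V: "finite V" "U \<subseteq> V" "W \<subseteq> V" "U \<inter> W = {}" and p: "0 \<le> p" "p \<le> 1"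
    and one: "\<And>e. e \<in> all_edges U \<Longrightarrow> \<pi>1 \<le> Prob (all_edges V) p (\<lambda>X. real (mixdeg X e W) \<le> z)"
    and two: "\<And>x y y'. {x, y, y'} \<subseteq> U \<Longrightarrow> x \<noteq> y \<Longrightarrow> x \<noteq> y' \<Longrightarrow> y \<noteq> y' \<Longrightarrow>
       Prob (all_edges V) p (\<lambda>X. real (mixdeg X {x, y} W) \<le> z \<and> real (mixdeg X {x, y'} W) \<le> z) \<le> \<pi>2"
    and L: "L \<le> real (card (all_edges U)) * \<pi>1" "0 < L" and M: "real (card U) ^ 3 * \<pi>2 \<le> M" "0 \<le> \<pi>2"
    and m: "4 * real m \<le> L"
  shows "Prob (all_edges V) p (\<lambda>X. \<not> (\<exists>f. matching U m f \<and> (\<forall>i<m. real (mixdeg X (f i) W) \<le> z))) \<le> 4 / L + 4 * M / L\<^sup>2 + 4 * M / L"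
proof -
  let ?S = "all_edges V"
  have fU: "finite U" and fW: "finite W" using finite_subset[OF V(2,1)] finite_subset[OF V(3,1)] by auto
  define Z where "Z = (\<lambda>e X. real (mixdeg X e W) \<le> z)"
  define R where "R = {(e, f) \<in> all_edges U \<times> all_edges U. e \<noteq> f \<and> e \<inter> f \<noteq> {}}"
  define \<mu> where "\<mu> = (\<Sum>e\<in>all_edges U. Prob ?S p (Z e))"
  have fS: "finite ?S" using V by simp
  have RU: "R \<subseteq> all_edges U \<times> all_edges U" by (auto simp: R_def)
  have fR: "finite R" using finite_subset[OF RU] fU by simp
  have L\<mu>: "L \<le> \<mu>" unfolding \<mu>_def
    using L(1) sum_mono[of "all_edges U" "\<lambda>_. \<pi>1" "\<lambda>e. Prob ?S p (Z e)"] one by (simp add: Z_def)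
  then have \<mu>0: "0 < \<mu>" using L(2) by simp
  have pairs: "Prob ?S p (\<lambda>X. Z (fst w) X \<and> Z (snd w) X) \<le> \<pi>2" if wR: "w \<in> R" for w
  proof -
    obtain e f x where w: "w = (e, f)" "e \<in> all_edges U" "f \<in> all_edges U" "e \<noteq> f" "x \<in> e" "x \<in> f"
      using wR by (auto simp: R_def)
    obtain a b where ab: "e = {a, b}" "a \<in> U" "b \<in> U" "a \<noteq> b" using w(2) by (rule all_edgesE)
    obtain c d where cd: "f = {c, d}" "c \<in> U" "d \<in> U" "c \<noteq> d" using w(3) by (rule all_edgesE)
    obtain y where y: "e = {x, y}" "x \<in> U" "y \<in> U" "x \<noteq> y" using ab w(5) by (auto simp: insert_commute)
    obtain y' where y': "f = {x, y'}" "y' \<in> U" "x \<noteq> y'" using cd w(6) by (auto simp: insert_commute)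
    have "y \<noteq> y'" using y y' w(4) by auto
    then show ?thesis using two[of x y y'] y y' w(1) by (simp add: Z_def)
  qed
  have sumR: "(\<Sum>w\<in>R. Prob ?S p (\<lambda>X. Z (fst w) X \<and> Z (snd w) X)) \<le> M"
  proof -
    have "(\<Sum>w\<in>R. Prob ?S p (\<lambda>X. Z (fst w) X \<and> Z (snd w) X)) \<le> (\<Sum>w\<in>R. \<pi>2)" by (rule sum_mono) (rule pairs)
    also have "\<dots> = real (card R) * \<pi>2" by simp
    also have "\<dots> \<le> real (card U ^ 3) * \<pi>2"
      using card_intersecting_pairs[OF fU] M(2) unfolding R_def[symmetric] by (intro mult_right_mono) (simp_all only: of_nat_le_iff)
    finally show ?thesis using M(1) by simp
  qed
  have M0: "0 \<le> M" using order_trans[OF _ M(1), of 0] M(2) by simp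
  have 1: "Prob ?S p (\<lambda>X. real (card {e\<in>all_edges U. Z e X}) \<le> \<mu> / 2) \<le> 4 / L + 4 * M / L\<^sup>2"
  proof -
    have "Prob ?S p (\<lambda>X. real (card {e\<in>all_edges U. Z e X}) \<le> \<mu> / 2) \<le>
       4 * (\<mu> + (\<Sum>(e, f)\<in>R. Prob ?S p (\<lambda>X. Z e X \<and> Z f X))) / \<mu>\<^sup>2"
    proof (rule second_moment[OF fS _ RU _ \<mu>_def \<mu>0])
      show "finite (all_edges U)" using fU by simp
      fix e f assume ef: "e \<in> all_edges U" "f \<in> all_edges U" "e \<noteq> f" "(e, f) \<notin> R"
      then have "e \<inter> f = {}" by (auto simp: R_def)
      moreover have "e \<subseteq> V - W" "f \<subseteq> V - W" using ef V by (auto simp: all_edges_def)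
      ultimately show "Prob ?S p (\<lambda>X. Z e X \<and> Z f X) = Prob ?S p (Z e) * Prob ?S p (Z f)"
        unfolding Z_def by (intro disjoint_pairs_indep[OF V(1,3) p refl]) auto
    qed
    also have "\<dots> \<le> 4 * (\<mu> + M) / \<mu>\<^sup>2" using sumR by (intro divide_right_mono) (auto simp: case_prod_unfold)
    also have "\<dots> = 4 / \<mu> + 4 * M / \<mu>\<^sup>2" using \<mu>0 by (simp add: power2_eq_square field_simps)
    also have "\<dots> \<le> 4 / L + 4 * M / L\<^sup>2" using L\<mu> L(2) M0 by (intro add_mono frac_le power_mono) auto
    finally show ?thesis .
  qed
  have 2: "Prob ?S p (\<lambda>X. \<mu> / 4 \<le> real (card {w\<in>R. Z (fst w) X \<and> Z (snd w) X})) \<le> 4 * M / L"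
  proof -
    have "Prob ?S p (\<lambda>X. \<mu> / 4 \<le> real (card {w\<in>R. Z (fst w) X \<and> Z (snd w) X})) \<le> (\<Sum>w\<in>R. Prob ?S p (\<lambda>X. Z (fst w) X \<and> Z (snd w) X)) / (\<mu> / 4)"
      by (rule markov_count) (use fS fR \<mu>0 in auto)
    also have "\<dots> \<le> M / (L / 4)" using sumR L\<mu> L(2) M0 by (intro frac_le) auto
    finally show ?thesis by (simp add: mult.commute)
  qed
  have "Prob ?S p (\<lambda>X. \<not> (\<exists>f. matching U m f \<and> (\<forall>i<m. real (mixdeg X (f i) W) \<le> z))) \<le>
     Prob ?S p (\<lambda>X. real (card {e\<in>all_edges U. Z e X}) \<le> \<mu> / 2) + Prob ?S p (\<lambda>X. \<mu> / 4 \<le> real (card {w\<in>R. Z (fst w) X \<and> Z (snd w) X}))"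
  proof (rule Prob_disj[OF fS])
    fix X assume no: "\<not> (\<exists>f. matching U m f \<and> (\<forall>i<m. real (mixdeg X (f i) W) \<le> z))"
    show "real (card {e\<in>all_edges U. Z e X}) \<le> \<mu> / 2 \<or> \<mu> / 4 \<le> real (card {w\<in>R. Z (fst w) X \<and> Z (snd w) X})"
    proof (rule ccontr)
      assume "\<not> ?thesis"
      then have c: "\<mu> / 2 < real (card {e\<in>all_edges U. Z e X})" "real (card {w\<in>R. Z (fst w) X \<and> Z (snd w) X}) < \<mu> / 4" by auto
      have "real m + real (card {w\<in>R. Z (fst w) X \<and> Z (snd w) X}) \<le> real (card {e\<in>all_edges U. Z e X})"
        using c m L\<mu> by linarith
      then have "m + card {w\<in>R. Z (fst w) X \<and> Z (snd w) X} \<le> card {e\<in>all_edges U. Z e X}" by linarith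
      then have "\<exists>f. matching U m f \<and> (\<forall>i<m. f i \<in> {e\<in>all_edges U. Z e X})"
      proof (rule obtain_matching[rotated 3])
        show "finite {e\<in>all_edges U. Z e X}" using fU by simp
        show "\<And>e. e \<in> {e\<in>all_edges U. Z e X} \<Longrightarrow> e \<subseteq> U \<and> card e = 2" by (simp add: all_edges_def)
        show "{w\<in>R. Z (fst w) X \<and> Z (snd w) X} =
          {(e, f) \<in> {e\<in>all_edges U. Z e X} \<times> {e\<in>all_edges U. Z e X}. e \<noteq> f \<and> e \<inter> f \<noteq> {}}"
          unfolding R_def by fastforce
      qed
      then show False using no by (auto simp: Z_def)
    qed
  qed
  then show ?thesis using 1 2 by linarith
qed

text \<open>At the deviation \<open>(1 - \<epsilon>) * sqrt (3 * r * (1 - r) * n * ln n)\<close> a pair is good with probability at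
least \<open>n powr - (3/2) * (1 - \<epsilon> / 2)\<close>, up to constants, so there are \<open>n powr (1/2 + 3/4 * \<epsilon>)\<close> good pairs on
average. Two pairs with a common vertex are both good with probability at most \<open>n powr - 2.6\<close>, which gives only
\<open>n powr 0.4\<close> conflicts. The exponent would be \<open>-3\<close> without correlation; that it is still below \<open>- 5/2\<close> uses \<open>s > 0.24\<close>.\<close>

lemma good_matching:
  fixes p \<epsilon> \<epsilon>1 :: real
  assumes p: "0.4012 < p" "p \<le> 1/2" and eps: "0 < \<epsilon>" "\<epsilon> \<le> 1/100" "0 < \<epsilon>1" "\<epsilon>1 \<le> \<epsilon> / 6"
  defines "r \<equiv> 2 * p * (1 - p)"
  defines "u \<equiv> \<lambda>n. nat \<lfloor>\<epsilon>1 * real n\<rfloor>" and "m \<equiv> \<lambda>n. nat \<lfloor>sqrt (real n) * ln (real n)\<rfloor>"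
  shows "edge_whp p (\<lambda>n X. \<exists>f. matching {1..u n} (m n) f \<and> (\<forall>i<m n. real (mixdeg X (f i) {3 * u n + 1..n}) \<le>
     r * real (card {3 * u n + 1..n}) - (1 - \<epsilon>) * (sqrt (3 * (r * (1 - r))) * sqrt (real n * ln (real n)))))"
proof -
  define s where "s = p * (1 - p)"
  define v where "v = r * (1 - r)"
  define v2 where "v2 = 6 * s - 16 * s\<^sup>2"
  define g where "g n = sqrt (real n * ln (real n))" for n :: nat
  define t where "t n = (1 - \<epsilon>) * (sqrt (3 * v) * g n)" for n :: nat
  define W where "W n = {3 * u n + 1..n}" for n
  define \<beta> where "\<beta> = 3 / 2 * (1 - \<epsilon> / 2)"
  \<comment> \<open>With this \<open>a\<close> the loss \<open>9 * a\<close> of \<open>pair_tail_lower\<close> is \<open>\<epsilon> / 4\<close>, and \<open>(1 - \<epsilon>) * (1 + \<epsilon> / 2) \<le> 1 - \<epsilon> / 2\<close>.\<close>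
  define a where "a = \<epsilon> / 36"
  define c where "c = \<epsilon>1\<^sup>2 / 32"
  \<comment> \<open>The optimal parameter in the exponential bound for two pairs with a common vertex.\<close>
  define l where "l n = 2 * t n / (real (card (W n)) * v2)" for n
  have p01: "0 \<le> p" "p \<le> 1" "0 < p" "p < 1" using p by auto
  have "0.4012 * (1 - 0.4012) < s" unfolding s_def using p by (intro prod_strict_mono) auto
  then have s0: "0.24 < s" by simp
  have s1: "s \<le> 1/4" unfolding s_def by (rule mult_one_minus_le_quarter)
  have r: "r = 2 * s" by (simp add: r_def s_def)
  have v: "v = 2 * s * (1 - 2 * s)" by (simp add: v_def r)
  have v2: "v2 = 2 * s * (3 - 8 * s)" by (simp add: v2_def power2_eq_square algebra_simps)
  have v0: "0 < v" "0 < v2" using s0 s1 by (auto simp: v v2)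
  have vv: "0.48 * v2 \<le> v"
  proof -
    have "2 * s * (0.48 * (3 - 8 * s)) \<le> 2 * s * (1 - 2 * s)" using s0 by (intro mult_left_mono) auto
    moreover have "0.48 * v2 = 2 * s * (0.48 * (3 - 8 * s))" by (simp add: v2)
    ultimately show ?thesis unfolding v by linarith
  qed
  have e1: "0 < 1 - \<epsilon>" "0 < c" using eps by (auto simp: c_def)
  have t_sq: "(t n)\<^sup>2 = (1 - \<epsilon>)\<^sup>2 * (3 * v) * (real n * ln (real n))" if "1 \<le> n" for n
    using v0 that by (simp add: t_def g_def power_mult_distrib)
  have a0: "0 < a" "a \<le> 1 / 6" using eps by (auto simp: a_def)
  define K where "K = (1 - \<epsilon>) * sqrt (3 * v)"
  have K0: "0 < K" using e1 v0 by (simp add: K_def)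
  have tK: "t n = K * g n" for n by (simp add: t_def K_def)
  have W_card: "(1 - \<epsilon> / 2) * real n \<le> real (card (W n))" "real (card (W n)) \<le> real n" for n
  proof -
    have "real (u n) \<le> \<epsilon>1 * real n" using eps by (simp add: u_def of_nat_nat)
    also have "\<dots> \<le> \<epsilon> / 6 * real n" using eps by (intro mult_right_mono) auto
    finally have "3 * real (u n) \<le> \<epsilon> / 2 * real n" by simp
    moreover have "real n \<le> real (card (W n)) + 3 * real (u n)" by (simp add: W_def)
    ultimately show "(1 - \<epsilon> / 2) * real n \<le> real (card (W n))" by (simp add: algebra_simps)
    show "real (card (W n)) \<le> real n" by (simp add: W_def)
  qed
  have W_half: "real n / 2 \<le> real (card (W n))" for n
  proof -
    have "1 / 2 * real n \<le> (1 - \<epsilon> / 2) * real n" using eps by (intro mult_right_mono) auto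
    then show ?thesis using W_card(1)[of n] by simp
  qed
  have gn0: "(\<lambda>n. g n / real n) \<longlonglongrightarrow> 0" unfolding g_def by real_asymp
  have small: "eventually (\<lambda>n. C * (g n / real n) < e) sequentially" if "0 < e" for C e :: real
    using order_tendstoD(2)[OF tendsto_mult_right_zero[OF gn0, of C]] that by simp
  have sm40: "eventually (\<lambda>n. 4 * K / v2 * (g n / real n) < 1 / 40) sequentially" by (rule small) simp
  have ev_l: "eventually (\<lambda>n. 0 \<le> l n \<and> exp (2 * l n) \<le> 1.06) sequentially"
    using sm40 eventually_gt_at_top[of 1]
  proof eventually_elim
    case (elim n)
    have g0: "0 \<le> g n" using elim(2) by (simp add: g_def)
    have "l n \<le> 2 * (K * g n) / (real n / 2 * v2)" unfolding l_def tK
      using W_half[of n] v0 K0 g0 elim by (intro frac_le mult_right_mono) auto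
    also have "\<dots> = 4 * K / v2 * (g n / real n)" by (simp add: mult_ac)
    finally have l1: "2 * l n \<le> 1 / 20" using elim(1) by linarith
    have l0: "0 \<le> l n" unfolding l_def tK using K0 g0 v0 by simp
    have "exp (2 * l n) \<le> exp (1 / 20)" using l1 by simp
    also have "\<dots> \<le> 1 + 1 / 20 + (1 / 20)\<^sup>2" by (rule exp_bound) auto
    also have "\<dots> \<le> (1.06::real)" by (simp add: power2_eq_square)
    finally show ?case using l0 by simp
  qed
  have ev_t: "eventually (\<lambda>n. t n / (real (card (W n)) * v) \<le> a\<^sup>2 / 16) sequentially"
  proof -
    have "0 < a\<^sup>2 / 16" using a0 by simp
    from small[OF this, of "2 * K / v"] eventually_gt_at_top[of 1] show ?thesis
    proof eventually_elim
      case (elim n)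
      have g0: "0 \<le> g n" using elim(2) by (simp add: g_def)
      have "t n / (real (card (W n)) * v) \<le> (K * g n) / (real n / 2 * v)" unfolding tK
        using W_half[of n] v0 K0 g0 elim by (intro frac_le mult_right_mono) auto
      also have "\<dots> = 2 * K / v * (g n / real n)" by (simp add: mult_ac)
      finally show ?case using elim(1) by linarith
    qed
  qed
  have lam: "(1 - \<epsilon>)\<^sup>2 \<ge> 0.98"
  proof -
    have "0.98 \<le> (0.99::real)\<^sup>2" by (simp add: power2_eq_square)
    also have "\<dots> \<le> (1 - \<epsilon>)\<^sup>2" using eps by (intro power_mono) auto
    finally show ?thesis .
  qed
  have ev_ln: "eventually (\<lambda>n. 2 \<le> 2 * a\<^sup>2 * ln (real n)) sequentially"
    using a0 by real_asymp
  have ev_u: "eventually (\<lambda>n. 4 \<le> \<epsilon>1 * real n) sequentially" using eps by real_asymp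
  have ev_m: "eventually (\<lambda>n. 4 * (sqrt (real n) * ln (real n)) \<le> c * (real n)\<^sup>2 * exp (- \<beta> * ln (real n))) sequentially"
    unfolding \<beta>_def using e1(2) eps(1) by real_asymp
  show ?thesis
  proof (rule edge_whpI)
    define L where "L n = c * (real n)\<^sup>2 * exp (- \<beta> * ln (real n))" for n :: nat
    define M where "M n = real n ^ 3 * exp (- 2.6 * ln (real n))" for n :: nat
    show "\<forall>\<^sub>F n in sequentially. Prob (all_edges {1..n}) p (\<lambda>X. \<not> (\<exists>f. matching {1..u n} (m n) f \<and> (\<forall>i<m n. real (mixdeg X (f i) {3 * u n + 1..n}) \<le>
     r * real (card {3 * u n + 1..n}) - (1 - \<epsilon>) * (sqrt (3 * (r * (1 - r))) * sqrt (real n * ln (real n))))))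
      \<le> 4 / L n + 4 * M n / (L n)\<^sup>2 + 4 * M n / L n"
      using ev_l ev_t ev_ln ev_u ev_m eventually_gt_at_top[of 1]
    proof eventually_elim
      case (elim n)
      let ?V = "{1..n}" and ?U = "{1..u n}"
      define z where "z = r * real (card (W n)) - t n"
      have ln0: "0 < ln (real n)" "0 < real n" using elim by auto
      have w0: "0 < real (card (W n))" using W_half[of n] ln0 by linarith
      have t0: "0 < t n" unfolding tK using K0 ln0 by (simp add: g_def)
      have u1: "real (u n) \<le> \<epsilon>1 * real n" "\<epsilon>1 * real n - 1 < real (u n)"
      proof -
        have "real (u n) = of_int \<lfloor>\<epsilon>1 * real n\<rfloor>" using eps by (simp add: u_def)
        then show "real (u n) \<le> \<epsilon>1 * real n" "\<epsilon>1 * real n - 1 < real (u n)" by linarith+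
      qed
      have "\<epsilon>1 * real n \<le> 1 * real n" using eps by (intro mult_right_mono) auto
      then have un: "u n \<le> n" using u1 by linarith
      have u2: "2 \<le> u n" using u1(2) elim(4) by linarith
      have m4: "4 * real (m n) \<le> L n"
      proof -
        have "real (m n) \<le> sqrt (real n) * ln (real n)" using ln0 by (simp add: m_def of_nat_nat)
        then show ?thesis using elim(5) unfolding L_def by linarith
      qed
      have tw_up: "(t n)\<^sup>2 / (real (card (W n)) * v) \<le> 3 * (1 - \<epsilon>) * ln (real n)"
      proof -
        have "(1 - \<epsilon>)\<^sup>2 * real n \<le> (1 - \<epsilon>) * real (card (W n))"
        proof -
          have "(1 - \<epsilon>) * real n \<le> real (card (W n))"
            using W_card(1)[of n] eps ln0 mult_right_mono[of "1 - \<epsilon>" "1 - \<epsilon> / 2" "real n"] by linarith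
          then have "(1 - \<epsilon>) * ((1 - \<epsilon>) * real n) \<le> (1 - \<epsilon>) * real (card (W n))" using e1 by (intro mult_left_mono) auto
          then show ?thesis by (simp add: power2_eq_square mult.assoc)
        qed
        then have "((1 - \<epsilon>)\<^sup>2 * real n) * (3 * v * ln (real n)) \<le> ((1 - \<epsilon>) * real (card (W n))) * (3 * v * ln (real n))"
          using v0 ln0 by (intro mult_right_mono) auto
        moreover have "(t n)\<^sup>2 = ((1 - \<epsilon>)\<^sup>2 * real n) * (3 * v * ln (real n))"
          using t_sq[of n] elim(6) by (simp add: mult_ac)
        moreover have "((1 - \<epsilon>) * real (card (W n))) * (3 * v * ln (real n)) = (3 * (1 - \<epsilon>) * ln (real n)) * (real (card (W n)) * v)"
          by (simp add: algebra_simps)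
        ultimately have "(t n)\<^sup>2 \<le> (3 * (1 - \<epsilon>) * ln (real n)) * (real (card (W n)) * v)" by linarith
        then show ?thesis using w0 v0 by (simp add: pos_divide_le_eq)
      qed
      have tw_low: "3 * 0.98 * ln (real n) \<le> (t n)\<^sup>2 / (real (card (W n)) * v)"
      proof -
        have "3 * 0.98 * ln (real n) * (real (card (W n)) * v) \<le> 3 * (1 - \<epsilon>)\<^sup>2 * ln (real n) * (real n * v)"
          using lam ln0 v0 W_card(2)[of n] by (intro mult_mono mult_right_mono) auto
        also have "\<dots> = (t n)\<^sup>2" using t_sq[of n] elim by (simp add: mult_ac)
        finally show ?thesis using w0 v0 by (simp add: pos_le_divide_eq)
      qed
      have "Prob (all_edges ?V) p (\<lambda>X. \<not> (\<exists>f. matching ?U (m n) f \<and> (\<forall>i<m n. real (mixdeg X (f i) (W n)) \<le> z)))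
        \<le> 4 / L n + 4 * M n / (L n)\<^sup>2 + 4 * M n / L n"
      proof (rule good_matching_fixed[where ?\<pi>1.0 = "exp (- \<beta> * ln (real n)) / 2" and ?\<pi>2.0 = "exp (- 2.6 * ln (real n))"])
        show UV: "?U \<subseteq> ?V" "W n \<subseteq> ?V" "?U \<inter> W n = {}" using un by (auto simp: W_def)
        fix e assume e: "e \<in> all_edges ?U"
        have "exp (- \<beta> * ln (real n)) / 2 \<le> exp (- ((t n)\<^sup>2 / (real (card (W n)) * (r * (1 - r)))) * (1 / 2 + 9 * a)) / 2"
        proof -
          have "(t n)\<^sup>2 / (real (card (W n)) * v) * (1 / 2 + 9 * a) \<le> (3 * (1 - \<epsilon>) * ln (real n)) * (1 / 2 + 9 * a)"
            using tw_up a0 by (intro mult_right_mono) auto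
          also have "\<dots> = (3 / 2 * ((1 - \<epsilon>) * (1 + \<epsilon> / 2))) * ln (real n)" by (simp add: a_def algebra_simps add_divide_distrib diff_divide_distrib)
          also have "\<dots> \<le> \<beta> * ln (real n)"
          proof (rule mult_right_mono)
            have "(1 - \<epsilon>) * (1 + \<epsilon> / 2) = 1 - \<epsilon> / 2 - \<epsilon>\<^sup>2 / 2" by (simp add: power2_eq_square algebra_simps add_divide_distrib diff_divide_distrib)
            then show "3 / 2 * ((1 - \<epsilon>) * (1 + \<epsilon> / 2)) \<le> \<beta>" unfolding \<beta>_def by simp
          qed (use ln0 in auto)
          finally show ?thesis unfolding v_def by simp
        qed
        also have "\<dots> \<le> Prob (all_edges ?V) p (\<lambda>X. real (mixdeg X e (W n)) \<le> r * real (card (W n)) - t n)"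
        proof (rule pair_tail_lower)
          show "card e = 2" "e \<subseteq> ?V - W n" using e UV by (auto simp: all_edges_def)
          show "W n \<noteq> {}" using w0 by auto
          show "2 \<le> (t n)\<^sup>2 / (real (card (W n)) * (r * (1 - r))) * a\<^sup>2"
          proof -
            have "3 * 0.98 * ln (real n) * a\<^sup>2 \<le> (t n)\<^sup>2 / (real (card (W n)) * v) * a\<^sup>2" using tw_low by (intro mult_right_mono) auto
            moreover have "2 * ln (real n) * a\<^sup>2 \<le> 3 * 0.98 * ln (real n) * a\<^sup>2" using ln0 by (intro mult_right_mono) auto
            moreover have "2 \<le> 2 * ln (real n) * a\<^sup>2" using elim(3) by (simp add: mult_ac)
            ultimately have "2 \<le> (t n)\<^sup>2 / (real (card (W n)) * v) * a\<^sup>2" by linarith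
            then show ?thesis unfolding v_def .
          qed
        qed (use UV p01 a0 t0 elim r_def in \<open>auto simp: v_def\<close>)
        finally show "exp (- \<beta> * ln (real n)) / 2 \<le> Prob (all_edges ?V) p (\<lambda>X. real (mixdeg X e (W n)) \<le> z)" unfolding z_def .
      next
        fix x y y' assume xy: "{x, y, y'} \<subseteq> ?U" "x \<noteq> y" "x \<noteq> y'" "y \<noteq> y'"
        have UV: "?U \<subseteq> ?V" "W n \<subseteq> ?V" "?U \<inter> W n = {}" using un by (auto simp: W_def)
        have "Prob (all_edges ?V) p (\<lambda>X. real (mixdeg X {x, y} (W n)) \<le> z \<and> real (mixdeg X {x, y'} (W n)) \<le> z)
          \<le> exp (real (card (W n)) * (6 * (p * (1 - p)) - 16 * (p * (1 - p))\<^sup>2) * ((l n)\<^sup>2 / 2 * exp (2 * l n)) - l n * (2 * t n))"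
          unfolding z_def by (rule two_pairs_tail_upper) (use UV p01 xy elim r_def in auto)
        also have "\<dots> \<le> exp (- 2.6 * ln (real n))"
        proof -
          define q where "q = 4 * (t n)\<^sup>2 / (real (card (W n)) * v2)"
          have "real (card (W n)) * v2 * ((l n)\<^sup>2 / 2 * exp (2 * l n)) - l n * (2 * t n) = q * (exp (2 * l n) / 2 - 1)"
            using w0 v0 by (simp add: l_def q_def power2_eq_square field_simps)
          also have "\<dots> \<le> q * (- 0.47)"
            using elim(1) w0 v0 by (intro mult_left_mono) (auto simp: q_def)
          also have "\<dots> \<le> - 2.6 * ln (real n)"
          proof -
            have "5.64 * ln (real n) \<le> 4 * (3 * 0.98 * ln (real n)) * 0.48" using ln0 by simp
            also have "4 * (3 * 0.98 * ln (real n)) * 0.48 \<le> 4 * ((t n)\<^sup>2 / (real (card (W n)) * v)) * (v / v2)"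
              using tw_low vv v0 ln0 w0 by (intro mult_mono) (auto simp: pos_le_divide_eq)
            also have "4 * ((t n)\<^sup>2 / (real (card (W n)) * v)) * (v / v2) = q" using v0 w0 by (simp add: q_def)
            finally have q: "5.64 * ln (real n) \<le> q" .
            define y where "y = ln (real n)"
            show ?thesis using q ln0(1) unfolding y_def[symmetric] by simp
          qed
          finally show ?thesis unfolding v2_def s_def by simp
        qed
        finally show "Prob (all_edges ?V) p (\<lambda>X. real (mixdeg X {x, y} (W n)) \<le> z \<and> real (mixdeg X {x, y'} (W n)) \<le> z) \<le> exp (- 2.6 * ln (real n))" .
      next
        have cu: "card (all_edges ?U) = u n choose 2"
          using n_subsets[of ?U 2] by (simp add: all_edges_def)
        have "real n ^ 2 * (\<epsilon>1\<^sup>2 / 16) \<le> real (card (all_edges ?U))"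
        proof -
          have "even (u n * (u n - 1))" by auto
          then have "2 * (u n choose 2) = u n * (u n - 1)" unfolding choose_two by (rule dvd_mult_div_cancel)
          moreover have "u n * u n \<le> 2 * (u n * (u n - 1))" using u2 by (cases "u n") auto
          ultimately have "u n * u n \<le> 4 * card (all_edges ?U)" unfolding cu by linarith
          then have "real (u n) * real (u n) \<le> 4 * real (card (all_edges ?U))"
            unfolding of_nat_mult[symmetric] by (metis of_nat_le_iff of_nat_mult of_nat_numeral)
          moreover have "(\<epsilon>1 * real n / 2) * (\<epsilon>1 * real n / 2) \<le> real (u n) * real (u n)"
            using u1(2) elim(4) by (intro mult_mono) linarith+
          moreover have "real n ^ 2 * (\<epsilon>1\<^sup>2 / 16) = (\<epsilon>1 * real n / 2) * (\<epsilon>1 * real n / 2) / 4"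
            by (simp add: power2_eq_square)
          ultimately show ?thesis by linarith
        qed
        then have "real n ^ 2 * (\<epsilon>1\<^sup>2 / 16) * (exp (- \<beta> * ln (real n)) / 2) \<le> real (card (all_edges ?U)) * (exp (- \<beta> * ln (real n)) / 2)"
          by (intro mult_right_mono) auto
        then show "L n \<le> real (card (all_edges ?U)) * (exp (- \<beta> * ln (real n)) / 2)" by (simp add: L_def c_def mult_ac)
        show "0 < L n" using e1 ln0 by (simp add: L_def)
        show "real (card ?U) ^ 3 * exp (- 2.6 * ln (real n)) \<le> M n" unfolding M_def using un by (intro mult_right_mono power_mono) auto
      qed (use p01 m4 in auto)
      then show ?case unfolding z_def W_def t_def g_def v_def .
    qed
    show "(\<lambda>n. 4 / L n + 4 * M n / (L n)\<^sup>2 + 4 * M n / L n) \<longlonglongrightarrow> 0"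
    proof -
      have 1: "(\<lambda>n. 4 / L n) \<longlonglongrightarrow> 0" unfolding L_def \<beta>_def using e1(2) eps(1) by real_asymp
      have 2: "(\<lambda>n. 4 * M n / L n) \<longlonglongrightarrow> 0" unfolding L_def M_def \<beta>_def using e1(2) eps(1) by real_asymp
      have "(\<lambda>n. (4 * M n / L n) * (4 / L n) / 4 + 4 / L n + 4 * M n / L n) \<longlonglongrightarrow> 0 * 0 / 4 + 0 + 0"
        by (intro tendsto_intros 1 2) simp
      then show ?thesis by (simp add: power2_eq_square mult_ac add_ac)
    qed
  qed
qed

section \<open>The upper bound in the critical window\<close>

text \<open>An object \<open>sel\<close> chosen by looking only at edges outside of \<open>G\<close> may be treated as fixed when estimating
an event that depends on the edges in \<open>G\<close>.\<close>

lemma Prob_conditional: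
  assumes S: "finite S" "G \<subseteq> S" and b: "\<And>e. Prob G p (bad e) \<le> \<beta>"
    and dep: "\<And>e X. X \<subseteq> S \<Longrightarrow> bad e X \<Longrightarrow> bad e (X \<inter> G)"
  shows "Prob S p (\<lambda>X. bad (sel (X - G)) X) \<le> \<beta>"
proof -
  have fin: "finite (S - G)" "finite G" using S finite_subset by auto
  have "Prob S p (\<lambda>X. bad (sel (X - G)) X) \<le> Prob S p (\<lambda>X. bad (sel (X - G)) (X \<inter> G))"
    by (rule Prob_mono) (use S dep in auto)
  also have "\<dots> = expec ((S - G) \<union> G) p (\<lambda>X. of_bool (bad (sel (X - G)) (X \<inter> G)))"
    unfolding Prob_eq_Ex using S(2) by (simp add: Un_absorb2)
  also have "\<dots> = expec (S - G) p (\<lambda>X. expec G p (\<lambda>Y. of_bool (bad (sel ((X \<union> Y) - G)) ((X \<union> Y) \<inter> G))))"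
    by (rule expec_union) (use fin in auto)
  also have "\<dots> = expec (S - G) p (\<lambda>X. expec G p (\<lambda>Y. of_bool (bad (sel X) Y)))"
  proof (intro expec_cong)
    fix X Y assume "X \<subseteq> S - G" "Y \<subseteq> G"
    then have "(X \<union> Y) - G = X" "(X \<union> Y) \<inter> G = Y" by auto
    then show "(of_bool (bad (sel ((X \<union> Y) - G)) ((X \<union> Y) \<inter> G)) :: real) = of_bool (bad (sel X) Y)" by simp
  qed
  also have "\<dots> \<le> expec (S - G) p (\<lambda>X. \<beta>)"
    by (rule expec_mono[OF fin(1)]) (simp only: Prob_eq_Ex[symmetric] b)
  finally show ?thesis by simp
qed

text \<open>The summand \<open>card A\<close> accounts for the parts that meet \<open>A\<close>.\<close>

definition deviates :: "real \<Rightarrow> real \<Rightarrow> 'a set set \<Rightarrow> 'a set \<Rightarrow> 'a set set \<Rightarrow> bool" where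
  "deviates p y X A Q \<longleftrightarrow> weight (\<lambda>k. mix_prob p (card A * k)) Q + real (card A) + y \<le> real (redcount X A Q)"

lemma prescribed_families:
  assumes V: "finite V" "0 < card V" and Q: "finite \<Q>" "\<And>Q. Q \<in> \<Q> \<Longrightarrow> Q \<in> disj_fams V"
    and p: "0 \<le> p" "p \<le> 1" and y: "0 \<le> y"
  shows "Prob (all_edges V) p (\<lambda>X. \<exists>A Q. A \<subseteq> V \<and> 2 \<le> card A \<and> card A \<le> 4 \<and> Q \<in> \<Q> \<and> deviates p y X A Q)
     \<le> 3 * real (card V) ^ 4 * real (card \<Q>) * exp (- y\<^sup>2 / (2 * real (card V)))"
proof -
  let ?n = "card V"
  define I where "I = {A. A \<subseteq> V \<and> 2 \<le> card A \<and> card A \<le> 4}"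
  have fI: "finite I" unfolding I_def by (rule finite_subset[of _ "Pow V"]) (use V in auto)
  have cI: "card I \<le> 3 * ?n ^ 4"
  proof -
    have sub: "I \<subseteq> (\<Union>k\<in>{2,3,4}. {A. A \<subseteq> V \<and> card A = k})" unfolding I_def by auto
    have le: "card {A. A \<subseteq> V \<and> card A = k} \<le> ?n ^ 4" if "k \<le> 4" for k
    proof -
      have "card {A. A \<subseteq> V \<and> card A = k} = ?n choose k" by (rule n_subsets[OF V(1)])
      also have "\<dots> \<le> ?n ^ k"
      proof (cases "k \<le> ?n")
        case True then show ?thesis by (rule binomial_le_pow)
      qed (simp add: binomial_eq_0)
      also have "\<dots> \<le> ?n ^ 4" using V(2) that by (intro power_increasing) auto
      finally show ?thesis .
    qed
    have "card I \<le> card (\<Union>k\<in>{2,3,4}. {A. A \<subseteq> V \<and> card A = k})"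
      by (rule card_mono[OF _ sub]) (auto intro: finite_subset[of _ "Pow V"] simp: V)
    also have "\<dots> \<le> (\<Sum>k\<in>{2,3,4}. card {A. A \<subseteq> V \<and> card A = k})" by (rule card_UN_le) auto
    also have "\<dots> \<le> (\<Sum>k\<in>{2,3,4::nat}. ?n ^ 4)" by (rule sum_mono) (use le in auto)
    finally show ?thesis by simp
  qed
  have "Prob (all_edges V) p (\<lambda>X. \<exists>A Q. A \<subseteq> V \<and> 2 \<le> card A \<and> card A \<le> 4 \<and> Q \<in> \<Q> \<and> deviates p y X A Q)
    \<le> real (card (I \<times> \<Q>)) * exp (- y\<^sup>2 / (2 * real ?n))"
  proof (rule Prob_union_bound)
    fix X assume "\<exists>A Q. A \<subseteq> V \<and> 2 \<le> card A \<and> card A \<le> 4 \<and> Q \<in> \<Q> \<and> deviates p y X A Q"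
    then show "\<exists>z\<in>I \<times> \<Q>. deviates p y X (fst z) (snd z)" by (auto simp: I_def)
  next
    fix z assume "z \<in> I \<times> \<Q>"
    then obtain A Q where z: "z = (A, Q)" "A \<in> I" "Q \<in> \<Q>" by auto
    have QV: "Q \<in> disj_fams V" by (rule Q(2)) fact
    have A: "A \<subseteq> V" "A \<noteq> {}" using z(2) by (auto simp: I_def)
    show "Prob (all_edges V) p (\<lambda>X. deviates p y X (fst z) (snd z)) \<le> exp (- y\<^sup>2 / (2 * real ?n))"
      unfolding deviates_def z(1) fst_conv snd_conv weight_def
      by (rule redcount_upper_general) (use V A QV p y card_fam_le[OF V(1) QV] in \<open>auto simp: disj_fams_def\<close>)
  qed (use V Q fI in auto)
  also have "\<dots> \<le> 3 * real ?n ^ 4 * real (card \<Q>) * exp (- y\<^sup>2 / (2 * real ?n))"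
  proof (rule mult_right_mono)
    have "card (I \<times> \<Q>) \<le> 3 * ?n ^ 4 * card \<Q>" using cI by (simp add: card_cartesian_product)
    then have "real (card (I \<times> \<Q>)) \<le> real (3 * ?n ^ 4 * card \<Q>)" by (simp only: of_nat_le_iff)
    then show "real (card (I \<times> \<Q>)) \<le> 3 * real ?n ^ 4 * real (card \<Q>)" by simp
  qed simp
  finally show ?thesis .
qed

lemma partition_in_disj_fams: "partition_on V P \<Longrightarrow> V \<subseteq> V' \<Longrightarrow> P \<in> disj_fams V'"
  unfolding disj_fams_def using disj_fam_partition[of V P] by (auto simp: partition_on_def)

lemma redcount_restrict:
  assumes "X \<subseteq> all_edges V" "A \<subseteq> U" "\<Union>Q \<subseteq> U"
  shows "redcount (X \<inter> all_edges U) A Q = redcount X A Q"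
proof -
  have "{a, b} \<in> X \<inter> all_edges U \<longleftrightarrow> {a, b} \<in> X" if "a \<in> U" "b \<in> U" for a b
  proof -
    have "a \<noteq> b" if "{a, b} \<in> X" using that assms(1) all_edges_iff[of a b V] by auto
    then show ?thesis using that by (auto simp: all_edges_iff)
  qed
  then have "mixed (X \<inter> all_edges U) A B \<longleftrightarrow> mixed X A B" if "B \<in> Q" for B
    using that assms(2,3) unfolding mixed_def by (meson Union_upper subsetD)
  then show ?thesis unfolding redcount_def by (metis (no_types, lifting) Collect_cong)
qed

lemma mixdeg_outside:
  assumes "A \<subseteq> U" "U \<inter> W = {}"
  shows "mixdeg (X - all_edges U) A W = mixdeg X A W"
proof -
  have "mixed (X - all_edges U) A {x} \<longleftrightarrow> mixed X A {x}" if "x \<in> W" for x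
    using that assms unfolding mixed_def by (auto simp: all_edges_iff)
  then show ?thesis unfolding mixdeg_def by (metis (no_types, lifting) Collect_cong)
qed

lemma weight_Un:
  assumes "partition_on A P" "partition_on B Q" "A \<inter> B = {}" "finite A" "finite B"
  shows "weight F (P \<union> Q) = weight F P + weight F Q"
  unfolding weight_def
proof (rule sum.union_disjoint)
  show "finite P" "finite Q" using finite_partition assms by auto
  show "P \<inter> Q = {}"
  proof (rule ccontr)
    assume "P \<inter> Q \<noteq> {}"
    then obtain C where "C \<in> P" "C \<in> Q" by auto
    then have "C \<subseteq> A" "C \<subseteq> B" "C \<noteq> {}" using assms(1,2) by (auto simp: partition_on_def)
    then show False using assms(3) by auto
  qed
qed

lemma redcount_Diff_le: "finite P \<Longrightarrow> redcount X A (P - {A}) \<le> redcount X A P"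
  by (rule redcount_mono) auto

lemma red_boundedI:
  assumes "finite P" "\<And>A. A \<in> P \<Longrightarrow> redcount X A P \<le> d"
  shows "red_bounded X d P"
  unfolding red_bounded_def using redcount_Diff_le[OF assms(1)] assms(2) le_trans by blast

text \<open>The three blocks are \<open>U1\<close> (good pairs), \<open>U2\<close> and \<open>W\<close>. While good pairs are merged, each of them profits from its small symmetric difference
in \<open>W\<close> (\<open>n1\<close>). Afterwards pairs in \<open>U2\<close> profit from the \<open>m\<close> merged pairs (\<open>n3\<close>); this needs \<open>cond\<close>, where the chosen pairs and
the edges inside of \<open>U1 \<union> U2\<close> are independent. For parts in \<open>W\<close> the chosen pairs are not independent, so they are charged one each,
which the \<open>u\<close> pairs of \<open>U2\<close>, fixed in advance, outweigh (\<open>n4\<close>). Once triples and quadruples appear the slack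
is linear and all parts in \<open>U1 \<union> U2\<close> may be counted as red (\<open>n5\<close>).\<close>

lemma upper_deterministic:
  fixes n u m a c d :: nat and p z C C1 :: real
  defines "s \<equiv> p * (1 - p)" and "U1 \<equiv> {1..u}" and "U2 \<equiv> {u + 1..3 * u}" and "W \<equiv> {3 * u + 1..n}"
    and "T \<equiv> a + c + (a - c) div 2"
  assumes p: "0 \<le> p" "p \<le> 1" and sizes: "3 * u + 4 \<le> n" "card W = 2 * a + c" "c \<le> a"
    and e: "matching U1 m e" "\<And>i. i < m \<Longrightarrow> real (mixdeg X (e i) W) \<le> z"
    and Q2: "Q2 0 = singles U2" "\<forall>t<u. merge_step (Q2 t) (Q2 (Suc t))" "\<forall>t\<le>u. has_sizes U2 (Q2 t) (2 * u - 2 * t) t 0 0"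
    and Q3: "Q3 0 = singles W" "\<forall>t<T. merge_step (Q3 t) (Q3 (Suc t))"
      "\<forall>t\<le>a. has_sizes W (Q3 t) (2 * a + c - 2 * t) t 0 0"
      "\<forall>t\<le>c. has_sizes W (Q3 (a + t)) (c - t) (a - t) t 0"
      "\<forall>t\<le>(a - c) div 2. has_sizes W (Q3 (a + c + t)) 0 (a - c - 2 * t) c t"
    and cond: "\<And>A j i. A \<subseteq> U1 \<union> U2 \<Longrightarrow> card A = 2 \<Longrightarrow> j \<le> m \<Longrightarrow> i \<le> u \<Longrightarrow> \<not> deviates p C1 X A (pair_part e j U1 \<union> Q2 i)"
    and pre: "\<And>A Q. A \<subseteq> {1..n} \<Longrightarrow> 2 \<le> card A \<Longrightarrow> card A \<le> 4 \<Longrightarrow> Q \<in> insert (singles U1) (insert (Q2 u) (Q3 ` {..T})) \<Longrightarrow> \<not> deviates p C X A Q"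
    and n1: "z + (6 * s * real u + 2 + C1) \<le> real d" and n2: "m + u \<le> d"
    and n3: "(2 * s * real (card W) + 2 + C) + (6 * s * real u - 2 * s\<^sup>2 * real m + 2 + C1) \<le> real d"
    and n4: "(2 * s * real u + 2 + C + real m) + ((4 * s - 2 * s\<^sup>2) * real u + 2 + C) + (2 * s * real (card W) + 2 + C) \<le> real d"
    and n5: "2 * real u + (real c * mix_prob p 3 + real a * mix_prob p 6 + 3 + C) \<le> real d"
      "2 * real u + (real (a - c) * mix_prob p 8 + real c * mix_prob p 12 + 4 + C) \<le> real d"
    and n6: "2 * u + (a - (a - c) div 2) \<le> Suc d"
  shows "reducible X d (singles {1..n})"
proof -
  have fin: "finite U1" "finite U2" "finite W" by (auto simp: U1_def U2_def W_def)
  have dj: "U1 \<inter> U2 = {}" "U1 \<inter> W = {}" "U2 \<inter> W = {}" by (auto simp: U1_def U2_def W_def)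
  have V: "U1 \<union> U2 \<union> W = {1..n}" using sizes(1) by (auto simp: U1_def U2_def W_def)
  have cU: "card U1 = u" "card U2 = 2 * u" by (auto simp: U1_def U2_def)
  have Wne: "W \<noteq> {}" using sizes(1) by (auto simp: W_def)
  have s0: "0 \<le> s" using p by (simp add: s_def)
  define A where "A t = pair_part e t U1" for t
  have A_sizes: "has_sizes U1 (A t) (u - 2 * t) t 0 0" if "t \<le> m" for t
    using pair_part_sizes[OF matching_mono[OF e(1) that] fin(1)] cU by (simp add: A_def)
  have A_part: "partition_on U1 (A t)" if "t \<le> m" for t using A_sizes[OF that] by (simp add: has_sizes_def)
  have Q2_part: "partition_on U2 (Q2 t)" if "t \<le> u" for t using Q2(3) that by (simp add: has_sizes_def)
  have stage: "t \<le> a \<or> (\<exists>k\<le>c. t = a + k) \<or> (\<exists>k\<le>(a - c) div 2. t = a + c + k)" if "t \<le> T" for t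
  proof -
    consider "t \<le> a" | "a < t" "t \<le> a + c" | "a + c < t" by linarith
    then show ?thesis
    proof cases
      case 2 then have "t - a \<le> c" "t = a + (t - a)" by auto
      then show ?thesis by blast
    next
      case 3 then have "t - (a + c) \<le> (a - c) div 2" "t = a + c + (t - (a + c))" using that by (auto simp: T_def)
      then show ?thesis by blast
    qed auto
  qed
  have Q3_part: "partition_on W (Q3 t)" if "t \<le> T" for t
    using stage[OF that] Q3(3-5) by (auto simp: has_sizes_def)
  have fA: "finite (A t)" if "t \<le> m" for t using finite_partition[OF fin(1) A_part[OF that]] .
  have fQ2: "finite (Q2 t)" if "t \<le> u" for t using finite_partition[OF fin(2) Q2_part[OF that]] .
  have fQ3: "finite (Q3 t)" if "t \<le> T" for t using finite_partition[OF fin(3) Q3_part[OF that]] .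
  have nd: "real (redcount X B Q) \<le> weight (\<lambda>k. mix_prob p (card B * k)) Q + real (card B) + y" if "\<not> deviates p y X B Q" for y B Q
    using that by (simp add: deviates_def)
  have g4: "mix_prob p 4 \<le> 2 * mix_prob p 2" using mix_prob_subadditive[of p 2 1 1] p by simp
  have g2: "mix_prob p 2 = 2 * s" "mix_prob p 4 = 4 * s - 2 * s\<^sup>2" by (simp_all add: mix_prob_polys s_def)
  have rc_sing_singles: "redcount X {x} (singles B) = 0" for x and B :: "nat set"
  proof -
    have "{C \<in> singles B. mixed X {x} C} = {}" by (auto simp: singles_def mixed_def)
    then show ?thesis unfolding redcount_def by (simp only: card.empty)
  qed
  have weight_A: "weight (\<lambda>k. mix_prob p (2 * k)) (A j \<union> Q2 i) \<le> 6 * s * real u - 2 * s\<^sup>2 * (real j + real i)"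
    if "j \<le> m" "i \<le> u" "2 * j \<le> u" for i j
  proof -
    have "weight (\<lambda>k. mix_prob p (2 * k)) (A j \<union> Q2 i) = weight (\<lambda>k. mix_prob p (2 * k)) (A j) + weight (\<lambda>k. mix_prob p (2 * k)) (Q2 i)"
      by (rule weight_Un[OF A_part Q2_part dj(1) fin(1,2)]) (use that in auto)
    also have "\<dots> = (real (u - 2 * j) * mix_prob p 2 + real j * mix_prob p 4) + (real (2 * u - 2 * i) * mix_prob p 2 + real i * mix_prob p 4)"
      using A_sizes[OF that(1)] Q2(3) that(2) by (simp add: has_sizes_def)
    also have "\<dots> = 6 * s * real u - 2 * s\<^sup>2 * (real j + real i)"
      using that unfolding g2 by (simp add: of_nat_diff algebra_simps)
    finally show ?thesis by simp
  qed
  have mu: "2 * j \<le> u" if "j \<le> m" for j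
  proof -
    have "card (\<Union> (e ` {..<j})) \<le> card U1" using matching_mono[OF e(1) that] fin(1)
      by (intro card_mono) (auto simp: matching_def)
    moreover have "card (\<Union> (e ` {..<j})) = (\<Sum>i<j. card (e i))"
      by (rule card_UN_disjoint) (use matching_mono[OF e(1) that] in \<open>auto simp: matching_def intro: card_ge_0_finite\<close>)
    moreover have "(\<Sum>i<j. card (e i)) = 2 * j" using matching_mono[OF e(1) that] by (simp add: matching_def)
    ultimately show ?thesis using cU by simp
  qed
  have cond': "real (redcount X B (A j \<union> Q2 i)) \<le> 6 * s * real u - 2 * s\<^sup>2 * (real j + real i) + 2 + C1"
    if "B \<subseteq> U1 \<union> U2" "card B = 2" "j \<le> m" "i \<le> u" for B i j
    using nd[OF cond[OF that]] weight_A[OF that(3,4) mu[OF that(3)]] that(2) unfolding A_def by simp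
  have weight_singles: "weight F (singles B) = real (card B) * F 1" if "finite B" for F and B :: "nat set"
    using has_sizes_singles[OF that] by (simp add: has_sizes_def)
  have W0: "singles W \<in> Q3 ` {..T}" unfolding Q3(1)[symmetric] by simp
  have ge2: "B \<subseteq> {1..n} \<Longrightarrow> card B = 2 \<Longrightarrow> real (redcount X B (singles W)) \<le> 2 * s * real (card W) + 2 + C" for B
    using nd[OF pre[of B "singles W"]] weight_singles[OF fin(3)] W0 by (simp add: g2 mult.commute)
  have ext: "\<exists>B'. B \<subseteq> B' \<and> B' \<subseteq> {1..n} \<and> card B' = k" if "B \<subseteq> {1..n}" "card B \<le> k" "k \<le> 4" for B k
    using exists_subset_between[of B k "{1..n}"] that sizes(1) by auto
  have "reducible X d (singles (U1 \<union> U2 \<union> W))"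
  proof (rule three_stage_reducible[where A = A and B = Q2 and C = Q3 and m = m and k = u and l = T, OF fin dj Wne])
    show "A 0 = singles U1" by (simp add: A_def)
    show "merge_step (A t) (A (Suc t))" if "t < m" for t unfolding A_def by (rule pair_part_step[OF e(1) that])
    show "red_bounded X d (A t \<union> singles U2 \<union> singles W)" if t: "t < m" for t
    proof (rule red_boundedI)
      show "finite (A t \<union> singles U2 \<union> singles W)" using fA[of t] t fin by (simp add: singles_def)
      fix B assume B: "B \<in> A t \<union> singles U2 \<union> singles W"
      have split: "redcount X B (A t \<union> singles U2 \<union> singles W) \<le> redcount X B (A t \<union> singles U2) + redcount X B (singles W)"
        by (rule redcount_Un)
      show "redcount X B (A t \<union> singles U2 \<union> singles W) \<le> d"
      proof (cases "\<exists>x. B = {x}")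
        case True
        then obtain x where x: "B = {x}" by auto
        have "redcount X B (A t \<union> singles U2) \<le> redcount X B (A t) + redcount X B (singles U2)" by (rule redcount_Un)
        moreover have "redcount X B (A t) \<le> t" using redcount_singleton[OF fin(1) A_sizes[of t], of X x] t x by simp
        ultimately show ?thesis using split rc_sing_singles x n2 t by simp
      next
        case False
        then obtain i where i: "B = e i" "i < t" using B by (auto simp: A_def pair_part_def singles_def)
        have B2: "card B = 2" "B \<subseteq> U1" using e(1) i t by (auto simp: matching_def)
        have "real (redcount X B (A t \<union> singles U2)) \<le> 6 * s * real u - 2 * s\<^sup>2 * (real t + real 0) + 2 + C1"
          unfolding Q2(1)[symmetric] by (rule cond') (use B2 t in auto)
        also have "\<dots> \<le> 6 * s * real u + 2 + C1" by simp
        finally have "real (redcount X B (A t \<union> singles U2)) \<le> 6 * s * real u + 2 + C1" .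
        moreover have "real (redcount X B (singles W)) \<le> z" unfolding redcount_singles using e(2)[of i] i t by simp
        ultimately show ?thesis using split n1 by linarith
      qed
    qed
    show "red_bounded X d (A m \<union> Q2 t \<union> singles W)" if t: "t < u" for t
    proof (rule red_boundedI)
      show "finite (A m \<union> Q2 t \<union> singles W)" using fA fQ2[of t] t fin by (simp add: singles_def)
      fix B assume B: "B \<in> A m \<union> Q2 t \<union> singles W"
      have split: "redcount X B (A m \<union> Q2 t \<union> singles W) \<le> redcount X B (A m \<union> Q2 t) + redcount X B (singles W)"
        by (rule redcount_Un)
      note sz2 = Q2(3)[rule_format, of t, OF less_imp_le[OF t]]
      show "redcount X B (A m \<union> Q2 t \<union> singles W) \<le> d"
      proof (cases "\<exists>x. B = {x}")
        case True
        then obtain x where x: "B = {x}" by auto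
        have "redcount X B (A m \<union> Q2 t) \<le> redcount X B (A m) + redcount X B (Q2 t)" by (rule redcount_Un)
        moreover have "redcount X B (A m) \<le> m" using redcount_singleton[OF fin(1) A_sizes[of m], of X x] x by simp
        moreover have "redcount X B (Q2 t) \<le> t" using redcount_singleton[OF fin(2) sz2, of X x] x by simp
        ultimately show ?thesis using split rc_sing_singles x n2 t by simp
      next
        case False
        then have B': "B \<in> A m \<union> Q2 t" using B by (auto simp: singles_def)
        then have BU: "B \<subseteq> U1 \<union> U2" using part_sizes(2)[OF fin(1) A_part[of m]] part_sizes(2)[OF fin(2) Q2_part[of t]] t by fastforce
        have "card B \<le> 2" using B' has_sizes_max[OF fin(1) A_sizes[of m], of B 2] has_sizes_max[OF fin(2) sz2, of B 2] by auto
        moreover have "1 \<le> card B" using B' part_sizes(1)[OF fin(1) A_part[of m]] part_sizes(1)[OF fin(2) Q2_part[of t]] t by fastforce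
        moreover have "card B \<noteq> 1" using False by (auto simp: card_1_singleton_iff)
        ultimately have B2: "card B = 2" by simp
        have "real (redcount X B (A m \<union> Q2 t)) \<le> 6 * s * real u - 2 * s\<^sup>2 * (real m + real t) + 2 + C1"
          by (rule cond') (use B2 BU t in auto)
        also have "\<dots> \<le> 6 * s * real u - 2 * s\<^sup>2 * real m + 2 + C1" by (simp add: algebra_simps)
        finally have "real (redcount X B (A m \<union> Q2 t)) \<le> 6 * s * real u - 2 * s\<^sup>2 * real m + 2 + C1" .
        moreover have "real (redcount X B (singles W)) \<le> 2 * s * real (card W) + 2 + C"
          by (rule ge2) (use BU B2 V in auto)
        ultimately show ?thesis using split n3 by linarith
      qed
    qed
    show "red_bounded X d (A m \<union> Q2 u \<union> Q3 t)" if t: "t < T" for t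
    proof (rule red_boundedI)
      show "finite (A m \<union> Q2 u \<union> Q3 t)" using fA fQ2 fQ3[of t] t by simp
      fix B assume B: "B \<in> A m \<union> Q2 u \<union> Q3 t"
      have BV: "B \<subseteq> {1..n}" using B V part_sizes(2)[OF fin(1) A_part[of m]] part_sizes(2)[OF fin(2) Q2_part[of u]]
          part_sizes(2)[OF fin(3) Q3_part[of t]] t by fastforce
      have small: "card B \<le> k" if "2 \<le> k" "B \<in> Q3 t \<Longrightarrow> card B \<le> k" for k
      proof -
        have "card B \<le> 2" if "B \<in> A m" using has_sizes_max[OF fin(1) A_sizes[of m] that, of 2] by simp
        moreover have "card B \<le> 2" if "B \<in> Q2 u" using has_sizes_max[OF fin(2) Q2(3)[rule_format, of u] that, of 2] by simp
        ultimately show ?thesis using B that by fastforce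
      qed
      have split: "redcount X B (A m \<union> Q2 u \<union> Q3 t) \<le> redcount X B' (A m) + redcount X B' (Q2 u) + redcount X B' (Q3 t)"
        if "B \<subseteq> B'" for B'
      proof -
        have "redcount X B (A m \<union> Q2 u \<union> Q3 t) \<le> redcount X B' (A m \<union> Q2 u \<union> Q3 t)"
          by (rule redcount_mono_left) (use fA fQ2 fQ3[of t] t that in auto)
        then show ?thesis using redcount_Un[of X B' "A m \<union> Q2 u" "Q3 t"] redcount_Un[of X B' "A m" "Q2 u"] by linarith
      qed
      have crude: "redcount X B' (A m) + redcount X B' (Q2 u) \<le> 2 * u" for B'
      proof -
        have "card (A m) = u - 2 * m + m" "card (Q2 u) = u"
          using has_sizes_cnt(4)[OF fin(1) A_sizes[of m]] has_sizes_cnt(4)[OF fin(2) Q2(3)[rule_format, of u]] by auto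
        then have "card (A m) \<le> u" "card (Q2 u) = u" using mu[of m] by auto
        then show ?thesis using redcount_le_card[OF fA[of m], of X B'] redcount_le_card[OF fQ2[of u], of X B'] by simp
      qed
      have Qmem: "Q3 t \<in> insert (singles U1) (insert (Q2 u) (Q3 ` {..T}))" using t by auto
      show "redcount X B (A m \<union> Q2 u \<union> Q3 t) \<le> d"
      proof (cases "t < a")
        case True
        note sz = Q3(3)[rule_format, of t, OF less_imp_le[OF True]]
        have "card B \<le> 2" by (rule small) (use has_sizes_max[OF fin(3) sz, of B 2] in auto)
        then obtain B' where B': "B \<subseteq> B'" "B' \<subseteq> {1..n}" "card B' = 2" using ext[OF BV, of 2] by auto
        have "redcount X B' (A m) \<le> m + redcount X B' (singles U1)" unfolding A_def by (rule redcount_pair_part[OF fin(1)])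
        moreover have "real (redcount X B' (singles U1)) \<le> 2 * s * real u + 2 + C"
          using nd[OF pre[of B' "singles U1"]] B' weight_singles[OF fin(1)] cU by (simp add: g2 mult.commute)
        moreover have "real (redcount X B' (Q2 u)) \<le> (4 * s - 2 * s\<^sup>2) * real u + 2 + C"
        proof -
          have "weight (\<lambda>k. mix_prob p (2 * k)) (Q2 u) = real u * mix_prob p 4" using Q2(3) by (simp add: has_sizes_def)
          then show ?thesis using nd[OF pre[of B' "Q2 u"]] B' by (simp add: g2 mult.commute)
        qed
        moreover have "real (redcount X B' (Q3 t)) \<le> 2 * s * real (card W) + 2 + C"
        proof -
          have "weight (\<lambda>k. mix_prob p (2 * k)) (Q3 t) = real (2 * a + c - 2 * t) * mix_prob p 2 + real t * mix_prob p 4"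
            using sz by (simp add: has_sizes_def)
          also have "\<dots> \<le> real (2 * a + c - 2 * t) * mix_prob p 2 + real t * (2 * mix_prob p 2)"
            using g4 by (intro add_left_mono mult_left_mono) auto
          also have "\<dots> = 2 * s * real (card W)" using True unfolding sizes(2) g2 by (simp add: of_nat_diff algebra_simps)
          finally show ?thesis using nd[OF pre[OF B'(2) _ _ Qmem]] B' by simp
        qed
        ultimately show ?thesis using split[OF B'(1)] n4 by linarith
      next
        case False
        show ?thesis
        proof (cases "t < a + c")
          case True
          define k where "k = t - a"
          have k: "k \<le> c" "t = a + k" using True False by (auto simp: k_def)
          note sz = Q3(4)[rule_format, OF k(1), folded k(2)]
          have "card B \<le> 3" by (rule small) (use has_sizes_max[OF fin(3) sz, of B 3] in auto)
          then obtain B' where B': "B \<subseteq> B'" "B' \<subseteq> {1..n}" "card B' = 3" using ext[OF BV, of 3] by auto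
          have "real (redcount X B' (Q3 t)) \<le> real c * mix_prob p 3 + real a * mix_prob p 6 + 3 + C"
          proof -
            have "mix_prob p 9 \<le> mix_prob p 3 + mix_prob p 6" using mix_prob_subadditive[of p 3 1 2] p by simp
            then have "real k * mix_prob p 9 \<le> real k * (mix_prob p 3 + mix_prob p 6)" by (intro mult_left_mono) auto
            moreover have "weight (\<lambda>k. mix_prob p (3 * k)) (Q3 t) = real (c - k) * mix_prob p 3 + real (a - k) * mix_prob p 6 + real k * mix_prob p 9"
              using sz by (simp add: has_sizes_def)
            ultimately have "weight (\<lambda>k. mix_prob p (3 * k)) (Q3 t) \<le> real c * mix_prob p 3 + real a * mix_prob p 6"
              using k(1) sizes(3) by (simp add: of_nat_diff algebra_simps)
            then show ?thesis using nd[OF pre[OF B'(2) _ _ Qmem]] B' by simp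
          qed
          then show ?thesis using split[OF B'(1)] crude[of B'] n5(1) by linarith
        next
          case False
          define k where "k = t - (a + c)"
          have k: "k \<le> (a - c) div 2" "t = a + c + k" using False t by (auto simp: k_def T_def)
          note sz = Q3(5)[rule_format, OF k(1), folded k(2)]
          have "card B \<le> 4" by (rule small) (use has_sizes_max[OF fin(3) sz, of B 4] in auto)
          then obtain B' where B': "B \<subseteq> B'" "B' \<subseteq> {1..n}" "card B' = 4" using ext[OF BV, of 4] by auto
          have "real (redcount X B' (Q3 t)) \<le> real (a - c) * mix_prob p 8 + real c * mix_prob p 12 + 4 + C"
          proof -
            have "mix_prob p 16 \<le> 2 * mix_prob p 8" using mix_prob_subadditive[of p 4 2 2] p by simp
            then have "real k * mix_prob p 16 \<le> real k * (2 * mix_prob p 8)" by (intro mult_left_mono) auto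
            moreover have "weight (\<lambda>k. mix_prob p (4 * k)) (Q3 t) = real (a - c - 2 * k) * mix_prob p 8 + real c * mix_prob p 12 + real k * mix_prob p 16"
              using sz by (simp add: has_sizes_def)
            moreover have "real (a - c - 2 * k) * mix_prob p 8 = real (a - c) * mix_prob p 8 - real k * (2 * mix_prob p 8)"
            proof -
              have "real (a - c - 2 * k) = real (a - c) - 2 * real k" using k(1) by (simp add: of_nat_diff)
              then show ?thesis by (simp only: left_diff_distrib)
            qed
            ultimately have "weight (\<lambda>k. mix_prob p (4 * k)) (Q3 t) \<le> real (a - c) * mix_prob p 8 + real c * mix_prob p 12" by linarith
            then show ?thesis using nd[OF pre[OF B'(2) _ _ Qmem]] B' by simp
          qed
          then show ?thesis using split[OF B'(1)] crude[of B'] n5(2) by linarith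
        qed
      qed
    qed
    show "card (A m) + card (Q2 u) + card (Q3 T) \<le> Suc d"
    proof -
      have "card (A m) \<le> u" using has_sizes_cnt(4)[OF fin(1) A_sizes[of m]] mu[of m] by simp
      moreover have "card (Q2 u) = u" using has_sizes_cnt(4)[OF fin(2) Q2(3)[rule_format, of u]] by simp
      moreover have "card (Q3 T) = a - (a - c) div 2"
      proof -
        have sz: "has_sizes W (Q3 T) 0 (a - c - 2 * ((a - c) div 2)) c ((a - c) div 2)" using Q3(5) by (simp add: T_def)
        have "card (Q3 T) = a - c - 2 * ((a - c) div 2) + c + (a - c) div 2" using has_sizes_cnt(4)[OF fin(3) sz] by simp
        then show ?thesis using sizes(3) by linarith
      qed
      ultimately show ?thesis using n6 by simp
    qed
  qed (use A_part Q2 Q2_part Q3 Q3_part in auto)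
  then show ?thesis unfolding V .
qed

text \<open>The selection rule is a choice function applied to the edges that do not lie inside \<open>U1 \<union> U2\<close>; being a good pair
depends only on edges between \<open>U1\<close> and \<open>W\<close>, so it is not affected by forgetting the others.\<close>

lemma upper_fixed:
  fixes n u m a c d :: nat and p z C C1 :: real
  defines "s \<equiv> p * (1 - p)" and "W \<equiv> {3 * u + 1..n}"
  assumes p: "0 \<le> p" "p \<le> 1" and sizes: "3 * u + 4 \<le> n" "card W = 2 * a + c" "c \<le> a" "0 < u"
    and C: "0 \<le> C" "0 \<le> C1"
    and n1: "z + (6 * s * real u + 2 + C1) \<le> real d" and n2: "m + u \<le> d"
    and n3: "(2 * s * real (card W) + 2 + C) + (6 * s * real u - 2 * s\<^sup>2 * real m + 2 + C1) \<le> real d"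
    and n4: "(2 * s * real u + 2 + C + real m) + ((4 * s - 2 * s\<^sup>2) * real u + 2 + C) + (2 * s * real (card W) + 2 + C) \<le> real d"
    and n5: "2 * real u + (real c * mix_prob p 3 + real a * mix_prob p 6 + 3 + C) \<le> real d"
      "2 * real u + (real (a - c) * mix_prob p 8 + real c * mix_prob p 12 + 4 + C) \<le> real d"
    and n6: "2 * u + (a - (a - c) div 2) \<le> Suc d"
  shows "Prob (all_edges {1..n}) p (\<lambda>X. \<not> reducible X d (singles {1..n})) \<le>
    Prob (all_edges {1..n}) p (\<lambda>X. \<not> (\<exists>e. matching {1..u} m e \<and> (\<forall>i<m. real (mixdeg X (e i) W) \<le> z)))
    + 3 * real n ^ 4 * (real n + 3) * exp (- C\<^sup>2 / (2 * real n))
    + 3 * (3 * real u) ^ 4 * ((real m + 1) * (real u + 1)) * exp (- C1\<^sup>2 / (2 * (3 * real u)))"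
proof -
  define U1 where "U1 = {1..u}"
  define U2 where "U2 = {u + 1..3 * u}"
  define U where "U = U1 \<union> U2"
  define T where "T = a + c + (a - c) div 2"
  let ?V = "{1..n}" and ?S = "all_edges {1..n}"
  have fin: "finite U1" "finite U2" "finite W" "finite U" by (auto simp: U1_def U2_def W_def U_def)
  have UV: "U \<subseteq> ?V" "W \<subseteq> ?V" "U1 \<subseteq> ?V" "U2 \<subseteq> ?V" "U \<inter> W = {}" "U1 \<subseteq> U"
    using sizes(1) by (auto simp: U_def U1_def U2_def W_def)
  have cU: "card U2 = 2 * u" "card U = 3 * u"
  proof -
    show "card U2 = 2 * u" by (simp add: U2_def)
    have "U = {1..3 * u}" by (auto simp: U_def U1_def U2_def)
    then show "card U = 3 * u" by simp
  qed
  obtain Q2 where Q2: "Q2 0 = singles U2" "\<forall>t<u. merge_step (Q2 t) (Q2 (Suc t))" "\<forall>t\<le>u. has_sizes U2 (Q2 t) (2 * u - 2 * t) t 0 0"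
    using pairing_chain[OF fin(2) cU(1)] by auto
  obtain Q3 where Q3: "Q3 0 = singles W" "\<forall>t<T. merge_step (Q3 t) (Q3 (Suc t))"
      "\<forall>t\<le>a. has_sizes W (Q3 t) (2 * a + c - 2 * t) t 0 0"
      "\<forall>t\<le>c. has_sizes W (Q3 (a + t)) (c - t) (a - t) t 0"
      "\<forall>t\<le>(a - c) div 2. has_sizes W (Q3 (a + c + t)) 0 (a - c - 2 * t) c t"
    using quad_chain[OF fin(3) sizes(2,3)] unfolding T_def by auto
  have Q3_part: "\<forall>t\<le>T. partition_on W (Q3 t)"
  proof -
    have chain: "partition_on W (Q3 t)" if "t \<le> T" for t
      using chain_partition[OF fin(3), of Q3 T t] Q3(1,2) that partition_on_singles[of W] by simp
    then show ?thesis by blast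
  qed
  define fam1 where "fam1 = insert (singles U1) (insert (Q2 u) (Q3 ` {..T}))"
  define fam2 where "fam2 e = (\<lambda>(j, i). pair_part e j U1 \<union> Q2 i) ` ({..m} \<times> {..u})" for e
  define E1 where "E1 X \<longleftrightarrow> (\<exists>A Q. A \<subseteq> ?V \<and> 2 \<le> card A \<and> card A \<le> 4 \<and> Q \<in> fam1 \<and> deviates p C X A Q)" for X
  define bad where "bad e X \<longleftrightarrow> matching U1 m e \<and> (\<exists>A Q. A \<subseteq> U \<and> 2 \<le> card A \<and> card A \<le> 4 \<and> Q \<in> fam2 e \<and> deviates p C1 X A Q)" for e X
  define ok where "ok e X \<longleftrightarrow> matching U1 m e \<and> (\<forall>i<m. real (mixdeg X (e i) W) \<le> z)" for e X
  define sel where "sel X = (SOME e. ok e X)" for X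
  have ok_outside: "ok e (X - all_edges U) \<longleftrightarrow> ok e X" for e X
  proof -
    have "mixdeg (X - all_edges U) (e i) W = mixdeg X (e i) W" if "matching U1 m e" "i < m" for i
    proof (rule mixdeg_outside)
      have "e i \<subseteq> U1" using that unfolding matching_def by blast
      then show "e i \<subseteq> U" using UV(6) by blast
    qed (rule UV(5))
    then show ?thesis unfolding ok_def by auto
  qed
  have P1: "Prob ?S p E1 \<le> 3 * real n ^ 4 * (real n + 3) * exp (- C\<^sup>2 / (2 * real n))"
  proof -
    have "Prob ?S p E1 \<le> 3 * real (card ?V) ^ 4 * real (card fam1) * exp (- C\<^sup>2 / (2 * real (card ?V)))"
      unfolding E1_def
    proof (rule prescribed_families)
      fix Q assume "Q \<in> fam1"
      then consider "Q = singles U1" | "Q = Q2 u" | t where "t \<le> T" "Q = Q3 t" by (auto simp: fam1_def)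
      then show "Q \<in> disj_fams ?V"
      proof cases
        case 1 then show ?thesis using partition_in_disj_fams[OF partition_on_singles UV(3)] by simp
      next
        case 2 then show ?thesis using partition_in_disj_fams[OF _ UV(4)] Q2(3) by (auto simp: has_sizes_def)
      next
        case 3 then show ?thesis using partition_in_disj_fams[OF _ UV(2)] Q3_part by auto
      qed
    qed (use p C sizes(1) in \<open>auto simp: fam1_def\<close>)
    also have "\<dots> \<le> 3 * real n ^ 4 * (real n + 3) * exp (- C\<^sup>2 / (2 * real n))"
    proof -
      have "T + 3 \<le> n + 3"
      proof -
        have "card W \<le> n" by (simp add: W_def)
        then show ?thesis using sizes(2,3) by (simp add: T_def)
      qed
      moreover have "card fam1 \<le> card (Q3 ` {..T}) + 2"
        unfolding fam1_def using card_insert_le_m1[of 1] by (simp add: card_insert_if)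
      moreover have "card (Q3 ` {..T}) \<le> T + 1" using card_image_le[of "{..T}" Q3] by simp
      ultimately have "real (card fam1) \<le> real n + 3" by linarith
      then show ?thesis by (simp add: mult_left_mono mult_right_mono)
    qed
    finally show ?thesis .
  qed
  have P2: "Prob ?S p (\<lambda>X. bad (sel (X - all_edges U)) X) \<le> 3 * (3 * real u) ^ 4 * ((real m + 1) * (real u + 1)) * exp (- C1\<^sup>2 / (2 * (3 * real u)))"
  proof (rule Prob_conditional)
    show "finite ?S" by simp
    show "all_edges U \<subseteq> ?S" using UV(1) by (auto simp: all_edges_def)
    fix e :: "nat \<Rightarrow> nat set"
    have fam2_part: "\<exists>j i. Q = pair_part e j U1 \<union> Q2 i \<and> partition_on U Q" if M: "matching U1 m e" and Qm: "Q \<in> fam2 e" for Q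
    proof -
      obtain j i where ji: "j \<le> m" "i \<le> u" "Q = pair_part e j U1 \<union> Q2 i" using Qm by (auto simp: fam2_def)
      have "partition_on U Q" unfolding ji(3) U_def
      proof (rule partition_on_Un[OF pair_part_partition[OF matching_mono[OF M ji(1)]]])
        show "partition_on U2 (Q2 i)" using Q2(3) ji by (simp add: has_sizes_def)
      qed (auto simp: U1_def U2_def)
      then show ?thesis using ji by blast
    qed
    show "Prob (all_edges U) p (bad e) \<le> 3 * (3 * real u) ^ 4 * ((real m + 1) * (real u + 1)) * exp (- C1\<^sup>2 / (2 * (3 * real u)))"
    proof (cases "matching U1 m e")
      case False
      then have "{X. bad e X} = {}" by (auto simp: bad_def)
      then show ?thesis by simp
    next
      case True
      have "Prob (all_edges U) p (bad e) \<le> Prob (all_edges U) p (\<lambda>X. \<exists>A Q. A \<subseteq> U \<and> 2 \<le> card A \<and> card A \<le> 4 \<and> Q \<in> fam2 e \<and> deviates p C1 X A Q)"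
        by (rule Prob_mono) (use fin in \<open>auto simp: bad_def\<close>)
      also have "\<dots> \<le> 3 * real (card U) ^ 4 * real (card (fam2 e)) * exp (- C1\<^sup>2 / (2 * real (card U)))"
      proof (rule prescribed_families)
        fix Q assume "Q \<in> fam2 e"
        then show "Q \<in> disj_fams U" using fam2_part[OF True] partition_in_disj_fams[of U Q U] by blast
      qed (use fin p C sizes cU in \<open>auto simp: fam2_def\<close>)
      also have "\<dots> \<le> 3 * real (card U) ^ 4 * ((real m + 1) * (real u + 1)) * exp (- C1\<^sup>2 / (2 * real (card U)))"
      proof (intro mult_right_mono mult_left_mono)
        have "card (fam2 e) \<le> card ({..m} \<times> {..u})" unfolding fam2_def by (rule card_image_le) simp
        also have "\<dots> = (m + 1) * (u + 1)" by (simp add: card_cartesian_product)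
        finally have "real (card (fam2 e)) \<le> real ((m + 1) * (u + 1))" by (simp only: of_nat_le_iff)
        then show "real (card (fam2 e)) \<le> (real m + 1) * (real u + 1)" by (simp only: of_nat_mult of_nat_add of_nat_1)
      qed auto
      finally show ?thesis unfolding cU by simp
    qed
    fix X assume X: "X \<subseteq> ?S" and b: "bad e X"
    then obtain A Q where AQ: "A \<subseteq> U" "2 \<le> card A" "card A \<le> 4" "Q \<in> fam2 e" "deviates p C1 X A Q" and M: "matching U1 m e"
      unfolding bad_def by blast
    have "\<Union>Q = U" using fam2_part[OF M AQ(4)] by (auto simp: partition_on_def)
    then have "deviates p C1 (X \<inter> all_edges U) A Q"
      using AQ(5) redcount_restrict[OF X AQ(1), of Q] by (simp add: deviates_def)
    then show "bad e (X \<inter> all_edges U)" unfolding bad_def using M AQ by blast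
  qed
  have "Prob ?S p (\<lambda>X. \<not> reducible X d (singles ?V)) \<le> Prob ?S p (\<lambda>X. \<not> (\<exists>e. ok e X)) + Prob ?S p (\<lambda>X. E1 X \<or> bad (sel (X - all_edges U)) X)"
  proof (rule Prob_disj)
    fix X assume X: "X \<subseteq> ?S" and no: "\<not> reducible X d (singles ?V)"
    show "\<not> (\<exists>e. ok e X) \<or> (E1 X \<or> bad (sel (X - all_edges U)) X)"
    proof (rule ccontr)
      assume neg: "\<not> ?thesis"
      then have ex: "\<exists>e. ok e (X - all_edges U)" and nE: "\<not> E1 X" and nb: "\<not> bad (sel (X - all_edges U)) X"
        by (auto simp: ok_outside)
      define e where "e = sel (X - all_edges U)"
      have "ok e (X - all_edges U)" unfolding e_def sel_def using ex by (rule someI_ex)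
      then have ok: "matching U1 m e" "\<And>i. i < m \<Longrightarrow> real (mixdeg X (e i) W) \<le> z" unfolding ok_outside by (auto simp: ok_def)
      have "reducible X d (singles ?V)"
      proof (rule upper_deterministic[of p u n a c m e X z Q2 Q3 C1 C d])
        show "\<not> deviates p C1 X A (pair_part e j {1..u} \<union> Q2 i)"
          if "A \<subseteq> {1..u} \<union> {u + 1..3 * u}" "card A = 2" "j \<le> m" "i \<le> u" for A j i
        proof -
          have "pair_part e j U1 \<union> Q2 i \<in> fam2 e" using that by (auto simp: fam2_def)
          moreover have "\<not> bad e X" using nb by (simp add: e_def)
          ultimately show ?thesis using ok(1) that unfolding bad_def U_def U1_def U2_def by auto
        qed
        show "\<not> deviates p C X A Q" if "A \<subseteq> {1..n}" "2 \<le> card A" "card A \<le> 4"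
          "Q \<in> insert (singles {1..u}) (insert (Q2 u) (Q3 ` {..a + c + (a - c) div 2}))" for A Q
          using nE that unfolding E1_def fam1_def U1_def T_def by blast
      qed (use p sizes ok Q2 Q3 n1 n2 n3 n4 n5 n6 in \<open>simp_all add: U1_def U2_def W_def T_def s_def\<close>)
      then show False using no by simp
    qed
  qed simp
  also have "Prob ?S p (\<lambda>X. E1 X \<or> bad (sel (X - all_edges U)) X) \<le> Prob ?S p E1 + Prob ?S p (\<lambda>X. bad (sel (X - all_edges U)) X)"
    by (rule Prob_disj) auto
  finally show ?thesis using P1 P2 unfolding ok_def U1_def by linarith
qed

text \<open>Verification of the numerical hypotheses of \<open>upper_fixed\<close> for large \<open>n\<close>. The block size is \<open>u = \<epsilon>1 * n\<close>
for a small constant \<open>\<epsilon>1\<close>: then the fluctuation \<open>4 * sqrt (3 * u * ln n)\<close> inside \<open>U1 \<union> U2\<close> is a small fraction of the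
critical deviation. All other comparisons are between the scales \<open>sqrt (n * ln n)\<close>,
\<open>sqrt n * ln n\<close> and \<open>n\<close>, here \<open>g\<close>, \<open>h\<close> and \<open>n\<close>.\<close>

lemma tww_upper_critical:
  fixes p \<epsilon> :: real
  assumes p: "0.4012 < p" "p \<le> 1/2" "critical_poly (p * (1 - p)) < 0" and eps: "0 < \<epsilon>" "\<epsilon> \<le> 1/100"
  defines "r \<equiv> 2 * p * (1 - p)"
  shows "edge_whp p (\<lambda>n X. real (tww (trigraph_of_graph ({1..n}, X))) \<le>
     r * real n - (1 - 2 * \<epsilon>) * (sqrt (3 * (r * (1 - r))) * sqrt (real n * ln (real n))))"
proof -
  define s where "s = p * (1 - p)"
  define v where "v = r * (1 - r)"
  define K where "K = sqrt (3 * v)"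
  define g where "g n = sqrt (real n * ln (real n))" for n :: nat
  define h where "h n = sqrt (real n) * ln (real n)" for n :: nat
  obtain \<alpha> \<eta> where al: "2 / 5 \<le> \<alpha>" "\<alpha> < 1 / 2" "0 < \<eta>"
    "(1 - 2 * \<alpha>) * mix_prob p 3 + \<alpha> * mix_prob p 6 \<le> 2 * s - \<eta>" "(3 * \<alpha> - 1) * mix_prob p 8 + (1 - 2 * \<alpha>) * mix_prob p 12 \<le> 2 * s - \<eta>"
    using supercritical_core[OF p] unfolding s_def by blast
  have p01: "0 \<le> p" "p \<le> 1" using p by auto
  have "0.4012 * (1 - 0.4012) < s" unfolding s_def using p by (intro prod_strict_mono) auto
  then have s0: "0.24 < s" by simp
  have s1: "s \<le> 1/4" unfolding s_def by (rule mult_one_minus_le_quarter)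
  have r: "r = 2 * s" by (simp add: r_def s_def)
  have v0: "0 < v" using s0 s1 by (simp add: v_def r)
  have K0: "0 < K" using v0 by (simp add: K_def)
  \<comment> \<open>The four bounds serve, in this order, \<open>good_matching\<close>, the linear slack \<open>\<eta>\<close>, the crude counts of parts, and the fluctuation inside \<open>U1 \<union> U2\<close>.\<close>
  define \<epsilon>1 where "\<epsilon>1 = min (\<epsilon> / 6) (min (\<eta> / 8) (min (1 / 1000) (\<epsilon>\<^sup>2 * v / 64)))"
  have e1: "0 < \<epsilon>1" "\<epsilon>1 \<le> \<epsilon> / 6" "\<epsilon>1 \<le> \<eta> / 8" "\<epsilon>1 \<le> 1 / 1000" "\<epsilon>1 \<le> \<epsilon>\<^sup>2 * v / 64"
    using eps al v0 by (auto simp: \<epsilon>1_def)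
  define u where "u n = nat \<lfloor>\<epsilon>1 * real n\<rfloor>" for n :: nat
  define m where "m n = nat \<lfloor>sqrt (real n) * ln (real n)\<rfloor>" for n :: nat
  define W where "W n = {3 * u n + 1..n}" for n
  define U1 where "U1 n = {1..u n}" for n
  define U2 where "U2 n = {u n + 1..3 * u n}" for n
  define w where "w n = n - 3 * u n" for n
  define a where "a n = nat \<lfloor>\<alpha> * real (w n)\<rfloor>" for n
  define c where "c n = w n - 2 * a n" for n
  define T where "T n = a n + c n + (a n - c n) div 2" for n
  define C where "C n = 4 * g n" for n
  define C1 where "C1 n = 4 * sqrt (3 * real (u n) * ln (real n))" for n
  define z where "z n = r * real (card (W n)) - (1 - \<epsilon>) * (K * g n)" for n
  define D where "D n = r * real n - (1 - 2 * \<epsilon>) * (K * g n)" for n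
  define d where "d n = nat \<lfloor>D n\<rfloor>" for n
  have card_W: "card (W n) = w n" for n by (simp add: W_def w_def)

  have ev: "eventually (\<lambda>n. 100 \<le> \<epsilon>1 * real n) sequentially"
    "eventually (\<lambda>n. h n + K * g n + 10 \<le> real n / 10) sequentially"
    "eventually (\<lambda>n. (8 + K) * g n + 10 \<le> 2 * s\<^sup>2 * h n) sequentially"
    "eventually (\<lambda>n. (12 + K) * g n + h n + 10 \<le> 2 * s\<^sup>2 * \<epsilon>1 * real n) sequentially"
    "eventually (\<lambda>n. (4 + K) * g n + 10 \<le> 3 / 4 * \<eta> * real n) sequentially"
    "eventually (\<lambda>n. 10 \<le> \<epsilon> * K * g n) sequentially"
  proof -
    show "eventually (\<lambda>n. 100 \<le> \<epsilon>1 * real n) sequentially" using e1(1) by real_asymp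
    have s2: "0 < 2 * s\<^sup>2" "0 < 2 * s\<^sup>2 * \<epsilon>1" "0 < 3 / 4 * \<eta>" "0 < \<epsilon> * K" using s0 e1 al eps K0 by auto
    have lim: "eventually (\<lambda>n. f n \<le> b * G n) sequentially"
      if "(\<lambda>n. f n / G n) \<longlonglongrightarrow> 0" "0 < b" "eventually (\<lambda>n. 0 < G n) sequentially" for f G :: "nat \<Rightarrow> real" and b
      using order_tendstoD(2)[OF that(1,2)] that(3) by eventually_elim (simp add: field_simps)
    have pos: "eventually (\<lambda>n. 0 < real n) sequentially" "eventually (\<lambda>n. 0 < h n) sequentially" "eventually (\<lambda>n. 0 < g n) sequentially"
      unfolding h_def g_def by real_asymp+
    have gn: "(\<lambda>n. g n / real n) \<longlonglongrightarrow> 0" "(\<lambda>n. h n / real n) \<longlonglongrightarrow> 0" "(\<lambda>n. 10 / real n) \<longlonglongrightarrow> 0"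
      "(\<lambda>n. g n / h n) \<longlonglongrightarrow> 0" "(\<lambda>n. 10 / h n) \<longlonglongrightarrow> 0" "(\<lambda>n. 10 / g n) \<longlonglongrightarrow> 0"
      unfolding g_def h_def by real_asymp+
    have comb: "(\<lambda>n. (x * g n + y * h n + 10) / real n) \<longlonglongrightarrow> 0" "(\<lambda>n. (x * g n + 10) / h n) \<longlonglongrightarrow> 0" for x y
    proof -
      have "(\<lambda>n. x * (g n / real n) + y * (h n / real n) + 10 / real n) \<longlonglongrightarrow> x * 0 + y * 0 + 0" by (intro tendsto_intros gn)
      then show "(\<lambda>n. (x * g n + y * h n + 10) / real n) \<longlonglongrightarrow> 0" by (simp add: add_divide_distrib)
      have "(\<lambda>n. x * (g n / h n) + 10 / h n) \<longlonglongrightarrow> x * 0 + 0" by (intro tendsto_intros gn)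
      then show "(\<lambda>n. (x * g n + 10) / h n) \<longlonglongrightarrow> 0" by (simp add: add_divide_distrib)
    qed
    show "eventually (\<lambda>n. h n + K * g n + 10 \<le> real n / 10) sequentially"
      using lim[OF comb(1)[of K 1], of "1/10"] pos by (simp add: add_ac)
    show "eventually (\<lambda>n. (8 + K) * g n + 10 \<le> 2 * s\<^sup>2 * h n) sequentially"
      by (rule lim[OF comb(2) s2(1) pos(2)])
    show "eventually (\<lambda>n. (12 + K) * g n + h n + 10 \<le> 2 * s\<^sup>2 * \<epsilon>1 * real n) sequentially"
      using lim[OF comb(1)[of "12 + K" 1] s2(2) pos(1)] by simp
    show "eventually (\<lambda>n. (4 + K) * g n + 10 \<le> 3 / 4 * \<eta> * real n) sequentially"
      using lim[OF comb(1)[of "4 + K" 0] s2(3) pos(1)] by simp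
    show "eventually (\<lambda>n. 10 \<le> \<epsilon> * K * g n) sequentially"
      by (rule lim[OF gn(6) s2(4) pos(3)])
  qed

  have up: "eventually (\<lambda>n. Prob (all_edges {1..n}) p (\<lambda>X. \<not> reducible X (d n) (singles {1..n})) \<le>
      Prob (all_edges {1..n}) p (\<lambda>X. \<not> (\<exists>e. matching {1..u n} (m n) e \<and> (\<forall>i<m n. real (mixdeg X (e i) (W n)) \<le> z n)))
      + 3 * real n ^ 4 * (real n + 3) * exp (- 8 * ln (real n)) + 3 * real n ^ 4 * (real n + 1) ^ 2 * exp (- 8 * ln (real n)) \<and>
      real (d n) \<le> D n) sequentially"
    using ev
  proof eventually_elim
    case (elim n)
    have n0: "0 < real n" using elim(1) e1 by (auto intro!: gr0I)
    have "\<epsilon>1 * real n \<le> 1 / 1000 * real n" using e1 by (intro mult_right_mono) auto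
    then have n100: "100000 \<le> real n" using elim(1) by linarith
    have ln1: "1 \<le> ln (real n)"
    proof -
      have "exp 1 \<le> real n" using exp_le n100 by linarith
      then show ?thesis using n0 by (simp add: ln_ge_iff)
    qed
    have g0: "0 \<le> g n" using ln1 by (simp add: g_def)
    have h0: "0 \<le> h n" using ln1 by (simp add: h_def)
    have Kg: "0 \<le> K * g n" using K0 g0 by simp
    have uf: "real (u n) = of_int \<lfloor>\<epsilon>1 * real n\<rfloor>" using e1 by (simp add: u_def)
    have u1: "real (u n) \<le> \<epsilon>1 * real n" "\<epsilon>1 * real n - 1 < real (u n)" unfolding uf by linarith+
    have u_small: "real (u n) \<le> real n / 1000" using u1 \<open>\<epsilon>1 * real n \<le> 1 / 1000 * real n\<close> by linarith
    have u_pos: "99 < real (u n)" using u1 elim(1) by linarith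
    have mf: "real (m n) = of_int \<lfloor>h n\<rfloor>" using h0 by (simp add: m_def h_def)
    have m1: "real (m n) \<le> h n" "h n - 1 < real (m n)" unfolding mf by linarith+
    have un: "3 * u n + 4 \<le> n" using u_small n100 by linarith
    have wr: "real (w n) = real n - 3 * real (u n)" using un by (simp add: w_def of_nat_diff)
    have w_big: "997 / 1000 * real n \<le> real (w n)" "real (w n) \<le> real n" using wr u_small by linarith+
    have aw0: "0 \<le> \<alpha> * real (w n)" using al by simp
    have af: "real (a n) = of_int \<lfloor>\<alpha> * real (w n)\<rfloor>" using aw0 by (simp add: a_def)
    have a1: "real (a n) \<le> \<alpha> * real (w n)" "\<alpha> * real (w n) - 1 < real (a n)" unfolding af by linarith+
    have "\<alpha> * real (w n) \<le> 1 / 2 * real (w n)" using al by (intro mult_right_mono) auto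
    then have a2: "2 * a n \<le> w n" using a1 by linarith
    have "2 / 5 * real (w n) \<le> \<alpha> * real (w n)" using al by (intro mult_right_mono) auto
    then have a3: "2 / 5 * real (w n) - 1 \<le> real (a n)" using a1 by linarith
    have wac: "w n = 2 * a n + c n" using a2 by (simp add: c_def)
    have cr: "real (c n) = real (w n) - 2 * real (a n)" using wac by linarith
    have ca: "c n \<le> a n"
    proof -
      have "100 \<le> real (w n)" using w_big n100 by linarith
      then have "real (c n) \<le> real (a n)" using cr a3 by linarith
      then show ?thesis by simp
    qed
    have r2: "r * real n \<ge> 12 / 25 * real n" using s0 n0 unfolding r by (intro mult_right_mono) auto
    have r_le: "r \<le> 1/2" using s1 r by simp
    have eKg: "(1 - 2 * \<epsilon>) * (K * g n) \<le> K * g n" using eps Kg by (simp add: mult_left_le_one_le)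
    have D_low: "r * real n - K * g n \<le> D n" using eKg by (simp add: D_def)
    have D0: "0 \<le> D n" using D_low r2 elim(2) n100 h0 by linarith
    have df: "real (d n) = of_int \<lfloor>D n\<rfloor>" using D0 by (simp add: d_def)
    have d1: "real (d n) \<le> D n" "D n - 1 < real (d n)" unfolding df by linarith+
    have rw: "2 * s * real (card (W n)) = r * real n - 6 * s * real (u n)" unfolding card_W wr r by (simp add: algebra_simps)
    have C1_le: "C1 n \<le> \<epsilon> / 2 * (K * g n)"
    proof -
      have "3 * real (u n) * ln (real n) \<le> 3 * (\<epsilon>\<^sup>2 * v / 64 * real n) * ln (real n)"
      proof (intro mult_right_mono mult_left_mono)
        have "\<epsilon>1 * real n \<le> \<epsilon>\<^sup>2 * v / 64 * real n" using e1 by (intro mult_right_mono) auto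
        then show "real (u n) \<le> \<epsilon>\<^sup>2 * v / 64 * real n" using u1 by linarith
      qed (use ln1 in auto)
      also have "\<dots> = (\<epsilon> / 8)\<^sup>2 * ((3 * v) * (real n * ln (real n)))" by (simp add: power2_eq_square)
      finally have "sqrt (3 * real (u n) * ln (real n)) \<le> sqrt ((\<epsilon> / 8)\<^sup>2 * ((3 * v) * (real n * ln (real n))))" by (rule real_sqrt_le_mono)
      also have "\<dots> = \<epsilon> / 8 * (K * g n)" unfolding K_def g_def real_sqrt_mult using eps by simp
      finally show ?thesis by (simp add: C1_def)
    qed
    have C1_le2: "C1 n \<le> 4 * g n"
    proof -
      have "3 * real (u n) * ln (real n) \<le> real n * ln (real n)" using u_small ln1 n0 by (intro mult_right_mono) auto
      then show ?thesis unfolding C1_def g_def by simp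
    qed
    have C0: "0 \<le> C n" "0 \<le> C1 n" using g0 ln1 by (auto simp: C_def C1_def)
    have s2m: "2 * s\<^sup>2 * h n - 1 \<le> 2 * s\<^sup>2 * real (m n)" and s2u: "2 * s\<^sup>2 * \<epsilon>1 * real n - 1 \<le> 2 * s\<^sup>2 * real (u n)"
    proof -
      have "s * s \<le> 1/4 * (1/4)" using s0 s1 by (intro mult_mono) auto
      then have ss: "0 \<le> 2 * s\<^sup>2" "2 * s\<^sup>2 \<le> 1" by (auto simp: power2_eq_square)
      have "2 * s\<^sup>2 * (h n - 1) \<le> 2 * s\<^sup>2 * real (m n)" "2 * s\<^sup>2 * (\<epsilon>1 * real n - 1) \<le> 2 * s\<^sup>2 * real (u n)"
        using m1(2) u1(2) ss(1) by (intro mult_left_mono; simp)+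
      then show "2 * s\<^sup>2 * h n - 1 \<le> 2 * s\<^sup>2 * real (m n)" "2 * s\<^sup>2 * \<epsilon>1 * real n - 1 \<le> 2 * s\<^sup>2 * real (u n)"
        using ss(2) by (simp_all add: right_diff_distrib mult.assoc)
    qed
    have gK: "(8 + K) * g n = 8 * g n + K * g n" "(12 + K) * g n = 12 * g n + K * g n" "(4 + K) * g n = 4 * g n + K * g n"
      by (simp_all add: distrib_right)
    have h5: "4 * g n + K * g n + 10 \<le> 3 / 4 * (\<eta> * real n)" using elim(5) unfolding gK(3) by simp
    have n1: "z n + (6 * s * real (u n) + 2 + C1 n) \<le> real (d n)"
    proof -
      have zr: "z n = r * real n - 6 * s * real (u n) - (1 - \<epsilon>) * (K * g n)" unfolding z_def using rw r by simp
      have e: "(1 - \<epsilon>) * (K * g n) = (1 - 2 * \<epsilon>) * (K * g n) + \<epsilon> * K * g n" "\<epsilon> / 2 * (K * g n) = \<epsilon> * K * g n / 2"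
        by (simp_all add: algebra_simps)
      show ?thesis using zr C1_le e d1(2) elim(6) unfolding D_def by linarith
    qed
    have n2: "m n + u n \<le> d n"
    proof -
      have "real (m n) + real (u n) \<le> real (d n)" using m1 u_small d1(2) D_low r2 elim(2) n100 Kg by linarith
      then show ?thesis by linarith
    qed
    have n3: "(2 * s * real (card (W n)) + 2 + C n) + (6 * s * real (u n) - 2 * s\<^sup>2 * real (m n) + 2 + C1 n) \<le> real (d n)"
      using rw s2m elim(3) d1(2) D_low C1_le2 gK unfolding C_def by linarith
    have n4: "(2 * s * real (u n) + 2 + C n + real (m n)) + ((4 * s - 2 * s\<^sup>2) * real (u n) + 2 + C n) + (2 * s * real (card (W n)) + 2 + C n) \<le> real (d n)"
    proof -
      define x y where "x = s\<^sup>2 * real (u n)" and "y = s * real (u n)"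
      have xy: "(4 * s - 2 * s\<^sup>2) * real (u n) = 4 * y - 2 * x" "2 * s * real (u n) = 2 * y" "6 * s * real (u n) = 6 * y"
        "2 * s\<^sup>2 * real (u n) = 2 * x" by (simp_all add: x_def y_def algebra_simps)
      show ?thesis unfolding xy using rw[unfolded xy] s2u[unfolded xy] elim(4) d1(2) D_low m1(1) gK(2) unfolding C_def by linarith
    qed
    have gs: "0 \<le> mix_prob p 3" "mix_prob p 3 \<le> 1" "0 \<le> mix_prob p 6" "0 \<le> mix_prob p 8" "0 \<le> mix_prob p 12" "mix_prob p 12 \<le> 1"
      using p01 by (auto intro!: mix_prob_bounds)
    have two_u: "2 * real (u n) \<le> 1 / 4 * (\<eta> * real n)"
    proof -
      have "\<epsilon>1 * real n \<le> \<eta> / 8 * real n" using e1 by (intro mult_right_mono) auto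
      then have "real (u n) \<le> \<eta> / 8 * real n" using u1 by linarith
      then show ?thesis by simp
    qed
    have c_le: "real (c n) \<le> (1 - 2 * \<alpha>) * real (w n) + 2" using cr a1 by (simp add: algebra_simps)
    have rn_eta: "x * real (w n) \<le> r * real n - \<eta> * real n" if "0 \<le> x" "x \<le> 2 * s - \<eta>" for x
    proof -
      have "x * real (w n) \<le> (2 * s - \<eta>) * real n" using that w_big(2) by (intro mult_mono) auto
      then show ?thesis by (simp add: r left_diff_distrib)
    qed
    have n5a: "2 * real (u n) + (real (c n) * mix_prob p 3 + real (a n) * mix_prob p 6 + 3 + C n) \<le> real (d n)"
    proof -
      have "real (c n) * mix_prob p 3 + real (a n) * mix_prob p 6 \<le> ((1 - 2 * \<alpha>) * real (w n) + 2) * mix_prob p 3 + (\<alpha> * real (w n)) * mix_prob p 6"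
        using c_le a1 gs by (intro add_mono mult_right_mono) auto
      also have "((1 - 2 * \<alpha>) * real (w n) + 2) * mix_prob p 3 + (\<alpha> * real (w n)) * mix_prob p 6 =
         ((1 - 2 * \<alpha>) * mix_prob p 3 + \<alpha> * mix_prob p 6) * real (w n) + 2 * mix_prob p 3" by (simp add: algebra_simps)
      also have "\<dots> \<le> (r * real n - \<eta> * real n) + 2 * 1"
        using al gs by (intro add_mono rn_eta mult_left_mono) auto
      finally have "real (c n) * mix_prob p 3 + real (a n) * mix_prob p 6 \<le> r * real n - \<eta> * real n + 2" by simp
      then show ?thesis using two_u h5 d1(2) D_low unfolding C_def by linarith
    qed
    have n5b: "2 * real (u n) + (real (a n - c n) * mix_prob p 8 + real (c n) * mix_prob p 12 + 4 + C n) \<le> real (d n)"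
    proof -
      have "real (a n - c n) \<le> (3 * \<alpha> - 1) * real (w n)" using ca cr a1 by (simp add: of_nat_diff algebra_simps)
      then have "real (a n - c n) * mix_prob p 8 + real (c n) * mix_prob p 12 \<le> ((3 * \<alpha> - 1) * real (w n)) * mix_prob p 8 + ((1 - 2 * \<alpha>) * real (w n) + 2) * mix_prob p 12"
        using c_le gs by (intro add_mono mult_right_mono) auto
      also have "((3 * \<alpha> - 1) * real (w n)) * mix_prob p 8 + ((1 - 2 * \<alpha>) * real (w n) + 2) * mix_prob p 12 =
         ((3 * \<alpha> - 1) * mix_prob p 8 + (1 - 2 * \<alpha>) * mix_prob p 12) * real (w n) + 2 * mix_prob p 12" by (simp add: algebra_simps)
      also have "\<dots> \<le> (r * real n - \<eta> * real n) + 2 * 1"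
        using al gs by (intro add_mono rn_eta mult_left_mono) auto
      finally have "real (a n - c n) * mix_prob p 8 + real (c n) * mix_prob p 12 \<le> r * real n - \<eta> * real n + 2" by simp
      then show ?thesis using two_u h5 d1(2) D_low unfolding C_def by linarith
    qed
    have n6: "2 * u n + (a n - (a n - c n) div 2) \<le> Suc (d n)"
    proof -
      have "2 * (a n - (a n - c n) div 2) \<le> a n + c n + 1" using ca by linarith
      then have "2 * real (a n - (a n - c n) div 2) \<le> real (a n) + real (c n) + 1" by linarith
      then have "real (a n - (a n - c n) div 2) \<le> 3 / 10 * real n + 1" using cr a3 w_big by linarith
      then have "2 * real (u n) + real (a n - (a n - c n) div 2) \<le> real (d n)"
        using u_small d1(2) D_low r2 elim(2) n100 h0 by linarith
      then have "real (2 * u n + (a n - (a n - c n) div 2)) \<le> real (d n)" by (simp only: of_nat_add of_nat_mult of_nat_numeral)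
      then show ?thesis by linarith
    qed
    have "Prob (all_edges {1..n}) p (\<lambda>X. \<not> reducible X (d n) (singles {1..n})) \<le>
      Prob (all_edges {1..n}) p (\<lambda>X. \<not> (\<exists>e. matching {1..u n} (m n) e \<and> (\<forall>i<m n. real (mixdeg X (e i) {3 * u n + 1..n}) \<le> z n)))
      + 3 * real n ^ 4 * (real n + 3) * exp (- (C n)\<^sup>2 / (2 * real n))
      + 3 * (3 * real (u n)) ^ 4 * ((real (m n) + 1) * (real (u n) + 1)) * exp (- (C1 n)\<^sup>2 / (2 * (3 * real (u n))))"
    proof (rule upper_fixed)
      show "card {3 * u n + 1..n} = 2 * a n + c n" using card_W wac by (simp add: W_def)
    qed (use n1 n2 n3 n4 n5a n5b n6 p01 un ca u_pos C0 in \<open>auto simp: s_def W_def\<close>)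
    also have "- (C n)\<^sup>2 / (2 * real n) = - 8 * ln (real n)"
      using n0 ln1 by (simp add: C_def g_def power_mult_distrib)
    also have "- (C1 n)\<^sup>2 / (2 * (3 * real (u n))) = - 8 * ln (real n)"
      using u_pos ln1 by (simp add: C1_def power_mult_distrib)
    also have "3 * (3 * real (u n)) ^ 4 * ((real (m n) + 1) * (real (u n) + 1)) * exp (- 8 * ln (real n)) \<le> 3 * real n ^ 4 * (real n + 1) ^ 2 * exp (- 8 * ln (real n))"
    proof (intro mult_right_mono mult_mono)
      show "(3 * real (u n)) ^ 4 \<le> real n ^ 4" using u_small n0 by (intro power_mono) auto
      show "(real (m n) + 1) * (real (u n) + 1) \<le> (real n + 1) ^ 2" unfolding power2_eq_square
        using m1 elim(2) Kg n0 u_small by (intro mult_mono) linarith+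
    qed (use n0 in auto)
    finally show ?case using d1(1) by (simp add: W_def)
  qed
  have "edge_whp p (\<lambda>n X. \<exists>f. matching {1..u n} (m n) f \<and> (\<forall>i<m n. real (mixdeg X (f i) {3 * u n + 1..n}) \<le>
     r * real (card {3 * u n + 1..n}) - (1 - \<epsilon>) * (sqrt (3 * (r * (1 - r))) * sqrt (real n * ln (real n)))))"
    unfolding r_def u_def m_def by (rule good_matching[OF p(1,2) eps e1(1,2)])
  then have am: "(\<lambda>n. Prob (all_edges {1..n}) p (\<lambda>X. \<not> (\<exists>e. matching {1..u n} (m n) e \<and> (\<forall>i<m n. real (mixdeg X (e i) (W n)) \<le> z n)))) \<longlonglongrightarrow> 0"
    unfolding edge_whp_def z_def W_def K_def g_def v_def .
  show ?thesis
  proof (rule edge_whpI)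
    show "\<forall>\<^sub>F n in sequentially. Prob (all_edges {1..n}) p (\<lambda>X. \<not> real (tww (trigraph_of_graph ({1..n}, X))) \<le>
        r * real n - (1 - 2 * \<epsilon>) * (sqrt (3 * (r * (1 - r))) * sqrt (real n * ln (real n)))) \<le>
      Prob (all_edges {1..n}) p (\<lambda>X. \<not> (\<exists>e. matching {1..u n} (m n) e \<and> (\<forall>i<m n. real (mixdeg X (e i) (W n)) \<le> z n)))
      + 3 * real n ^ 4 * (real n + 3) * exp (- 8 * ln (real n)) + 3 * real n ^ 4 * (real n + 1) ^ 2 * exp (- 8 * ln (real n))"
      using up
    proof eventually_elim
      case (elim n)
      have "Prob (all_edges {1..n}) p (\<lambda>X. \<not> real (tww (trigraph_of_graph ({1..n}, X))) \<le>
        r * real n - (1 - 2 * \<epsilon>) * (sqrt (3 * (r * (1 - r))) * sqrt (real n * ln (real n))))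
        \<le> Prob (all_edges {1..n}) p (\<lambda>X. \<not> reducible X (d n) (singles {1..n}))"
      proof (rule Prob_mono)
        fix X assume X: "X \<subseteq> all_edges {1..n}" and no: "\<not> real (tww (trigraph_of_graph ({1..n}, X))) \<le>
          r * real n - (1 - 2 * \<epsilon>) * (sqrt (3 * (r * (1 - r))) * sqrt (real n * ln (real n)))"
        show "\<not> reducible X (d n) (singles {1..n})"
        proof
          assume "reducible X (d n) (singles {1..n})"
          then have "tww (trigraph_of_graph ({1..n}, X)) \<le> d n" using tww_le[OF _ X] by simp
          then have "real (tww (trigraph_of_graph ({1..n}, X))) \<le> D n" using elim by linarith
          then show False using no unfolding D_def K_def g_def v_def by simp
        qed
      qed simp
      then show ?case using elim by linarith
    qed
    have 1: "(\<lambda>n. 3 * real n ^ 4 * (real n + 3) * exp (- 8 * ln (real n))) \<longlonglongrightarrow> 0"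
      "(\<lambda>n. 3 * real n ^ 4 * (real n + 1) ^ 2 * exp (- 8 * ln (real n))) \<longlonglongrightarrow> 0" by real_asymp+
    show "(\<lambda>n. Prob (all_edges {1..n}) p (\<lambda>X. \<not> (\<exists>e. matching {1..u n} (m n) e \<and> (\<forall>i<m n. real (mixdeg X (e i) (W n)) \<le> z n)))
      + 3 * real n ^ 4 * (real n + 3) * exp (- 8 * ln (real n)) + 3 * real n ^ 4 * (real n + 1) ^ 2 * exp (- 8 * ln (real n))) \<longlonglongrightarrow> 0"
      using tendsto_add[OF tendsto_add[OF am 1(1)] 1(2)] by simp
  qed
qed

section \<open>Twin-width of dense random graphs\<close>

theorem theorem1p3:
  shows "\<exists>pstar :: real. 0.4012 < pstar \<and> pstar < 0.4013 \<and>
    (\<forall>p q :: real. q = 1 - p \<longrightarrow>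
      (pstar < p \<and> p \<le> 1/2 \<longrightarrow>
        gnp_whp_eq_plus_o p (\<lambda>G. real (tww (trigraph_of_graph G)))
          (\<lambda>n. 2 * p * q * real n - sqrt (6 * p * q * (1 - 2 * p * q) * real n * ln (real n)))
          (\<lambda>n. sqrt (real n * ln (real n)))) \<and>
      (0 < p \<and> p < pstar \<longrightarrow>
        (\<exists>c > 0. gnp_whp p (\<lambda>n G.
          real (tww (trigraph_of_graph G)) > (2 * p * q + c) * real n))))"
proof -
  obtain z :: real where z: "0.4012 < z" "z < 0.4013" "\<And>p. 0 < p \<Longrightarrow> p < z \<Longrightarrow> 0 < critical_poly (p * (1 - p))"
    "\<And>p. z < p \<Longrightarrow> p \<le> 1 / 2 \<Longrightarrow> critical_poly (p * (1 - p)) < 0"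
    using critical_probability by blast
  show ?thesis
  proof (rule exI[of _ z], intro conjI allI impI z(1,2))
    fix p q :: real assume q: "q = 1 - p" and p: "z < p \<and> p \<le> 1 / 2"
    define r where "r = 2 * p * (1 - p)"
    define K where "K = sqrt (3 * (r * (1 - r)))"
    define g where "g n = sqrt (real n * ln (real n))" for n :: nat
    have p01: "0 < p" "p < 1" "0.4012 < p" "p \<le> 1/2" using p z by auto
    have "0 \<le> r" "r \<le> 1/2" using p01 mult_one_minus_le_quarter[of p] by (auto simp: r_def)
    then have "r * (1 - r) \<le> 1/4" "0 \<le> r * (1 - r)" using mult_one_minus_le_quarter[of r] by auto
    then have K: "0 \<le> K" "K \<le> 1" unfolding K_def by (auto simp: real_sqrt_le_1_iff)
    have eq: "sqrt (6 * p * q * (1 - 2 * p * q) * real n * ln (real n)) = K * g n" for n :: nat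
    proof -
      have "6 * p * q * (1 - 2 * p * q) * real n * ln (real n) = (3 * (r * (1 - r))) * (real n * ln (real n))"
        by (simp add: r_def q algebra_simps)
      then have "sqrt (6 * p * q * (1 - 2 * p * q) * real n * ln (real n)) = sqrt ((3 * (r * (1 - r))) * (real n * ln (real n)))"
        by (simp only:)
      then show ?thesis unfolding K_def g_def by (simp only: real_sqrt_mult)
    qed
    have rq: "2 * p * q = r" by (simp add: r_def q)
    have evg: "eventually (\<lambda>n. 0 < g n) sequentially" unfolding g_def by real_asymp
    show "gnp_whp_eq_plus_o p (\<lambda>G. real (tww (trigraph_of_graph G)))
          (\<lambda>n. 2 * p * q * real n - sqrt (6 * p * q * (1 - 2 * p * q) * real n * ln (real n)))
          (\<lambda>n. sqrt (real n * ln (real n)))"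
      unfolding eq g_def[symmetric]
    proof (rule whp_o_from_epsilon[OF _ evg])
      fix \<epsilon> :: real assume e: "0 < \<epsilon>"
      define \<delta> where "\<delta> = min (\<epsilon> / 2) (1 / 100)"
      have d: "0 < \<delta>" "\<delta> \<le> 1/100" "\<delta> \<le> \<epsilon>" "2 * \<delta> \<le> \<epsilon>" using e by (auto simp: \<delta>_def)
      have lo: "edge_whp p (\<lambda>n X. 2 * p * q * real n - (1 + \<delta>) * (K * g n) \<le> real (tww (trigraph_of_graph ({1..n}, X))))"
        using tww_lower_critical[OF p01(1,2) q d(1)] unfolding eq .
      have hi: "edge_whp p (\<lambda>n X. real (tww (trigraph_of_graph ({1..n}, X))) \<le> r * real n - (1 - 2 * \<delta>) * (K * g n))"
        using tww_upper_critical[OF p01(3,4) z(4) d(1,2)] p unfolding r_def K_def g_def by simp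
      show "gnp_whp p (\<lambda>n G. \<bar>real (tww (trigraph_of_graph G)) - (2 * p * q * real n - K * g n)\<bar> \<le> \<epsilon> * g n)"
        unfolding gnp_whp_iff
      proof (rule edge_whp_conj_mono[OF lo hi])
       show "\<forall>\<^sub>F n in sequentially. \<forall>X\<subseteq>all_edges {1..n}.
          2 * p * q * real n - (1 + \<delta>) * (K * g n) \<le> real (tww (trigraph_of_graph ({1..n}, X))) \<longrightarrow>
          real (tww (trigraph_of_graph ({1..n}, X))) \<le> r * real n - (1 - 2 * \<delta>) * (K * g n) \<longrightarrow>
          \<bar>real (tww (trigraph_of_graph ({1..n}, X))) - (2 * p * q * real n - K * g n)\<bar> \<le> \<epsilon> * g n"
        using evg
       proof (eventually_elim, intro allI impI)
        fix n and X :: "nat set set"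
        assume g: "0 < g n" and "X \<subseteq> all_edges {1..n}" and 1: "2 * p * q * real n - (1 + \<delta>) * (K * g n) \<le> real (tww (trigraph_of_graph ({1..n}, X)))"
          and 2: "real (tww (trigraph_of_graph ({1..n}, X))) \<le> r * real n - (1 - 2 * \<delta>) * (K * g n)"
        have Kg: "K * g n \<le> g n" "0 \<le> K * g n" using K g by (auto simp: mult_left_le_one_le)
        have "\<delta> * (K * g n) \<le> \<epsilon> * g n" "2 * \<delta> * (K * g n) \<le> \<epsilon> * g n" using Kg d by (intro mult_mono; simp)+
        then show "\<bar>real (tww (trigraph_of_graph ({1..n}, X))) - (2 * p * q * real n - K * g n)\<bar> \<le> \<epsilon> * g n"
          using 1 2 unfolding rq by (simp add: algebra_simps abs_le_iff)
       qed
      qed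
    qed
  next
    fix p q :: real assume q: "q = 1 - p" and p: "0 < p \<and> p < z"
    then have "\<exists>c>0. edge_whp p (\<lambda>n X. real (tww (trigraph_of_graph ({1..n}, X))) > (2 * p * (1 - p) + c) * real n)"
      using z by (intro tww_lower_subcritical) auto
    then show "\<exists>c>0. gnp_whp p (\<lambda>n G. real (tww (trigraph_of_graph G)) > (2 * p * q + c) * real n)"
      unfolding gnp_whp_iff q .
  qed
qed

end
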